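(* Let $m,d,K\ge1$, $n\ge2$, $1\le\nu_K\le n-1$ be integers, $N=dn-1+(n-1)(K-1)+\nu_K$, $g=\gcd(m,n)$, and $$\tau=\left(dn-1,(n-1)^{K-1},\nu_K\right),\qquad \mu=\left(((d+K-1)m)^{\nu_K},((d+K-2)m)^{n-1},\dots,(dm)^{n-1},0^{dn-1}\right).$$ Let $\varpi=(q,t)=\left(\omega u^{-n/g},u^{m/g}\right)$, where $u$ is an indeterminate and $\omega^{m/g}$ is a primitive $g$-th root of unity, and suppose the nonsymmetric Macdonald polynomial $M_\mu$ is singular at $(q,t)=\varpi$. Then for every $S\in\mathrm{Tab}_\tau$, at $(q,t)=\varpi$, $$M_{\alpha(S)}\left(\overline x(S);\varpi\right)=\frac{M_\mu\left(\overline{\overline x};\varpi\right)}{h_{S_1}\left(\overline{\overline x}\right)}\cdot f_S\left(\overline x(S)\right),$$ and moreover $$\frac{M_\mu(\overline{\overline x})}{h_{S_1}(\overline{\overline x})}\doteq\prod_{k=1}^{\nu_K}\left[\left(z_k,t^{dn-1}qy_K;q\right)_{dm-1}\prod_{i=1}^{K-1}\left(z_k,t^{n-1}qy_i;q\right)_{m-1}\right]\prod_{i=1}^{K-1}\prod_{s=0}^{n-2}\left(t^sy_i,t^{dn-1}qy_K;q\right)_{dm-1}\prod_{1\le i<j\le K-1}\prod_{s=0}^{n-2}\left(t^sy_i,t^{n-1}qy_j;q\right)_{m-1},$$ where $\doteq$ denotes equality up to a nonzero scalar factor not depending on the variables $y_i,z_k$, and $(a,b;q)_k=\prod_{i=1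}^k(a-bq^{i-1})$.
   Context: Tableaux. The Ferrers diagram of $\tau$ is the set of boxes $(i,j)$ (row $i$, column $j$; row 1 at the bottom), $1\le i\le\ell(\tau)$, $1\le j\le\tau_i$. $\mathrm{Tab}_\tau$ is the set of reverse standard Young tableaux of shape $\tau$: fillings of the boxes by $1,\dots,N$, each used once, decreasing along each row (as $j$ increases) and along each column (as $i$ increases). For $S\in\mathrm{Tab}_\tau$ the entry $k$ is in box $(\mathrm{row}_S[k],\mathrm{col}_S[k])$ and its content is $c_S[k]=\mathrm{col}_S[k]-\mathrm{row}_S[k]$; $S^{(i)}$ is $S$ with $i$ and $i+1$ exchanged. $S_0$ (resp. $S_1$) has $N,N-1,\dots,1$ entered column by column (resp. row by row). $\alpha(S)\in\mathbb N_0^N$ is given by $\alpha(S)_i=v(\mathrm{row}_S[i])$, $v(1)=0$, $v(j)=(d+j-2)m$ for $2\le j\le K+1$; so $\alpha(S_1)=\mu$. Exponents in partitions denote repetitions. Special points. Let $z_1,\dots,z_{\nu_K},y_1,\dots,y_K$ be free variables. For $S\in\mathrm{Tab}_\tau$, $\overline x(S)$ has $k$-th coordinate, where $(r,c)=(\mathrm{row}_S[k],\mathrm{col}_S[k])$: $t^{dn-1-c}y_K$ if $r=1$; $t^{n-1-c}y_{K+1-r}$ if $2\le r\le K$; $z_{\nu_K+1-c}$ if $r=K+1$. $\overline{\overline x}=\overline x(S_1)$, i.e. $\overline{\overline x}=(z_1,\dots,z_{\nu_K},\,y_1,ty_1,\dots,t^{n-2}y_1,\,\dots,\,y_{K-1},ty_{K-1},\dots,t^{n-2}y_{K-1},\,y_K,ty_K,\dots,t^{dn-2}y_K)$.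 Modified alternating polynomial: $f_S(x)=\prod\left(t^{R_S(i,j)}x_i-x_j\right)$ over $1\le i<j\le N$ with $\mathrm{col}_S[i]=\mathrm{col}_S[j]$, where $R_S(i,j)$ is the number of $k>i$ with $\mathrm{row}_S[k]=\mathrm{row}_S[j]$ and $\mathrm{col}_S[k]\ge\mathrm{col}_S[i]$. Operators act on the right on polynomials in $x_1,\dots,x_N$: $pT_i=(1-t)x_{i+1}\frac{p(x)-p(xs_i)}{x_i-x_{i+1}}+t\,p(xs_i)$, where $xs_i$ exchanges $x_i,x_{i+1}$; $f\omega^q=f(qx_N,x_1,\dots,x_{N-1})$; $\xi_i=t^{i-1}T_{i-1}^{-1}\cdots T_1^{-1}\omega^qT_{N-1}\cdots T_i$; $f\mathcal D_N^{q,t}=(f-f\xi_N)/x_N$, $\mathcal D_i^{q,t}=\frac1tT_i\mathcal D_{i+1}^{q,t}T_i$. A polynomial $p$ is singular if $p\mathcal D_i^{q,t}=0$ for all $i$ (at the specialization). Minimal polynomials: $h_{S_0}=\prod(tx_i-x_j)$ over $i<j$ with $\mathrm{col}_{S_0}[i]=\mathrm{col}_{S_0}[j]$; whenever $\mathrm{row}_S[i]<\mathrm{row}_S[i+1]$ and $\mathrm{col}_S[i]>\mathrm{col}_S[i+1]$, $h_{S^{(i)}}=h_ST_i-\frac{t-1}{1-t^{c_S[i+1]-c_S[i]}}h_S$. Every $S$ is reached from $S_0$ by such steps and $h_S$ is well defined. Nonsymmetric Macdonald polynomials: for $\alpha\in\mathbb N_0^N$ let $\alpha^+$ be its nonincreasing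 rearrangement, $r(\alpha,i)=\#\{j:\alpha_j>\alpha_i\}+\#\{j\le i:\alpha_j=\alpha_i\}$. Write $\alpha\succ\beta$ if $\alpha\ne\beta$ and $\sum_{i\le j}\alpha_i\ge\sum_{i\le j}\beta_i$ for all $j$; $\alpha\rhd\beta$ if $|\alpha|=|\beta|$ and either $\alpha^+\succ\beta^+$, or $\alpha^+=\beta^+$ and $\alpha\succ\beta$. For generic $(q,t)$, $M_\alpha$ is the simultaneous eigenfunction $M_\alpha\xi_i=\zeta_\alpha(i)M_\alpha$, $\zeta_\alpha(i)=q^{\alpha_i}t^{N-r(\alpha,i)}$, with $\rhd$-leading term a power of $t$ times $x^\alpha$, normalized so that $M_\alpha T_i=M_{\alpha s_i}-\frac{1-t}{1-\zeta_\alpha(i+1)/\zeta_\alpha(i)}M_\alpha$ whenever $\alpha_i<\alpha_{i+1}$ ($\alpha s_i$ exchanges $\alpha_i,\alpha_{i+1}$). Speaking of $M_\mu$ at $\varpi$ presupposes its coefficients have no pole there. *)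

theory Defs
  imports
    Complex_Main
    "HOL-Library.Poly_Mapping"
    "HOL-Computational_Algebra.Polynomial"
    "HOL-Computational_Algebra.Fraction_Field"
    "HOL-Combinatorics.Transposition"
begin

section \<open>Multivariate polynomials\<close>

text \<open>
  A polynomial is a finitely supported map from monomials (finitely supported exponent functions)
  to coefficients. The variables are indexed by all natural numbers; \<open>x\<^sub>i\<close> is the variable
  of index \<open>i\<close>, and polynomials in \<open>x\<^sub>1, \<dots>, x\<^sub>N\<close> are singled out by
  \<open>in_vars N\<close>.
\<close>

type_synonym 'a mpoly = "(nat \<Rightarrow>\<^sub>0 nat) \<Rightarrow>\<^sub>0 'a"

definition Var :: "nat \<Rightarrow> 'a::comm_ring_1 mpoly" where
  "Var i = Poly_Mapping.single (Poly_Mapping.single i 1) 1"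

definition Const :: "'a::comm_ring_1 \<Rightarrow> 'a mpoly" where
  "Const c = Poly_Mapping.single 0 c"

definition in_vars :: "nat \<Rightarrow> 'a::comm_ring_1 mpoly \<Rightarrow> bool" where
  "in_vars N p \<longleftrightarrow> (\<forall>k\<in>Poly_Mapping.keys p. Poly_Mapping.keys k \<subseteq> {1..N})"

definition eval_mpoly :: "('a::comm_ring_1 \<Rightarrow> 'b::comm_ring_1) \<Rightarrow> (nat \<Rightarrow> 'b) \<Rightarrow> 'a mpoly \<Rightarrow> 'b" where
  "eval_mpoly \<phi> x p = (\<Sum>k\<in>Poly_Mapping.keys p. \<phi> (Poly_Mapping.lookup p k) *
      (\<Prod>j\<in>Poly_Mapping.keys k. x j ^ Poly_Mapping.lookup k j))"

definition subst_mpoly :: "(nat \<Rightarrow> 'a mpoly) \<Rightarrow> 'a::comm_ring_1 mpoly \<Rightarrow> 'a mpoly" where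
  "subst_mpoly s p = eval_mpoly Const s p"

definition exact_quot :: "'a::idom mpoly \<Rightarrow> 'a mpoly \<Rightarrow> 'a mpoly" where
  "exact_quot p r = (THE s. s * r = p)"


section \<open>Operators\<close>

text \<open>
  The operators act on the right: \<open>p A B\<close> means first \<open>A\<close>, then \<open>B\<close>. They are
  written here as functions, and \<^term>\<open>fold f [a, b, c]\<close> applies \<^term>\<open>f a\<close> first.
\<close>

definition swap_vars :: "nat \<Rightarrow> 'a::comm_ring_1 mpoly \<Rightarrow> 'a mpoly" where
  "swap_vars i p = subst_mpoly (\<lambda>j. Var (transpose i (i + 1) j)) p"

definition opT :: "'a::field \<Rightarrow> nat \<Rightarrow> 'a mpoly \<Rightarrow> 'a mpoly" where
  "opT t i p = Const (1 - t) * Var (i + 1) * exact_quot (p - swap_vars i p) (Var i - Var (i + 1))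
      + Const t * swap_vars i p"

definition op_omega :: "'a::field \<Rightarrow> nat \<Rightarrow> 'a mpoly \<Rightarrow> 'a mpoly" where
  "op_omega q N p = subst_mpoly (\<lambda>j. if j = 1 then Const q * Var N
      else if j \<in> {2..N} then Var (j - 1) else Var j) p"

definition op_xi :: "'a::field \<Rightarrow> 'a \<Rightarrow> nat \<Rightarrow> nat \<Rightarrow> 'a mpoly \<Rightarrow> 'a mpoly" where
  "op_xi q t N i p = Const (t ^ (i - 1)) *
      fold (opT t) (rev [i..<N]) (op_omega q N (fold (\<lambda>j. inv (opT t j)) (rev [1..<i]) p))"

text \<open>\<open>opD_aux q t N k\<close> is the operator \<open>\<D>\<^bsub>N-k\<^esub>\<close>.\<close>

primrec opD_aux :: "'a::field \<Rightarrow> 'a \<Rightarrow> nat \<Rightarrow> nat \<Rightarrow> 'a mpoly \<Rightarrow> 'a mpoly" where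
  "opD_aux q t N 0 p = exact_quot (p - op_xi q t N N p) (Var N)"
| "opD_aux q t N (Suc k) p =
     Const (1 / t) * opT t (N - Suc k) (opD_aux q t N k (opT t (N - Suc k) p))"

definition opD :: "'a::field \<Rightarrow> 'a \<Rightarrow> nat \<Rightarrow> nat \<Rightarrow> 'a mpoly \<Rightarrow> 'a mpoly" where
  "opD q t N i p = opD_aux q t N (N - i) p"

definition singular_poly :: "'a::field \<Rightarrow> 'a \<Rightarrow> nat \<Rightarrow> 'a mpoly \<Rightarrow> bool" where
  "singular_poly q t N p \<longleftrightarrow> (\<forall>i\<in>{1..N}. opD q t N i p = 0)"


section \<open>Compositions and nonsymmetric Macdonald polynomials\<close>

text \<open>An element of \<open>\<nat>\<^sub>0\<^sup>N\<close> is a function on \<open>nat\<close> vanishing outside \<open>{1..N}\<close>.\<close>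

definition compositions :: "nat \<Rightarrow> (nat \<Rightarrow> nat) set" where
  "compositions N = {\<alpha>. \<forall>i. i \<notin> {1..N} \<longrightarrow> \<alpha> i = 0}"

definition comp_of_list :: "nat list \<Rightarrow> nat \<Rightarrow> nat" where
  "comp_of_list xs i = (if 1 \<le> i \<and> i \<le> length xs then xs ! (i - 1) else 0)"

definition comp_plus :: "nat \<Rightarrow> (nat \<Rightarrow> nat) \<Rightarrow> nat \<Rightarrow> nat" where
  "comp_plus N \<alpha> = comp_of_list (rev (sort (map \<alpha> [1..<N + 1])))"

definition comp_rank :: "nat \<Rightarrow> (nat \<Rightarrow> nat) \<Rightarrow> nat \<Rightarrow> nat" where
  "comp_rank N \<alpha> i = card {j\<in>{1..N}. \<alpha> j > \<alpha> i} + card {j\<in>{1..i}. \<alpha> j = \<alpha> i}"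

definition dominates :: "nat \<Rightarrow> (nat \<Rightarrow> nat) \<Rightarrow> (nat \<Rightarrow> nat) \<Rightarrow> bool" where
  "dominates N \<alpha> \<beta> \<longleftrightarrow> \<alpha> \<noteq> \<beta> \<and> (\<forall>j\<in>{1..N}. (\<Sum>i=1..j. \<alpha> i) \<ge> (\<Sum>i=1..j. \<beta> i))"

definition comp_greater :: "nat \<Rightarrow> (nat \<Rightarrow> nat) \<Rightarrow> (nat \<Rightarrow> nat) \<Rightarrow> bool" where
  "comp_greater N \<alpha> \<beta> \<longleftrightarrow> (\<Sum>i=1..N. \<alpha> i) = (\<Sum>i=1..N. \<beta> i) \<and>
     (dominates N (comp_plus N \<alpha>) (comp_plus N \<beta>)
      \<or> comp_plus N \<alpha> = comp_plus N \<beta> \<and> dominates N \<alpha> \<beta>)"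

definition zeta :: "'a::field \<Rightarrow> 'a \<Rightarrow> nat \<Rightarrow> (nat \<Rightarrow> nat) \<Rightarrow> nat \<Rightarrow> 'a" where
  "zeta q t N \<alpha> i = q ^ \<alpha> i * t ^ (N - comp_rank N \<alpha> i)"

text \<open>
  The field \<open>\<complex>(q, t)\<close>: the inner polynomial variable is \<open>q\<close>, the outer one is \<open>t\<close>.
\<close>

type_synonym cqt = "complex poly poly fract"

definition gen_q :: cqt where "gen_q = Fract [:[:0, 1:]:] 1"
definition gen_t :: cqt where "gen_t = Fract [:0, 1:] 1"

text \<open>
  The conditions below determine the polynomials up to one common power of \<open>t\<close> for each
  orbit of compositions under permutation; \<open>macdonald_family N M\<close> says that \<open>M\<close> is the
  family for some choice of these powers.
\<close>

definition macdonald_family :: "nat \<Rightarrow> ((nat \<Rightarrow> nat) \<Rightarrow> cqt mpoly) \<Rightarrow> bool" where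
  "macdonald_family N M \<longleftrightarrow> (\<forall>\<alpha>\<in>compositions N.
     in_vars N (M \<alpha>)
   \<and> (\<forall>i\<in>{1..N}. op_xi gen_q gen_t N i (M \<alpha>) = Const (zeta gen_q gen_t N \<alpha> i) * M \<alpha>)
   \<and> (\<exists>e::int. \<forall>k\<in>Poly_Mapping.keys (M \<alpha> - Const (gen_t powi e) * (\<Prod>i=1..N. Var i ^ \<alpha> i)).
         comp_greater N \<alpha> (Poly_Mapping.lookup k))
   \<and> (\<forall>i. 1 \<le> i \<and> i < N \<and> \<alpha> i < \<alpha> (i + 1) \<longrightarrow>
        opT gen_t i (M \<alpha>) = M (\<alpha> \<circ> transpose i (i + 1))
          - Const ((1 - gen_t) / (1 - zeta gen_q gen_t N \<alpha> (i + 1) / zeta gen_q gen_t N \<alpha> i)) * M \<alpha>))"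


section \<open>Specialization of the parameters\<close>

type_synonym cu = "complex poly fract"

definition cu_const :: "complex \<Rightarrow> cu" where "cu_const c = Fract [:c:] 1"
definition cu_u :: cu where "cu_u = Fract [:0, 1:] 1"

definition eval_qt :: "cu \<Rightarrow> cu \<Rightarrow> complex poly poly \<Rightarrow> cu" where
  "eval_qt a b P = poly (map_poly (\<lambda>p. poly (map_poly cu_const p) a) P) b"

definition no_pole :: "cu \<Rightarrow> cu \<Rightarrow> cqt \<Rightarrow> bool" where
  "no_pole a b f \<longleftrightarrow> (\<exists>P Q. f = Fract P Q \<and> eval_qt a b Q \<noteq> 0)"

definition special_value :: "cu \<Rightarrow> cu \<Rightarrow> cqt \<Rightarrow> cu" where
  "special_value a b f =
     (THE v. \<exists>P Q. f = Fract P Q \<and> eval_qt a b Q \<noteq> 0 \<and> v = eval_qt a b P / eval_qt a b Q)"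

definition no_pole_mpoly :: "cu \<Rightarrow> cu \<Rightarrow> cqt mpoly \<Rightarrow> bool" where
  "no_pole_mpoly a b p \<longleftrightarrow> (\<forall>k. no_pole a b (Poly_Mapping.lookup p k))"

text \<open>Unspecified at coefficients with a pole, so meaningful only under \<^const>\<open>no_pole_mpoly\<close>.\<close>

definition specialize :: "cu \<Rightarrow> cu \<Rightarrow> cqt mpoly \<Rightarrow> cu mpoly" where
  "specialize a b p = Poly_Mapping.map (special_value a b) p"


section \<open>Tableaux\<close>

text \<open>
  A partition is the list of its parts. A tableau is a function on boxes \<open>(i, j)\<close>
  (row \<open>i\<close>, column \<open>j\<close>, both from 1) with value 0 off the diagram.
\<close>

type_synonym tableau = "nat \<times> nat \<Rightarrow> nat"

definition boxes :: "nat list \<Rightarrow> (nat \<times> nat) set" where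
  "boxes \<tau> = {(i, j). 1 \<le> i \<and> i \<le> length \<tau> \<and> 1 \<le> j \<and> j \<le> \<tau> ! (i - 1)}"

definition Tab :: "nat list \<Rightarrow> tableau set" where
  "Tab \<tau> = {S. bij_betw S (boxes \<tau>) {1..sum_list \<tau>} \<and> (\<forall>b. b \<notin> boxes \<tau> \<longrightarrow> S b = 0)
     \<and> (\<forall>i j. (i, j) \<in> boxes \<tau> \<and> (i, j + 1) \<in> boxes \<tau> \<longrightarrow> S (i, j) > S (i, j + 1))
     \<and> (\<forall>i j. (i, j) \<in> boxes \<tau> \<and> (i + 1, j) \<in> boxes \<tau> \<longrightarrow> S (i, j) > S (i + 1, j))}"

definition row_of :: "tableau \<Rightarrow> nat \<Rightarrow> nat" where
  "row_of S k = fst (THE b. S b = k)"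

definition col_of :: "tableau \<Rightarrow> nat \<Rightarrow> nat" where
  "col_of S k = snd (THE b. S b = k)"

definition content :: "tableau \<Rightarrow> nat \<Rightarrow> int" where
  "content S k = int (col_of S k) - int (row_of S k)"

definition exchange :: "tableau \<Rightarrow> nat \<Rightarrow> tableau" where
  "exchange S i = transpose i (i + 1) \<circ> S"

text \<open>
  \<open>S\<^sub>0\<close> and \<open>S\<^sub>1\<close>: a box gets \<open>N\<close> minus the number of boxes preceding it, in the
  column by column and the row by row order respectively.
\<close>

definition tab0 :: "nat list \<Rightarrow> tableau" where
  "tab0 \<tau> b = (if b \<in> boxes \<tau> then sum_list \<tau> -
     card {b' \<in> boxes \<tau>. snd b' < snd b \<or> snd b' = snd b \<and> fst b' < fst b} else 0)"

definition tab1 :: "nat list \<Rightarrow> tableau" where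
  "tab1 \<tau> b = (if b \<in> boxes \<tau> then sum_list \<tau> -
     card {b' \<in> boxes \<tau>. fst b' < fst b \<or> fst b' = fst b \<and> snd b' < snd b} else 0)"

definition same_col_pairs :: "nat list \<Rightarrow> tableau \<Rightarrow> (nat \<times> nat) set" where
  "same_col_pairs \<tau> S = {(i, j). 1 \<le> i \<and> i < j \<and> j \<le> sum_list \<tau> \<and> col_of S i = col_of S j}"

definition alt_exponent :: "nat list \<Rightarrow> tableau \<Rightarrow> nat \<Rightarrow> nat \<Rightarrow> nat" where
  "alt_exponent \<tau> S i j =
     card {k. i < k \<and> k \<le> sum_list \<tau> \<and> row_of S k = row_of S j \<and> col_of S k \<ge> col_of S i}"

definition alt_poly :: "'a::field \<Rightarrow> nat list \<Rightarrow> tableau \<Rightarrow> 'a mpoly" where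
  "alt_poly t \<tau> S = (\<Prod>(i, j)\<in>same_col_pairs \<tau> S. Const (t ^ alt_exponent \<tau> S i j) * Var i - Var j)"

text \<open>
  Every tableau is reached from \<^term>\<open>tab0 \<tau>\<close>, with a result independent of the chosen steps
  (for \<open>t\<close> not a root of unity and not 0); this makes the description in \<open>min_poly\<close> definite.
\<close>

inductive is_min_poly :: "'a::field \<Rightarrow> nat list \<Rightarrow> tableau \<Rightarrow> 'a mpoly \<Rightarrow> bool"
  for t :: "'a::field" and \<tau> :: "nat list" where
  base: "is_min_poly t \<tau> (tab0 \<tau>) (\<Prod>(i, j)\<in>same_col_pairs \<tau> (tab0 \<tau>). Const t * Var i - Var j)"
| step: "is_min_poly t \<tau> S h \<Longrightarrow> 1 \<le> i \<Longrightarrow> i < sum_list \<tau> \<Longrightarrow>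
     row_of S i < row_of S (i + 1) \<Longrightarrow> col_of S i > col_of S (i + 1) \<Longrightarrow>
     is_min_poly t \<tau> (exchange S i)
       (opT t i h - Const ((t - 1) / (1 - t powi (content S (i + 1) - content S i))) * h)"

definition min_poly :: "'a::field \<Rightarrow> nat list \<Rightarrow> tableau \<Rightarrow> 'a mpoly" where
  "min_poly t \<tau> S = (THE h. is_min_poly t \<tau> S h)"

definition row_value :: "nat \<Rightarrow> nat \<Rightarrow> nat \<Rightarrow> nat" where
  "row_value m d j = (if j = 1 then 0 else (d + j - 2) * m)"

definition tab_comp :: "nat \<Rightarrow> nat \<Rightarrow> nat list \<Rightarrow> tableau \<Rightarrow> nat \<Rightarrow> nat" where
  "tab_comp m d \<tau> S i = (if i \<in> {1..sum_list \<tau>} then row_value m d (row_of S i) else 0)"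


section \<open>Special points\<close>

text \<open>
  The field \<open>\<complex>(u)(z\<^sub>1, \<dots>, z\<^sub>\<nu>, y\<^sub>1, y\<^sub>2, \<dots>)\<close>; the
  variables of the underlying polynomial ring are used in this order (from index 1).
\<close>

type_synonym cuyz = "cu mpoly fract"

definition cuyz_const :: "cu \<Rightarrow> cuyz" where "cuyz_const c = Fract (Const c) 1"
definition z_var :: "nat \<Rightarrow> cuyz" where "z_var k = Fract (Var k) 1"
definition y_var :: "nat \<Rightarrow> nat \<Rightarrow> cuyz" where "y_var \<nu> i = Fract (Var (\<nu> + i)) 1"

definition special_point ::
  "'b::field \<Rightarrow> nat \<Rightarrow> nat \<Rightarrow> nat \<Rightarrow> nat \<Rightarrow> (nat \<Rightarrow> 'b) \<Rightarrow> (nat \<Rightarrow> 'b) \<Rightarrow> tableau \<Rightarrow> nat \<Rightarrow> 'b" where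
  "special_point t n d K \<nu> z y S k = (let r = row_of S k; c = col_of S k in
     if r = 1 then t ^ (d * n - 1 - c) * y K
     else if r \<le> K then t ^ (n - 1 - c) * y (K + 1 - r)
     else z (\<nu> + 1 - c))"

definition qpoch2 :: "'b::field \<Rightarrow> 'b \<Rightarrow> 'b \<Rightarrow> nat \<Rightarrow> 'b" where
  "qpoch2 a b q k = (\<Prod>i=1..k. a - b * q ^ (i - 1))"

definition primitive_root_of_unity :: "nat \<Rightarrow> complex \<Rightarrow> bool" where
  "primitive_root_of_unity g w \<longleftrightarrow> w ^ g = 1 \<and> (\<forall>k. 0 < k \<and> k < g \<longrightarrow> w ^ k \<noteq> 1)"

end

(*
The polynomial at S_0 is antisymmetric along the columns of S_0, hence a multiple s of h_{S_0}. Both the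
M_{alpha(S)} and the h_S are obtained from S_0 by the same intertwiners. At the point of S all terms vanish
except the one carried by the point of S_0, so M_{alpha(S)} takes there the value C f_S and h_{S_1} takes the
value f_{S_1}, where C is the value of s at the point of S_0.

The Hecke module generated by M_mu consists of singular polynomials. Singularity relates the value of such a
polynomial at a point to its value at the point with one coordinate multiplied by q and moved to the other end.
Starting from a pigeonhole argument in the columns of S_0, this yields vanishing on the hyperplanes of the
factors a - b q^{i-1}. These are distinct and none of them is a zero of f_{S_1}, so their product divides C.
By homogeneity the quotient is a scalar, which is not zero because the leading monomial of M_mu survives.
*)
theory Submission
  imports Defs "HOL-Combinatorics.List_Permutation"
begin

section \<open>Polynomials and their evaluation\<close>

text \<open>Everything rests on one arithmetic fact: at the specialization, q^a t^b = 1 exactly when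
  (a, b) is an integer multiple of (m, n). It turns the spectral vector of alpha(S) into powers of t
  with the contents as exponents, so that the Macdonald intertwiners specialize to those defining
  h_S. It also decides when q^j t^(row length) Y meets a row again, which is where the ranges j < dm
  and j < m come from. The obstacle is that antisymmetry at S_0 concerns fillings that are not
  tableaux, where Macdonald polynomials may have poles. A box is pushed out of its place by
  invertible intertwiners until either its xi_N-eigenvalue contradicts singularity or two
  neighbouring generators act by t and -1, against the braid relation; so the offending polynomial
  is zero. That a single term survives at a special point is a triangularity: a generator changes an
  inversion number by at most one, and h_{S_0} is supported where this number is 0. The pigeonhole
  argument uses that S_0 has dn-1 columns, at most n-1 of them with more than one box.\<close>

definition ringhom :: "('a::comm_ring_1 \<Rightarrow> 'b::comm_ring_1) \<Rightarrow> bool" where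
  "ringhom f \<longleftrightarrow> f 1 = 1 \<and> (\<forall>a b. f (a + b) = f a + f b) \<and> (\<forall>a b. f (a * b) = f a * f b)"

lemma ringhom_simps:
  assumes "ringhom f"
  shows "f 1 = 1" "f (a + b) = f a + f b" "f (a * b) = f a * f b" "f 0 = 0" "f (- a) = - f a"
    "f (a - b) = f a - f b" "f (a ^ n) = f a ^ n"
    "f (sum g A) = (\<Sum>i\<in>A. f (g i))" "f (prod g A) = (\<Prod>i\<in>A. f (g i))"
proof -
  show 1: "f 1 = 1" and 2: "f (a + b) = f a + f b" and 3: "f (a * b) = f a * f b" for a b
    using assms by (auto simp: ringhom_def)
  have "f 0 + f 0 = f 0" using 2[of 0 0] by simp
  then show 4: "f 0 = 0" by simp
  show 5: "f (- a) = - f a" for a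
    using 2[of a "-a"] 4 by (simp add: eq_neg_iff_add_eq_0 add.commute)
  show "f (a - b) = f a - f b" using 2[of a "- b"] 5[of b] by simp
  show "f (a ^ n) = f a ^ n" by (induction n) (simp_all add: 1 3)
  show "f (sum g A) = (\<Sum>i\<in>A. f (g i))"
    by (induction A rule: infinite_finite_induct) (simp_all add: 2 4)
  show "f (prod g A) = (\<Prod>i\<in>A. f (g i))"
    by (induction A rule: infinite_finite_induct) (simp_all add: 1 3)
qed

lemma ringhom_comp: "ringhom f \<Longrightarrow> ringhom g \<Longrightarrow> ringhom (\<lambda>x. g (f x))"
  by (simp add: ringhom_def)

lemma ringhom_id: "ringhom (\<lambda>x. x)"
  by (simp add: ringhom_def)

lemma ringhom_Const: "ringhom Const"
  by (auto simp: ringhom_def Const_def single_add mult_single)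

lemmas Const_simps = ringhom_simps[OF ringhom_Const]

lemma Const_eq_iff [simp]: "Const a = Const b \<longleftrightarrow> a = b"
  by (metis Const_def lookup_single_eq)

lemma Const_eq_0_iff [simp]: "Const a = 0 \<longleftrightarrow> a = 0"
  by (metis Const_eq_iff Const_simps(4))

lemma ringhom_Fract: "ringhom (\<lambda>p::'a::idom. Fract p 1)"
  by (auto simp: ringhom_def One_fract_def)

lemma Fract_1_eq_iff: "Fract p 1 = Fract r 1 \<longleftrightarrow> p = r" for p r :: "'a::idom"
  by (simp add: eq_fract)

lemma mpoly_additive_induct [case_names zero plus]:
  fixes p :: "'k \<Rightarrow>\<^sub>0 'a::comm_monoid_add"
  assumes "P 0" "\<And>f k c. P f \<Longrightarrow> P (f + Poly_Mapping.single k c)"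
  shows "P p"
proof (induction p rule: update_induct)
  case const
  then show ?case by (rule assms(1))
next
  case (update f a b)
  have "Poly_Mapping.update a b f = f + Poly_Mapping.single a b"
    using update by (intro poly_mapping_eqI) (auto simp: lookup_update lookup_add lookup_single in_keys_iff when_def)
  then show ?case using assms(2) update by simp
qed

definition mon :: "(nat \<Rightarrow>\<^sub>0 nat) \<Rightarrow> 'a::comm_ring_1 mpoly" where
  "mon k = Poly_Mapping.single k 1"

lemma single_conv_mon: "Poly_Mapping.single k c = Const c * mon k"
  by (simp add: Const_def mon_def mult_single)

lemma mon_0 [simp]: "mon 0 = 1"
  by (simp add: mon_def)

lemma mon_plus: "mon (k + l) = mon k * mon l"
  by (simp add: mon_def mult_single)

lemma mon_Suc: "mon (k + Poly_Mapping.single i (Suc 0)) = mon k * Var i"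
  by (simp add: mon_def Var_def mult_single)

lemma monom_induct [case_names zero Suc]:
  fixes k :: "nat \<Rightarrow>\<^sub>0 nat"
  assumes "P 0" "\<And>k i. P k \<Longrightarrow> P (k + Poly_Mapping.single i (Suc 0))"
  shows "P k"
proof (induction k rule: mpoly_additive_induct)
  case zero
  then show ?case by (rule assms(1))
next
  case (plus f i c)
  then show ?case
  proof (induction c)
    case (Suc c)
    then have "P (f + Poly_Mapping.single i c + Poly_Mapping.single i (Suc 0))" by (intro assms(2)) auto
    then show ?case by (simp add: single_add[symmetric] add.assoc)
  qed auto
qed

lemma mpoly_induct [case_names Const Var add mult]:
  fixes p :: "'a::comm_ring_1 mpoly"
  assumes C: "\<And>c. P (Const c)" and V: "\<And>i. P (Var i)"
    and A: "\<And>p r. P p \<Longrightarrow> P r \<Longrightarrow> P (p + r)" and M: "\<And>p r. P p \<Longrightarrow> P r \<Longrightarrow> P (p * r)"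
  shows "P p"
proof (induction p rule: mpoly_additive_induct)
  case zero
  then show ?case using C[of 0] by (simp add: Const_simps)
next
  case (plus f k c)
  have "P (mon k)"
    by (induction k rule: monom_induct) (use C[of 1] V M in \<open>auto simp: mon_Suc Const_simps\<close>)
  then show ?case using plus A M C by (simp add: single_conv_mon)
qed

lemma mpoly_expand: "p = (\<Sum>k\<in>Poly_Mapping.keys p. Const (Poly_Mapping.lookup p k) * mon k)"
  by (intro poly_mapping_eqI)
    (auto simp: single_conv_mon[symmetric] lookup_sum lookup_single when_def in_keys_iff)

lemma lookup_Const_mult: "Poly_Mapping.lookup (Const c * p) k = c * Poly_Mapping.lookup p k"
proof (induction p rule: mpoly_additive_induct)
  case (plus f l d)
  have "Const c * Poly_Mapping.single l d = Poly_Mapping.single l (c * d)"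
    by (simp add: Const_def mult_single)
  then show ?case using plus by (simp add: distrib_left lookup_add lookup_single when_def)
qed simp

lemma eval_single:
  assumes "ringhom \<phi>"
  shows "eval_mpoly \<phi> x (Poly_Mapping.single k c) =
    \<phi> c * (\<Prod>j\<in>Poly_Mapping.keys k. x j ^ Poly_Mapping.lookup k j)"
  using ringhom_simps(4)[OF assms] by (cases "c = 0") (auto simp: eval_mpoly_def)

lemma eval_superset:
  assumes "ringhom \<phi>" "finite A" "Poly_Mapping.keys p \<subseteq> A"
  shows "eval_mpoly \<phi> x p = (\<Sum>k\<in>A. \<phi> (Poly_Mapping.lookup p k) *
      (\<Prod>j\<in>Poly_Mapping.keys k. x j ^ Poly_Mapping.lookup k j))"
  unfolding eval_mpoly_def using assms ringhom_simps(4)[OF assms(1)]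
  by (intro sum.mono_neutral_left) (auto simp: in_keys_iff)

lemma eval_add:
  assumes "ringhom \<phi>"
  shows "eval_mpoly \<phi> x (p + r) = eval_mpoly \<phi> x p + eval_mpoly \<phi> x r"
proof -
  define A where "A = Poly_Mapping.keys p \<union> Poly_Mapping.keys r"
  have "finite A" "Poly_Mapping.keys (p + r) \<subseteq> A" "Poly_Mapping.keys p \<subseteq> A" "Poly_Mapping.keys r \<subseteq> A"
    using keys_add[of p r] by (auto simp: A_def)
  then show ?thesis
    using assms by (simp add: eval_superset[of \<phi> A] lookup_add ringhom_simps(2)[OF assms] distrib_right sum.distrib)
qed

lemma prod_keys_superset:
  fixes x :: "nat \<Rightarrow> 'b::comm_monoid_mult"
  assumes "finite A" "Poly_Mapping.keys k \<subseteq> A"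
  shows "(\<Prod>j\<in>Poly_Mapping.keys k. x j ^ Poly_Mapping.lookup k j) = (\<Prod>j\<in>A. x j ^ Poly_Mapping.lookup k j)"
  using assms by (intro prod.mono_neutral_left) (auto simp: in_keys_iff)

lemma prod_keys_add:
  fixes x :: "nat \<Rightarrow> 'b::comm_ring_1" and k l :: "nat \<Rightarrow>\<^sub>0 nat"
  shows "(\<Prod>j\<in>Poly_Mapping.keys (k + l). x j ^ Poly_Mapping.lookup (k + l) j) =
    (\<Prod>j\<in>Poly_Mapping.keys k. x j ^ Poly_Mapping.lookup k j) *
    (\<Prod>j\<in>Poly_Mapping.keys l. x j ^ Poly_Mapping.lookup l j)"
proof -
  define A where "A = Poly_Mapping.keys k \<union> Poly_Mapping.keys l"
  have "finite A" "Poly_Mapping.keys (k + l) \<subseteq> A" "Poly_Mapping.keys k \<subseteq> A" "Poly_Mapping.keys l \<subseteq> A"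
    using keys_add[of k l] by (auto simp: A_def)
  then show ?thesis
    by (simp only: prod_keys_superset[of A]) (simp add: lookup_add power_add prod.distrib)
qed

lemma eval_0 [simp]: "eval_mpoly \<phi> x 0 = 0"
  by (simp add: eval_mpoly_def)

lemma eval_mult_single:
  assumes h: "ringhom \<phi>"
  shows "eval_mpoly \<phi> x (Poly_Mapping.single k c * r) =
    eval_mpoly \<phi> x (Poly_Mapping.single k c) * eval_mpoly \<phi> x r"
proof (induction r rule: mpoly_additive_induct)
  case (plus f l d)
  then show ?case
    using h by (simp add: distrib_left eval_add mult_single eval_single prod_keys_add ringhom_simps(3)[OF h] mult_ac)
qed simp

lemma eval_mult:
  assumes h: "ringhom \<phi>"
  shows "eval_mpoly \<phi> x (p * r) = eval_mpoly \<phi> x p * eval_mpoly \<phi> x r"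
proof (induction p rule: mpoly_additive_induct)
  case (plus f k c)
  then show ?case
    using h by (simp add: distrib_right eval_add eval_mult_single)
qed simp

lemma eval_Const: "ringhom \<phi> \<Longrightarrow> eval_mpoly \<phi> x (Const c) = \<phi> c"
  by (simp add: Const_def eval_single)

lemma eval_Var: "ringhom \<phi> \<Longrightarrow> eval_mpoly \<phi> x (Var i) = x i"
  by (simp add: Var_def eval_single ringhom_simps(1))

lemma ringhom_eval: "ringhom \<phi> \<Longrightarrow> ringhom (eval_mpoly \<phi> x)"
  using eval_Const[of \<phi> x 1] by (auto simp: ringhom_def eval_add eval_mult Const_simps)

lemmas eval_simps = ringhom_simps[OF ringhom_eval] eval_Const eval_Var

lemma eval_unique:
  assumes h: "ringhom f" and "\<And>c. f (Const c) = \<phi> c" and "\<And>i. f (Var i) = x i"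
  shows "f p = eval_mpoly \<phi> x p"
proof -
  have p: "ringhom \<phi>"
    using ringhom_comp[OF ringhom_Const h] assms(2) by simp
  show ?thesis
    by (induction p rule: mpoly_induct) (simp_all add: assms eval_simps[OF p] ringhom_simps[OF h] p)
qed

lemma eval_comp:
  assumes "ringhom \<phi>" "ringhom f"
  shows "f (eval_mpoly \<phi> x p) = eval_mpoly (\<lambda>c. f (\<phi> c)) (\<lambda>i. f (x i)) p"
proof (rule eval_unique)
  show "ringhom (\<lambda>p. f (eval_mpoly \<phi> x p))"
    by (rule ringhom_comp[OF ringhom_eval[OF assms(1)] assms(2)])
qed (simp_all add: assms eval_Const eval_Var)

lemma eval_Const_Var [simp]: "eval_mpoly Const Var p = p"
  by (rule eval_unique[symmetric]) (auto simp: ringhom_id)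

lemma eval_subst:
  assumes "ringhom \<phi>"
  shows "eval_mpoly \<phi> x (subst_mpoly s p) = eval_mpoly \<phi> (\<lambda>i. eval_mpoly \<phi> x (s i)) p"
  unfolding subst_mpoly_def
  using eval_comp[OF ringhom_Const ringhom_eval[OF assms], of x s p] assms by (simp add: eval_simps)

text \<open>The generic point; by injectivity, polynomial identities may be checked there in a field.\<close>

definition generic_pt :: "nat \<Rightarrow> 'a::field mpoly fract" where
  "generic_pt i = Fract (Var i) 1"

definition gev :: "(nat \<Rightarrow> 'a::field mpoly fract) \<Rightarrow> 'a mpoly \<Rightarrow> 'a mpoly fract" where
  "gev x p = eval_mpoly (\<lambda>c. Fract (Const c) 1) x p"

lemma ringhom_FC: "ringhom (\<lambda>c::'a::field. Fract (Const c) 1)"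
  by (rule ringhom_comp[OF ringhom_Const ringhom_Fract])

lemma ringhom_gev: "ringhom (gev x)"
  unfolding gev_def by (rule ringhom_eval[OF ringhom_FC])

lemma gev_Fract: "gev (\<lambda>i. Fract (s i) 1) p = Fract (eval_mpoly Const s p) 1"
  unfolding gev_def by (rule eval_comp[OF ringhom_Const ringhom_Fract, symmetric])

lemma gev_generic_pt: "gev generic_pt p = Fract p 1"
  using gev_Fract[of Var p] by (simp add: generic_pt_def[abs_def])

lemma gev_eqI: "gev generic_pt p = gev generic_pt r \<Longrightarrow> p = r"
  by (simp add: gev_generic_pt Fract_1_eq_iff)

lemma lookup_Var: "Poly_Mapping.lookup (Var i) k = (if k = Poly_Mapping.single i 1 then 1 else 0)"
  by (auto simp: Var_def lookup_single when_def)

lemma Var_eq_iff [simp]: "(Var i :: 'a::comm_ring_1 mpoly) = Var j \<longleftrightarrow> i = j"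
proof
  assume "Var i = (Var j :: 'a mpoly)"
  then have "Poly_Mapping.lookup (Var i :: 'a mpoly) (Poly_Mapping.single i 1) =
    Poly_Mapping.lookup (Var j :: 'a mpoly) (Poly_Mapping.single i 1)" by simp
  then have "Poly_Mapping.single i 1 = Poly_Mapping.single j (1::nat)"
    by (simp add: lookup_Var split: if_splits)
  then have "Poly_Mapping.lookup (Poly_Mapping.single i 1) i = Poly_Mapping.lookup (Poly_Mapping.single j (1::nat)) i"
    by simp
  then show "i = j" by (auto simp: lookup_single when_def split: if_splits)
qed simp

lemma Var_neq_0 [simp]: "Var i \<noteq> (0 :: 'a::comm_ring_1 mpoly)"
proof
  assume "Var i = (0 :: 'a mpoly)"
  then have "Poly_Mapping.lookup (Var i :: 'a mpoly) (Poly_Mapping.single i 1) = 0" by simp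
  then show False by (simp add: lookup_Var)
qed

lemma generic_pt_eq_iff [simp]: "generic_pt i = generic_pt j \<longleftrightarrow> i = j"
  by (simp add: generic_pt_def Fract_1_eq_iff)

section \<open>The Hecke algebra action\<close>

abbreviation tp :: "nat \<Rightarrow> nat \<Rightarrow> nat" where
  "tp i \<equiv> transpose i (Suc i)"

lemma exact_quot_mult: "r \<noteq> 0 \<Longrightarrow> exact_quot (s * r) r = (s :: 'a::idom mpoly)"
  unfolding exact_quot_def by (rule the_equality) auto

lemma ringhom_subst: "ringhom (subst_mpoly s)"
  unfolding subst_mpoly_def by (rule ringhom_eval[OF ringhom_Const])

lemma ringhom_swap: "ringhom (swap_vars i)"
  unfolding swap_vars_def by (rule ringhom_subst)

lemma swap_Const [simp]: "swap_vars i (Const c) = Const c"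
  by (simp add: swap_vars_def subst_mpoly_def eval_Const ringhom_Const)

lemma swap_Var: "swap_vars i (Var j) = Var (tp i j)"
  by (simp add: swap_vars_def subst_mpoly_def eval_Var ringhom_Const)

lemma eval_swap:
  "ringhom \<phi> \<Longrightarrow> eval_mpoly \<phi> x (swap_vars i p) = eval_mpoly \<phi> (x \<circ> tp i) p"
  by (simp add: swap_vars_def eval_subst eval_Var comp_def)

lemma Var_diff_neq_0 [simp]: "Var i - Var (Suc i) \<noteq> (0 :: 'a::comm_ring_1 mpoly)"
  by simp

text \<open>Gives meaning to \<open>exact_quot\<close> in \<open>opT\<close>, which is a definite
  description. Divisibility passes to products by a twisted Leibniz identity.\<close>

lemma Var_diff_dvd: "(Var i - Var (Suc i)) dvd (p - swap_vars i p)"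
proof (induction p rule: mpoly_induct)
  case (Var j)
  consider "j = i" | "j = Suc i" | "j \<noteq> i" "j \<noteq> Suc i" by blast
  then show ?case
  proof cases
    case 2
    then have "Var j - swap_vars i (Var j) = - (Var i - Var (Suc i))"
      by (simp add: swap_Var)
    then show ?thesis by (metis dvd_minus_iff dvd_refl)
  qed (auto simp: swap_Var)
next
  case (add p r)
  have "p + r - swap_vars i (p + r) = (p - swap_vars i p) + (r - swap_vars i r)"
    by (simp add: ringhom_simps[OF ringhom_swap])
  then show ?case using add by (metis dvd_add)
next
  case (mult p r)
  have "p * r - swap_vars i (p * r) = (p - swap_vars i p) * r + swap_vars i p * (r - swap_vars i r)"
    by (simp add: ringhom_simps[OF ringhom_swap] algebra_simps)
  then show ?case using mult by (metis dvd_add dvd_mult dvd_mult2)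
qed simp

definition divdiff :: "nat \<Rightarrow> 'a::field mpoly \<Rightarrow> 'a mpoly" where
  "divdiff i p = exact_quot (p - swap_vars i p) (Var i - Var (Suc i))"

lemma divdiff_mult: "divdiff i p * (Var i - Var (Suc i)) = p - swap_vars i p"
proof -
  obtain s where s: "p - swap_vars i p = s * (Var i - Var (Suc i))"
    using Var_diff_dvd[of i p] by (metis dvd_def mult.commute)
  show ?thesis unfolding divdiff_def s by (simp add: exact_quot_mult)
qed

lemma divdiff_unique: "s * (Var i - Var (Suc i)) = p - swap_vars i p \<Longrightarrow> divdiff i p = s"
  unfolding divdiff_def by (metis Suc_eq_plus1 Var_diff_neq_0 exact_quot_mult)

lemma divdiff_Const [simp]: "divdiff i (Const c) = 0"
  by (rule divdiff_unique) simp

lemma divdiff_Var: "divdiff i (Var j) = (if j = i then 1 else if j = Suc i then -1 else 0)"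
  by (rule divdiff_unique) (auto simp: swap_Var)

lemma divdiff_add: "divdiff i (p + r) = divdiff i p + divdiff i r"
  by (rule divdiff_unique) (simp only: distrib_right divdiff_mult ringhom_simps[OF ringhom_swap], simp)

lemma divdiff_mult_rule: "divdiff i (p * r) = divdiff i p * r + swap_vars i p * divdiff i r"
proof (rule divdiff_unique)
  have "(divdiff i p * r + swap_vars i p * divdiff i r) * (Var i - Var (Suc i)) =
    (divdiff i p * (Var i - Var (Suc i))) * r + swap_vars i p * (divdiff i r * (Var i - Var (Suc i)))"
    by (simp add: algebra_simps)
  also have "\<dots> = p * r - swap_vars i (p * r)"
    by (simp only: divdiff_mult ringhom_simps[OF ringhom_swap]) (simp add: algebra_simps)
  finally show "(divdiff i p * r + swap_vars i p * divdiff i r) * (Var i - Var (Suc i)) = p * r - swap_vars i (p * r)" .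
qed

lemma opT_divdiff: "opT t i p = Const (1 - t) * Var (Suc i) * divdiff i p + Const t * swap_vars i p"
  by (simp add: opT_def divdiff_def)

text \<open>The value at a point of a polynomial acted on by a generator: \<open>a, b\<close> are the two coordinates involved, and
  \<open>p, p'\<close> the values of the polynomial at the point and at its image under the transposition.\<close>

definition hecke_at :: "'b::field \<Rightarrow> 'b \<Rightarrow> 'b \<Rightarrow> 'b \<Rightarrow> 'b \<Rightarrow> 'b" where
  "hecke_at t a b p p' = (1 - t) * b / (a - b) * p + (t - (1 - t) * b / (a - b)) * p'"

lemma eval_divdiff:
  fixes \<phi> :: "'a::field \<Rightarrow> 'b::field"
  assumes "ringhom \<phi>" "x i \<noteq> x (Suc i)"
  shows "eval_mpoly \<phi> x (divdiff i p) = (eval_mpoly \<phi> x p - eval_mpoly \<phi> (x \<circ> tp i) p) / (x i - x (Suc i))"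
  using arg_cong[OF divdiff_mult[of i p], of "eval_mpoly \<phi> x"] assms
  by (simp add: eval_simps[OF assms(1)] eval_swap assms(1) field_simps)

lemma eval_opT:
  fixes \<phi> :: "'a::field \<Rightarrow> 'b::field"
  assumes "ringhom \<phi>" "x i \<noteq> x (Suc i)"
  shows "eval_mpoly \<phi> x (opT t i p) =
    hecke_at (\<phi> t) (x i) (x (Suc i)) (eval_mpoly \<phi> x p) (eval_mpoly \<phi> (x \<circ> tp i) p)"
  using assms
  by (simp add: opT_divdiff eval_simps[OF assms(1)] eval_swap eval_divdiff ringhom_simps[OF assms(1)] hecke_at_def algebra_simps
      diff_divide_distrib)

text \<open>At x_{i+1} = t x_i the coefficient of the exchanged value vanishes. At points with
  geometric progressions of ratio t a generator inside a progression therefore acts as the scalar t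
  and never leaves the point.\<close>

lemma eval_opT_eq:
  fixes \<phi> :: "'a::field \<Rightarrow> 'b::field"
  assumes "ringhom \<phi>" "x (Suc i) = \<phi> t * x i" "\<phi> t \<noteq> 1" "x i \<noteq> 0"
  shows "eval_mpoly \<phi> x (opT t i p) = \<phi> t * eval_mpoly \<phi> x p"
proof -
  have "x i \<noteq> x (Suc i)" using assms by simp
  moreover have "(1 - \<phi> t) * x (Suc i) / (x i - x (Suc i)) = \<phi> t"
    using assms calculation by (simp add: field_simps)
  ultimately show ?thesis using assms(1) by (simp add: eval_opT hecke_at_def)
qed

lemma opT_add: "opT t i (p + r) = opT t i p + opT t i r"
  by (simp add: opT_divdiff divdiff_add ringhom_simps[OF ringhom_swap] algebra_simps)

lemma opT_smult: "opT t i (Const c * p) = Const c * opT t i p"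
  by (simp add: opT_divdiff divdiff_mult_rule ringhom_simps[OF ringhom_swap] algebra_simps)

lemma opT_smult': "opT t i (p * Const c) = opT t i p * Const c"
  using opT_smult[of t i c p] by (simp add: mult.commute)

lemma opT_0 [simp]: "opT t i 0 = 0"
  using opT_smult[of t i 0 0] by (simp add: Const_simps)

lemma opT_uminus: "opT t i (- p) = - opT t i p"
  using opT_add[of t i p "- p"] by (simp add: eq_neg_iff_add_eq_0 add.commute)

lemma opT_diff: "opT t i (p - r) = opT t i p - opT t i r"
  using opT_add[of t i p "- r"] by (simp add: opT_uminus)

section \<open>Hecke relations, checked at the generic point\<close>

lemma gev_opT:
  assumes "x i \<noteq> x (Suc i)"
  shows "gev x (opT t i p) = hecke_at (Fract (Const t) 1) (x i) (x (Suc i)) (gev x p) (gev (x \<circ> tp i) p)"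
  unfolding gev_def using eval_opT[OF ringhom_FC assms] .

lemma gev_Const: "gev x (Const c) = Fract (Const c) 1"
  unfolding gev_def by (rule eval_Const[OF ringhom_FC])

lemmas gev_simps = ringhom_simps[OF ringhom_gev]

lemma opT_quadratic: "opT t i (opT t i p) = Const (t - 1) * opT t i p + Const t * p"
proof (rule gev_eqI)
  define T where "T = (Fract (Const t) 1 :: 'a mpoly fract)"
  have T: "Fract (Const (t - 1)) 1 = T - 1"
    unfolding T_def by (simp add: ringhom_simps[OF ringhom_FC])
  have [simp]: "(generic_pt \<circ> tp i) i = generic_pt (Suc i)" "(generic_pt \<circ> tp i) (Suc i) = generic_pt i" "(generic_pt \<circ> tp i) \<circ> tp i = generic_pt" for i
    by (auto simp: fun_eq_iff)
  define a where "a = (generic_pt i :: 'a mpoly fract)"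
  define b where "b = (generic_pt (Suc i) :: 'a mpoly fract)"
  have ab: "a \<noteq> b" by (simp add: a_def b_def)
  have alg: "hecke_at T a b (hecke_at T a b P Q) (hecke_at T b a Q P) = (T - 1) * hecke_at T a b P Q + T * P" for P Q
  proof -
    define u where "u = (1 - T) * b / (a - b)"
    have u': "(1 - T) * a / (b - a) = T - 1 - u"
      unfolding u_def using ab by (simp add: field_simps)
    show ?thesis unfolding hecke_at_def u' u_def[symmetric] by algebra
  qed
  have "gev generic_pt (opT t i (opT t i p)) = hecke_at T a b (hecke_at T a b (gev generic_pt p) (gev (generic_pt \<circ> tp i) p))
      (hecke_at T b a (gev (generic_pt \<circ> tp i) p) (gev generic_pt p))"
    by (simp add: gev_opT T_def a_def b_def)
  also have "\<dots> = gev generic_pt (Const (t - 1) * opT t i p + Const t * p)"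
    by (simp add: alg gev_simps gev_Const T gev_opT) (simp add: T_def a_def b_def)
  finally show "gev generic_pt (opT t i (opT t i p)) = gev generic_pt (Const (t - 1) * opT t i p + Const t * p)" .
qed

text \<open>The six values are those of a polynomial at the six permutations of three coordinates.
  Exchanging the two coordinates in u = (1-t)b/(a-b) gives t-1-u, so the relation reduces to one
  identity between three coefficients, u v = w (u + v + 1 - t).\<close>

lemma hecke_at_braid:
  fixes a b c t :: "'b::field"
  assumes "a \<noteq> b" "b \<noteq> c" "a \<noteq> c"
  shows "hecke_at t a b (hecke_at t b c (hecke_at t a b p0 p1) (hecke_at t a c p2 p21)) (hecke_at t a c (hecke_at t b a p1 p0) (hecke_at t b c p12 p121))
    = hecke_at t b c (hecke_at t a b (hecke_at t b c p0 p2) (hecke_at t a c p1 p12)) (hecke_at t a c (hecke_at t c b p2 p0) (hecke_at t a b p21 p121))"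
proof -
  define u where "u = (1 - t) * b / (a - b)"
  define v where "v = (1 - t) * c / (b - c)"
  define w where "w = (1 - t) * c / (a - c)"
  have u': "(1 - t) * a / (b - a) = t - 1 - u" and v': "(1 - t) * b / (c - b) = t - 1 - v"
    unfolding u_def v_def using assms by (simp_all add: field_simps)
  have "(a - b) * (b - c) * (a - c) * (u * v - w * (u + v + 1 - t)) = 0"
  proof -
    have "u * (a - b) = (1 - t) * b" "v * (b - c) = (1 - t) * c" "w * (a - c) = (1 - t) * c"
      unfolding u_def v_def w_def using assms by simp_all
    then show ?thesis by algebra
  qed
  then have *: "u * v = w * (u + v + 1 - t)" using assms by simp
  show ?thesis
    unfolding hecke_at_def u' v' u_def[symmetric] v_def[symmetric] w_def[symmetric]
    using * by algebra
qed

lemma opT_braid: "opT t i (opT t (Suc i) (opT t i p)) = opT t (Suc i) (opT t i (opT t (Suc i) p))"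
proof (rule gev_eqI)
  define T where "T = (Fract (Const t) 1 :: 'a mpoly fract)"
  let ?x = "generic_pt :: nat \<Rightarrow> 'a mpoly fract"
  let ?s = "tp i" and ?r = "tp (Suc i)"
  have w: "?x \<circ> ?r \<circ> ?s \<circ> ?r = ?x \<circ> ?s \<circ> ?r \<circ> ?s"
    by (auto simp: fun_eq_iff transpose_def)
  have w2: "?x \<circ> ?s \<circ> ?s = ?x" "?x \<circ> ?r \<circ> ?r = ?x"
    by (auto simp: fun_eq_iff)
  have [simp]: "i \<noteq> Suc (Suc i)" "Suc (Suc i) \<noteq> i" by auto
  have v: "(?x \<circ> ?s) i = ?x (Suc i)" "(?x \<circ> ?s) (Suc i) = ?x i" "(?x \<circ> ?s) (Suc (Suc i)) = ?x (Suc (Suc i))"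
    "(?x \<circ> ?r) i = ?x i" "(?x \<circ> ?r) (Suc i) = ?x (Suc (Suc i))" "(?x \<circ> ?r) (Suc (Suc i)) = ?x (Suc i)"
    "(?x \<circ> ?s \<circ> ?r) i = ?x (Suc i)" "(?x \<circ> ?s \<circ> ?r) (Suc i) = ?x (Suc (Suc i))" "(?x \<circ> ?s \<circ> ?r) (Suc (Suc i)) = ?x i"
    "(?x \<circ> ?r \<circ> ?s) i = ?x (Suc (Suc i))" "(?x \<circ> ?r \<circ> ?s) (Suc i) = ?x i" "(?x \<circ> ?r \<circ> ?s) (Suc (Suc i)) = ?x (Suc i)"
    by (simp_all add: transpose_def)
  show "gev ?x (opT t i (opT t (Suc i) (opT t i p))) = gev ?x (opT t (Suc i) (opT t i (opT t (Suc i) p)))"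
    by (simp add: gev_opT v w w2 T_def[symmetric] del: o_apply) (rule hecke_at_braid; simp)
qed

lemma opT_commute:
  assumes "Suc i < j"
  shows "opT t i (opT t j p) = opT t j (opT t i p)"
proof (rule gev_eqI)
  let ?x = "generic_pt :: nat \<Rightarrow> 'a mpoly fract"
  have w: "?x \<circ> tp j \<circ> tp i = ?x \<circ> tp i \<circ> tp j"
    using assms by (auto simp: fun_eq_iff transpose_def)
  have v: "(?x \<circ> tp i) j = ?x j" "(?x \<circ> tp i) (Suc j) = ?x (Suc j)"
    "(?x \<circ> tp j) i = ?x i" "(?x \<circ> tp j) (Suc i) = ?x (Suc i)"
    using assms by (simp_all add: transpose_def)
  have alg: "hecke_at t a b (hecke_at t c d p q) (hecke_at t c d r s) = hecke_at t c d (hecke_at t a b p r) (hecke_at t a b q s)"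
    for t a b c d p q r s :: "'a mpoly fract"
    unfolding hecke_at_def by algebra
  show "gev ?x (opT t i (opT t j p)) = gev ?x (opT t j (opT t i p))"
    by (simp add: gev_opT v w alg del: o_apply)
qed

text \<open>The quadratic relation T^2 = (t-1) T + t solved for the inverse. As a polynomial in the
  generator it inherits linearity and commutation.\<close>

definition opTi :: "'a::field \<Rightarrow> nat \<Rightarrow> 'a mpoly \<Rightarrow> 'a mpoly" where
  "opTi t i p = Const (1 / t) * (opT t i p + Const (1 - t) * p)"

lemma Const_mult_cancel: "c \<noteq> 0 \<Longrightarrow> Const (1 / c) * (Const c * p) = p" for c :: "'a::field"
  by (simp add: mult.assoc[symmetric] Const_simps(3)[symmetric] Const_simps(1))

lemma opTi_opT: "t \<noteq> 0 \<Longrightarrow> opTi t i (opT t i p) = p"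
  unfolding opTi_def opT_quadratic
  using Const_mult_cancel[of t p] by (simp add: Const_simps algebra_simps)

lemma opT_opTi: "t \<noteq> 0 \<Longrightarrow> opT t i (opTi t i p) = p"
  using opTi_opT[of t i p] by (simp only: opTi_def opT_smult opT_add not_False_eq_True)

lemma inv_opT: "t \<noteq> 0 \<Longrightarrow> inv (opT t i) = opTi t i"
  by (intro inv_equality ext) (simp_all add: opTi_opT opT_opTi)

lemma opT_inj: "t \<noteq> 0 \<Longrightarrow> opT t i p = opT t i r \<Longrightarrow> p = r"
  by (metis opTi_opT)

lemma opT_eq_0_iff: "t \<noteq> 0 \<Longrightarrow> opT t i p = 0 \<longleftrightarrow> p = 0"
  using opT_inj[of t i p 0] by auto

lemma opTi_add: "opTi t i (p + r) = opTi t i p + opTi t i r"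
  by (simp add: opTi_def opT_add algebra_simps)

lemma opTi_smult: "opTi t i (Const c * p) = Const c * opTi t i p"
  by (simp add: opTi_def opT_smult distrib_left mult.left_commute)

lemma opT_opTi_commute: "Suc i < j \<Longrightarrow> opT t i (opTi t j p) = opTi t j (opT t i p)"
  using opT_commute[of i j t p] by (simp add: opTi_def opT_smult opT_add)

lemma opTi_opT_commute: "Suc i < j \<Longrightarrow> opT t j (opTi t i p) = opTi t i (opT t j p)"
  using opT_commute[of i j t p] by (simp add: opTi_def opT_smult opT_add)

text \<open>On a common eigenvector the braid relation forces neighbouring generators to have equal
  eigenvalues; t and -1 give t (t+1) w = 0.\<close>

lemma braid_eigen_0:
  assumes "t \<noteq> 0" "t \<noteq> -1" "opT t j w = Const t * w" "opT t (Suc j) w = - w"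
  shows "w = 0"
proof -
  have "- (Const t * (Const t * w)) = Const t * w"
    using opT_braid[of t j w] by (simp only: assms(3,4) opT_smult opT_uminus mult_minus_right minus_minus)
  then have "Const t * (Const (t + 1) * w) = 0"
    by (simp add: Const_simps distrib_left distrib_right neg_eq_iff_add_eq_0)
  moreover have "t + 1 \<noteq> 0" using assms(2) by (simp add: add_eq_0_iff2)
  ultimately show ?thesis using assms(1) by simp
qed

section \<open>The q-shifted rotation\<close>

lemma eval_omega:
  assumes "ringhom \<phi>"
  shows "eval_mpoly \<phi> x (op_omega q N p) =
    eval_mpoly \<phi> (\<lambda>j. if j = 1 then \<phi> q * x N else if j \<in> {2..N} then x (j - 1) else x j) p"
  unfolding op_omega_def eval_subst[OF assms]
  by (rule arg_cong[where f = "\<lambda>x. eval_mpoly \<phi> x p"]) (auto simp: fun_eq_iff eval_simps[OF assms] assms)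

lemma ringhom_omega: "ringhom (op_omega q N)"
  unfolding op_omega_def by (rule ringhom_subst)

lemma omega_Const [simp]: "op_omega q N (Const c) = Const c"
  by (simp add: op_omega_def subst_mpoly_def eval_Const ringhom_Const)

lemma omega_smult: "op_omega q N (Const c * p) = Const c * op_omega q N p"
  by (simp add: ringhom_simps[OF ringhom_omega])

text \<open>The rotation moves coordinates by one place; the bounds on i keep the wrapped coordinate
  q x_N out of the exchange.\<close>

lemma omega_opT:
  assumes "1 \<le> i" "Suc i < N"
  shows "op_omega q N (opT t (Suc i) p) = opT t i (op_omega q N p)"
proof (rule gev_eqI)
  let ?x = "generic_pt :: nat \<Rightarrow> 'a mpoly fract"
  let ?o = "\<lambda>x j. if j = 1 then Fract (Const q) 1 * x N else if j \<in> {2..N} then x (j - 1) else x j"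
  have o: "gev x (op_omega q N p) = gev (?o x) p" for x p
    unfolding gev_def by (rule eval_omega[OF ringhom_FC])
  have w: "?o ?x \<circ> tp (Suc i) = ?o (?x \<circ> tp i)"
    using assms by (auto simp: fun_eq_iff transpose_def)
  have v: "?o ?x (Suc i) = ?x i" "?o ?x (Suc (Suc i)) = ?x (Suc i)" using assms by auto
  have "gev ?x (op_omega q N (opT t (Suc i) p)) = gev (?o ?x) (opT t (Suc i) p)"
    by (simp add: o)
  also have "\<dots> = hecke_at (Fract (Const t) 1) (?x i) (?x (Suc i)) (gev (?o ?x) p) (gev (?o ?x \<circ> tp (Suc i)) p)"
    using gev_opT[of "?o ?x" "Suc i" t p] unfolding Suc_eq_plus1[symmetric] v by simp
  also have "\<dots> = gev ?x (opT t i (op_omega q N p))"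
    unfolding w using gev_opT[of ?x i t "op_omega q N p"] by (simp add: o)
  finally show "gev ?x (op_omega q N (opT t (Suc i) p)) = gev ?x (opT t i (op_omega q N p))" .
qed

section \<open>Singular polynomials and the q-shift\<close>

lemma Var_minus_dvd: "(Var a - s) dvd (p - eval_mpoly Const (Var(a := s)) p)"
proof (induction p rule: mpoly_induct)
  case (add p r)
  let ?e = "eval_mpoly Const (Var(a := s))"
  have "p + r - ?e (p + r) = (p - ?e p) + (r - ?e r)"
    by (simp add: eval_simps[OF ringhom_Const])
  then show ?case using add by (metis dvd_add)
next
  case (mult p r)
  let ?e = "eval_mpoly Const (Var(a := s))"
  have "p * r - ?e (p * r) = (p - ?e p) * r + ?e p * (r - ?e r)"
    by (simp add: eval_simps[OF ringhom_Const] algebra_simps)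
  then show ?case using mult by (metis dvd_add dvd_mult dvd_mult2)
qed (simp_all add: eval_Const eval_Var ringhom_Const)

text \<open>The operator D_N kills p iff p is fixed by xi_N. With v = p T_{N-1}^{-1} ... T_1^{-1}
  this becomes an equation free of inverses, which compares v at a q-shifted rotation of a point
  with v T_1 ... T_{N-1} at the point itself.\<close>

definition shift_rel :: "'a::field \<Rightarrow> 'a \<Rightarrow> nat \<Rightarrow> 'a mpoly \<Rightarrow> bool" where
  "shift_rel q t N v \<longleftrightarrow> Const (t ^ (N - 1)) * op_omega q N v = fold (opT t) [1..<N] v"

definition prod_opTi :: "'a::field \<Rightarrow> nat \<Rightarrow> 'a mpoly \<Rightarrow> 'a mpoly" where
  "prod_opTi t i p = fold (opTi t) (rev [1..<i]) p"

text \<open>For \<open>i = N\<close> the relation says that \<open>p\<close> is fixed by \<open>\<xi>\<^sub>N\<close>; in general, that \<open>p \<xi>\<^sub>i\<close> is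
  \<open>t\<^bsup>i-N\<^esup> p T\<^sub>i \<dots> T\<^bsub>N-1\<^esub> T\<^bsub>N-1\<^esub> \<dots> T\<^sub>i\<close>.
  In this form, singularity is visibly preserved by the generators.\<close>

definition sing :: "'a::field \<Rightarrow> 'a \<Rightarrow> nat \<Rightarrow> 'a mpoly \<Rightarrow> bool" where
  "sing q t N p \<longleftrightarrow> (\<forall>i\<in>{1..N}. shift_rel q t N (prod_opTi t i p))"

lemma fold_opT_add: "fold (opT t) xs (p + r) = fold (opT t) xs p + fold (opT t) xs r"
  by (induction xs arbitrary: p r) (simp_all add: opT_add)

lemma fold_opT_smult: "fold (opT t) xs (Const c * p) = Const c * fold (opT t) xs p"
  by (induction xs arbitrary: p) (simp_all add: opT_smult)

lemma prod_opTi_add: "prod_opTi t i (p + r) = prod_opTi t i p + prod_opTi t i r"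
proof -
  have "fold (opTi t) xs (p + r) = fold (opTi t) xs p + fold (opTi t) xs r" for xs
    by (induction xs arbitrary: p r) (simp_all add: opTi_add)
  then show ?thesis unfolding prod_opTi_def by blast
qed

lemma prod_opTi_smult: "prod_opTi t i (Const c * p) = Const c * prod_opTi t i p"
proof -
  have "fold (opTi t) xs (Const c * p) = Const c * fold (opTi t) xs p" for xs
    by (induction xs arbitrary: p) (simp_all add: opTi_smult)
  then show ?thesis unfolding prod_opTi_def by blast
qed

lemma shift_rel_add: "shift_rel q t N v \<Longrightarrow> shift_rel q t N w \<Longrightarrow> shift_rel q t N (v + w)"
  by (simp add: shift_rel_def fold_opT_add ringhom_simps[OF ringhom_omega] distrib_left)

lemma shift_rel_smult: "shift_rel q t N v \<Longrightarrow> shift_rel q t N (Const c * v)"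
  by (simp only: shift_rel_def fold_opT_smult omega_smult mult.left_commute[of _ "Const c"])

lemma sing_add: "sing q t N v \<Longrightarrow> sing q t N w \<Longrightarrow> sing q t N (v + w)"
  by (simp add: sing_def prod_opTi_add shift_rel_add)

lemma sing_smult: "sing q t N v \<Longrightarrow> sing q t N (Const c * v)"
  by (simp add: sing_def prod_opTi_smult shift_rel_smult)

lemma sing_shift_rel: "sing q t N v \<Longrightarrow> 1 \<le> N \<Longrightarrow> shift_rel q t N v"
  by (auto simp: sing_def prod_opTi_def dest: bspec[of _ _ 1])

lemma fold_opT_commute:
  "(\<And>j. j \<in> set xs \<Longrightarrow> Suc j < k \<or> Suc k < j) \<Longrightarrow> fold (opT t) xs (opT t k p) = opT t k (fold (opT t) xs p)"
proof (induction xs arbitrary: p)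
  case (Cons x xs)
  have "opT t x (opT t k p) = opT t k (opT t x p)"
    using Cons.prems[of x] opT_commute[of x k t p] opT_commute[of k x t p] by auto
  then show ?case using Cons by simp
qed simp

lemma fold_opTi_commute:
  "(\<And>j. j \<in> set xs \<Longrightarrow> Suc j < k \<or> Suc k < j) \<Longrightarrow> fold (opTi t) xs (opT t k p) = opT t k (fold (opTi t) xs p)"
proof (induction xs arbitrary: p)
  case (Cons x xs)
  have "opTi t x (opT t k p) = opT t k (opTi t x p)"
    using Cons.prems[of x] opTi_opT_commute[of x k t p] opT_opTi_commute[of k x t p] by auto
  then show ?case using Cons by simp
qed simp

lemma upt_split: "a \<le> b \<Longrightarrow> b \<le> c \<Longrightarrow> [a..<c] = [a..<b] @ [b..<c]"
  by (metis le_Suc_ex upt_add_eq_append)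

lemma upt_split2: "a \<le> b \<Longrightarrow> Suc b < c \<Longrightarrow> [a..<c] = [a..<b] @ [b, Suc b] @ [Suc (Suc b)..<c]"
  using upt_split[of a b c] upt_conv_Cons[of b c] upt_conv_Cons[of "Suc b" c] by simp

lemma fold_opT_shift:
  assumes "2 \<le> k" "k < N"
  shows "fold (opT t) [1..<N] (opT t k v) = opT t (k - 1) (fold (opT t) [1..<N] v)"
proof -
  obtain j where j: "k = Suc j" "1 \<le> j" using assms by (cases k) auto
  have split: "[1..<N] = [1..<j] @ [j, Suc j] @ [Suc (Suc j)..<N]"
    using assms j by (intro upt_split2) auto
  define w where "w = fold (opT t) [1..<j] v"
  have "fold (opT t) [1..<j] (opT t k v) = opT t k w"
    unfolding w_def j by (rule fold_opT_commute) auto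
  moreover have "opT t (Suc j) (opT t j (opT t k w)) = opT t j (opT t (Suc j) (opT t j w))"
    unfolding j using opT_braid[of t j w] by simp
  moreover have "fold (opT t) [Suc (Suc j)..<N] (opT t j p) = opT t j (fold (opT t) [Suc (Suc j)..<N] p)" for p
    by (rule fold_opT_commute) auto
  ultimately show ?thesis unfolding split by (simp add: w_def j)
qed

text \<open>Both sides of the relation turn T_k into T_{k-1}: the rotation by
  \<open>omega_opT\<close>, the product T_1 ... T_{N-1} by the braid relation.\<close>

lemma shift_rel_opT:
  assumes "shift_rel q t N v" "2 \<le> k" "k < N"
  shows "shift_rel q t N (opT t k v)"
proof -
  have "op_omega q N (opT t k v) = opT t (k - 1) (op_omega q N v)"
    using omega_opT[of "k - 1" N q t v] assms by simp
  then show ?thesis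
    using assms unfolding shift_rel_def by (simp only: fold_opT_shift flip: opT_smult)
qed

lemma opT_conv_opTi:
  assumes "t \<noteq> 0"
  shows "opT t k p = Const t * opTi t k p + Const (t - 1) * p"
proof -
  have "Const t * opTi t k p = opT t k p + Const (1 - t) * p"
    using Const_mult_cancel[of "1 / t" "opT t k p + Const (1 - t) * p"] assms by (simp add: opTi_def)
  then show ?thesis by (simp add: Const_simps algebra_simps)
qed

lemma opTi_braid:
  assumes "t \<noteq> 0"
  shows "opTi t k (opTi t (Suc k) (opT t k v)) = opT t (Suc k) (opTi t k (opTi t (Suc k) v))"
proof (rule opT_inj[OF assms], rule opT_inj[OF assms])
  define w where "w = opTi t k (opTi t (Suc k) v)"
  have v: "v = opT t (Suc k) (opT t k w)"
    by (simp add: w_def opT_opTi assms)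
  show "opT t (Suc k) (opT t k (opTi t k (opTi t (Suc k) (opT t k v)))) =
    opT t (Suc k) (opT t k (opT t (Suc k) (opTi t k (opTi t (Suc k) v))))"
    by (simp add: opT_opTi assms flip: w_def) (simp add: v opT_braid)
qed

text \<open>T_k is moved through T_{i-1}^{-1} ... T_1^{-1}. It passes unchanged if i < k, cancels if
  i = k + 1, and becomes T_{k+1} by the braid relation if i > k + 1. For i = k it is written as t
  T_k^{-1} + (t - 1), which mixes the conditions for k + 1 and k; this is why the condition is
  imposed for all i at once.\<close>

lemma sing_opT:
  assumes "sing q t N p" "1 \<le> k" "k < N" and t: "t \<noteq> 0"
  shows "sing q t N (opT t k p)"
  unfolding sing_def
proof
  fix i assume i: "i \<in> {1..N}"
  have R: "shift_rel q t N (prod_opTi t i p)" if "i \<in> {1..N}" for i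
    using assms(1) that by (auto simp: sing_def)
  consider "i < k" | "i = k" | "i = Suc k" | "Suc k < i" by linarith
  then show "shift_rel q t N (prod_opTi t i (opT t k p))"
  proof cases
    case 1
    then have "prod_opTi t i (opT t k p) = opT t k (prod_opTi t i p)"
      unfolding prod_opTi_def by (intro fold_opTi_commute) auto
    then show ?thesis using R[OF i] assms i 1 by (simp add: shift_rel_opT)
  next
    case 2
    have "prod_opTi t k (opTi t k p) = prod_opTi t (Suc k) p"
      using assms(2) by (simp add: prod_opTi_def)
    then have "prod_opTi t i (opT t k p) = Const t * prod_opTi t (Suc k) p + Const (t - 1) * prod_opTi t k p"
      by (simp only: 2 opT_conv_opTi[OF t] prod_opTi_add prod_opTi_smult)
    then show ?thesis using R[of k] R[of "Suc k"] assms by (simp add: shift_rel_add shift_rel_smult)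
  next
    case 3
    then have "prod_opTi t i (opT t k p) = prod_opTi t k p"
      using assms by (simp add: prod_opTi_def opTi_opT)
    then show ?thesis using R[of k] assms by simp
  next
    case 4
    then have split: "rev [1..<i] = rev [Suc (Suc k)..<i] @ [Suc k, k] @ rev [1..<k]"
    proof -
      have "[1..<i] = [1..<k] @ [k, Suc k] @ [Suc (Suc k)..<i]"
        using 4 assms by (intro upt_split2) auto
      then show ?thesis by simp
    qed
    have 1: "fold (opTi t) (rev [Suc (Suc k)..<i]) (opT t k p) = opT t k (fold (opTi t) (rev [Suc (Suc k)..<i]) p)"
      by (rule fold_opTi_commute) auto
    have 2: "fold (opTi t) (rev [1..<k]) (opT t (Suc k) p) = opT t (Suc k) (fold (opTi t) (rev [1..<k]) p)" for p
      by (rule fold_opTi_commute) auto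
    have "prod_opTi t i (opT t k p) = opT t (Suc k) (prod_opTi t i p)"
      unfolding prod_opTi_def split by (simp add: 1 2[simplified] opTi_braid[OF t])
    then show ?thesis using R[OF i] assms 4 i by (simp add: shift_rel_opT)
  qed
qed

section \<open>From the operators D_i to the relation with the rotation\<close>

lemma eval_opTi_at_0:
  fixes \<phi> :: "'a::field \<Rightarrow> 'b::field"
  assumes "ringhom \<phi>" "x i = 0" "x (Suc i) \<noteq> 0"
  shows "eval_mpoly \<phi> x (opTi t i p) = \<phi> (1 / t) * eval_mpoly \<phi> (x \<circ> tp i) p"
  using assms by (simp add: opTi_def eval_simps[OF assms(1)] eval_opT hecke_at_def ringhom_simps[OF assms(1)]) (simp add: algebra_simps)

lemma eval_fold_opTi_at_0:
  fixes \<phi> :: "'a::field \<Rightarrow> 'b::field"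
  assumes h: "ringhom \<phi>" and "k \<le> N" "y k = 0" "\<And>j. k < j \<Longrightarrow> j \<le> N \<Longrightarrow> y j \<noteq> 0"
  shows "eval_mpoly \<phi> y (fold (opTi t) (rev [k..<N]) p) = \<phi> (1 / t) ^ (N - k) *
    eval_mpoly \<phi> (\<lambda>j. if k \<le> j \<and> j < N then y (Suc j) else if j = N then 0 else y j) p"
  using assms(2-4)
proof (induction "N - k" arbitrary: k y)
  case 0
  then have "(\<lambda>j. if k \<le> j \<and> j < N then y (Suc j) else if j = N then 0 else y j) = y" by (auto simp: fun_eq_iff)
  then show ?case using 0 by simp
next
  case (Suc d)
  then have k: "k < N" by simp
  have "eval_mpoly \<phi> y (fold (opTi t) (rev [k..<N]) p) =
     \<phi> (1 / t) * eval_mpoly \<phi> (y \<circ> tp k) (fold (opTi t) (rev [Suc k..<N]) p)"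
    using k Suc.prems eval_opTi_at_0[OF h, of y k t] by (simp add: upt_conv_Cons)
  also have "eval_mpoly \<phi> (y \<circ> tp k) (fold (opTi t) (rev [Suc k..<N]) p) = \<phi> (1 / t) ^ (N - Suc k) *
    eval_mpoly \<phi> (\<lambda>j. if Suc k \<le> j \<and> j < N then (y \<circ> tp k) (Suc j) else if j = N then 0 else (y \<circ> tp k) j) p"
    using Suc.hyps(2) Suc.prems k by (intro Suc.hyps(1)) (auto simp: transpose_def)
  also have "(\<lambda>j. if Suc k \<le> j \<and> j < N then (y \<circ> tp k) (Suc j) else if j = N then 0 else (y \<circ> tp k) j) =
    (\<lambda>j. if k \<le> j \<and> j < N then y (Suc j) else if j = N then 0 else y j)"
    using k by (auto simp: fun_eq_iff transpose_def not_less_eq_eq le_Suc_eq dest: le_antisym)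
  finally show ?case using k by (simp add: mult.assoc[symmetric] Suc_diff_Suc flip: power_Suc)
qed

lemma op_xi_N:
  assumes "t \<noteq> 0"
  shows "op_xi q t N N p = Const (t ^ (N - 1)) * op_omega q N (fold (opTi t) (rev [1..<N]) p)"
  by (simp add: op_xi_def inv_opT[OF assms])

text \<open>Makes the division in D_N exact. At x_N = 0 the rotation puts 0 in front; an inverse
  generator at a vanishing first coordinate is a mere swap times 1/t, so the zero travels back to
  position N and the powers of t cancel.\<close>

lemma Var_dvd_diff_xi:
  assumes t: "t \<noteq> 0" and N: "1 \<le> N"
  shows "Var N dvd (p - op_xi q t N N p)"
proof -
  define y :: "nat \<Rightarrow> 'a mpoly" where "y = Var(N := 0)"
  define x where "x = (\<lambda>i. Fract (y i) 1)"
  define f where "f = p - op_xi q t N N p"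
  let ?\<phi> = "\<lambda>c::'a. Fract (Const c) 1"
  have x: "x N = 0" "\<And>i. i \<noteq> N \<Longrightarrow> x i \<noteq> 0"
    by (auto simp: x_def y_def Zero_fract_def eq_fract)
  define x' where "x' = (\<lambda>j. if j = 1 then ?\<phi> q * x N else if j \<in> {2..N} then x (j - 1) else x j)"
  have "gev x (op_xi q t N N p) = ?\<phi> (t ^ (N - 1)) * eval_mpoly ?\<phi> x' (fold (opTi t) (rev [1..<N]) p)"
    unfolding gev_def op_xi_N[OF t] eval_simps[OF ringhom_FC] eval_omega[OF ringhom_FC] x'_def
    by (simp add: eval_Const[OF ringhom_FC])
  also have "eval_mpoly ?\<phi> x' (fold (opTi t) (rev [1..<N]) p) = ?\<phi> (1 / t) ^ (N - 1) *
    eval_mpoly ?\<phi> (\<lambda>j. if 1 \<le> j \<and> j < N then x' (Suc j) else if j = N then 0 else x' j) p"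
    using N x by (intro eval_fold_opTi_at_0 ringhom_FC) (auto simp: x'_def)
  also have "(\<lambda>j. if 1 \<le> j \<and> j < N then x' (Suc j) else if j = N then 0 else x' j) = x"
    using N x by (auto simp: x'_def fun_eq_iff)
  also have "?\<phi> (t ^ (N - 1)) * (?\<phi> (1 / t) ^ (N - 1) * eval_mpoly ?\<phi> x p) = eval_mpoly ?\<phi> x p"
  proof -
    have "?\<phi> (t ^ (N - 1)) * ?\<phi> (1 / t) ^ (N - 1) = ?\<phi> (t ^ (N - 1) * (1 / t) ^ (N - 1))"
      by (simp only: ringhom_simps[OF ringhom_FC])
    also have "\<dots> = 1" using t by (simp only: ringhom_simps(1)[OF ringhom_FC] flip: power_mult_distrib) (simp add: ringhom_simps(1)[OF ringhom_FC])
    finally show ?thesis by (simp only: mult.assoc[symmetric] mult_1_left)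
  qed
  finally have "gev x f = 0" unfolding f_def gev_simps by (simp add: gev_def)
  then have "eval_mpoly Const y f = 0"
    unfolding x_def gev_Fract by (simp add: Zero_fract_def eq_fract)
  then show ?thesis using Var_minus_dvd[of N 0 f] by (simp add: y_def f_def)
qed

lemma opD_aux_eq_0:
  assumes t: "t \<noteq> 0" and "k < N"
  shows "opD_aux q t N k p = 0 \<longleftrightarrow> op_xi q t N N (fold (opT t) [N - k..<N] p) = fold (opT t) [N - k..<N] p"
  using assms(2)
proof (induction k arbitrary: p)
  case 0
  obtain s where s: "p - op_xi q t N N p = s * Var N"
    using Var_dvd_diff_xi[OF t, of N p q] 0 by (auto simp: dvd_def mult.commute)
  have "opD_aux q t N 0 p = s" unfolding opD_aux.simps s by (rule exact_quot_mult) simp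
  moreover have "op_xi q t N N p = p \<longleftrightarrow> s = 0"
    using s by (metis Var_neq_0 eq_iff_diff_eq_0 mult_eq_0_iff)
  moreover have "fold (opT t) [N - 0..<N] p = p" by simp
  ultimately show ?case by (simp only:)
next
  case (Suc k)
  have "[N - Suc k..<N] = (N - Suc k) # [N - k..<N]"
    using Suc.prems upt_conv_Cons[of "N - Suc k" N] by (simp add: Suc_diff_Suc)
  then show ?case using Suc t by (simp add: opT_eq_0_iff)
qed

lemma fold_opTi_opT:
  assumes t: "t \<noteq> 0"
  shows "fold (opTi t) (rev xs) (fold (opT t) xs p) = p"
  by (induction xs arbitrary: p) (simp_all add: opTi_opT[OF t])

lemma fold_opT_opTi:
  assumes t: "t \<noteq> 0"
  shows "fold (opT t) xs (fold (opTi t) (rev xs) p) = p"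
  by (induction xs arbitrary: p rule: rev_induct) (simp_all add: opT_opTi[OF t])

lemma singular_imp_sing:
  assumes "singular_poly q t N p" and t: "t \<noteq> 0"
  shows "sing q t N p"
  unfolding sing_def
proof
  fix i assume i: "i \<in> {1..N}"
  then have "opD_aux q t N (N - i) p = 0"
    using assms by (auto simp: singular_poly_def opD_def)
  moreover have "N - i < N" "N - (N - i) = i" using i by auto
  ultimately have "op_xi q t N N (fold (opT t) [i..<N] p) = fold (opT t) [i..<N] p"
    using opD_aux_eq_0[OF t, of "N - i" N q p] by simp
  moreover have split: "[1..<N] = [1..<i] @ [i..<N]" using i by (intro upt_split) auto
  have "fold (opTi t) (rev [1..<N]) (fold (opT t) [i..<N] p) = prod_opTi t i p"
    unfolding split by (simp add: prod_opTi_def fold_opTi_opT[OF t])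
  moreover have "fold (opT t) [1..<N] (prod_opTi t i p) = fold (opT t) [i..<N] p"
    unfolding split prod_opTi_def by (simp add: fold_opT_opTi[OF t])
  ultimately show "shift_rel q t N (prod_opTi t i p)"
    unfolding shift_rel_def op_xi_N[OF t] by simp
qed

lemma sing_xi_N:
  assumes "sing q t N p" "1 \<le> N" and t: "t \<noteq> 0"
  shows "op_xi q t N N p = p"
proof -
  have "shift_rel q t N (prod_opTi t N p)" using assms by (auto simp: sing_def)
  then show ?thesis unfolding shift_rel_def op_xi_N[OF t] prod_opTi_def by (simp only: fold_opT_opTi[OF t])
qed

section \<open>Specialization of the parameters\<close>

lemma ringhom_poly_map:
  fixes h :: "'a::comm_ring_1 \<Rightarrow> 'b::comm_ring_1"
  assumes h: "ringhom h"
  shows "ringhom (\<lambda>p. poly (map_poly h p) x)"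
proof -
  have h0: "h 0 = 0" by (rule ringhom_simps(4)[OF h])
  define e where "e = (\<lambda>p. poly (map_poly h p) x)"
  have pC: "e (pCons c p) = h c + x * e p" for c p
    by (cases "c = 0 \<and> p = 0") (auto simp: e_def map_poly_pCons h0)
  have e0: "e 0 = 0" by (simp add: e_def)
  have add: "e (p + r) = e p + e r" for p r
    by (induction p r rule: poly_induct2) (simp_all add: pC e0 ringhom_simps[OF h] algebra_simps)
  have sm: "e (smult c p) = h c * e p" for c p
    by (induction p) (simp_all add: pC e0 ringhom_simps[OF h] algebra_simps)
  have mult: "e (p * r) = e p * e r" for p r
    by (induction p) (simp_all add: pC e0 add sm ringhom_simps[OF h] algebra_simps)
  have "e 1 = 1" by (simp add: one_pCons pC e0 ringhom_simps[OF h])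
  then show ?thesis using add mult unfolding ringhom_def e_def by blast
qed

lemma ringhom_cu_const: "ringhom cu_const"
  by (auto simp: ringhom_def cu_const_def One_fract_def one_pCons mult.commute)

lemma ringhom_eval_qt: "ringhom (eval_qt a b)"
  unfolding eval_qt_def[abs_def] by (intro ringhom_poly_map ringhom_cu_const)

lemmas eqt = ringhom_simps[OF ringhom_eval_qt]

lemma eval_qt_nz: "eval_qt a b Q \<noteq> 0 \<Longrightarrow> Q \<noteq> 0"
  by (auto simp: eqt)

lemma special_value_Fract:
  assumes "eval_qt a b Q \<noteq> 0"
  shows "special_value a b (Fract P Q) = eval_qt a b P / eval_qt a b Q"
  unfolding special_value_def
proof (rule the_equality)
  fix v assume "\<exists>P' Q'. Fract P Q = Fract P' Q' \<and> eval_qt a b Q' \<noteq> 0 \<and> v = eval_qt a b P' / eval_qt a b Q'"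
  then obtain P' Q' where *: "Fract P Q = Fract P' Q'" "eval_qt a b Q' \<noteq> 0" "v = eval_qt a b P' / eval_qt a b Q'"
    by blast
  then have "P * Q' = P' * Q" using assms by (simp add: eq_fract eval_qt_nz)
  then have "eval_qt a b P * eval_qt a b Q' = eval_qt a b P' * eval_qt a b Q"
    by (metis eqt(3))
  then show "v = eval_qt a b P / eval_qt a b Q" using *(2,3) assms by (simp add: frac_eq_eq)
qed (use assms in blast)

lemma no_pole_Fract: "eval_qt a b Q \<noteq> 0 \<Longrightarrow> no_pole a b (Fract P Q)"
  unfolding no_pole_def by blast

lemma no_pole_add:
  assumes "no_pole a b f" "no_pole a b g"
  shows "no_pole a b (f + g) \<and> special_value a b (f + g) = special_value a b f + special_value a b g"
proof -
  obtain P Q P' Q' where *: "f = Fract P Q" "eval_qt a b Q \<noteq> 0" "g = Fract P' Q'" "eval_qt a b Q' \<noteq> 0"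
    using assms unfolding no_pole_def by blast
  have fg: "f + g = Fract (P * Q' + P' * Q) (Q * Q')" using * by (simp add: eval_qt_nz)
  have n: "eval_qt a b (Q * Q') \<noteq> 0" using * by (simp add: eqt)
  show ?thesis unfolding fg using no_pole_Fract[OF n] special_value_Fract[OF n] *
    by (simp add: special_value_Fract eqt field_simps)
qed

lemma no_pole_mult:
  assumes "no_pole a b f" "no_pole a b g"
  shows "no_pole a b (f * g) \<and> special_value a b (f * g) = special_value a b f * special_value a b g"
proof -
  obtain P Q P' Q' where *: "f = Fract P Q" "eval_qt a b Q \<noteq> 0" "g = Fract P' Q'" "eval_qt a b Q' \<noteq> 0"
    using assms unfolding no_pole_def by blast
  have fg: "f * g = Fract (P * P') (Q * Q')" using * by simp
  have n: "eval_qt a b (Q * Q') \<noteq> 0" using * by (simp add: eqt)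
  show ?thesis unfolding fg using no_pole_Fract[OF n] special_value_Fract[OF n] *
    by (simp add: special_value_Fract eqt)
qed

lemma no_pole_inverse:
  assumes "no_pole a b f" "special_value a b f \<noteq> 0"
  shows "no_pole a b (inverse f) \<and> special_value a b (inverse f) = inverse (special_value a b f)"
proof -
  obtain P Q where *: "f = Fract P Q" "eval_qt a b Q \<noteq> 0"
    using assms unfolding no_pole_def by blast
  then have "eval_qt a b P \<noteq> 0" using assms(2) by (simp add: special_value_Fract)
  then show ?thesis using * by (simp add: no_pole_Fract special_value_Fract)
qed

lemma no_pole_poly: "no_pole a b (Fract P 1) \<and> special_value a b (Fract P 1) = eval_qt a b P"
  using no_pole_Fract[of a b 1 P] special_value_Fract[of a b 1 P] by (simp add: eqt)

text \<open>Bundles the absence of a pole with the value, so that the rules of arithmetic compose;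
  \<open>special_value\<close> alone is unspecified at a pole.\<close>

definition spv :: "cu \<Rightarrow> cu \<Rightarrow> cqt \<Rightarrow> cu \<Rightarrow> bool" where
  "spv a b f v \<longleftrightarrow> no_pole a b f \<and> special_value a b f = v"

lemma spv_add: "spv a b f v \<Longrightarrow> spv a b g w \<Longrightarrow> spv a b (f + g) (v + w)"
  using no_pole_add unfolding spv_def by blast

lemma spv_mult: "spv a b f v \<Longrightarrow> spv a b g w \<Longrightarrow> spv a b (f * g) (v * w)"
  using no_pole_mult unfolding spv_def by blast

lemma spv_inverse: "spv a b f v \<Longrightarrow> v \<noteq> 0 \<Longrightarrow> spv a b (inverse f) (inverse v)"
  using no_pole_inverse unfolding spv_def by blast

lemma spv_divide: "spv a b f v \<Longrightarrow> spv a b g w \<Longrightarrow> w \<noteq> 0 \<Longrightarrow> spv a b (f / g) (v / w)"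
  unfolding divide_inverse by (intro spv_mult spv_inverse)

lemma spv_1: "spv a b 1 1" and spv_0: "spv a b 0 0"
  using no_pole_poly[of a b 1] no_pole_poly[of a b 0]
  by (simp_all add: spv_def One_fract_def Zero_fract_def eqt)

lemma spv_uminus: "spv a b f v \<Longrightarrow> spv a b (- f) (- v)"
proof -
  have "spv a b (-1) (-1)"
    using no_pole_poly[of a b "-1"] by (simp add: spv_def One_fract_def eqt)
  then show "spv a b f v \<Longrightarrow> spv a b (- f) (- v)" using spv_mult[of a b "-1" "-1" f v] by simp
qed

lemma spv_diff: "spv a b f v \<Longrightarrow> spv a b g w \<Longrightarrow> spv a b (f - g) (v - w)"
  unfolding diff_conv_add_uminus by (intro spv_add spv_uminus)

lemma spv_power: "spv a b f v \<Longrightarrow> spv a b (f ^ n) (v ^ n)"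
  by (induction n) (auto intro: spv_mult spv_1)

lemma spv_gen_t: "spv a b gen_t b"
proof -
  have "eval_qt a b [:0, 1:] = b"
    using ringhom_simps[OF ringhom_poly_map[OF ringhom_cu_const, of a]]
    by (simp add: eval_qt_def map_poly_pCons)
  then show ?thesis using no_pole_poly[of a b "[:0, 1:]"] by (simp add: spv_def gen_t_def)
qed

lemma spv_gen_q: "spv a b gen_q a"
proof -
  have "eval_qt a b [:[:0, 1:]:] = a"
    using ringhom_simps[OF ringhom_cu_const]
    by (simp add: eval_qt_def map_poly_pCons)
  then show ?thesis using no_pole_poly[of a b "[:[:0, 1:]:]"] by (simp add: spv_def gen_q_def)
qed

lemma spv_powi: "spv a b f v \<Longrightarrow> v \<noteq> 0 \<Longrightarrow> spv a b (f powi k) (v powi k)"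
  by (cases k) (auto simp: power_int_def intro: spv_power spv_inverse)

lemma spv_unique: "spv a b f v \<Longrightarrow> spv a b f w \<Longrightarrow> v = w"
  by (simp add: spv_def)

section \<open>Specialization of polynomials and of the operators\<close>

definition spz :: "cu \<Rightarrow> cu \<Rightarrow> cqt mpoly \<Rightarrow> cu mpoly \<Rightarrow> bool" where
  "spz a b p p' \<longleftrightarrow> (\<forall>k. spv a b (Poly_Mapping.lookup p k) (Poly_Mapping.lookup p' k))"

lemma lookup_specialize:
  "Poly_Mapping.lookup (specialize a b p) k = special_value a b (Poly_Mapping.lookup p k)"
  using spv_0[of a b] by (simp add: specialize_def spv_def map.rep_eq when_def)

lemma spz_iff: "spz a b p p' \<longleftrightarrow> no_pole_mpoly a b p \<and> specialize a b p = p'"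
  by (auto simp: spz_def spv_def no_pole_mpoly_def poly_mapping_eq_iff lookup_specialize fun_eq_iff)

lemma spz_unique: "spz a b p p' \<Longrightarrow> spz a b p p'' \<Longrightarrow> p' = p''"
  by (simp add: spz_iff)

lemma spz_0: "spz a b 0 0"
  by (simp add: spz_def spv_0)

lemma spz_add: "spz a b p p' \<Longrightarrow> spz a b r r' \<Longrightarrow> spz a b (p + r) (p' + r')"
  by (simp add: spz_def lookup_add spv_add)

lemma spz_sum: "(\<And>i. i \<in> A \<Longrightarrow> spz a b (f i) (g i)) \<Longrightarrow> spz a b (sum f A) (sum g A)"
  by (induction A rule: infinite_finite_induct) (auto intro: spz_0 spz_add)

lemma spz_smult: "spv a b c v \<Longrightarrow> spz a b p p' \<Longrightarrow> spz a b (Const c * p) (Const v * p')"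
  by (simp add: spz_def lookup_Const_mult spv_mult)

lemma spz_uminus: "spz a b p p' \<Longrightarrow> spz a b (- p) (- p')"
  by (simp add: spz_def spv_uminus)

lemma spz_mon: "spz a b (mon k) (mon k)"
  by (auto simp: spz_def mon_def lookup_single when_def spv_0 spv_1)

lemma spz_expand:
  assumes "spz a b p p'"
  shows "p' = (\<Sum>k\<in>Poly_Mapping.keys p. Const (Poly_Mapping.lookup p' k) * mon k)"
proof (rule poly_mapping_eqI)
  fix k
  have "k \<notin> Poly_Mapping.keys p \<Longrightarrow> Poly_Mapping.lookup p' k = 0"
    using assms spv_unique[OF spv_0] by (auto simp: spz_def in_keys_iff dest: spec[of _ k])
  then show "Poly_Mapping.lookup p' k =
      Poly_Mapping.lookup (\<Sum>k\<in>Poly_Mapping.keys p. Const (Poly_Mapping.lookup p' k) * mon k) k"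
    by (auto simp: single_conv_mon[symmetric] lookup_sum lookup_single when_def)
qed

text \<open>Coefficients are specialized one at a time, so a linear operator commutes with
  specialization once it does so on monomials. The operators F and F' live over different fields and
  are compared only there.\<close>

lemma spz_linear:
  assumes "spz a b p p'"
    and F: "\<And>p r. F (p + r) = F p + F r" "\<And>c p. F (Const c * p) = Const c * F p"
    and F': "\<And>p r. F' (p + r) = F' p + F' r" "\<And>c p. F' (Const c * p) = Const c * F' p"
    and m: "\<And>k. spz a b (F (mon k)) (F' (mon k))"
  shows "spz a b (F p) (F' p')"
proof -
  have F0: "F 0 = 0" "F' 0 = 0" using F(2)[of 0 0] F'(2)[of 0 0] by (simp_all add: Const_simps)
  have sF: "F (sum f A) = (\<Sum>i\<in>A. F (f i))" "F' (sum g A) = (\<Sum>i\<in>A. F' (g i))" for f g and A :: "(nat \<Rightarrow>\<^sub>0 nat) set"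
    by (induction A rule: infinite_finite_induct) (simp_all add: F0 F(1) F'(1))
  have "F p = (\<Sum>k\<in>Poly_Mapping.keys p. Const (Poly_Mapping.lookup p k) * F (mon k))"
    by (subst mpoly_expand) (simp add: sF F(2))
  moreover have "F' p' = (\<Sum>k\<in>Poly_Mapping.keys p. Const (Poly_Mapping.lookup p' k) * F' (mon k))"
    by (subst spz_expand[OF assms(1)]) (simp add: sF F'(2))
  ultimately show ?thesis using assms(1) m by (auto simp: spz_def[of _ _ p] intro!: spz_sum spz_smult)
qed

lemma spz_mon_mult: "spz a b p p' \<Longrightarrow> spz a b (mon k * p) (mon k * p')"
  by (rule spz_linear) (auto simp: distrib_left mult.left_commute spz_mon simp flip: mon_plus)

lemma spz_mult: "spz a b p p' \<Longrightarrow> spz a b r r' \<Longrightarrow> spz a b (p * r) (p' * r')"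
  by (rule spz_linear[where F = "\<lambda>p. p * r" and F' = "\<lambda>p. p * r'"])
    (auto simp: distrib_right mult.assoc spz_mon_mult)

lemma spz_Var: "spz a b (Var i) (Var i)"
  using spz_mon[of a b "Poly_Mapping.single i 1"] by (simp add: mon_def Var_def)

lemma spz_Const: "spv a b c v \<Longrightarrow> spz a b (Const c) (Const v)"
  using spz_smult[of a b c v "mon 0" "mon 0"] spz_mon[of a b 0] by simp

lemma spz_1: "spz a b 1 1"
  using spz_mon[of a b 0] by simp

lemma spz_hom:
  assumes "spz a b p p'" "ringhom F" "ringhom F'" "\<And>c. F (Const c) = Const c" "\<And>c. F' (Const c) = Const c"
    "\<And>i. spz a b (F (Var i)) (F' (Var i))"
  shows "spz a b (F p) (F' p')"
proof (rule spz_linear[OF assms(1)])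
  show "spz a b (F (mon k)) (F' (mon k))" for k
    by (induction k rule: monom_induct)
      (simp_all add: ringhom_simps[OF assms(2)] ringhom_simps[OF assms(3)] spz_1 mon_Suc spz_mult assms(6))
qed (simp_all add: ringhom_simps[OF assms(2)] ringhom_simps[OF assms(3)] assms(4,5))

lemma spz_swap: "spz a b p p' \<Longrightarrow> spz a b (swap_vars i p) (swap_vars i p')"
  by (rule spz_hom) (auto simp: ringhom_swap swap_Var spz_Var)

lemma spz_omega:
  assumes "spz a b p p'"
  shows "spz a b (op_omega gen_q N p) (op_omega a N p')"
  using assms ringhom_omega ringhom_omega
proof (rule spz_hom)
  show "spz a b (op_omega gen_q N (Var i)) (op_omega a N (Var i))" for i
    by (auto simp: op_omega_def subst_mpoly_def eval_Var ringhom_Const intro!: spz_Var spz_mult spz_Const spv_gen_q)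
qed simp_all

lemma divdiff_smult: "divdiff i (Const c * p) = Const c * divdiff i p"
  by (simp add: divdiff_mult_rule)

lemma divdiff_1 [simp]: "divdiff i 1 = 0"
  using divdiff_Const[of i 1] by (simp add: Const_simps(1))

lemma spz_divdiff: "spz a b p p' \<Longrightarrow> spz a b (divdiff i p) (divdiff i p')"
proof (rule spz_linear[where F = "divdiff i" and F' = "divdiff i"])
  show "spz a b (divdiff i (mon k)) (divdiff i (mon k))" for k
  proof (induction k rule: monom_induct)
    case zero
    show ?case by (simp add: spz_0)
  next
    case (Suc k j)
    have "spz a b (divdiff i (Var j)) (divdiff i (Var j))"
      using spz_1[of a b] spz_0[of a b] by (auto simp: divdiff_Var intro: spz_uminus)
    then show ?case using Suc
      by (auto simp: mon_Suc divdiff_mult_rule intro!: spz_add spz_mult spz_Var spz_swap spz_mon)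
  qed
qed (simp_all add: divdiff_add divdiff_smult)

lemma spz_opT: "spz a b p p' \<Longrightarrow> spz a b (opT gen_t i p) (opT b i p')"
  unfolding opT_divdiff
  by (intro spz_add spz_mult spz_Const spz_Var spz_divdiff spz_swap spv_diff spv_1 spv_gen_t)

lemma spz_opTi: "spz a b p p' \<Longrightarrow> b \<noteq> 0 \<Longrightarrow> spz a b (opTi gen_t i p) (opTi b i p')"
  unfolding opTi_def
  by (intro spz_add spz_mult spz_Const spz_opT spv_diff spv_1 spv_gen_t spv_divide)

lemma gen_t_neq_0 [simp]: "gen_t \<noteq> 0" and gen_q_neq_0 [simp]: "gen_q \<noteq> 0"
  by (simp_all add: gen_t_def gen_q_def Zero_fract_def eq_fract)

lemma spz_xi_N:
  assumes "spz a b p p'" "b \<noteq> 0"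
  shows "spz a b (op_xi gen_q gen_t N N p) (op_xi a b N N p')"
proof -
  have "spz a b (fold (opTi gen_t) xs p) (fold (opTi b) xs p')" for xs
    using assms by (induction xs arbitrary: p p') (simp_all add: spz_opTi)
  then show ?thesis unfolding op_xi_N[OF gen_t_neq_0] op_xi_N[OF assms(2)]
    by (intro spz_mult spz_Const spz_omega spv_power spv_gen_t)
qed

section \<open>Nonsymmetric Macdonald polynomials\<close>

lemma in_vars_0: "in_vars N 0" by (simp add: in_vars_def)

lemma in_vars_Const: "in_vars N (Const c)" by (simp add: in_vars_def Const_def)

lemma in_vars_Var: "i \<in> {1..N} \<Longrightarrow> in_vars N (Var i)" by (simp add: in_vars_def Var_def)

lemma in_vars_add: "in_vars N p \<Longrightarrow> in_vars N r \<Longrightarrow> in_vars N (p + r)"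
  using keys_add[of p r] by (auto simp: in_vars_def)

lemma in_vars_mult: "in_vars N p \<Longrightarrow> in_vars N r \<Longrightarrow> in_vars N (p * r)"
proof -
  assume *: "in_vars N p" "in_vars N r"
  show ?thesis unfolding in_vars_def
  proof
    fix k assume "k \<in> Poly_Mapping.keys (p * r)"
    then obtain a b where ab: "k = a + b" "a \<in> Poly_Mapping.keys p" "b \<in> Poly_Mapping.keys r"
      using keys_mult[of p r] by blast
    have "Poly_Mapping.keys a \<subseteq> {1..N}" "Poly_Mapping.keys b \<subseteq> {1..N}"
      using * ab unfolding in_vars_def by auto
    then show "Poly_Mapping.keys k \<subseteq> {1..N}"
      unfolding ab(1) using keys_add[of a b] by (meson Un_least order_trans)
  qed
qed

lemma in_vars_uminus: "in_vars N p \<Longrightarrow> in_vars N (- p)"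
  using in_vars_mult[OF in_vars_Const[of N "-1"], of p] by (simp add: Const_simps)

lemma in_vars_diff: "in_vars N p \<Longrightarrow> in_vars N r \<Longrightarrow> in_vars N (p - r)"
  unfolding diff_conv_add_uminus by (intro in_vars_add in_vars_uminus)

lemma in_vars_sum: "(\<And>i. i \<in> A \<Longrightarrow> in_vars N (f i)) \<Longrightarrow> in_vars N (sum f A)"
  by (induction A rule: infinite_finite_induct) (auto intro: in_vars_0 in_vars_add)

lemma mon_conv_prod: "mon k = (\<Prod>j\<in>Poly_Mapping.keys k. Var j ^ Poly_Mapping.lookup k j)"
proof -
  have "mon k = eval_mpoly Const Var (mon k)" by simp
  also have "\<dots> = (\<Prod>j\<in>Poly_Mapping.keys k. Var j ^ Poly_Mapping.lookup k j)"
    unfolding mon_def eval_single[OF ringhom_Const] by (simp add: Const_simps(1))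
  finally show ?thesis .
qed

lemma in_vars_linear:
  assumes "in_vars N p"
    and F: "\<And>p r. F (p + r) = F p + F r" "\<And>c p. F (Const c * p) = Const c * F p"
    and m: "\<And>k. Poly_Mapping.keys k \<subseteq> {1..N} \<Longrightarrow> in_vars N (F (mon k))"
  shows "in_vars N (F p)"
proof -
  have F0: "F 0 = 0" using F(2)[of 0 0] by (simp add: Const_simps)
  have sF: "F (sum f A) = (\<Sum>i\<in>A. F (f i))" for f and A :: "(nat \<Rightarrow>\<^sub>0 nat) set"
    by (induction A rule: infinite_finite_induct) (simp_all add: F0 F(1))
  have "F p = (\<Sum>k\<in>Poly_Mapping.keys p. Const (Poly_Mapping.lookup p k) * F (mon k))"
    by (subst mpoly_expand) (simp add: sF F(2))
  then show ?thesis using assms(1) m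
    by (auto simp: in_vars_def[of _ p] intro!: in_vars_sum in_vars_mult in_vars_Const)
qed

lemma in_vars_divdiff_mult:
  "in_vars N p \<Longrightarrow> in_vars N r \<Longrightarrow> in_vars N (swap_vars i p) \<Longrightarrow> in_vars N (divdiff i p) \<Longrightarrow> in_vars N (divdiff i r) \<Longrightarrow>
    in_vars N (divdiff i (p * r))"
  by (simp add: divdiff_mult_rule in_vars_add in_vars_mult)

lemma in_vars_mon_aux:
  assumes "Poly_Mapping.keys k \<subseteq> {1..N}" "1 \<le> i" "i < N"
  shows "in_vars N (mon k :: 'a::field mpoly) \<and> in_vars N (swap_vars i (mon k :: 'a mpoly)) \<and>
    in_vars N (divdiff i (mon k :: 'a mpoly))"
proof -
  define Q where "Q = (\<lambda>p::'a mpoly. in_vars N p \<and> in_vars N (swap_vars i p) \<and> in_vars N (divdiff i p))"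
  have Q1: "Q 1" unfolding Q_def using in_vars_Const[of N "1::'a"] swap_Const[of i "1::'a"]
    by (simp add: Const_simps(1) in_vars_0)
  have Qm: "Q (p * r)" if "Q p" "Q r" for p r
    using that unfolding Q_def by (simp add: in_vars_mult in_vars_divdiff_mult ringhom_simps[OF ringhom_swap])
  have Qv: "Q (Var j)" if "j \<in> {1..N}" for j
  proof -
    have "tp i j \<in> {1..N}" using that assms by (auto simp: transpose_def)
    then show ?thesis unfolding Q_def using that in_vars_Const[of N "1::'a"] in_vars_Const[of N "-1::'a"]
      by (simp add: swap_Var in_vars_Var divdiff_Var Const_simps in_vars_0)
  qed
  have Qp: "Q (p ^ n)" if "Q p" for p n
    by (induction n) (auto intro: Q1 Qm that)
  have "Q (\<Prod>j\<in>A. Var j ^ Poly_Mapping.lookup k j)" if "A \<subseteq> {1..N}" for A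
    using that by (induction A rule: infinite_finite_induct) (auto intro!: Q1 Qm Qp Qv)
  then have "Q (mon k)" unfolding mon_conv_prod using assms(1) by blast
  then show ?thesis unfolding Q_def .
qed

lemma in_vars_opT:
  assumes "in_vars N p" "1 \<le> i" "i < N"
  shows "in_vars N (opT t i p)"
proof -
  have "in_vars N (divdiff i p)"
    by (rule in_vars_linear[OF assms(1), where F = "divdiff i"])
      (simp_all only: divdiff_add divdiff_smult in_vars_mon_aux[OF _ assms(2,3)])
  moreover have "in_vars N (swap_vars i p)"
    by (rule in_vars_linear[OF assms(1), where F = "swap_vars i"])
      (simp_all only: ringhom_simps[OF ringhom_swap] swap_Const in_vars_mon_aux[OF _ assms(2,3)])
  ultimately show ?thesis unfolding opT_divdiff
    using assms by (intro in_vars_add in_vars_mult in_vars_Const in_vars_Var) auto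
qed

text \<open>Algebraic independence of q and t: an eigenvalue remembers both the part and its rank.
  The separation of compositions by eigenvalues rests on this.\<close>

lemma gen_pow_eq_iff: "gen_q ^ a * gen_t ^ b = gen_q ^ a' * gen_t ^ b' \<longleftrightarrow> a = a' \<and> b = b'"
proof -
  have p: "Fract x 1 ^ n = Fract (x ^ n) 1" for x :: "complex poly poly" and n
    by (simp add: ringhom_simps(7)[OF ringhom_Fract])
  have "[:[:0, 1:]:] ^ a = ([:[:0, 1:] ^ a:] :: complex poly poly)" for a
    by (induction a) (auto simp: one_pCons mult.commute)
  then have "gen_q ^ a * gen_t ^ b = Fract (monom (monom 1 a) b) 1" for a b
    by (simp add: gen_q_def gen_t_def p monom_altdef)
  moreover have "a = a' \<and> b = b'" if "monom (monom (1::complex) a) b = monom (monom 1 a') b'"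
  proof -
    have m: "monom (1::complex) a \<noteq> 0" for a by simp
    have b: "b = b'" using arg_cong[OF that, of degree] by (simp only: degree_monom_eq[OF m])
    then have "monom (1::complex) a = monom 1 a'" using that by simp
    from arg_cong[OF this, of degree] show ?thesis using b by (simp add: degree_monom_eq)
  qed
  ultimately show ?thesis by (auto simp: Fract_1_eq_iff)
qed

lemma zeta_neq_0: "zeta gen_q gen_t N \<alpha> i \<noteq> 0"
  by (simp add: zeta_def)

lemma comp_rank_le: "i \<in> {1..N} \<Longrightarrow> comp_rank N \<alpha> i \<le> N"
proof -
  assume "i \<in> {1..N}"
  then have "comp_rank N \<alpha> i \<le> card {j\<in>{1..N}. \<alpha> j > \<alpha> i} + card {j\<in>{1..N}. \<alpha> j = \<alpha> i}"
    unfolding comp_rank_def by (intro add_left_mono card_mono) auto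
  also have "\<dots> = card ({j\<in>{1..N}. \<alpha> j > \<alpha> i} \<union> {j\<in>{1..N}. \<alpha> j = \<alpha> i})"
    by (rule card_Un_disjoint[symmetric]) auto
  also have "\<dots> \<le> card {1..N}" by (rule card_mono) auto
  finally show ?thesis by simp
qed

lemma zeta_eq_iff:
  assumes "i \<in> {1..N}" "j \<in> {1..N}"
  shows "zeta gen_q gen_t N \<alpha> i = zeta gen_q gen_t N \<beta> j \<longleftrightarrow>
    \<alpha> i = \<beta> j \<and> comp_rank N \<alpha> i = comp_rank N \<beta> j"
  using comp_rank_le[OF assms(1), of \<alpha>] comp_rank_le[OF assms(2), of \<beta>]
  by (auto simp: zeta_def gen_pow_eq_iff)

lemma comp_rank_Suc:
  assumes "\<alpha> i = \<alpha> (Suc i)"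
  shows "comp_rank N \<alpha> (Suc i) = Suc (comp_rank N \<alpha> i)"
proof -
  have "{j\<in>{1..Suc i}. \<alpha> j = \<alpha> i} = insert (Suc i) {j\<in>{1..i}. \<alpha> j = \<alpha> i}" using assms by (auto simp: le_Suc_eq)
  then show ?thesis using assms[symmetric] by (simp add: comp_rank_def)
qed

lemma comp_rank_swap:
  assumes "1 \<le> k" "k < N" "\<alpha> k \<noteq> \<alpha> (Suc k)"
  shows "comp_rank N (\<alpha> \<circ> tp k) k = comp_rank N \<alpha> (Suc k)"
    and "comp_rank N (\<alpha> \<circ> tp k) (Suc k) = comp_rank N \<alpha> k"
proof -
  have im: "card {j\<in>{1..N}. P (tp k j)} = card {j\<in>{1..N}. P j}" for P
    by (rule bij_betw_same_card[of "tp k"]) (use assms in \<open>auto simp: bij_betw_def inj_on_def transpose_def image_iff\<close>)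
  have 1: "{j\<in>{1..Suc k}. (\<alpha> \<circ> tp k) j = \<alpha> k} = tp k ` {j\<in>{1..k}. \<alpha> j = \<alpha> k}"
    using assms by (auto simp: transpose_def image_iff split: if_splits)
  have 2: "{j\<in>{1..k}. (\<alpha> \<circ> tp k) j = \<alpha> (Suc k)} = tp k ` {j\<in>{1..Suc k}. \<alpha> j = \<alpha> (Suc k)}"
    using assms by (auto simp: transpose_def image_iff split: if_splits)
  have "card (tp k ` A) = card A" for A by (rule card_image) (auto intro: inj_on_subset[OF inj_transpose])
  then show "comp_rank N (\<alpha> \<circ> tp k) k = comp_rank N \<alpha> (Suc k)" "comp_rank N (\<alpha> \<circ> tp k) (Suc k) = comp_rank N \<alpha> k"
    using im[of "\<lambda>j. \<alpha> j > \<alpha> (Suc k)"] im[of "\<lambda>j. \<alpha> j > \<alpha> k"] 1 2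
    unfolding comp_rank_def by simp_all
qed

lemma zeta_swap:
  assumes "1 \<le> k" "k < N" "\<alpha> k \<noteq> \<alpha> (Suc k)"
  shows "zeta q t N (\<alpha> \<circ> tp k) k = zeta q t N \<alpha> (Suc k)"
    and "zeta q t N (\<alpha> \<circ> tp k) (Suc k) = zeta q t N \<alpha> k"
  using comp_rank_swap[OF assms] by (simp_all add: zeta_def)

lemma compositions_swap: "\<alpha> \<in> compositions N \<Longrightarrow> 1 \<le> k \<Longrightarrow> k < N \<Longrightarrow> \<alpha> \<circ> tp k \<in> compositions N"
  by (auto simp: compositions_def transpose_def)

text \<open>A number that strictly increases along dominance; used to see that the order on
  compositions is well-founded.\<close>

definition psum :: "nat \<Rightarrow> (nat \<Rightarrow> nat) \<Rightarrow> nat" where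
  "psum N \<alpha> = (\<Sum>j=1..N. \<Sum>i=1..j. \<alpha> i)"

lemma dominates_psum:
  assumes "dominates N \<alpha> \<beta>" "\<alpha> \<in> compositions N" "\<beta> \<in> compositions N"
  shows "psum N \<beta> < psum N \<alpha>"
  unfolding psum_def
proof (rule sum_strict_mono_ex1)
  show "\<forall>j\<in>{1..N}. (\<Sum>i=1..j. \<beta> i) \<le> (\<Sum>i=1..j. \<alpha> i)" using assms by (auto simp: dominates_def)
  show "\<exists>j\<in>{1..N}. (\<Sum>i=1..j. \<beta> i) < (\<Sum>i=1..j. \<alpha> i)"
  proof (rule ccontr)
    assume "\<not> ?thesis"
    then have eq: "(\<Sum>i=1..j. \<beta> i) = (\<Sum>i=1..j. \<alpha> i)" if "j \<in> {1..N}" for j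
      using that assms(1) unfolding dominates_def by (metis le_less)
    have eq': "(\<Sum>i=1..j. \<beta> i) = (\<Sum>i=1..j. \<alpha> i)" if "j \<le> N" for j
      using that eq[of j] by (cases "j = 0") auto
    have "\<alpha> j = \<beta> j" for j
    proof (cases "j \<in> {1..N}")
      case True
      then obtain i where "j = Suc i" by (cases j) auto
      then show ?thesis using eq'[of j] eq'[of i] True by simp
    qed (use assms(2,3) in \<open>auto simp: compositions_def\<close>)
    then show False using assms(1) by (auto simp: dominates_def)
  qed
qed simp

lemma comp_plus_compositions: "comp_plus N \<alpha> \<in> compositions N"
  by (auto simp: comp_plus_def compositions_def comp_of_list_def)

lemma comp_greater_wf: "wf {(\<beta>, \<alpha>). \<alpha> \<in> compositions N \<and> \<beta> \<in> compositions N \<and> comp_greater N \<alpha> \<beta>}"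
proof (rule wf_subset)
  show "wf (inv_image (less_than <*lex*> less_than) (\<lambda>\<alpha>. (psum N (comp_plus N \<alpha>), psum N \<alpha>)))"
    by (intro wf_inv_image wf_lex_prod wf_less_than)
  show "{(\<beta>, \<alpha>). \<alpha> \<in> compositions N \<and> \<beta> \<in> compositions N \<and> comp_greater N \<alpha> \<beta>} \<subseteq>
    inv_image (less_than <*lex*> less_than) (\<lambda>\<alpha>. (psum N (comp_plus N \<alpha>), psum N \<alpha>))"
    by (auto simp: comp_greater_def dominates_psum comp_plus_compositions)
qed

lemma keys_compositions: "Poly_Mapping.keys k \<subseteq> {1..N} \<Longrightarrow> Poly_Mapping.lookup k \<in> compositions N"
  by (auto simp: compositions_def in_keys_iff)

section \<open>The Macdonald polynomials span; equal neighbouring parts\<close>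

definition mspan :: "nat \<Rightarrow> ((nat \<Rightarrow> nat) \<Rightarrow> cqt mpoly) \<Rightarrow> cqt mpoly \<Rightarrow> bool" where
  "mspan N M v \<longleftrightarrow> (\<exists>B c. finite B \<and> B \<subseteq> compositions N \<and> v = (\<Sum>\<beta>\<in>B. Const (c \<beta>) * M \<beta>))"

lemma mspan_add:
  assumes "mspan N M v" "mspan N M w"
  shows "mspan N M (v + w)"
proof -
  obtain B c B' c' where *: "finite B" "B \<subseteq> compositions N" "v = (\<Sum>\<beta>\<in>B. Const (c \<beta>) * M \<beta>)"
    "finite B'" "B' \<subseteq> compositions N" "w = (\<Sum>\<beta>\<in>B'. Const (c' \<beta>) * M \<beta>)"
    using assms unfolding mspan_def by blast
  have v: "v = (\<Sum>\<beta>\<in>B \<union> B'. Const (if \<beta> \<in> B then c \<beta> else 0) * M \<beta>)"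
    unfolding *(3) using * by (intro sum.mono_neutral_cong_left) (auto simp: Const_simps)
  have w: "w = (\<Sum>\<beta>\<in>B \<union> B'. Const (if \<beta> \<in> B' then c' \<beta> else 0) * M \<beta>)"
    unfolding *(6) using * by (intro sum.mono_neutral_cong_left) (auto simp: Const_simps)
  have "v + w = (\<Sum>\<beta>\<in>B \<union> B'. Const ((if \<beta> \<in> B then c \<beta> else 0) + (if \<beta> \<in> B' then c' \<beta> else 0)) * M \<beta>)"
    unfolding v w by (simp add: sum.distrib[symmetric] Const_simps(2) distrib_right)
  then show ?thesis unfolding mspan_def using * by (intro exI[of _ "B \<union> B'"] exI conjI) auto
qed

lemma mspan_smult:
  assumes "mspan N M v"
  shows "mspan N M (Const a * v)"
proof -
  obtain B c where *: "finite B" "B \<subseteq> compositions N" "v = (\<Sum>\<beta>\<in>B. Const (c \<beta>) * M \<beta>)"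
    using assms unfolding mspan_def by blast
  have "Const a * v = (\<Sum>\<beta>\<in>B. Const (a * c \<beta>) * M \<beta>)"
    unfolding * by (simp add: sum_distrib_left Const_simps(3) mult.assoc)
  then show ?thesis unfolding mspan_def using * by (intro exI[of _ B] exI conjI) auto
qed

lemma mspan_0: "mspan N M 0"
  unfolding mspan_def by (rule exI[of _ "{}"]) simp

lemma mspan_sum: "(\<And>i. i \<in> A \<Longrightarrow> mspan N M (f i)) \<Longrightarrow> mspan N M (sum f A)"
  by (induction A rule: infinite_finite_induct) (auto intro: mspan_0 mspan_add)

lemma mspan_M: "\<beta> \<in> compositions N \<Longrightarrow> mspan N M (M \<beta>)"
  unfolding mspan_def by (intro exI[of _ "{\<beta>}"] exI[of _ "\<lambda>_. 1"]) (auto simp: Const_simps)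

text \<open>Triangularity inverted along the well-founded order: M_alpha is an invertible multiple
  of its monomial plus monomials that are already in the span.\<close>

lemma macdonald_spans_mon:
  assumes "macdonald_family N M" "Poly_Mapping.keys k \<subseteq> {1..N}"
  shows "mspan N M (mon k)"
proof -
  have "\<forall>k. Poly_Mapping.keys k \<subseteq> {1..N} \<longrightarrow> Poly_Mapping.lookup k = \<alpha> \<longrightarrow> mspan N M (mon k)" for \<alpha>
    using comp_greater_wf[of N]
  proof (induction \<alpha> rule: wf_induct_rule)
    case (less \<alpha>)
    show ?case
    proof (intro allI impI)
      fix k :: "nat \<Rightarrow>\<^sub>0 nat" assume k: "Poly_Mapping.keys k \<subseteq> {1..N}" "Poly_Mapping.lookup k = \<alpha>"
      have \<alpha>: "\<alpha> \<in> compositions N" using keys_compositions k by blast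
      obtain e :: int where iv: "in_vars N (M \<alpha>)" and
        e: "\<forall>l\<in>Poly_Mapping.keys (M \<alpha> - Const (gen_t powi e) * (\<Prod>i=1..N. Var i ^ \<alpha> i)).
          comp_greater N \<alpha> (Poly_Mapping.lookup l)"
        using assms(1) \<alpha> unfolding macdonald_family_def by blast
      have mk: "(\<Prod>i=1..N. Var i ^ \<alpha> i) = (mon k :: cqt mpoly)"
        unfolding mon_conv_prod k(2)[symmetric] by (rule prod_keys_superset[symmetric]) (use k in auto)
      define r where "r = M \<alpha> - Const (gen_t powi e) * mon k"
      have "in_vars N (mon k :: cqt mpoly)"
        using k(1) by (simp add: in_vars_def mon_def)
      then have ivr: "in_vars N r"
        unfolding r_def by (intro in_vars_diff in_vars_mult in_vars_Const iv)
      have "mspan N M (mon l)" if "l \<in> Poly_Mapping.keys r" for l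
      proof -
        have l: "Poly_Mapping.keys l \<subseteq> {1..N}" using ivr that by (auto simp: in_vars_def)
        moreover have "comp_greater N \<alpha> (Poly_Mapping.lookup l)"
          using e that unfolding mk r_def by blast
        ultimately show ?thesis using less[of "Poly_Mapping.lookup l"] \<alpha> keys_compositions[OF l] by blast
      qed
      then have "mspan N M r" by (subst mpoly_expand) (intro mspan_sum mspan_smult)
      then have "mspan N M (Const (1 / gen_t powi e) * (M \<alpha> + Const (-1) * r))"
        using \<alpha> by (intro mspan_add mspan_smult mspan_M)
      moreover have "M \<alpha> + Const (-1) * r = Const (gen_t powi e) * mon k"
        by (simp add: r_def Const_simps)
      ultimately show "mspan N M (mon k)" by (simp add: Const_mult_cancel)
    qed
  qed
  then show ?thesis using assms(2) by blast
qed

lemma macdonald_spans: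
  assumes "macdonald_family N M" "in_vars N v"
  shows "mspan N M v"
  using assms(2) unfolding in_vars_def
  by (subst mpoly_expand) (blast intro: mspan_sum mspan_smult macdonald_spans_mon[OF assms(1)])

text \<open>No linear independence is needed: the operators \<open>X a - z a \<beta>\<close> remove the summands one at a time.\<close>

lemma eigenvector_not_in_span:
  fixes X :: "bool \<Rightarrow> 'a::field mpoly \<Rightarrow> 'a mpoly"
  assumes lin: "\<And>a p r. X a (p + r) = X a p + X a r" "\<And>a c p. X a (Const c * p) = Const c * X a p"
    and "finite B" "v = (\<Sum>\<beta>\<in>B. Const (c \<beta>) * M \<beta>)"
    and "\<And>a \<beta>. \<beta> \<in> B \<Longrightarrow> X a (M \<beta>) = Const (z a \<beta>) * M \<beta>"
    and "\<And>a. X a v = Const (l a) * v"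
    and "\<And>\<beta>. \<beta> \<in> B \<Longrightarrow> \<exists>a. z a \<beta> \<noteq> l a"
  shows "v = 0"
  using assms(3-)
proof (induction B arbitrary: v c rule: finite_induct)
  case (insert \<beta> B)
  obtain a where a: "z a \<beta> \<noteq> l a" using insert.prems by blast
  have X0: "X a 0 = 0" using lin(2)[of a 0 0] by (simp add: Const_simps)
  have Xs: "X a (sum f A) = (\<Sum>i\<in>A. X a (f i))" for f and A :: "'b set"
    by (induction A rule: infinite_finite_induct) (simp_all add: X0 lin(1))
  have "X a v = (\<Sum>\<gamma>\<in>insert \<beta> B. Const (c \<gamma>) * (Const (z a \<gamma>) * M \<gamma>))"
    unfolding insert.prems(1) Xs by (rule sum.cong) (simp_all add: lin(2) insert.prems(2))
  then have "Const (l a) * v - Const (z a \<beta>) * v =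
    (\<Sum>\<gamma>\<in>insert \<beta> B. Const (c \<gamma>) * (Const (z a \<gamma>) * M \<gamma>)) - Const (z a \<beta>) * v"
    by (simp add: insert.prems(3))
  also have "\<dots> = (\<Sum>\<gamma>\<in>insert \<beta> B. Const (c \<gamma> * (z a \<gamma> - z a \<beta>)) * M \<gamma>)"
    unfolding insert.prems(1) sum_distrib_left sum_subtractf[symmetric]
    by (rule sum.cong) (simp_all add: Const_simps algebra_simps)
  also have "\<dots> = (\<Sum>\<gamma>\<in>B. Const (c \<gamma> * (z a \<gamma> - z a \<beta>)) * M \<gamma>)"
    using insert.hyps by (simp add: Const_simps)
  finally have e: "Const (l a - z a \<beta>) * v = (\<Sum>\<gamma>\<in>B. Const (c \<gamma> * (z a \<gamma> - z a \<beta>)) * M \<gamma>)"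
    by (simp add: Const_simps algebra_simps)
  have "v = Const (1 / (l a - z a \<beta>)) * (Const (l a - z a \<beta>) * v)"
    using a by (intro Const_mult_cancel[symmetric]) auto
  also have "\<dots> = (\<Sum>\<gamma>\<in>B. Const (c \<gamma> * (z a \<gamma> - z a \<beta>) / (l a - z a \<beta>)) * M \<gamma>)"
    unfolding e by (simp add: sum_distrib_left mult.assoc[symmetric] Const_simps(3)[symmetric])
  finally show ?case using insert.prems by (intro insert.IH) auto
qed simp

lemma op_xi_lin:
  "op_xi gen_q gen_t N i (p + r) = op_xi gen_q gen_t N i p + op_xi gen_q gen_t N i r"
  "op_xi gen_q gen_t N i (Const c * p) = Const c * op_xi gen_q gen_t N i p"
  using prod_opTi_add[of gen_t i] prod_opTi_smult[of gen_t i]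
  by (simp_all add: op_xi_def inv_opT prod_opTi_def fold_opT_add fold_opT_smult ringhom_simps[OF ringhom_omega]
      algebra_simps)

lemma op_xi_Suc:
  assumes "t \<noteq> 0" "1 \<le> i" "i < N"
  shows "opT t i (op_xi q t N (Suc i) (opT t i p)) = Const t * op_xi q t N i p"
proof -
  have "fold (\<lambda>j. inv (opT t j)) (rev [1..<Suc i]) (opT t i p) = fold (\<lambda>j. inv (opT t j)) (rev [1..<i]) p"
    using assms by (simp add: inv_opT opTi_opT)
  moreover have "rev [i..<N] = rev [Suc i..<N] @ [i]" using assms by (simp add: upt_conv_Cons)
  moreover have "t ^ i = t * t ^ (i - 1)" using assms by (cases i) auto
  ultimately show ?thesis
    unfolding op_xi_def by (simp add: opT_smult Const_simps(3) mult.assoc)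
qed

text \<open>The defining conditions do not mention this case. The difference v of the two sides
  satisfies v T_i = -v and has the eigenvalues of xi_i and xi_{i+1} interchanged. No composition has
  such eigenvalues, so v, being in the span of eigenvectors, is zero.\<close>

lemma macdonald_T_equal:
  assumes M: "macdonald_family N M" and \<alpha>: "\<alpha> \<in> compositions N" "1 \<le> i" "i < N" "\<alpha> i = \<alpha> (Suc i)"
  shows "opT gen_t i (M \<alpha>) = Const gen_t * M \<alpha>"
proof -
  define v where "v = opT gen_t i (M \<alpha>) - Const gen_t * M \<alpha>"
  define \<zeta> where "\<zeta> = zeta gen_q gen_t N"
  define a where "a = \<zeta> \<alpha> i"
  define b where "b = \<zeta> \<alpha> (Suc i)"
  define X where "X = (\<lambda>s. op_xi gen_q gen_t N (if s then i else Suc i))"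
  have eig: "op_xi gen_q gen_t N j (M \<beta>) = Const (\<zeta> \<beta> j) * M \<beta>" if "\<beta> \<in> compositions N" "j \<in> {1..N}" for j \<beta>
    using M that unfolding macdonald_family_def \<zeta>_def by blast
  have ab: "a = gen_t * b"
  proof -
    have r: "comp_rank N \<alpha> (Suc i) = Suc (comp_rank N \<alpha> i)" by (rule comp_rank_Suc[OF \<alpha>(4)])
    moreover have "comp_rank N \<alpha> (Suc i) \<le> N" using \<alpha> by (intro comp_rank_le) auto
    ultimately have "N - comp_rank N \<alpha> i = Suc (N - comp_rank N \<alpha> (Suc i))" by simp
    then show ?thesis using \<alpha>(4) by (simp add: a_def b_def \<zeta>_def zeta_def)
  qed
  have iv: "in_vars N v"
    unfolding v_def using M \<alpha> by (intro in_vars_diff in_vars_opT in_vars_mult in_vars_Const) (auto simp: macdonald_family_def)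
  have Tv: "opT gen_t i v = - v"
    unfolding v_def by (simp add: opT_diff opT_smult opT_quadratic Const_simps algebra_simps)
  have xa: "op_xi gen_q gen_t N i (M \<alpha>) = Const a * M \<alpha>" and xb: "op_xi gen_q gen_t N (Suc i) (M \<alpha>) = Const b * M \<alpha>"
    unfolding a_def b_def using \<alpha> by (auto intro!: eig)
  have "opT gen_t i (op_xi gen_q gen_t N (Suc i) (opT gen_t i (M \<alpha>))) = Const gen_t * (Const a * M \<alpha>)"
    using \<alpha> by (simp add: op_xi_Suc xa)
  also have "\<dots> = opT gen_t i (Const a * (opT gen_t i (M \<alpha>) - Const (gen_t - 1) * M \<alpha>))"
    by (simp add: opT_smult opT_diff opT_quadratic mult.left_commute)
  finally have xT: "op_xi gen_q gen_t N (Suc i) (opT gen_t i (M \<alpha>)) =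
      Const a * (opT gen_t i (M \<alpha>) - Const (gen_t - 1) * M \<alpha>)"
    by (rule opT_inj[OF gen_t_neq_0])
  have Xb: "op_xi gen_q gen_t N (Suc i) v = Const a * v"
  proof -
    have "v = opT gen_t i (M \<alpha>) + Const (- gen_t) * M \<alpha>" by (simp add: v_def Const_simps)
    then have "op_xi gen_q gen_t N (Suc i) v = Const a * (opT gen_t i (M \<alpha>) - Const (gen_t - 1) * M \<alpha>) +
      Const (- gen_t) * (Const b * M \<alpha>)"
      by (simp only: op_xi_lin xT xb)
    then show ?thesis by (simp add: v_def ab Const_simps algebra_simps)
  qed
  have "Const gen_t * op_xi gen_q gen_t N i v = opT gen_t i (op_xi gen_q gen_t N (Suc i) (opT gen_t i v))"
    using \<alpha> by (simp add: op_xi_Suc)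
  also have "op_xi gen_q gen_t N (Suc i) (opT gen_t i v) = Const (- a) * v"
    using op_xi_lin(2)[of N "Suc i" "-1" v] by (simp add: Tv Xb Const_simps)
  also have "opT gen_t i (Const (- a) * v) = Const gen_t * (Const b * v)"
    unfolding opT_smult Tv ab by (simp add: Const_simps)
  finally have Xa: "op_xi gen_q gen_t N i v = Const b * v" by simp
  obtain B c where B: "finite B" "B \<subseteq> compositions N" "v = (\<Sum>\<beta>\<in>B. Const (c \<beta>) * M \<beta>)"
    using macdonald_spans[OF M iv] unfolding mspan_def by blast
  have "v = 0"
  proof (rule eigenvector_not_in_span[where X = X and z = "\<lambda>s \<beta>. \<zeta> \<beta> (if s then i else Suc i)" and l = "\<lambda>s. if s then b else a",
        OF _ _ B(1,3)])
    fix \<beta> assume \<beta>: "\<beta> \<in> B"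
    show "X s (M \<beta>) = Const (\<zeta> \<beta> (if s then i else Suc i)) * M \<beta>" for s
      unfolding X_def using \<beta> B \<alpha> by (intro eig) auto
    show "\<exists>s. \<zeta> \<beta> (if s then i else Suc i) \<noteq> (if s then b else a)"
    proof (rule ccontr)
      assume "\<not> ?thesis"
      then have "\<zeta> \<beta> i = \<zeta> \<alpha> (Suc i)" "\<zeta> \<beta> (Suc i) = \<zeta> \<alpha> i" unfolding a_def b_def by (metis (full_types))+
      then have *: "\<beta> i = \<alpha> (Suc i)" "comp_rank N \<beta> i = comp_rank N \<alpha> (Suc i)"
        "\<beta> (Suc i) = \<alpha> i" "comp_rank N \<beta> (Suc i) = comp_rank N \<alpha> i"
        unfolding \<zeta>_def using \<alpha> by (simp_all add: zeta_eq_iff)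
      \<comment> \<open>Equal neighbouring parts make the rank grow by one from i to i + 1, whereas
        the interchanged eigenvalues would make it drop by one.\<close>
      then have "comp_rank N \<beta> (Suc i) = Suc (comp_rank N \<beta> i)" using \<alpha> by (intro comp_rank_Suc) simp
      then show False using * comp_rank_Suc[OF \<alpha>(4), of N] by simp
    qed
  qed (auto simp: X_def op_xi_lin Xa Xb)
  then show ?thesis by (simp add: v_def)
qed

text \<open>Coefficient of the intertwiner T_i + kap(rho), where rho is the ratio of the eigenvalues
  at i + 1 and at i.\<close>

definition kap :: "'a::field \<Rightarrow> 'a \<Rightarrow> 'a" where
  "kap t \<rho> = (1 - t) / (1 - \<rho>)"

lemma kap_inverse: "\<rho> \<noteq> 0 \<Longrightarrow> \<rho> \<noteq> 1 \<Longrightarrow> kap t \<rho> + kap t (1 / \<rho>) = 1 - t"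
proof -
  assume *: "\<rho> \<noteq> 0" "\<rho> \<noteq> 1"
  have "kap t (1 / \<rho>) = - \<rho> * kap t \<rho>" using * by (simp add: kap_def field_simps)
  then have "kap t \<rho> + kap t (1 / \<rho>) = (1 - \<rho>) * kap t \<rho>" by (simp add: algebra_simps)
  also have "\<dots> = 1 - t" using * by (simp add: kap_def)
  finally show ?thesis .
qed

text \<open>The scalar by which two opposite intertwiners compose. Its zeros rho = t and rho = 1/t
  are where an intertwiner stops being invertible.\<close>

lemma kap_norm: "\<rho> \<noteq> 0 \<Longrightarrow> \<rho> \<noteq> 1 \<Longrightarrow>
    t + kap t \<rho> * kap t (1 / \<rho>) = (t - \<rho>) * (1 - t * \<rho>) / (1 - \<rho>) ^ 2"
proof -
  assume *: "\<rho> \<noteq> 0" "\<rho> \<noteq> 1"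
  have "kap t (1 / \<rho>) = - \<rho> * kap t \<rho>" using * by (simp add: kap_def field_simps)
  then have "t + kap t \<rho> * kap t (1 / \<rho>) = t - \<rho> * (1 - t) ^ 2 / (1 - \<rho>) ^ 2"
    by (simp add: kap_def power2_eq_square)
  also have "\<dots> = (t * (1 - \<rho>) ^ 2 - \<rho> * (1 - t) ^ 2) / (1 - \<rho>) ^ 2"
    using * by (simp add: diff_divide_distrib)
  also have "t * (1 - \<rho>) ^ 2 - \<rho> * (1 - t) ^ 2 = (t - \<rho>) * (1 - t * \<rho>)"
    by (simp add: power2_eq_square algebra_simps)
  finally show ?thesis .
qed

lemma macdonald_T_less:
  assumes M: "macdonald_family N M" and \<alpha>: "\<alpha> \<in> compositions N" "1 \<le> k" "k < N" "\<alpha> k < \<alpha> (Suc k)"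
  shows "opT gen_t k (M \<alpha>) = M (\<alpha> \<circ> tp k)
    - Const (kap gen_t (zeta gen_q gen_t N \<alpha> (Suc k) / zeta gen_q gen_t N \<alpha> k)) * M \<alpha>"
  using assms unfolding macdonald_family_def kap_def by auto

lemma zeta_ratio_neq:
  assumes "1 \<le> k" "k < N" "\<alpha> k \<noteq> \<alpha> (Suc k)"
  shows "zeta gen_q gen_t N \<alpha> (Suc k) / zeta gen_q gen_t N \<alpha> k \<noteq> 1"
    "zeta gen_q gen_t N \<alpha> (Suc k) / zeta gen_q gen_t N \<alpha> k \<noteq> gen_t"
    "gen_t * (zeta gen_q gen_t N \<alpha> (Suc k) / zeta gen_q gen_t N \<alpha> k) \<noteq> 1"
proof -
  have z: "zeta gen_q gen_t N \<alpha> (Suc k) * gen_t ^ a \<noteq> zeta gen_q gen_t N \<alpha> k * gen_t ^ b" for a b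
    using gen_pow_eq_iff[of "\<alpha> (Suc k)" "N - comp_rank N \<alpha> (Suc k) + a" "\<alpha> k" "N - comp_rank N \<alpha> k + b"] assms(3)
    by (auto simp: zeta_def power_add mult.assoc)
  show "zeta gen_q gen_t N \<alpha> (Suc k) / zeta gen_q gen_t N \<alpha> k \<noteq> 1"
    "zeta gen_q gen_t N \<alpha> (Suc k) / zeta gen_q gen_t N \<alpha> k \<noteq> gen_t"
    "gen_t * (zeta gen_q gen_t N \<alpha> (Suc k) / zeta gen_q gen_t N \<alpha> k) \<noteq> 1"
    using z[of 0 0] z[of 0 1] z[of 1 0] zeta_neq_0[of N \<alpha> k] by (simp_all add: divide_eq_eq mult.commute)
qed

text \<open>The normalization prescribes only steps with alpha_k < alpha_{k+1}. The opposite step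
  follows by applying the quadratic relation to such a step from the exchanged composition.\<close>

lemma macdonald_T_greater:
  assumes M: "macdonald_family N M" and \<alpha>: "\<alpha> \<in> compositions N" "1 \<le> k" "k < N" "\<alpha> k > \<alpha> (Suc k)"
  defines "\<rho> \<equiv> zeta gen_q gen_t N \<alpha> (Suc k) / zeta gen_q gen_t N \<alpha> k"
  shows "opT gen_t k (M \<alpha>) + Const (kap gen_t \<rho>) * M \<alpha>
    = Const (gen_t + kap gen_t \<rho> * kap gen_t (1 / \<rho>)) * M (\<alpha> \<circ> tp k)"
proof -
  define \<delta> where "\<delta> = \<alpha> \<circ> tp k"
  define \<kappa> where "\<kappa> = kap gen_t (1 / \<rho>)"
  have \<rho>: "\<rho> \<noteq> 0" "\<rho> \<noteq> 1"
    using zeta_ratio_neq[of k N \<alpha>] \<alpha> unfolding \<rho>_def by (auto simp: zeta_neq_0)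
  have kk: "kap gen_t \<rho> = 1 - gen_t - \<kappa>"
    unfolding \<kappa>_def using kap_inverse[OF \<rho>, of gen_t] by (simp add: algebra_simps)
  have "\<delta> \<circ> tp k = \<alpha>" by (auto simp: \<delta>_def fun_eq_iff)
  moreover have "zeta gen_q gen_t N \<delta> (Suc k) / zeta gen_q gen_t N \<delta> k = 1 / \<rho>"
    unfolding \<delta>_def \<rho>_def using zeta_swap[of k N \<alpha> gen_q gen_t] \<alpha> by simp
  ultimately have 1: "opT gen_t k (M \<delta>) = M \<alpha> - Const \<kappa> * M \<delta>"
    using macdonald_T_less[OF M compositions_swap[OF \<alpha>(1-3)] \<alpha>(2,3)] \<alpha>(4) unfolding \<delta>_def \<kappa>_def by simp
  then have "M \<alpha> = opT gen_t k (M \<delta>) + Const \<kappa> * M \<delta>" by simp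
  then have "opT gen_t k (M \<alpha>) = Const (gen_t - 1) * opT gen_t k (M \<delta>) + Const gen_t * M \<delta> + Const \<kappa> * opT gen_t k (M \<delta>)"
    by (simp add: opT_add opT_smult opT_quadratic)
  then show ?thesis
    unfolding 1 kk \<delta>_def[symmetric] \<kappa>_def[symmetric] by (simp add: Const_simps algebra_simps)
qed

lemma macdonald_T_neq:
  assumes M: "macdonald_family N M" and \<alpha>: "\<alpha> \<in> compositions N" "1 \<le> k" "k < N" "\<alpha> k \<noteq> \<alpha> (Suc k)"
  defines "\<rho> \<equiv> zeta gen_q gen_t N \<alpha> (Suc k) / zeta gen_q gen_t N \<alpha> k"
  shows "\<exists>c. c \<noteq> 0 \<and> opT gen_t k (M \<alpha>) + Const (kap gen_t \<rho>) * M \<alpha> = Const c * M (\<alpha> \<circ> tp k)"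
proof (cases "\<alpha> k < \<alpha> (Suc k)")
  case True
  then show ?thesis unfolding \<rho>_def using macdonald_T_less[OF M \<alpha>(1-3) True]
    by (intro exI[of _ 1]) (simp add: Const_simps)
next
  case False
  have \<rho>: "\<rho> \<noteq> 0" "\<rho> \<noteq> 1" "gen_t \<noteq> \<rho>" "1 \<noteq> gen_t * \<rho>"
    using zeta_ratio_neq[OF \<alpha>(2-4)] unfolding \<rho>_def by (auto simp: zeta_neq_0)
  then have "gen_t + kap gen_t \<rho> * kap gen_t (1 / \<rho>) \<noteq> 0"
    unfolding kap_norm[OF \<rho>(1,2)] by simp
  then show ?thesis using macdonald_T_greater[OF M \<alpha>(1-3)] \<alpha>(4) False unfolding \<rho>_def by force
qed

section \<open>Fillings and tableaux\<close>

definition filling :: "nat list \<Rightarrow> tableau \<Rightarrow> bool" where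
  "filling \<tau> R \<longleftrightarrow> bij_betw R (boxes \<tau>) {1..sum_list \<tau>} \<and> (\<forall>b. b \<notin> boxes \<tau> \<longrightarrow> R b = 0)"

text \<open>Only the rows are ordered. Exchanging neighbouring entries of one column leaves the
  tableaux but stays in this class, where the spectral vector is still given by the
  contents.\<close>

definition row_standard :: "nat list \<Rightarrow> tableau \<Rightarrow> bool" where
  "row_standard \<tau> R \<longleftrightarrow> filling \<tau> R \<and>
    (\<forall>i j. (i, j) \<in> boxes \<tau> \<and> (i, j + 1) \<in> boxes \<tau> \<longrightarrow> R (i, j) > R (i, j + 1))"

definition box_of :: "tableau \<Rightarrow> nat \<Rightarrow> nat \<times> nat" where
  "box_of R k = (THE b. R b = k)"

lemma row_of_box: "row_of R k = fst (box_of R k)" and col_of_box: "col_of R k = snd (box_of R k)"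
  by (simp_all add: row_of_def col_of_def box_of_def)

lemma filling_box:
  assumes "filling \<tau> R"
  shows "b \<in> boxes \<tau> \<Longrightarrow> box_of R (R b) = b" "b \<in> boxes \<tau> \<Longrightarrow> R b \<in> {1..sum_list \<tau>}"
    "k \<in> {1..sum_list \<tau>} \<Longrightarrow> box_of R k \<in> boxes \<tau>" "k \<in> {1..sum_list \<tau>} \<Longrightarrow> R (box_of R k) = k"
proof -
  have inj: "inj_on R (boxes \<tau>)" and im: "R ` boxes \<tau> = {1..sum_list \<tau>}" and z: "b \<notin> boxes \<tau> \<Longrightarrow> R b = 0" for b
    using assms unfolding filling_def bij_betw_def by blast+
  show 1: "R b \<in> {1..sum_list \<tau>}" if "b \<in> boxes \<tau>" for b using im that by blast
  show 2: "box_of R (R b) = b" if b: "b \<in> boxes \<tau>" for b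
    unfolding box_of_def
  proof (rule the_equality)
    fix b' assume e: "R b' = R b"
    then have "b' \<in> boxes \<tau>" using z[of b'] 1[OF b] by (metis atLeastAtMost_iff not_one_le_zero)
    then show "b' = b" using inj e b by (auto dest: inj_onD)
  qed simp
  show "box_of R k \<in> boxes \<tau>" "R (box_of R k) = k" if k: "k \<in> {1..sum_list \<tau>}"
  proof -
    obtain b where "b \<in> boxes \<tau>" "k = R b" using im k by (metis imageE)
    then show "box_of R k \<in> boxes \<tau>" "R (box_of R k) = k" using 2 by auto
  qed
qed

lemma filling_inj: "filling \<tau> R \<Longrightarrow> b \<in> boxes \<tau> \<Longrightarrow> b' \<in> boxes \<tau> \<Longrightarrow> R b = R b' \<longleftrightarrow> b = b'"
  by (auto simp: filling_def bij_betw_def dest: inj_onD)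

lemma box_of_inj:
  "filling \<tau> R \<Longrightarrow> k \<in> {1..sum_list \<tau>} \<Longrightarrow> l \<in> {1..sum_list \<tau>} \<Longrightarrow> box_of R k = box_of R l \<longleftrightarrow> k = l"
  using filling_box(4) by metis

lemma box_of_exchange: "box_of (exchange R k) j = box_of R (tp k j)"
proof -
  have "exchange R k b = j \<longleftrightarrow> R b = tp k j" for b
    by (auto simp: exchange_def)
  then show ?thesis unfolding box_of_def by simp
qed

lemma row_of_exchange: "row_of (exchange R k) = row_of R \<circ> tp k"
  and col_of_exchange: "col_of (exchange R k) = col_of R \<circ> tp k"
  and content_exchange: "content (exchange R k) = content R \<circ> tp k"
  by (auto simp: fun_eq_iff row_of_box col_of_box box_of_exchange content_def)

lemma exchange_exchange [simp]: "exchange (exchange R k) k = R"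
  by (auto simp: exchange_def fun_eq_iff)

lemma tp_range: "1 \<le> k \<Longrightarrow> k < N \<Longrightarrow> tp k j \<in> {1..N} \<longleftrightarrow> j \<in> {1..N}"
  by (auto simp: transpose_def)

lemma bij_tp: "1 \<le> k \<Longrightarrow> k < N \<Longrightarrow> bij_betw (tp k) {1..N} {1..N}"
  by (rule bij_betw_byWitness[where f' = "tp k"]) (auto simp: transpose_def)

lemma filling_exchange:
  assumes "filling \<tau> R" "1 \<le> k" "k < sum_list \<tau>"
  shows "filling \<tau> (exchange R k)"
  using assms bij_betw_trans[OF _ bij_tp[OF assms(2,3)]] by (auto simp: filling_def exchange_def)

lemma tp_less: "a < b \<Longrightarrow> \<not> (a = k \<and> b = Suc k) \<Longrightarrow> tp k a < tp k b"
  by (auto simp: transpose_def)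

lemma row_standard_exchange:
  assumes "row_standard \<tau> R" "1 \<le> k" "k < sum_list \<tau>" "row_of R k \<noteq> row_of R (Suc k)"
  shows "row_standard \<tau> (exchange R k)"
  unfolding row_standard_def
proof (intro conjI allI impI)
  have f: "filling \<tau> R" using assms by (simp add: row_standard_def)
  then show "filling \<tau> (exchange R k)" by (rule filling_exchange[OF _ assms(2,3)])
  fix i j assume b: "(i, j) \<in> boxes \<tau> \<and> (i, j + 1) \<in> boxes \<tau>"
  have "\<not> (R (i, j + 1) = k \<and> R (i, j) = Suc k)"
    using filling_box(1)[OF f] b assms(4) by (metis fst_conv row_of_box)
  then show "exchange R k (i, j) > exchange R k (i, j + 1)"
    using assms(1) b by (auto simp: exchange_def row_standard_def intro!: tp_less)
qed

lemma Tab_row_standard: "S \<in> Tab \<tau> \<Longrightarrow> row_standard \<tau> S"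
  by (auto simp: Tab_def row_standard_def filling_def)

lemma Tab_filling: "S \<in> Tab \<tau> \<Longrightarrow> filling \<tau> S"
  by (simp add: Tab_def filling_def)

lemma Tab_exchange:
  assumes "S \<in> Tab \<tau>" "1 \<le> k" "k < sum_list \<tau>" "row_of S k \<noteq> row_of S (Suc k)" "col_of S k \<noteq> col_of S (Suc k)"
  shows "exchange S k \<in> Tab \<tau>"
proof -
  have f: "filling \<tau> S" using assms by (simp add: Tab_filling)
  have r: "row_standard \<tau> (exchange S k)" using assms by (intro row_standard_exchange Tab_row_standard)
  have "exchange S k (i + 1, j) < exchange S k (i, j)" if b: "(i, j) \<in> boxes \<tau> \<and> (i + 1, j) \<in> boxes \<tau>" for i j
  proof -
    have "\<not> (S (i + 1, j) = k \<and> S (i, j) = Suc k)"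
      using filling_box(1)[OF f] b assms(5) by (metis snd_conv col_of_box)
    then show ?thesis
      using assms(1) b by (auto simp: exchange_def Tab_def intro!: tp_less)
  qed
  then show ?thesis using r by (auto simp: Tab_def row_standard_def filling_def)
qed

lemma boxes_row: "(r, c) \<in> boxes \<tau> \<Longrightarrow> 1 \<le> c' \<Longrightarrow> c' \<le> c \<Longrightarrow> (r, c') \<in> boxes \<tau>"
  by (auto simp: boxes_def)

lemma boxes_Sigma: "boxes \<tau> = Sigma {1..length \<tau>} (\<lambda>r. {1..\<tau> ! (r - 1)})"
  by (auto simp: boxes_def)

lemma finite_boxes: "finite (boxes \<tau>)"
  by (simp add: boxes_Sigma)

lemma card_boxes: "card (boxes \<tau>) = sum_list \<tau>"
proof -
  have "card (boxes \<tau>) = (\<Sum>r=1..length \<tau>. \<tau> ! (r - 1))"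
    by (simp add: boxes_Sigma)
  also have "\<dots> = (\<Sum>i<length \<tau>. \<tau> ! i)"
    by (rule sum.reindex_bij_witness[where i = Suc and j = "\<lambda>r. r - 1"]) auto
  finally show ?thesis by (simp add: sum_list_sum_nth atLeast0LessThan)
qed

lemma row_standard_less:
  assumes "row_standard \<tau> R" "(r, c) \<in> boxes \<tau>" "(r, c') \<in> boxes \<tau>" "c < c'"
  shows "R (r, c) > R (r, c')"
  using assms(4,3)
proof (induction c')
  case (Suc j)
  have b: "(r, j) \<in> boxes \<tau>"
    using boxes_row[OF Suc.prems(2), of j] Suc.prems assms(2) by (auto simp: boxes_def)
  then have "R (r, j) > R (r, Suc j)"
    using assms(1) Suc.prems by (auto simp: row_standard_def)
  then show ?case using Suc b by (cases "c = j") auto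
qed simp

section \<open>Orderings of the boxes and the tableaux S_0 and S_1\<close>

definition before_total :: "'b set \<Rightarrow> ('b \<Rightarrow> 'b \<Rightarrow> bool) \<Rightarrow> bool" where
  "before_total B bef \<longleftrightarrow> (\<forall>a\<in>B. \<not> bef a a) \<and> (\<forall>a\<in>B. \<forall>b\<in>B. \<forall>c\<in>B. bef a b \<longrightarrow> bef b c \<longrightarrow> bef a c)
    \<and> (\<forall>a\<in>B. \<forall>b\<in>B. a \<noteq> b \<longrightarrow> bef a b \<or> bef b a)"

text \<open>Counting predecessors turns a total order on the boxes into a filling with the larger
  entries first; S_0 and S_1 are the two instances.\<close>

lemma rank_bij:
  assumes "finite B" "before_total B bef"
  defines "f \<equiv> \<lambda>b. card B - card {b'\<in>B. bef b' b}"
  shows "bij_betw f B {1..card B}" "a \<in> B \<Longrightarrow> b \<in> B \<Longrightarrow> f b < f a \<longleftrightarrow> bef a b"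
proof -
  have irr: "\<And>a. a \<in> B \<Longrightarrow> \<not> bef a a" and tr: "\<And>a b c. a \<in> B \<Longrightarrow> b \<in> B \<Longrightarrow> c \<in> B \<Longrightarrow> bef a b \<Longrightarrow> bef b c \<Longrightarrow> bef a c"
    and tot: "\<And>a b. a \<in> B \<Longrightarrow> b \<in> B \<Longrightarrow> a \<noteq> b \<Longrightarrow> bef a b \<or> bef b a"
    using assms(2) unfolding before_total_def by blast+
  have lt: "card {b'\<in>B. bef b' a} < card {b'\<in>B. bef b' b}" if ab: "a \<in> B" "b \<in> B" "bef a b" for a b
  proof (rule psubset_card_mono)
    have "a \<in> {b'\<in>B. bef b' b}" "a \<notin> {b'\<in>B. bef b' a}" using ab irr by blast+
    moreover have "{b'\<in>B. bef b' a} \<subseteq> {b'\<in>B. bef b' b}" using ab tr by blast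
    ultimately show "{b'\<in>B. bef b' a} \<subset> {b'\<in>B. bef b' b}" by blast
  qed (use assms(1) in simp)
  have le: "card {b'\<in>B. bef b' a} < card B" if a: "a \<in> B" for a
  proof (rule psubset_card_mono[OF assms(1)])
    show "{b'\<in>B. bef b' a} \<subset> B" using a irr by blast
  qed
  have lt': "f b < f a" if "a \<in> B" "b \<in> B" "bef a b" for a b
    using lt[OF that] le[OF that(2)] unfolding f_def by linarith
  show iff: "f b < f a \<longleftrightarrow> bef a b" if "a \<in> B" "b \<in> B" for a b
    using lt'[OF that] lt'[OF that(2,1)] tot[OF that] by fastforce
  have inj: "inj_on f B"
  proof (rule inj_onI)
    fix a b assume "a \<in> B" "b \<in> B" "f a = f b"
    then show "a = b" using iff[of a b] iff[of b a] tot[of a b] by auto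
  qed
  have "f ` B \<subseteq> {1..card B}" unfolding f_def using le by fastforce
  then have "f ` B = {1..card B}" using inj by (intro card_subset_eq) (auto simp: card_image)
  then show "bij_betw f B {1..card B}" using inj by (simp add: bij_betw_def)
qed

lemma filling_rank:
  assumes f: "filling \<tau> S" and bef: "\<And>a b. a \<in> boxes \<tau> \<Longrightarrow> b \<in> boxes \<tau> \<Longrightarrow> S b < S a \<longleftrightarrow> bef a b" and b: "b \<in> boxes \<tau>"
  shows "S b = sum_list \<tau> - card {b'\<in>boxes \<tau>. bef b' b}"
proof -
  have "{b'\<in>boxes \<tau>. bef b' b} = {b'\<in>boxes \<tau>. S b < S b'}" using bef b by (intro Collect_cong) blast
  moreover have "bij_betw S {b'\<in>boxes \<tau>. S b < S b'} {S b<..sum_list \<tau>}"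
  proof (rule bij_betw_subset)
    show "bij_betw S (boxes \<tau>) {1..sum_list \<tau>}" using f by (simp add: filling_def)
    show "S ` {b'\<in>boxes \<tau>. S b < S b'} = {S b<..sum_list \<tau>}"
    proof (intro set_eqI iffI)
      fix k assume k: "k \<in> {S b<..sum_list \<tau>}"
      then have "k \<in> {1..sum_list \<tau>}" by auto
      then show "k \<in> S ` {b'\<in>boxes \<tau>. S b < S b'}"
        using filling_box(3,4)[OF f, of k] k by (intro image_eqI[of _ _ "box_of S k"]) auto
    qed (use filling_box(2)[OF f] in auto)
  qed auto
  ultimately have "card {b'\<in>boxes \<tau>. bef b' b} = sum_list \<tau> - S b"
    by (metis bij_betw_same_card card_greaterThanAtMost)
  moreover have "S b \<le> sum_list \<tau>" using filling_box(2)[OF f b] by simp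
  ultimately show ?thesis by simp
qed

definition bef0 :: "nat \<times> nat \<Rightarrow> nat \<times> nat \<Rightarrow> bool" where
  "bef0 b' b \<longleftrightarrow> snd b' < snd b \<or> snd b' = snd b \<and> fst b' < fst b"

definition bef1 :: "nat \<times> nat \<Rightarrow> nat \<times> nat \<Rightarrow> bool" where
  "bef1 b' b \<longleftrightarrow> fst b' < fst b \<or> fst b' = fst b \<and> snd b' < snd b"

lemma tot0: "a = b \<and> \<not> bef0 a b \<or> bef0 a b \<or> bef0 b a" and tot1: "a = b \<and> \<not> bef1 a b \<or> bef1 a b \<or> bef1 b a"
  by (cases a; cases b; auto simp: bef0_def bef1_def)+

lemma before_total_01: "before_total B bef0" "before_total B bef1"
  by (auto simp: before_total_def bef0_def bef1_def)

lemma tab0_less: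
  shows "filling \<tau> (tab0 \<tau>)" "a \<in> boxes \<tau> \<Longrightarrow> b \<in> boxes \<tau> \<Longrightarrow> tab0 \<tau> b < tab0 \<tau> a \<longleftrightarrow> bef0 a b"
proof -
  note r = rank_bij[OF finite_boxes[of \<tau>] before_total_01(1), unfolded card_boxes]
  have e: "tab0 \<tau> b = sum_list \<tau> - card {b'\<in>boxes \<tau>. bef0 b' b}" if "b \<in> boxes \<tau>" for b
    using that by (simp add: tab0_def bef0_def)
  show "filling \<tau> (tab0 \<tau>)" unfolding filling_def using r(1) e
    by (auto simp: tab0_def cong: bij_betw_cong)
  show "a \<in> boxes \<tau> \<Longrightarrow> b \<in> boxes \<tau> \<Longrightarrow> tab0 \<tau> b < tab0 \<tau> a \<longleftrightarrow> bef0 a b"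
    using r(2) e by simp
qed

lemma tab1_less:
  shows "filling \<tau> (tab1 \<tau>)" "a \<in> boxes \<tau> \<Longrightarrow> b \<in> boxes \<tau> \<Longrightarrow> tab1 \<tau> b < tab1 \<tau> a \<longleftrightarrow> bef1 a b"
proof -
  note r = rank_bij[OF finite_boxes[of \<tau>] before_total_01(2), unfolded card_boxes]
  have e: "tab1 \<tau> b = sum_list \<tau> - card {b'\<in>boxes \<tau>. bef1 b' b}" if "b \<in> boxes \<tau>" for b
    using that by (simp add: tab1_def bef1_def)
  show "filling \<tau> (tab1 \<tau>)" unfolding filling_def using r(1) e
    by (auto simp: tab1_def cong: bij_betw_cong)
  show "a \<in> boxes \<tau> \<Longrightarrow> b \<in> boxes \<tau> \<Longrightarrow> tab1 \<tau> b < tab1 \<tau> a \<longleftrightarrow> bef1 a b"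
    using r(2) e by simp
qed

lemma tab0_Tab: "tab0 \<tau> \<in> Tab \<tau>" and tab1_Tab: "tab1 \<tau> \<in> Tab \<tau>"
proof -
  have *: "S \<in> Tab \<tau>" if f: "filling \<tau> S" and r: "\<And>a b. a \<in> boxes \<tau> \<Longrightarrow> b \<in> boxes \<tau> \<Longrightarrow> bef a b \<Longrightarrow> S b < S a"
    and b: "\<And>i j. bef (i, j) (i, j + 1)" "\<And>i j. bef (i, j) (i + 1, j)" for S bef
    using f r b by (simp add: Tab_def filling_def)
  show "tab0 \<tau> \<in> Tab \<tau>"
    by (rule *[of _ bef0]) (simp_all add: tab0_less bef0_def)
  show "tab1 \<tau> \<in> Tab \<tau>"
    by (rule *[of _ bef1]) (simp_all add: tab1_less bef1_def)
qed

lemma tab_eqI: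
  assumes "filling \<tau> S" "filling \<tau> S'" "\<And>a b. a \<in> boxes \<tau> \<Longrightarrow> b \<in> boxes \<tau> \<Longrightarrow> S b < S a \<longleftrightarrow> S' b < S' a"
  shows "S = S'"
proof
  fix b
  show "S b = S' b"
  proof (cases "b \<in> boxes \<tau>")
    case True
    have "S b = sum_list \<tau> - card {b'\<in>boxes \<tau>. S' b < S' b'}"
      by (rule filling_rank[OF assms(1) _ True]) (rule assms(3))
    moreover have "S' b = sum_list \<tau> - card {b'\<in>boxes \<tau>. S' b < S' b'}"
      by (rule filling_rank[OF assms(2) _ True]) simp
    ultimately show ?thesis by simp
  qed (use assms(1,2) in \<open>simp add: filling_def split_paired_All[symmetric] del: split_paired_All\<close>)
qed

locale partition_shape =
  fixes \<tau> :: "nat list"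
  assumes part: "sorted_wrt (\<ge>) \<tau>"
begin

abbreviation "N \<equiv> sum_list \<tau>"
abbreviation "B \<equiv> boxes \<tau>"

lemma boxes_col: "(r, c) \<in> B \<Longrightarrow> 1 \<le> r' \<Longrightarrow> r' \<le> r \<Longrightarrow> (r', c) \<in> B"
proof -
  assume *: "(r, c) \<in> B" "1 \<le> r'" "r' \<le> r"
  then have "r' = r \<or> \<tau> ! (r - 1) \<le> \<tau> ! (r' - 1)"
    using sorted_wrt_nth_less[OF part, of "r' - 1" "r - 1"] by (cases "r' = r") (auto simp: boxes_def)
  then show ?thesis using * by (auto simp: boxes_def)
qed

lemma Tab_less:
  assumes S: "S \<in> Tab \<tau>" and b: "(r, c) \<in> B" "(r', c') \<in> B" "r \<le> r'" "c \<le> c'" "(r, c) \<noteq> (r', c')"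
  shows "S (r', c') < S (r, c)"
proof -
  have colmono: "S (r', c') < S (r, c')" if "(r', c') \<in> B" "1 \<le> r" "r < r'" for r r' c'
    using that(3,1)
  proof (induction r')
    case (Suc j)
    have j: "(j, c') \<in> B" using boxes_col[OF Suc.prems(2), of j] Suc.prems that(2) by auto
    then have "S (Suc j, c') < S (j, c')" using S Suc.prems by (auto simp: Tab_def)
    then show ?case using Suc j by (cases "r = j") auto
  qed simp
  have r: "1 \<le> r" using b(1) by (auto simp: boxes_def)
  have m: "(r, c') \<in> B" using boxes_col[OF b(2) r b(3)] .
  have "S (r, c') \<le> S (r, c)" using row_standard_less[OF Tab_row_standard[OF S] b(1) m] b(4) by (cases "c = c'") auto
  moreover have "S (r', c') \<le> S (r, c')" using colmono[OF b(2) r] b(3) by (cases "r = r'") auto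
  ultimately have "S (r', c') \<le> S (r, c)" by simp
  moreover have "S (r', c') \<noteq> S (r, c)" using filling_inj[OF Tab_filling[OF S]] b by metis
  ultimately show ?thesis by simp
qed

text \<open>Entries decrease to the right and upwards, so for k < l the box of l is not weakly above
  and to the right of that of k. Comparing the rows of neighbouring entries is thus as good as
  comparing their columns.\<close>

lemma Tab_row_col:
  assumes S: "S \<in> Tab \<tau>" and k: "1 \<le> k" "k < l" "l \<le> N"
  shows "row_of S k \<le> row_of S l \<Longrightarrow> col_of S l < col_of S k"
    and "col_of S k \<le> col_of S l \<Longrightarrow> row_of S l < row_of S k"
proof -
  have kN: "k \<in> {1..N}" "l \<in> {1..N}" using k by auto
  note fb = filling_box[OF Tab_filling[OF S]]
  have "\<not> (row_of S k \<le> row_of S l \<and> col_of S k \<le> col_of S l)"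
  proof
    assume *: "row_of S k \<le> row_of S l \<and> col_of S k \<le> col_of S l"
    have "S (box_of S l) < S (box_of S k)"
      using Tab_less[OF S, of "row_of S k" "col_of S k" "row_of S l" "col_of S l"] * fb(3)[OF kN(1)] fb(3)[OF kN(2)]
        box_of_inj[OF Tab_filling[OF S] kN] k
      by (simp add: row_of_box col_of_box)
    then show False using fb(4)[OF kN(1)] fb(4)[OF kN(2)] k by simp
  qed
  then show "row_of S k \<le> row_of S l \<Longrightarrow> col_of S l < col_of S k"
    and "col_of S k \<le> col_of S l \<Longrightarrow> row_of S l < row_of S k" by auto
qed

lemma antitone_Suc:
  fixes f :: "nat \<Rightarrow> nat"
  assumes "\<And>k. 1 \<le> k \<Longrightarrow> k < n \<Longrightarrow> f (Suc k) \<le> f k" "1 \<le> i" "i \<le> j" "j \<le> n"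
  shows "f j \<le> f i"
  using assms(3,4)
proof (induction j)
  case (Suc j)
  show ?case
  proof (cases "i = Suc j")
    case False
    then have "f j \<le> f i" "f (Suc j) \<le> f j" using Suc assms(1)[of j] assms(2) by auto
    then show ?thesis by simp
  qed simp
qed (use assms in simp)

text \<open>The terminal case of the inductions towards S_0: a weakly decreasing column word
  determines the tableau. \<open>no_ascent_tab1\<close> is the mirror image for S_1.\<close>

lemma no_descent_tab0:
  assumes S: "S \<in> Tab \<tau>" and nd: "\<And>k. 1 \<le> k \<Longrightarrow> k < N \<Longrightarrow> col_of S (Suc k) \<le> col_of S k"
  shows "S = tab0 \<tau>"
proof (rule tab_eqI[OF Tab_filling[OF S] tab0_less(1)])
  note fb = filling_box[OF Tab_filling[OF S]]
  have lt: "S b < S a" if ab: "a \<in> B" "b \<in> B" and bef: "bef0 a b" for a b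
  proof (cases "snd a < snd b")
    case True
    show ?thesis
    proof (rule ccontr)
      assume "\<not> ?thesis"
      then have "col_of S (S b) \<le> col_of S (S a)" using antitone_Suc[where n = N and f = "col_of S", OF nd] fb(2) ab by auto
      then show False using True fb(1) ab by (simp add: col_of_box)
    qed
  next
    case False
    then show ?thesis using Tab_less[OF S, of "fst a" "snd a" "fst b" "snd b"] ab bef
      by (cases a; cases b) (auto simp: bef0_def)
  qed
  show "S b < S a \<longleftrightarrow> tab0 \<tau> b < tab0 \<tau> a" if ab: "a \<in> B" "b \<in> B" for a b
    unfolding tab0_less(2)[OF ab] using lt[OF ab] lt[OF ab(2,1)] tot0[of a b] by auto
qed

lemma no_ascent_tab1:
  assumes S: "S \<in> Tab \<tau>" and nd: "\<And>k. 1 \<le> k \<Longrightarrow> k < N \<Longrightarrow> row_of S (Suc k) \<le> row_of S k"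
  shows "S = tab1 \<tau>"
proof (rule tab_eqI[OF Tab_filling[OF S] tab1_less(1)])
  note fb = filling_box[OF Tab_filling[OF S]]
  have lt: "S b < S a" if ab: "a \<in> B" "b \<in> B" and bef: "bef1 a b" for a b
  proof (cases "fst a < fst b")
    case True
    show ?thesis
    proof (rule ccontr)
      assume "\<not> ?thesis"
      then have "row_of S (S b) \<le> row_of S (S a)" using antitone_Suc[where n = N and f = "row_of S", OF nd] fb(2) ab by auto
      then show False using True fb(1) ab by (simp add: row_of_box)
    qed
  next
    case False
    then show ?thesis using Tab_less[OF S, of "fst a" "snd a" "fst b" "snd b"] ab bef
      by (cases a; cases b) (auto simp: bef1_def)
  qed
  show "S b < S a \<longleftrightarrow> tab1 \<tau> b < tab1 \<tau> a" if ab: "a \<in> B" "b \<in> B" for a b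
    unfolding tab1_less(2)[OF ab] using lt[OF ab] lt[OF ab(2,1)] tot1[of a b] by auto
qed

end

text \<open>Increasing pairs are counted because the column word of S_0 is weakly decreasing; the
  number measures the distance from S_0.\<close>

definition inv_set :: "nat \<Rightarrow> (nat \<Rightarrow> nat) \<Rightarrow> (nat \<times> nat) set" where
  "inv_set n c = {(i, j). 1 \<le> i \<and> i < j \<and> j \<le> n \<and> c i < c j}"

definition invs :: "nat \<Rightarrow> (nat \<Rightarrow> nat) \<Rightarrow> nat" where
  "invs n c = card (inv_set n c)"

lemma finite_inv_set: "finite (inv_set n c)"
  by (rule finite_subset[of _ "{1..n} \<times> {1..n}"]) (auto simp: inv_set_def)

lemma invs_swap_greater:
  assumes "1 \<le> k" "k < n" "c (Suc k) < c k"
  shows "invs n (c \<circ> tp k) = Suc (invs n c)"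
proof -
  let ?f = "map_prod (tp k) (tp k)"
  have eq: "inv_set n (c \<circ> tp k) = insert (k, Suc k) (?f ` inv_set n c)"
  proof (intro set_eqI iffI)
    fix p assume p: "p \<in> inv_set n (c \<circ> tp k)"
    obtain i j where ij: "p = (i, j)" by force
    show "p \<in> insert (k, Suc k) (?f ` inv_set n c)"
    proof (cases "i = k \<and> j = Suc k")
      case False
      then have "tp k i < tp k j" using p ij by (intro tp_less) (auto simp: inv_set_def)
      moreover have "tp k i \<in> {1..n}" "tp k j \<in> {1..n}" using p ij assms tp_range[OF assms(1,2)] by (auto simp: inv_set_def)
      ultimately have "(tp k i, tp k j) \<in> inv_set n c" using p ij by (auto simp: inv_set_def)
      then show ?thesis by (intro insertI2 image_eqI[of _ _ "(tp k i, tp k j)"]) (auto simp: ij)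
    qed (simp add: ij)
  next
    fix p assume "p \<in> insert (k, Suc k) (?f ` inv_set n c)"
    then show "p \<in> inv_set n (c \<circ> tp k)"
    proof
      assume "p \<in> ?f ` inv_set n c"
      then obtain i j where ij: "p = (tp k i, tp k j)" "(i, j) \<in> inv_set n c" by auto
      have "\<not> (i = k \<and> j = Suc k)" using ij assms by (auto simp: inv_set_def)
      then have "tp k i < tp k j" using ij by (intro tp_less) (auto simp: inv_set_def)
      moreover have "tp k i \<in> {1..n}" "tp k j \<in> {1..n}" using ij assms tp_range[OF assms(1,2)] by (auto simp: inv_set_def)
      ultimately show ?thesis using ij by (auto simp: inv_set_def)
    qed (use assms in \<open>auto simp: inv_set_def\<close>)
  qed
  have "(k, Suc k) \<notin> ?f ` inv_set n c"
  proof
    assume "(k, Suc k) \<in> ?f ` inv_set n c"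
    then obtain i j where "(i, j) \<in> inv_set n c" "tp k i = k" "tp k j = Suc k" by auto
    then have "i = Suc k" "j = k" by (auto simp: transpose_eq_iff)
    then show False using \<open>(i, j) \<in> inv_set n c\<close> by (auto simp: inv_set_def)
  qed
  moreover have "inj_on ?f (inv_set n c)"
    by (rule inj_on_subset[OF _ subset_UNIV]) (auto simp: inj_on_def dest: injD[OF inj_transpose])
  ultimately show ?thesis unfolding invs_def eq by (simp add: finite_inv_set card_image)
qed

lemma invs_swap_less:
  assumes "1 \<le> k" "k < n" "c k < c (Suc k)"
  shows "invs n c = Suc (invs n (c \<circ> tp k))"
proof -
  have "c \<circ> tp k \<circ> tp k = c" by (auto simp: fun_eq_iff)
  then show ?thesis using invs_swap_greater[of k n "c \<circ> tp k"] assms by simp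
qed

lemma invs_swap_le:
  assumes "1 \<le> k" "k < n"
  shows "invs n (c \<circ> tp k) \<le> Suc (invs n c)"
proof (cases "c k" "c (Suc k)" rule: linorder_cases)
  case equal
  then have "c \<circ> tp k = c" by (auto simp: fun_eq_iff transpose_def)
  then show ?thesis by simp
qed (use invs_swap_less[OF assms, of c] invs_swap_greater[OF assms, of c] in auto)

lemma invs_bound: "invs n c \<le> n * n"
proof -
  have "inv_set n c \<subseteq> {1..n} \<times> {1..n}" by (auto simp: inv_set_def)
  then have "card (inv_set n c) \<le> card ({1..n} \<times> {1..n})" by (rule card_mono[rotated]) simp
  then show ?thesis by (simp add: invs_def card_cartesian_product)
qed

section \<open>Minimal polynomials\<close>

definition opA :: "'a::field \<Rightarrow> nat \<Rightarrow> 'a \<Rightarrow> 'a mpoly \<Rightarrow> 'a mpoly" where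
  "opA t k \<rho> h = opT t k h + Const (kap t \<rho>) * h"

lemma opA_commute: "Suc i < j \<Longrightarrow> opA t i \<rho> (opA t j \<sigma> h) = opA t j \<sigma> (opA t i \<rho> h)"
  using opT_commute[of i j t h] by (simp add: opA_def opT_add opT_smult opT_smult' algebra_simps)

lemma kap_mult:
  assumes "\<rho> \<noteq> 1" "\<sigma> \<noteq> 1" "\<rho> * \<sigma> \<noteq> 1"
  shows "kap t \<rho> * kap t \<sigma> = kap t (\<rho> * \<sigma>) * (kap t \<rho> + kap t \<sigma> + t - 1)"
proof -
  define u v w where "u = kap t \<rho>" "v = kap t \<sigma>" "w = kap t (\<rho> * \<sigma>)"
  have "u * (1 - \<rho>) = 1 - t" "v * (1 - \<sigma>) = 1 - t" "w * (1 - \<rho> * \<sigma>) = 1 - t"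
    unfolding u_v_w_def kap_def using assms by simp_all
  then have "(1 - \<rho>) * (1 - \<sigma>) * (1 - \<rho> * \<sigma>) * (u * v - w * (u + v + t - 1)) = 0" by algebra
  then show ?thesis using assms unfolding u_v_w_def by auto
qed

text \<open>The Yang-Baxter relation of the intertwiners. After the braid and quadratic relations
  only the rational identity \<open>kap_mult\<close> remains. Path independence of h_S rests on
  it.\<close>

lemma opA_yang_baxter:
  assumes "\<rho> \<noteq> 1" "\<sigma> \<noteq> 1" "\<rho> * \<sigma> \<noteq> 1"
  shows "opA t i \<sigma> (opA t (Suc i) (\<rho> * \<sigma>) (opA t i \<rho> h)) =
    opA t (Suc i) \<rho> (opA t i (\<rho> * \<sigma>) (opA t (Suc i) \<sigma> h))"
proof -
  define u v w where "u = kap t \<rho>" "v = kap t \<sigma>" "w = kap t (\<rho> * \<sigma>)"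
  define T where "T = opT t i"
  define T' where "T' = opT t (Suc i)"
  define q where "q = t - 1"
  have uvw: "Const u * Const v = Const w * (Const u + Const v + Const q)"
    using kap_mult[OF assms, of t] unfolding u_v_w_def q_def by (simp flip: Const_simps(2,3) add: algebra_simps)
  have br: "T (T' (T h)) = T' (T (T' h))" unfolding T_def T'_def by (rule opT_braid)
  have lin: "T (p + r) = T p + T r" "T (Const c * p) = Const c * T p"
    "T' (p + r) = T' p + T' r" "T' (Const c * p) = Const c * T' p" for p r c
    unfolding T_def T'_def by (simp_all add: opT_add opT_smult)
  have qd: "T (T h) = Const q * T h + Const t * h" "T' (T' h) = Const q * T' h + Const t * h"
    unfolding T_def T'_def q_def by (rule opT_quadratic)+
  show ?thesis
    unfolding opA_def u_v_w_def[symmetric] T_def[symmetric] T'_def[symmetric]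
    by (simp only: lin br qd) (use uvw in algebra)
qed

definition cont_ratio :: "'a::field \<Rightarrow> tableau \<Rightarrow> nat \<Rightarrow> 'a" where
  "cont_ratio t S k = t powi (content S (Suc k) - content S k)"

lemma min_poly_step:
  assumes "is_min_poly t \<tau> S h" "1 \<le> i" "i < sum_list \<tau>" "row_of S i < row_of S (Suc i)" "col_of S i > col_of S (Suc i)"
  shows "is_min_poly t \<tau> (exchange S i) (opA t i (cont_ratio t S i) h)"
proof -
  have "(t - 1) / (1 - r) = - ((1 - t) / (1 - r))" for r by (simp add: minus_divide_left)
  then have "opT t i h - Const ((t - 1) / (1 - t powi (content S (i + 1) - content S i))) * h = opA t i (cont_ratio t S i) h"
    by (simp add: opA_def kap_def cont_ratio_def Const_simps)
  then show ?thesis using is_min_poly.step[of t \<tau> S h i] assms by simp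
qed

context partition_shape
begin

definition descent :: "tableau \<Rightarrow> nat \<Rightarrow> bool" where
  "descent S k \<longleftrightarrow> 1 \<le> k \<and> k < N \<and> col_of S k < col_of S (Suc k)"

lemma descent_row: "S \<in> Tab \<tau> \<Longrightarrow> descent S k \<Longrightarrow> row_of S (Suc k) < row_of S k"
  using Tab_row_col(2)[of S k "Suc k"] by (auto simp: descent_def)

lemma descent_exchange: "S \<in> Tab \<tau> \<Longrightarrow> descent S k \<Longrightarrow> exchange S k \<in> Tab \<tau>"
  using descent_row[of S k] by (intro Tab_exchange) (auto simp: descent_def)

lemma step_descent:
  assumes "S \<in> Tab \<tau>" "descent S k" "is_min_poly t \<tau> (exchange S k) h"
  shows "is_min_poly t \<tau> S (opA t k (cont_ratio t (exchange S k) k) h)"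
  using min_poly_step[OF assms(3), of k] descent_row[OF assms(1,2)] assms(2)
  by (simp add: descent_def row_of_exchange col_of_exchange)

lemma invs_descent: "descent S k \<Longrightarrow> invs N (col_of S) = Suc (invs N (col_of (exchange S k)))"
  unfolding col_of_exchange by (rule invs_swap_less) (auto simp: descent_def)

lemma is_min_poly_Tab: "is_min_poly t \<tau> S h \<Longrightarrow> S \<in> Tab \<tau>"
  by (induction rule: is_min_poly.induct) (auto intro: tab0_Tab Tab_exchange)

text \<open>The last step is read from its end, as a descent of S, so that induction on inversions
  can remove it.\<close>

lemma is_min_poly_cases:
  assumes "is_min_poly t \<tau> S h"
  obtains "S = tab0 \<tau>" "h = (\<Prod>(i, j)\<in>same_col_pairs \<tau> (tab0 \<tau>). Const t * Var i - Var j)"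
  | k h' where "S \<in> Tab \<tau>" "descent S k" "is_min_poly t \<tau> (exchange S k) h'" "h = opA t k (cont_ratio t (exchange S k) k) h'"
  using assms
proof (cases rule: is_min_poly.cases)
  case (step S' h' i)
  have d: "descent S i" using step by (simp add: descent_def col_of_exchange)
  have S': "exchange S i = S'" using step by simp
  have "(t - 1) / (1 - r) = - ((1 - t) / (1 - r))" for r by (simp add: minus_divide_left)
  then have "h = opA t i (cont_ratio t (exchange S i) i) h'"
    unfolding S' using step by (simp add: opA_def kap_def cont_ratio_def Const_simps)
  moreover have "S \<in> Tab \<tau>" using is_min_poly_Tab[OF assms] .
  moreover have "is_min_poly t \<tau> (exchange S i) h'" unfolding S' by (rule step)
  ultimately show ?thesis using that(2)[OF _ d] by blast
qed (use that in blast)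

lemma tab0_no_descent: "\<not> descent (tab0 \<tau>) k"
proof
  assume d: "descent (tab0 \<tau>) k"
  let ?b = "box_of (tab0 \<tau>) k" and ?b' = "box_of (tab0 \<tau>) (Suc k)"
  note fb = filling_box[OF tab0_less(1)[of \<tau>]]
  have b: "?b \<in> B" "?b' \<in> B" "tab0 \<tau> ?b = k" "tab0 \<tau> ?b' = Suc k" using fb(3,4) d by (auto simp: descent_def)
  then have "bef0 ?b' ?b" using tab0_less(2)[OF b(2,1)] by simp
  then show False using d by (auto simp: bef0_def descent_def col_of_box)
qed

lemma is_min_poly_ex:
  assumes "S \<in> Tab \<tau>"
  shows "\<exists>h. is_min_poly t \<tau> S h"
  using assms
proof (induction "invs N (col_of S)" arbitrary: S rule: less_induct)
  case less
  show ?case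
  proof (cases "\<exists>k. descent S k")
    case True
    then obtain k where k: "descent S k" by blast
    then obtain h where "is_min_poly t \<tau> (exchange S k) h"
      using less.hyps[of "exchange S k"] invs_descent[OF k] descent_exchange[OF less.prems k] by auto
    then show ?thesis using step_descent[OF less.prems k] by blast
  next
    case False
    then have "S = tab0 \<tau>"
      by (intro no_descent_tab0[OF less.prems]) (metis descent_def not_le)
    then show ?thesis using is_min_poly.base by blast
  qed
qed

text \<open>A diamond argument: two last steps at k and l lead down to a common tableau, through a
  square if l > k + 1 and a hexagon if l = k + 1. Along the two ways the intertwiners agree by
  commutation or by Yang-Baxter.\<close>

lemma is_min_poly_unique_aux:
  assumes t: "\<And>k::int. t powi k = 1 \<Longrightarrow> k = 0" "t \<noteq> (0::'a::field)"
    and IH: "\<And>S' h h'. invs N (col_of S') < invs N (col_of S) \<Longrightarrow>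
      is_min_poly t \<tau> S' h \<Longrightarrow> is_min_poly t \<tau> S' h' \<Longrightarrow> h = h'"
    and S: "S \<in> Tab \<tau>" and k: "descent S k" "is_min_poly t \<tau> (exchange S k) h1"
    and l: "descent S l" "is_min_poly t \<tau> (exchange S l) h2" and kl: "k < l"
  shows "opA t k (cont_ratio t (exchange S k) k) h1 = opA t l (cont_ratio t (exchange S l) l) h2"
proof (cases "l = Suc k")
  case False
  then have kl: "Suc k < l" using kl by simp
  have [simp]: "tp k l = l" "tp k (Suc l) = Suc l" "tp l k = k" "tp l (Suc k) = Suc k"
    using kl by (auto simp: transpose_def)
  have dl: "descent (exchange S k) l" and dk: "descent (exchange S l) k"
    using k(1) l(1) by (auto simp: descent_def col_of_exchange)
  have T: "exchange S k \<in> Tab \<tau>" "exchange S l \<in> Tab \<tau>" using descent_exchange S k l by auto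
  define U where "U = exchange (exchange S k) l"
  have U: "U = exchange (exchange S l) k"
    using kl by (auto simp: U_def exchange_def fun_eq_iff transpose_def)
  have "U \<in> Tab \<tau>" unfolding U_def by (rule descent_exchange[OF T(1) dl])
  then obtain h3 where h3: "is_min_poly t \<tau> U h3" using is_min_poly_ex by blast
  have "h1 = opA t l (cont_ratio t U l) h3"
    using IH[OF _ k(2) step_descent[OF T(1) dl]] h3 invs_descent[OF k(1)] U_def by simp
  moreover have "h2 = opA t k (cont_ratio t U k) h3"
    using IH[OF _ l(2) step_descent[OF T(2) dk]] h3 invs_descent[OF l(1)] U by simp
  moreover have "cont_ratio t U l = cont_ratio t (exchange S l) l" "cont_ratio t U k = cont_ratio t (exchange S k) k"
    unfolding U_def cont_ratio_def content_exchange by simp_all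
  ultimately show ?thesis using opA_commute[OF kl] by simp
next
  case True
  note l = l[unfolded True]
  have [simp]: "tp k (Suc (Suc k)) = Suc (Suc k)" "tp (Suc k) k = k" by (auto simp: transpose_def)
  define a b c where "a = content S k" "b = content S (Suc k)" "c = content S (Suc (Suc k))"
  have col: "col_of S k < col_of S (Suc k)" "col_of S (Suc k) < col_of S (Suc (Suc k))" and kN: "1 \<le> k" "Suc k < N"
    using k(1) l(1) by (auto simp: descent_def)
  have row: "row_of S (Suc k) < row_of S k" "row_of S (Suc (Suc k)) < row_of S (Suc k)"
    using descent_row[OF S k(1)] descent_row[OF S l(1)] by auto
  have ct: "a < b" "b < c" using col row by (auto simp: a_b_c_def content_def)
  \<comment> \<open>The two sides of the hexagon from S down to U, in which the entries k and k + 2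
    have changed places.\<close>
  define S1 where "S1 = exchange S k" define S2 where "S2 = exchange S1 (Suc k)"
  define R1 where "R1 = exchange S (Suc k)" define R2 where "R2 = exchange R1 k"
  define U where "U = exchange S2 k"
  have U: "U = exchange R2 (Suc k)"
    by (auto simp: U_def S2_def S1_def R2_def R1_def exchange_def fun_eq_iff transpose_def)
  note d = descent_def col_of_exchange
  have d1: "descent S1 (Suc k)" using col kN by (simp add: S1_def d)
  have d2: "descent S2 k" using col kN by (simp add: S1_def S2_def d)
  have e1: "descent R1 k" using col kN by (simp add: R1_def d)
  have e2: "descent R2 (Suc k)" using col kN by (simp add: R1_def R2_def d)
  have T1: "S1 \<in> Tab \<tau>" "R1 \<in> Tab \<tau>" unfolding S1_def R1_def using descent_exchange S k(1) l(1) by auto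
  have T2: "S2 \<in> Tab \<tau>" "R2 \<in> Tab \<tau>" unfolding S2_def R2_def using descent_exchange T1 d1 e1 by auto
  have "U \<in> Tab \<tau>" unfolding U_def by (rule descent_exchange[OF T2(1) d2])
  then obtain h3 where h3: "is_min_poly t \<tau> U h3" using is_min_poly_ex by blast
  have m1: "is_min_poly t \<tau> S2 (opA t k (cont_ratio t U k) h3)"
    using step_descent[OF T2(1) d2, of t h3] h3 unfolding U_def by simp
  have m2: "is_min_poly t \<tau> R2 (opA t (Suc k) (cont_ratio t U (Suc k)) h3)"
    using step_descent[OF T2(2) e2, of t h3] h3 unfolding U by simp
  have h1: "h1 = opA t (Suc k) (cont_ratio t S2 (Suc k)) (opA t k (cont_ratio t U k) h3)"
  proof (rule IH)
    show "is_min_poly t \<tau> S1 h1" using k(2) by (simp add: S1_def)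
    show "is_min_poly t \<tau> S1 (opA t (Suc k) (cont_ratio t S2 (Suc k)) (opA t k (cont_ratio t U k) h3))"
      using step_descent[OF T1(1) d1] m1 by (simp add: S2_def)
  qed (use invs_descent[OF k(1)] in \<open>simp add: S1_def\<close>)
  have h2: "h2 = opA t k (cont_ratio t R2 k) (opA t (Suc k) (cont_ratio t U (Suc k)) h3)"
  proof (rule IH)
    show "is_min_poly t \<tau> R1 h2" using l(2) by (simp add: R1_def)
    show "is_min_poly t \<tau> R1 (opA t k (cont_ratio t R2 k) (opA t (Suc k) (cont_ratio t U (Suc k)) h3))"
      using step_descent[OF T1(2) e1] m2 by (simp add: R2_def)
  qed (use invs_descent[OF l(1)] in \<open>simp add: R1_def\<close>)
  define \<rho> where "\<rho> = t powi (b - c)"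
  define \<sigma> where "\<sigma> = t powi (a - b)"
  have rs: "\<rho> * \<sigma> = t powi (a - c)" unfolding \<rho>_def \<sigma>_def using t(2) by (simp flip: power_int_add)
  have ne: "\<rho> \<noteq> 1" "\<sigma> \<noteq> 1" "\<rho> * \<sigma> \<noteq> 1"
    unfolding rs unfolding \<rho>_def \<sigma>_def using t(1)[of "b - c"] t(1)[of "a - b"] t(1)[of "a - c"] ct by auto
  have "cont_ratio t S1 k = \<sigma>" "cont_ratio t R1 (Suc k) = \<rho>"
    "cont_ratio t S2 (Suc k) = \<rho> * \<sigma>" "cont_ratio t R2 k = \<rho> * \<sigma>" "cont_ratio t U k = \<rho>" "cont_ratio t U (Suc k) = \<sigma>"
    unfolding rs unfolding \<rho>_def \<sigma>_def a_b_c_def cont_ratio_def U_def S1_def S2_def R1_def R2_def content_exchange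
    by simp_all
  then show ?thesis unfolding True h1 h2 S1_def[symmetric] R1_def[symmetric]
    using opA_yang_baxter[OF ne, of t k h3] by simp
qed

lemma is_min_poly_unique:
  assumes t: "\<And>k::int. t powi k = 1 \<Longrightarrow> k = 0" "t \<noteq> (0::'a::field)"
    and "is_min_poly t \<tau> S h" "is_min_poly t \<tau> S h'"
  shows "h = h'"
  using assms(3,4)
proof (induction "invs N (col_of S)" arbitrary: S h h' rule: less_induct)
  case less
  note IH = less.hyps
  have S: "S \<in> Tab \<tau>" using is_min_poly_Tab less.prems by blast
  show ?case
  proof (cases rule: is_min_poly_cases[OF less.prems(1)])
    case 1
    then show ?thesis
      by (cases rule: is_min_poly_cases[OF less.prems(2)]) (use tab0_no_descent in auto)
  next
    case (2 k h1)
    show ?thesis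
    proof (cases rule: is_min_poly_cases[OF less.prems(2)])
      case 1
      then show ?thesis using 2 tab0_no_descent by auto
    next
      case l: (2 l h2)
      show ?thesis
      proof (cases k l rule: linorder_cases)
        case less
        then show ?thesis using is_min_poly_unique_aux[OF t IH S 2(2,3) l(2,3)] 2(4) l(4) by simp
      next
        case greater
        then show ?thesis using is_min_poly_unique_aux[OF t IH S l(2,3) 2(2,3)] 2(4) l(4) by simp
      next
        case equal
        then show ?thesis using IH[OF _ 2(3), of h2] l 2 invs_descent[OF 2(2)] by simp
      qed
    qed
  qed
qed

lemma min_poly_eq:
  assumes "\<And>k::int. t powi k = 1 \<Longrightarrow> k = 0" "t \<noteq> (0::'a::field)" "is_min_poly t \<tau> S h"
  shows "min_poly t \<tau> S = h"
  unfolding min_poly_def using is_min_poly_unique[OF assms(1,2) _ assms(3)] assms(3) by blast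

end

section \<open>The specialization point\<close>

lemma cu_u_neq_0 [simp]: "cu_u \<noteq> 0"
  by (simp add: cu_u_def Zero_fract_def eq_fract)

lemma cu_const_u_power:
  assumes "cu_const c * cu_u ^ k = 1"
  shows "k = 0 \<and> c = 1"
proof -
  have "cu_u ^ k = Fract ([:0, 1:] ^ k) 1"
    unfolding cu_u_def by (simp add: ringhom_simps(7)[OF ringhom_Fract])
  then have "cu_const c * cu_u ^ k = Fract (monom c k) 1"
    by (simp add: cu_const_def monom_altdef)
  then have m: "monom c k = 1" using assms Fract_1_eq_iff[of "monom c k" 1] by (simp add: One_fract_def)
  then have "c \<noteq> 0" by auto
  then have "k = 0" using arg_cong[OF m, of degree] by (simp add: degree_monom_eq)
  then show ?thesis using arg_cong[OF m, of "\<lambda>p. coeff p 0"] by simp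
qed

lemma cu_const_u_powi:
  assumes "cu_const c * cu_u powi k = 1"
  shows "k = 0 \<and> c = 1"
proof (cases "k \<ge> 0")
  case True
  then show ?thesis using cu_const_u_power[of c "nat k"] assms by (auto simp: power_int_def)
next
  case False
  define j where "j = nat (- k)"
  have cj: "cu_const c = cu_u ^ j" using assms False by (simp add: power_int_def j_def field_simps)
  have c0: "c \<noteq> 0"
    using cj ringhom_simps(4)[OF ringhom_cu_const] by (metis cu_u_neq_0 power_not_zero)
  have "cu_const (1 / c) * cu_const c = 1"
    using c0 by (simp add: ringhom_simps(3)[OF ringhom_cu_const, symmetric] ringhom_simps(1)[OF ringhom_cu_const])
  then have "j = 0" using cu_const_u_power[of "1 / c" j] cj by simp
  then show ?thesis using False by (simp add: j_def)
qed

lemma primitive_root_powi: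
  assumes "primitive_root_of_unity g w" "g \<ge> 1" "w powi k = 1"
  shows "int g dvd k"
proof -
  have w: "w ^ g = 1" and p: "\<And>k. 0 < k \<Longrightarrow> k < g \<Longrightarrow> w ^ k \<noteq> 1"
    using assms(1) by (auto simp: primitive_root_of_unity_def)
  have w0: "w \<noteq> 0" using w assms(2) by (metis power_0_left not_one_le_zero zero_neq_one)
  have "k = int g * (k div int g) + k mod int g" by simp
  then have "w powi k = (w powi int g) powi (k div int g) * w powi (k mod int g)"
    using w0 by (metis power_int_add power_int_mult)
  then have "w powi (k mod int g) = 1" using assms(3) w by simp
  moreover have "k mod int g \<ge> 0" using assms(2) by simp
  ultimately have "w ^ nat (k mod int g) = 1" by (metis nat_0_le power_int_of_nat)
  moreover have "nat (k mod int g) < g" using assms(2) by (simp add: nat_less_iff)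
  ultimately have "nat (k mod int g) = 0" using p by blast
  moreover have "k mod int g \<ge> 0" using assms(2) by simp
  ultimately show ?thesis by (auto simp: dvd_eq_mod_eq_0)
qed

locale params =
  fixes m d K n \<nu> :: nat and \<omega> :: complex and q t :: cu and \<tau> :: "nat list"
  assumes m: "m \<ge> 1" and d: "d \<ge> 1" and K: "K \<ge> 1" and n: "n \<ge> 2" and \<nu>: "1 \<le> \<nu>" "\<nu> \<le> n - 1"
    and \<tau>: "\<tau> = (d * n - 1) # replicate (K - 1) (n - 1) @ [\<nu>]"
    and prim: "primitive_root_of_unity (gcd m n) (\<omega> ^ (m div gcd m n))"
    and q: "q = cu_const \<omega> * inverse cu_u ^ (n div gcd m n)"
    and t: "t = cu_u ^ (m div gcd m n)"
begin

definition row_len :: "nat \<Rightarrow> nat" where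
  "row_len r = (if r = 1 then d * n - 1 else if r \<le> K then n - 1 else \<nu>)"

lemma dn_ge: "n \<le> d * n"
  using d by simp

lemma row_len_antimono: "1 \<le> r \<Longrightarrow> r \<le> r' \<Longrightarrow> row_len r' \<le> row_len r"
  using \<nu> diff_le_mono[OF dn_ge, of 1] K by (auto simp: row_len_def)

lemma tau_nth: "i < K + 1 \<Longrightarrow> \<tau> ! i = row_len (Suc i)"
  using K by (auto simp: \<tau> row_len_def nth_Cons nth_append split: nat.split)

lemma length_tau [simp]: "length \<tau> = K + 1"
  using K by (simp add: \<tau>)

sublocale partition_shape \<tau>
  by standard (auto simp: sorted_wrt_iff_nth_less tau_nth intro: row_len_antimono)

lemma N_eq: "N = d * n - 1 + (n - 1) * (K - 1) + \<nu>"
  by (simp add: \<tau> sum_list_replicate mult.commute)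

lemma boxes_iff: "(r, c) \<in> B \<longleftrightarrow> 1 \<le> r \<and> r \<le> K + 1 \<and> 1 \<le> c \<and> c \<le> row_len r"
  using tau_nth[of "r - 1"] by (auto simp: boxes_def)

lemma card_bef1:
  assumes "(r, c) \<in> B"
  shows "card {b\<in>B. bef1 b (r, c)} = (if r = 1 then c - 1 else d * n - 1 + (n - 1) * (r - 2) + (c - 1))"
proof -
  have rc: "1 \<le> r" "r \<le> K + 1" "1 \<le> c" "c \<le> row_len r" using assms boxes_iff by auto
  have "{b\<in>B. bef1 b (r, c)} = Sigma {1..r - 1} (\<lambda>r'. {1..row_len r'}) \<union> {r} \<times> {1..c - 1}"
    using rc by (auto simp: bef1_def boxes_iff)
  moreover have "card (Sigma {1..r - 1} (\<lambda>r'. {1..row_len r'}) \<union> {r} \<times> {1..c - 1}) = (\<Sum>r'=1..r - 1. row_len r') + (c - 1)"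
    using rc by (subst card_Un_disjoint) (auto simp: card_cartesian_product)
  moreover have "(\<Sum>r'=1..Suc j. row_len r') = d * n - 1 + (n - 1) * j" if "Suc j \<le> K" for j
    using that by (induction j) (auto simp: row_len_def)
  from this[of "r - 2"] have "r \<noteq> 1 \<Longrightarrow> (\<Sum>r'=1..r - 1. row_len r') = d * n - 1 + (n - 1) * (r - 2)"
    using rc by (simp add: numeral_2_eq_2 Suc_diff_Suc del: sum.cl_ivl_Suc)
  ultimately show ?thesis using rc by auto
qed

lemma t_neq_0 [simp]: "t \<noteq> 0" by (simp add: t)

abbreviation (input) "g \<equiv> gcd m n"

lemma g_facts: "g \<ge> 1" "g * (m div g) = m" "g * (n div g) = n" "coprime (m div g) (n div g)" "m div g \<ge> 1"
  using m n by (auto simp: Suc_le_eq div_greater_zero_iff gcd_le1_nat intro: div_gcd_coprime)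

lemma omega_neq_0 [simp]: "\<omega> \<noteq> 0"
proof
  assume "\<omega> = 0"
  then have "(\<omega> ^ (m div g)) ^ g = 0" using g_facts by (cases "m div g"; cases g) simp_all
  then show False using prim by (metis primitive_root_of_unity_def zero_neq_one)
qed

lemma cu_const_omega_neq_0 [simp]: "cu_const \<omega> \<noteq> 0"
  by (simp add: cu_const_def Zero_fract_def eq_fract)

lemma q_neq_0 [simp]: "q \<noteq> 0"
  by (simp add: q)

lemma cu_const_powi: "cu_const \<omega> powi a = cu_const (\<omega> powi a)"
proof -
  have "inverse (cu_const \<omega>) = cu_const (inverse \<omega>)"
    by (rule inverse_unique) (simp add: ringhom_simps(3)[OF ringhom_cu_const, symmetric] ringhom_simps(1)[OF ringhom_cu_const])
  then show ?thesis by (simp add: power_int_def ringhom_simps(7)[OF ringhom_cu_const])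
qed

lemma qt_powi: "q powi a * t powi b = cu_const (\<omega> powi a) * cu_u powi (int (m div g) * b - int (n div g) * a)"
proof -
  have u: "(cu_u ^ k) powi c = cu_u powi (int k * c)" for k c
    by (metis power_int_mult power_int_of_nat)
  have "q powi a = cu_const (\<omega> powi a) * cu_u powi (- (int (n div g) * a))"
    by (simp add: q power_int_mult_distrib cu_const_powi power_inverse power_int_inverse u power_int_minus)
  moreover have "t powi b = cu_u powi (int (m div g) * b)" by (simp add: t u)
  ultimately show ?thesis by (simp add: mult.assoc flip: power_int_add)
qed

text \<open>The exponent of u gives (m/g) b = (n/g) a, so a = (m/g) k by coprimality. What remains
  is (omega^(m/g))^k = 1, and primitivity of this root yields g dvd k.\<close>

lemma qt_eq_1:
  assumes "q powi a * t powi b = 1"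
  shows "\<exists>k. a = int m * k \<and> b = int n * k"
proof -
  have *: "int (m div g) * b = int (n div g) * a" "\<omega> powi a = 1"
    using cu_const_u_powi[OF assms[unfolded qt_powi]] by auto
  have "coprime (int (m div g)) (int (n div g))" using g_facts(4) by simp
  moreover have "int (m div g) dvd int (n div g) * a" using * by (metis dvd_triv_left)
  ultimately obtain k where k: "a = int (m div g) * k"
    by (metis coprime_dvd_mult_right_iff dvd_def)
  have "(\<omega> ^ (m div g)) powi k = 1" using *(2) k by (metis power_int_mult power_int_of_nat)
  then have "int g dvd k" using primitive_root_powi[OF prim] g_facts(1) by blast
  then obtain l where l: "k = int g * l" by (auto simp: dvd_def)
  have "a = int m * l" using k l g_facts(2) by (metis mult.commute mult.left_commute of_nat_mult)
  moreover have "int (m div g) * b = int (m div g) * (int (n div g) * k)"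
    using * k by (simp add: mult.left_commute)
  then have "b = int (n div g) * k" using g_facts(5) by simp
  then have "b = int n * l" using l g_facts(3) by (metis mult.commute mult.left_commute of_nat_mult)
  ultimately show ?thesis by blast
qed

lemma q_m_t_n: "q ^ m * t ^ n = 1"
proof -
  have "\<omega> ^ m = 1" using prim g_facts(2) by (metis mult.commute power_mult primitive_root_of_unity_def)
  moreover have "int (m div g) * int n - int (n div g) * int m = 0"
    using g_facts(2,3) by (metis cancel_comm_monoid_add_class.diff_cancel mult.commute mult.left_commute of_nat_mult)
  ultimately show ?thesis using qt_powi[of "int m" "int n"]
    by (simp add: ringhom_simps(1)[OF ringhom_cu_const])
qed

lemma t_powi_eq_1: "t powi k = 1 \<Longrightarrow> k = 0"
  using qt_eq_1[of 0 k] m by auto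

lemma t_powi_inj: "t powi k = t powi l \<Longrightarrow> k = l"
  using t_powi_eq_1[of "k - l"] by (simp add: power_int_diff)

lemma t_neq_1: "t \<noteq> 1" and t_neq_m1: "t \<noteq> -1"
proof -
  show "t \<noteq> 1" using t_powi_eq_1[of 1] by auto
  show "t \<noteq> -1" using t_powi_eq_1[of 2] by auto
qed

lemma row_value_less: "1 \<le> r \<Longrightarrow> r < r' \<Longrightarrow> row_value m d r < row_value m d r'"
  using m d by (auto simp: row_value_def)

lemma row_value_eq_iff: "1 \<le> r \<Longrightarrow> 1 \<le> r' \<Longrightarrow> row_value m d r = row_value m d r' \<longleftrightarrow> r = r'"
  using row_value_less[of r r'] row_value_less[of r' r] by (cases r r' rule: linorder_cases) auto

lemma row_value_less_iff: "1 \<le> r \<Longrightarrow> 1 \<le> r' \<Longrightarrow> row_value m d r < row_value m d r' \<longleftrightarrow> r < r'"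
  using row_value_less[of r r'] row_value_less[of r' r] row_value_eq_iff[of r r'] by (cases r r' rule: linorder_cases) auto

section \<open>Compositions of fillings and their spectral vectors\<close>

abbreviation "al R \<equiv> tab_comp m d \<tau> R"

lemma row_ge_1: "filling \<tau> R \<Longrightarrow> k \<in> {1..N} \<Longrightarrow> 1 \<le> row_of R k"
  using filling_box(3)[of \<tau> R k] boxes_iff[of "row_of R k" "col_of R k"] by (simp add: row_of_box col_of_box)

lemma al_compositions: "al R \<in> compositions N"
  by (auto simp: compositions_def tab_comp_def)

lemma al_exchange: "1 \<le> k \<Longrightarrow> k < N \<Longrightarrow> al (exchange R k) = al R \<circ> tp k"
  using tp_range[of k N] by (intro ext) (simp only: tab_comp_def row_of_exchange comp_apply)

lemma al_eq_iff: "filling \<tau> R \<Longrightarrow> k \<in> {1..N} \<Longrightarrow> l \<in> {1..N} \<Longrightarrow> al R k = al R l \<longleftrightarrow> row_of R k = row_of R l"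
  using row_value_eq_iff row_ge_1 by (simp add: tab_comp_def)

lemma al_less_iff: "filling \<tau> R \<Longrightarrow> k \<in> {1..N} \<Longrightarrow> l \<in> {1..N} \<Longrightarrow> al R k < al R l \<longleftrightarrow> row_of R k < row_of R l"
  using row_value_less_iff row_ge_1 by (simp add: tab_comp_def)

text \<open>The rank counts the boxes in higher rows and, since entries decrease along a row, those
  of the same row from the column of k on. The complement is what precedes the box row by
  row.\<close>

lemma comp_rank_al:
  assumes R: "row_standard \<tau> R" and k: "k \<in> {1..N}"
  shows "N - comp_rank N (al R) k = card {b\<in>B. bef1 b (box_of R k)}"
proof -
  have f: "filling \<tau> R" using R by (simp add: row_standard_def)
  note fb = filling_box[OF f]
  define r c where "r = row_of R k" "c = col_of R k"
  have bk: "box_of R k = (r, c)" by (simp add: r_c_def row_of_box col_of_box)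
  then have rc: "(r, c) \<in> B" "R (r, c) = k" using fb(3,4)[OF k] by auto
  have injR: "inj_on R A" if "A \<subseteq> B" for A
    using f that by (auto simp: filling_def bij_betw_def intro: inj_on_subset)
  have img: "R ` {b\<in>B. P b} = {j\<in>{1..N}. P (box_of R j)}" for P
  proof (intro set_eqI iffI)
    fix j assume "j \<in> {j\<in>{1..N}. P (box_of R j)}"
    then show "j \<in> R ` {b\<in>B. P b}" using fb(3,4)[of j] by (intro image_eqI[of _ _ "box_of R j"]) auto
  qed (use fb(1,2) in auto)
  have "{j\<in>{1..N}. al R j > al R k} = R ` {b\<in>B. fst b > r}"
    unfolding img using al_less_iff[OF f k] by (auto simp: r_c_def row_of_box)
  then have c1: "card {j\<in>{1..N}. al R j > al R k} = card {b\<in>B. fst b > r}"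
    by (simp add: card_image injR)
  have "{j\<in>{1..k}. al R j = al R k} = R ` {b\<in>B. fst b = r \<and> snd b \<ge> c}"
  proof -
    have "j \<le> k \<longleftrightarrow> c \<le> col_of R j" if j: "j \<in> {1..N}" "row_of R j = r" for j
    proof -
      have bj: "(r, col_of R j) \<in> B" "R (r, col_of R j) = j"
        using fb(3,4)[OF j(1)] j(2) by (auto simp: row_of_box col_of_box)
      show ?thesis
        using row_standard_less[OF R rc(1) bj(1)] row_standard_less[OF R bj(1) rc(1)] rc(2) bj(2)
        by (cases c "col_of R j" rule: linorder_cases) auto
    qed
    moreover have "j \<in> {1..k} \<longleftrightarrow> j \<in> {1..N} \<and> j \<le> k" for j using k by auto
    ultimately show ?thesis
      unfolding img using al_eq_iff[OF f _ k] by (intro Collect_cong) (metis r_c_def row_of_box col_of_box)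
  qed
  then have c2: "card {j\<in>{1..k}. al R j = al R k} = card {b\<in>B. fst b = r \<and> snd b \<ge> c}"
    by (simp add: card_image injR)
  have "comp_rank N (al R) k = card ({b\<in>B. fst b > r} \<union> {b\<in>B. fst b = r \<and> snd b \<ge> c})"
    unfolding comp_rank_def c1 c2 by (rule card_Un_disjoint[symmetric]) (auto simp: finite_boxes)
  moreover have "B = ({b\<in>B. fst b > r} \<union> {b\<in>B. fst b = r \<and> snd b \<ge> c}) \<union> {b\<in>B. bef1 b (r, c)}"
    by (auto simp: bef1_def)
  then have "N = card ({b\<in>B. fst b > r} \<union> {b\<in>B. fst b = r \<and> snd b \<ge> c}) + card {b\<in>B. bef1 b (r, c)}"
    unfolding card_boxes[symmetric] by (subst card_Un_disjoint[symmetric]) (auto simp: finite_boxes bef1_def)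
  ultimately show ?thesis unfolding bk by simp
qed

text \<open>By q^m = t^(-n) the factor q^((d+r-2)m) contributes -n(d+r-2) to the exponent of t; the
  dn-1+(n-1)(r-2)+(c-1) boxes preceding (r, c) bring it to c - r. The row values of alpha are made
  for this cancellation.\<close>

lemma zeta_content:
  assumes R: "row_standard \<tau> R" and k: "k \<in> {1..N}"
  shows "zeta q t N (al R) k = t powi content R k"
proof -
  have f: "filling \<tau> R" using R by (simp add: row_standard_def)
  define r c where "r = row_of R k" "c = col_of R k"
  have bk: "box_of R k = (r, c)" by (simp add: r_c_def row_of_box col_of_box)
  have rc: "(r, c) \<in> B" using filling_box(3)[OF f k] bk by simp
  then have rc': "1 \<le> r" "1 \<le> c" by (auto simp: boxes_iff)
  have z: "zeta q t N (al R) k = q ^ row_value m d r * t ^ card {b\<in>B. bef1 b (r, c)}"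
    unfolding zeta_def comp_rank_al[OF R k] bk using k by (simp add: tab_comp_def r_c_def)
  have qm: "q ^ m = t powi (- int n)" using q_m_t_n by (simp add: power_int_minus field_simps)
  show ?thesis
  proof (cases "r = 1")
    case True
    then have "content R k = int (c - 1)" using rc' by (simp add: content_def r_c_def of_nat_diff)
    then show ?thesis unfolding z card_bef1[OF rc] using True by (simp add: row_value_def)
  next
    case False
    have "q ^ row_value m d r = t powi (- int n * int (d + r - 2))"
    proof -
      have "q ^ row_value m d r = (q ^ m) ^ (d + r - 2)"
        using False by (simp add: row_value_def mult.commute[of _ m] power_mult)
      then show ?thesis unfolding qm by (simp only: power_int_mult power_int_of_nat)
    qed
    then have "zeta q t N (al R) k = t powi (- int n * int (d + r - 2) + int (d * n - 1 + (n - 1) * (r - 2) + (c - 1)))"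
      unfolding z card_bef1[OF rc] using False by (simp only: power_int_add[OF disjI1[OF t_neq_0]] power_int_of_nat if_False)
    also have "- int n * int (d + r - 2) + int (d * n - 1 + (n - 1) * (r - 2) + (c - 1)) = content R k"
    proof -
      obtain r' where r': "r = r' + 2" using False rc' by (metis Suc_leI le_neq_implies_less add.commute less_eqE one_add_one plus_1_eq_Suc)
      obtain n' where n': "n = Suc n'" using n by (cases n) auto
      have "d * n \<ge> 1" using d n by (simp add: Suc_le_eq)
      then have "int (d * n - 1) = int d * int n - 1" by (simp add: of_nat_diff)
      moreover have "int (c - 1) = int c - 1" using rc' by simp
      ultimately show ?thesis
        unfolding content_def r_c_def[symmetric] by (simp add: r' n' algebra_simps)
    qed
    finally show ?thesis .
  qed
qed

lemma spv_zeta: "spv q t (zeta gen_q gen_t N \<alpha> k) (zeta q t N \<alpha> k)"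
  unfolding zeta_def by (intro spv_mult spv_power spv_gen_q spv_gen_t)

lemma spv_zeta_ratio:
  assumes R: "row_standard \<tau> R" and k: "1 \<le> k" "k < N"
  shows "spv q t (zeta gen_q gen_t N (al R) (Suc k) / zeta gen_q gen_t N (al R) k) (cont_ratio t R k)"
proof -
  have "spv q t (zeta gen_q gen_t N (al R) (Suc k) / zeta gen_q gen_t N (al R) k)
    (t powi content R (Suc k) / t powi content R k)"
    using spv_zeta[of "al R" k] spv_zeta[of "al R" "Suc k"] zeta_content[OF R, of k] zeta_content[OF R, of "Suc k"] k
    by (intro spv_divide) simp_all
  then show ?thesis by (simp add: cont_ratio_def power_int_diff)
qed

end

section \<open>Specialized Macdonald polynomials\<close>

lemma opA_inverse:
  assumes "\<rho> \<noteq> 0" "\<rho> \<noteq> 1"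
  shows "opA t k (1 / \<rho>) (opA t k \<rho> p) = Const (t + kap t \<rho> * kap t (1 / \<rho>)) * p"
proof -
  have "Const (kap t (1 / \<rho>)) + Const (kap t \<rho>) = Const (1 - t)"
    using kap_inverse[OF assms, of t] by (simp flip: Const_simps(2) add: add.commute)
  then have e: "Const (kap t (1 / \<rho>)) = Const (1 - t) - Const (kap t \<rho>)" by (simp add: algebra_simps)
  show ?thesis
    unfolding opA_def opT_add opT_smult opT_quadratic Const_simps(2,3)
    by (simp add: e Const_simps algebra_simps)
qed

lemma opA_eq_0:
  assumes "\<rho> \<noteq> 0" "\<rho> \<noteq> 1" "t \<noteq> \<rho>" "t * \<rho> \<noteq> 1" "opA t k \<rho> p = 0"
  shows "p = 0"
proof -
  have "Const (t + kap t \<rho> * kap t (1 / \<rho>)) * p = 0"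
    using opA_inverse[OF assms(1,2), of t k p] assms(5) by (simp add: opA_def)
  then show ?thesis using assms kap_norm[OF assms(1,2), of t] by auto
qed

locale macdonald_params = params +
  fixes M :: "(nat \<Rightarrow> nat) \<Rightarrow> cqt mpoly"
  assumes M: "macdonald_family N M"
    and M_tab1: "no_pole_mpoly q t (M (tab_comp m d \<tau> (tab1 \<tau>)))"
      "singular_poly q t N (specialize q t (M (tab_comp m d \<tau> (tab1 \<tau>))))"
begin

abbreviation "P S \<equiv> specialize q t (M (al S))"

text \<open>The scalar \<open>c\<close> absorbs the zeros and poles of the intertwiners, since \<open>M (al R)\<close> itself may have a pole when
  \<open>R\<close> is not a tableau.\<close>

definition specializes :: "tableau \<Rightarrow> cu mpoly \<Rightarrow> bool" where
  "specializes R p \<longleftrightarrow> (\<exists>c. c \<noteq> 0 \<and> spz q t (Const c * M (al R)) p)"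

text \<open>Different contents keep the coefficient of the intertwiner finite. The generic scalar
  gained in the step is nonzero but may vanish or have a pole at the specialization, so it goes into
  the scalar of \<open>specializes\<close>.\<close>

lemma specializes_exchange:
  assumes R: "row_standard \<tau> R" and k: "1 \<le> k" "k < N" "row_of R k \<noteq> row_of R (Suc k)"
    and c: "content R k \<noteq> content R (Suc k)" and p: "specializes R p"
  shows "specializes (exchange R k) (opA t k (cont_ratio t R k) p)"
proof -
  obtain c where c0: "c \<noteq> 0" and sp: "spz q t (Const c * M (al R)) p" using p by (auto simp: specializes_def)
  define \<rho> where "\<rho> = zeta gen_q gen_t N (al R) (Suc k) / zeta gen_q gen_t N (al R) k"
  have f: "filling \<tau> R" using R by (simp add: row_standard_def)
  have ne: "al R k \<noteq> al R (Suc k)" using al_eq_iff[OF f] k by auto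
  obtain c' where c': "c' \<noteq> 0" "opT gen_t k (M (al R)) + Const (kap gen_t \<rho>) * M (al R) = Const c' * M (al R \<circ> tp k)"
    using macdonald_T_neq[OF M al_compositions k(1,2) ne] unfolding \<rho>_def by blast
  have "cont_ratio t R k \<noteq> 1" using t_powi_eq_1 assms(5) unfolding cont_ratio_def by fastforce
  then have "spv q t (kap gen_t \<rho>) (kap t (cont_ratio t R k))"
    unfolding kap_def \<rho>_def using spv_zeta_ratio[OF R k(1,2)]
    by (intro spv_divide spv_diff spv_1 spv_gen_t) auto
  then have "spz q t (opA gen_t k \<rho> (Const c * M (al R))) (opA t k (cont_ratio t R k) p)"
    unfolding opA_def using sp by (intro spz_add spz_opT spz_smult)
  moreover have "opA gen_t k \<rho> (Const c * M (al R)) = Const c * (opT gen_t k (M (al R)) + Const (kap gen_t \<rho>) * M (al R))"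
    by (simp add: opA_def opT_smult algebra_simps)
  ultimately have "spz q t (Const (c * c') * M (al (exchange R k))) (opA t k (cont_ratio t R k) p)"
    using c' al_exchange[OF k(1,2)] by (simp add: Const_simps(3) mult.assoc)
  then show ?thesis unfolding specializes_def using c0 c' by (intro exI[of _ "c * c'"]) simp
qed

lemma specializes_same_row:
  assumes f: "filling \<tau> R" and k: "1 \<le> k" "k < N" "row_of R k = row_of R (Suc k)" and p: "specializes R p"
  shows "opT t k p = Const t * p"
proof -
  obtain c where sp: "spz q t (Const c * M (al R)) p" using p by (auto simp: specializes_def)
  have "al R k = al R (Suc k)" using al_eq_iff[OF f] k by auto
  then have "opT gen_t k (Const c * M (al R)) = Const gen_t * (Const c * M (al R))"
    using macdonald_T_equal[OF M al_compositions k(1,2)] by (simp add: opT_smult mult.left_commute)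
  then show ?thesis using spz_opT[OF sp, of k] spz_smult[OF spv_gen_t sp] by (metis spz_unique)
qed

lemma specializes_xi_N:
  assumes R: "row_standard \<tau> R" and p: "specializes R p" and N: "1 \<le> N"
  shows "op_xi q t N N p = Const (t powi content R N) * p"
proof -
  obtain c where sp: "spz q t (Const c * M (al R)) p" using p by (auto simp: specializes_def)
  have "op_xi gen_q gen_t N N (M (al R)) = Const (zeta gen_q gen_t N (al R) N) * M (al R)"
    using M al_compositions N unfolding macdonald_family_def by auto
  then have "op_xi gen_q gen_t N N (Const c * M (al R)) = Const (zeta gen_q gen_t N (al R) N) * (Const c * M (al R))"
    by (simp add: op_xi_lin mult.left_commute)
  moreover have "spv q t (zeta gen_q gen_t N (al R) N) (t powi content R N)"
    using spv_zeta[of "al R" N] zeta_content[OF R, of N] N by simp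
  ultimately show ?thesis
    using spz_xi_N[OF sp t_neq_0, of N] spz_smult[OF _ sp] by (metis spz_unique)
qed

lemma N_ge_2: "2 \<le> N"
proof -
  have "2 \<le> d * n" using n d by (metis dn_ge le_trans)
  then show ?thesis using \<nu> by (simp add: N_eq)
qed

lemma ascent_content:
  assumes S: "S \<in> Tab \<tau>" and k: "1 \<le> k" "k < N" "row_of S k < row_of S (Suc k)"
  shows "content S (Suc k) - content S k \<le> -2"
  using Tab_row_col(1)[OF S k(1), of "Suc k"] k by (simp add: content_def)

text \<open>The ratio is t to the content difference. A difference of at least 2 in absolute value
  keeps it away from 1, where the intertwiner has a pole, and from t and 1/t, where it
  degenerates.\<close>

lemma cont_ratio_generic:
  assumes "\<bar>content R (Suc k) - content R k\<bar> \<ge> 2"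
  shows "cont_ratio t R k \<noteq> 0" "cont_ratio t R k \<noteq> 1" "t \<noteq> cont_ratio t R k" "t * cont_ratio t R k \<noteq> 1"
proof -
  define e where "e = content R (Suc k) - content R k"
  have "t * cont_ratio t R k = t powi (1 + e)" "t powi 1 = t"
    by (simp_all add: cont_ratio_def e_def power_int_add)
  then show "cont_ratio t R k \<noteq> 0" "cont_ratio t R k \<noteq> 1" "t \<noteq> cont_ratio t R k" "t * cont_ratio t R k \<noteq> 1"
    using assms t_powi_eq_1[of e] t_powi_inj[of 1 e] t_powi_eq_1[of "1 + e"]
    by (auto simp: cont_ratio_def e_def)
qed

text \<open>Inverts a step towards S_1. At an ascent of a tableau the content difference is at most
  -2, so the scalar by which the two intertwiners compose survives specialization, and S inherits
  the absence of poles from \<open>exchange S k\<close>.\<close>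

lemma P_step:
  assumes S: "S \<in> Tab \<tau>" and k: "1 \<le> k" "k < N" "row_of S k < row_of S (Suc k)"
    and np: "no_pole_mpoly q t (M (al (exchange S k)))"
  shows "no_pole_mpoly q t (M (al S))"
    "P (exchange S k) = opA t k (cont_ratio t S k) (P S)"
    "\<exists>c. P S = Const c * opA t k (1 / cont_ratio t S k) (P (exchange S k))"
proof -
  note R = Tab_row_standard[OF S]
  note f = Tab_filling[OF S]
  define S' where "S' = exchange S k"
  define \<rho> where "\<rho> = zeta gen_q gen_t N (al S) (Suc k) / zeta gen_q gen_t N (al S) k"
  define r where "r = cont_ratio t S k"
  have lt: "al S k < al S (Suc k)" using al_less_iff[OF f] k by auto
  have a: "al S' = al S \<circ> tp k" "al S' \<circ> tp k = al S"
    unfolding S'_def using k by (auto simp: al_exchange fun_eq_iff)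
  have cond: "\<bar>content S (Suc k) - content S k\<bar> \<ge> 2" using ascent_content[OF S k] by simp
  note g = cont_ratio_generic[OF cond, folded r_def]
  have sr: "spv q t \<rho> r" unfolding \<rho>_def r_def by (rule spv_zeta_ratio[OF R k(1,2)])
  have \<rho>0: "\<rho> \<noteq> 0" "\<rho> \<noteq> 1" unfolding \<rho>_def using zeta_ratio_neq(1)[OF k(1,2), of "al S"] lt by (auto simp: zeta_neq_0)
  have zr: "zeta gen_q gen_t N (al S') (Suc k) / zeta gen_q gen_t N (al S') k = 1 / \<rho>"
    unfolding a(1) \<rho>_def using zeta_swap[of k N "al S" gen_q gen_t] k lt by simp
  define C where "C = gen_t + kap gen_t (1 / \<rho>) * kap gen_t \<rho>"
  define c where "c = t + kap t (1 / r) * kap t r"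
  have k1: "spv q t (kap gen_t \<rho>) (kap t r)" "spv q t (kap gen_t (1 / \<rho>)) (kap t (1 / r))"
    unfolding kap_def using sr g by (auto intro!: spv_divide spv_diff spv_1 spv_gen_t)
  then have sC: "spv q t C c" unfolding C_def c_def by (intro spv_add spv_mult spv_gen_t)
  have c0: "c \<noteq> 0" unfolding c_def using kap_norm[OF g(1,2), of t] g by (simp add: mult.commute)
  then have C0: "C \<noteq> 0" using sC spv_unique[OF spv_0] by metis
  have "opT gen_t k (M (al S')) + Const (kap gen_t (1 / \<rho>)) * M (al S') = Const C * M (al S)"
    using macdonald_T_greater[OF M al_compositions k(1,2), of S'] lt unfolding zr C_def
    by (simp add: a(1) a(2)[unfolded a(1)])
  then have MS: "M (al S) = Const (1 / C) * opA gen_t k (1 / \<rho>) (M (al S'))"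
    unfolding opA_def using Const_mult_cancel[OF C0, of "M (al S)"] by simp
  have "spz q t (M (al S')) (P S')" using np by (simp add: spz_iff S'_def)
  then have "spz q t (Const (1 / C) * opA gen_t k (1 / \<rho>) (M (al S'))) (Const (1 / c) * opA t k (1 / r) (P S'))"
    unfolding opA_def using k1 by (intro spz_smult spz_add spz_opT spv_divide spv_1 sC c0)
  then have sp: "spz q t (M (al S)) (Const (1 / c) * opA t k (1 / r) (P S'))" unfolding MS[symmetric] .
  then show "no_pole_mpoly q t (M (al S))" by (simp add: spz_iff)
  have PS: "P S = Const (1 / c) * opA t k (1 / r) (P S')" using sp by (simp add: spz_iff)
  then show "\<exists>c. P S = Const c * opA t k (1 / cont_ratio t S k) (P (exchange S k))"
    unfolding S'_def r_def by blast
  have "M (al S') = opA gen_t k \<rho> (M (al S))"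
    using macdonald_T_less[OF M al_compositions k(1,2), of S] lt unfolding \<rho>_def a opA_def by (simp add: algebra_simps)
  moreover have "spz q t (opA gen_t k \<rho> (M (al S))) (opA t k r (P S))"
    using sp PS k1 unfolding opA_def by (intro spz_smult spz_add spz_opT) simp_all
  ultimately show "P (exchange S k) = opA t k (cont_ratio t S k) (P S)"
    by (simp add: spz_iff S'_def r_def)
qed

lemma sing_opA: "sing q t N p \<Longrightarrow> 1 \<le> k \<Longrightarrow> k < N \<Longrightarrow> sing q t N (opA t k r p)"
  unfolding opA_def by (intro sing_add sing_opT sing_smult) simp_all

text \<open>The hypotheses on S_1 spread to all tableaux: an exchange at a row ascent raises the
  number of inversions, which N * N bounds, and only S_1 has no row ascent left.\<close>

lemma P_no_pole:
  assumes "S \<in> Tab \<tau>"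
  shows "no_pole_mpoly q t (M (al S)) \<and> sing q t N (P S)"
  using assms
proof (induction "N * N - invs N (col_of S)" arbitrary: S rule: less_induct)
  case less
  note S = less.prems
  show ?case
  proof (cases "\<exists>k. 1 \<le> k \<and> k < N \<and> row_of S k < row_of S (Suc k)")
    case True
    then obtain k where k: "1 \<le> k" "k < N" "row_of S k < row_of S (Suc k)" by blast
    have col: "col_of S (Suc k) < col_of S k" using Tab_row_col(1)[OF S k(1), of "Suc k"] k by simp
    have T: "exchange S k \<in> Tab \<tau>" using S k col by (intro Tab_exchange) auto
    have "invs N (col_of (exchange S k)) = Suc (invs N (col_of S))"
      unfolding col_of_exchange using k col by (intro invs_swap_greater) auto
    then have "N * N - invs N (col_of (exchange S k)) < N * N - invs N (col_of S)"
      using invs_bound[of N "col_of (exchange S k)"] by simp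
    then have IH: "no_pole_mpoly q t (M (al (exchange S k)))" "sing q t N (P (exchange S k))"
      using less.hyps T by auto
    note st = P_step[OF S k IH(1)]
    then show ?thesis using sing_smult[OF sing_opA[OF IH(2) k(1,2)]] by metis
  next
    case False
    then have "S = tab1 \<tau>"
      by (intro no_ascent_tab1[OF S]) (metis not_le)
    then show ?thesis using M_tab1 singular_imp_sing t_neq_0 by blast
  qed
qed

lemmas P_exchange = P_step(2)[OF _ _ _ _ conjunct1[OF P_no_pole]]

lemma specializes_P: "S \<in> Tab \<tau> \<Longrightarrow> specializes S (P S)"
  unfolding specializes_def using P_no_pole[of S] by (intro exI[of _ 1]) (simp add: spz_iff Const_simps)

end

section \<open>Antisymmetry along the columns of S_0\<close>

context partition_shape
begin

abbreviation "S0 \<equiv> tab0 \<tau>"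

lemmas S0_box = filling_box[OF tab0_less(1)[of \<tau>]]
lemmas S0_less = tab0_less(2)[of _ \<tau>]

lemma S0_Suc:
  assumes "(Suc r, c) \<in> B" "1 \<le> r"
  shows "(r, c) \<in> B" "S0 (r, c) = Suc (S0 (Suc r, c))"
proof -
  show b: "(r, c) \<in> B" using boxes_col[OF assms(1,2)] by simp
  define i where "i = S0 (Suc r, c)"
  have lt: "i < S0 (r, c)" unfolding i_def using S0_less[OF b assms(1)] by (simp add: bef0_def)
  have iN: "Suc i \<in> {1..N}" using S0_box(2)[OF b] lt by auto
  define b' where "b' = box_of S0 (Suc i)"
  have b': "b' \<in> B" "S0 b' = Suc i" unfolding b'_def using S0_box(3,4)[OF iN] by auto
  have "bef0 b' (Suc r, c)" using S0_less[OF b'(1) assms(1)] b'(2) by (simp add: i_def)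
  moreover have "\<not> bef0 (r, c) b'"
  proof
    assume x: "bef0 (r, c) b'"
    then have "Suc i < S0 (r, c)" using S0_less[OF b b'(1)] b' by simp
    show False using x \<open>bef0 b' (Suc r, c)\<close> by (auto simp: bef0_def)
  qed
  moreover have "\<not> bef0 b' (r, c)"
  proof
    assume "bef0 b' (r, c)"
    then have "S0 (r, c) < Suc i" using S0_less[OF b'(1) b] b' by simp
    then show False using lt by simp
  qed
  ultimately have "b' = (r, c)" using tot0[of b' "(r, c)"] by auto
  then show "S0 (r, c) = Suc (S0 (Suc r, c))" using b'(2) by (simp add: i_def)
qed

lemma S0_same_col:
  assumes i: "1 \<le> i" "i < N" and col: "col_of S0 i = col_of S0 (Suc i)"
  obtains r c where "(Suc r, c) \<in> B" "1 \<le> r" "S0 (Suc r, c) = i"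
proof -
  obtain s c where b: "box_of S0 i = (s, c)" by force
  obtain s' c' where b': "box_of S0 (Suc i) = (s', c')" by force
  have c: "c' = c" using col b b' by (simp add: col_of_box)
  have sB: "(s, c) \<in> B" "S0 (s, c) = i" using S0_box(3,4)[of i] i b by auto
  have s'B: "(s', c) \<in> B" "S0 (s', c) = Suc i" using S0_box(3,4)[of "Suc i"] i b' c by auto
  have "bef0 (s', c) (s, c)" using S0_less[OF s'B(1) sB(1)] sB s'B by simp
  then have lt: "s' < s" by (simp add: bef0_def)
  have s': "1 \<le> s'" using s'B by (auto simp: boxes_def)
  obtain r where r: "s = Suc r" using lt by (cases s) auto
  show ?thesis using that[of r c] sB lt s' r by simp
qed

lemma S0_col_antitone:
  assumes "1 \<le> i" "i \<le> j" "j \<le> N"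
  shows "col_of S0 j \<le> col_of S0 i"
proof (rule antitone_Suc[where f = "col_of S0" and n = N, OF _ assms])
  show "col_of S0 (Suc k) \<le> col_of S0 k" if "1 \<le> k" "k < N" for k
    using tab0_no_descent[of k] that by (simp add: descent_def)
qed

end

context macdonald_params
begin

abbreviation "P0 \<equiv> P S0"

text \<open>The entry of box (r+1, c) climbs to E, just below the entry of its left neighbour, or to
  N if there is none. The first exchange, past (r, c), has content difference 1 and produces v. The
  boxes passed later lie in column c below row r or in column c - 1 above row r + 1; their contents
  differ by at least 2, so those intertwiners are invertible and w = 0 forces v = 0.\<close>

lemma sign_push:
  assumes b: "(Suc r, c) \<in> B" "1 \<le> r"
    and i: "i = S0 (Suc r, c)"
    and E: "E = (if c = 1 then N else S0 (Suc r, c - 1) - 1)"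
    and IH: "c \<noteq> 1 \<Longrightarrow> opT t (Suc E) P0 = - P0"
    and k: "Suc i \<le> k" "k \<le> E"
  defines "v \<equiv> opA t i (cont_ratio t S0 i) P0"
  shows "\<exists>R w. row_standard \<tau> R \<and> specializes R w \<and> sing q t N w \<and> R (Suc r, c) = k \<and>
    (\<forall>l\<in>{1..N}. k < l \<longrightarrow> box_of R l = box_of S0 l) \<and> (w = 0 \<longrightarrow> v = 0) \<and>
    (c \<noteq> 1 \<longrightarrow> opT t (Suc E) w = - w)"
proof -
  have br: "(r, c) \<in> B" "S0 (r, c) = Suc i" using S0_Suc[OF b] i by auto
  have iN: "1 \<le> i" "i < N" using S0_box(2)[OF b(1)] S0_box(2)[OF br(1)] br(2) i by auto
  have c1: "1 \<le> c" using b(1) by (simp add: boxes_iff)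
  have bc: "(Suc r, c - 1) \<in> B \<and> S0 (Suc r, c - 1) = Suc E" if "c \<noteq> 1"
    using boxes_row[OF b(1), of "c - 1"] c1 that S0_box(2)[of "(Suc r, c - 1)"] E by auto
  have EN: "E \<le> N" using bc S0_box(2)[of "(Suc r, c - 1)"] E by (cases "c = 1") auto
  have box_i: "box_of S0 i = (Suc r, c)" "box_of S0 (Suc i) = (r, c)"
    using S0_box(1)[OF b(1)] S0_box(1)[OF br(1)] br(2) i by auto
  have comm: "opT t (Suc E) (opA t k r' w) = - opA t k r' w"
    if "Suc k \<le> E" "opT t (Suc E) w = - w" for k r' w
    using opT_commute[of k "Suc E" t w] that by (simp add: opA_def opT_add opT_smult opT_uminus)
  show ?thesis
    using k
  proof (induction k rule: dec_induct)
    case base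
    have ct: "content S0 i \<noteq> content S0 (Suc i)" and rw: "row_of S0 i \<noteq> row_of S0 (Suc i)"
      using box_i by (auto simp: content_def row_of_box col_of_box)
    note RS = Tab_row_standard[OF tab0_Tab[of \<tau>]]
    have "specializes (exchange S0 i) v" unfolding v_def
      by (rule specializes_exchange[OF RS iN rw ct specializes_P[OF tab0_Tab]])
    moreover have "row_standard \<tau> (exchange S0 i)" by (rule row_standard_exchange[OF RS iN rw])
    moreover have "sing q t N v" unfolding v_def using sing_opA iN P_no_pole[OF tab0_Tab] by blast
    moreover have "exchange S0 i (Suc r, c) = Suc i" using i by (simp add: exchange_def)
    moreover have "\<forall>l\<in>{1..N}. Suc i < l \<longrightarrow> box_of (exchange S0 i) l = box_of S0 l"
      by (auto simp: box_of_exchange transpose_def)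
    moreover have "c \<noteq> 1 \<longrightarrow> opT t (Suc E) v = - v"
      unfolding v_def using base comm[of i P0] IH by blast
    ultimately show ?case by blast
  next
    case (step k)
    obtain R w where R: "row_standard \<tau> R" and w: "specializes R w" "sing q t N w" and Rk: "R (Suc r, c) = k"
      and l: "\<And>l. l \<in> {1..N} \<Longrightarrow> k < l \<Longrightarrow> box_of R l = box_of S0 l" and block_start: "w = 0 \<Longrightarrow> v = 0"
      and wE: "c \<noteq> 1 \<Longrightarrow> opT t (Suc E) w = - w"
      using step.IH[OF Suc_leD[OF step.prems]] by blast
    have kN: "1 \<le> k" "k < N" "Suc k \<in> {1..N}" using step EN by auto
    obtain r' c' where b': "box_of S0 (Suc k) = (r', c')" by force
    have b'B: "(r', c') \<in> B" "S0 (r', c') = Suc k" using S0_box(3,4)[OF kN(3)] b' by auto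
    have "bef0 (r', c') (r, c)" using S0_less[OF b'B(1) br(1)] b'B(2) br(2) step by simp
    moreover have "c \<noteq> 1 \<Longrightarrow> bef0 (Suc r, c - 1) (r', c')"
      using S0_less[of "(Suc r, c - 1)" "(r', c')"] bc b'B step by simp
    moreover have "1 \<le> c'" using b'B by (simp add: boxes_iff)
    ultimately have between: "c' = c \<and> r' < r \<or> c' = c - 1 \<and> Suc r < r' \<and> c \<noteq> 1"
      using c1 by (cases "c = 1") (auto simp: bef0_def)
    have bk: "box_of R k = (Suc r, c)" using Rk filling_box(1)[of \<tau> R, OF _ b(1)] R by (auto simp: row_standard_def)
    have bk': "box_of R (Suc k) = (r', c')" using l[OF kN(3)] b' by simp
    have rw: "row_of R k \<noteq> row_of R (Suc k)" and cd: "\<bar>content R (Suc k) - content R k\<bar> \<ge> 2"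
      using bk bk' between c1 by (auto simp: content_def row_of_box col_of_box)
    define w' where "w' = opA t k (cont_ratio t R k) w"
    have "specializes (exchange R k) w'" unfolding w'_def
      by (rule specializes_exchange[OF R kN(1,2) rw _ w(1)]) (use cd in auto)
    moreover have "row_standard \<tau> (exchange R k)" by (rule row_standard_exchange[OF R kN(1,2) rw])
    moreover have "sing q t N w'" unfolding w'_def using sing_opA kN w by blast
    moreover have "exchange R k (Suc r, c) = Suc k" using Rk by (simp add: exchange_def)
    moreover have "\<forall>l\<in>{1..N}. Suc k < l \<longrightarrow> box_of (exchange R k) l = box_of S0 l"
      using l by (auto simp: box_of_exchange transpose_def)
    moreover have "w' = 0 \<longrightarrow> v = 0"
      unfolding w'_def using opA_eq_0[OF cont_ratio_generic[OF cd]] block_start by blast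
    moreover have "c \<noteq> 1 \<longrightarrow> opT t (Suc E) w' = - w'"
      unfolding w'_def using comm[OF _ wE] step by auto
    ultimately show ?case by blast
  qed
qed

text \<open>The content ratio t makes the first intertwiner T_i + 1, so v = 0 is the claim. If c =
  1, then w has xi_N-eigenvalue t^(-r), against the value 1 forced by singularity. Otherwise E and E
  + 1 end up in one row, so T_E acts by t, while T_{E+1} acts by -1 by induction on c;
  \<open>braid_eigen_0\<close> excludes this unless w = 0.\<close>

lemma sign_box:
  assumes "(Suc r, c) \<in> B" "1 \<le> r"
  shows "opT t (S0 (Suc r, c)) P0 = - P0"
  using assms
proof (induction c)
  case 0
  then show ?case by (simp add: boxes_iff)
next
  case (Suc c0)
  define c where "c = Suc c0"
  note b = Suc.prems[folded c_def]
  define i where "i = S0 (Suc r, c)"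
  define E where "E = (if c = 1 then N else S0 (Suc r, c - 1) - 1)"
  define v where "v = opA t i (cont_ratio t S0 i) P0"
  have br: "(r, c) \<in> B" "S0 (r, c) = Suc i" using S0_Suc[OF b] i_def by auto
  have bc: "(Suc r, c - 1) \<in> B \<and> S0 (Suc r, c - 1) = Suc E" if "c \<noteq> 1"
    using boxes_row[OF b(1), of "c - 1"] that S0_box(2)[of "(Suc r, c - 1)"] by (auto simp: E_def c_def)
  have IH: "opT t (Suc E) P0 = - P0" if "c \<noteq> 1"
    using Suc.IH[OF _ b(2)] bc[OF that] by (simp add: c_def)
  have iE: "Suc i \<le> E" "E \<le> N"
  proof -
    show "E \<le> N" using bc S0_box(2)[of "(Suc r, c - 1)"] by (cases "c = 1") (auto simp: E_def)
    show "Suc i \<le> E"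
    proof (cases "c = 1")
      case True
      then show ?thesis using S0_box(2)[OF br(1)] br(2) by (simp add: E_def)
    next
      case False
      then have "bef0 (Suc r, c - 1) (r, c)" by (auto simp: bef0_def c_def)
      then show ?thesis using S0_less[of "(Suc r, c - 1)" "(r, c)"] bc[OF False] br by simp
    qed
  qed
  obtain R w where R: "row_standard \<tau> R" and w: "specializes R w" "sing q t N w" and RE: "R (Suc r, c) = E"
    and l: "\<And>l. l \<in> {1..N} \<Longrightarrow> E < l \<Longrightarrow> box_of R l = box_of S0 l" and block_start: "w = 0 \<Longrightarrow> v = 0"
    and wE: "c \<noteq> 1 \<Longrightarrow> opT t (Suc E) w = - w"
    using sign_push[OF b i_def E_def IH iE(1) order_refl] unfolding v_def by blast
  have f: "filling \<tau> R" using R by (simp add: row_standard_def)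
  have bE: "box_of R E = (Suc r, c)" using filling_box(1)[OF f b(1)] RE by simp
  have "w = 0"
  proof (cases "c = 1")
    case True
    then have EN: "E = N" by (simp add: E_def)
    have N1: "1 \<le> N" using N_ge_2 by simp
    have ct: "content R N = - int r" using bE True unfolding EN content_def by (simp add: row_of_box col_of_box)
    have "w = Const (t powi (- int r)) * w"
      using specializes_xi_N[OF R w(1) N1] sing_xi_N[OF w(2) N1 t_neq_0] ct by simp
    then have "Const (t powi (- int r) - 1) * w = 0" by (simp add: Const_simps algebra_simps)
    moreover have "t powi (- int r) \<noteq> 1" using t_powi_eq_1[of "- int r"] b(2) by auto
    ultimately show ?thesis by simp
  next
    case False
    have EN: "1 \<le> E" "E < N" "Suc E \<in> {1..N}" using iE bc[OF False] S0_box(2)[of "(Suc r, c - 1)"] by auto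
    have "box_of R (Suc E) = (Suc r, c - 1)" using l[OF EN(3)] S0_box(1) bc[OF False] by fastforce
    then have "row_of R E = row_of R (Suc E)" using bE by (simp add: row_of_box)
    then have "opT t E w = Const t * w" using specializes_same_row[OF f EN(1,2) _ w(1)] by blast
    then show ?thesis using braid_eigen_0[OF t_neq_0 t_neq_m1] wE[OF False] by blast
  qed
  then have "v = 0" using block_start by blast
  moreover have "cont_ratio t S0 i = t"
    using S0_box(1)[OF b(1)] S0_box(1)[OF br(1)] br(2) i_def
    by (simp add: cont_ratio_def content_def row_of_box col_of_box)
  ultimately have "opT t i P0 + P0 = 0"
    unfolding v_def opA_def kap_def using t_neq_1 by (simp add: Const_simps)
  then show ?case unfolding i_def c_def by (simp add: eq_neg_iff_add_eq_0)
qed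

lemma sign_S0:
  assumes "1 \<le> i" "i < N" "col_of S0 i = col_of S0 (Suc i)"
  shows "opT t i P0 = - P0"
  using S0_same_col[OF assms] sign_box by metis

text \<open>The Hecke module generated by the polynomial at \<open>S\<^sub>0\<close>: all its elements are singular.\<close>

inductive_set V :: "cu mpoly set" where
  V_P0: "P0 \<in> V"
| V_add: "p \<in> V \<Longrightarrow> r \<in> V \<Longrightarrow> p + r \<in> V"
| V_smult: "p \<in> V \<Longrightarrow> Const c * p \<in> V"
| V_opT: "p \<in> V \<Longrightarrow> 1 \<le> i \<Longrightarrow> i < N \<Longrightarrow> opT t i p \<in> V"

lemma V_opA: "p \<in> V \<Longrightarrow> 1 \<le> i \<Longrightarrow> i < N \<Longrightarrow> opA t i r p \<in> V"
  unfolding opA_def by (intro V_add V_smult V_opT)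

lemma V_sing: "p \<in> V \<Longrightarrow> sing q t N p"
  by (induction rule: V.induct) (use P_no_pole[OF tab0_Tab] in \<open>auto intro: sing_add sing_smult sing_opT\<close>)

lemma P_descent:
  assumes "S \<in> Tab \<tau>" "descent S k"
  shows "P S = opA t k (cont_ratio t (exchange S k) k) (P (exchange S k))"
proof -
  have T: "exchange S k \<in> Tab \<tau>" by (rule descent_exchange[OF assms])
  have "row_of (exchange S k) k < row_of (exchange S k) (Suc k)"
    using descent_row[OF assms] by (simp add: row_of_exchange)
  then show ?thesis using P_exchange[OF T, of k] assms by (simp add: descent_def)
qed

lemma P_in_V:
  assumes "S \<in> Tab \<tau>"
  shows "P S \<in> V"
  using assms
proof (induction "invs N (col_of S)" arbitrary: S rule: less_induct)
  case less
  show ?case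
  proof (cases "\<exists>k. descent S k")
    case True
    then obtain k where k: "descent S k" by blast
    have "P (exchange S k) \<in> V"
      using less.hyps[of "exchange S k"] invs_descent[OF k] descent_exchange[OF less.prems k] by simp
    then show ?thesis unfolding P_descent[OF less.prems k] using k by (intro V_opA) (auto simp: descent_def)
  next
    case False
    then have "S = S0"
      by (intro no_descent_tab0[OF less.prems]) (metis descent_def not_le)
    then show ?thesis using V_P0 by simp
  qed
qed

end

section \<open>Divisibility by linear forms\<close>

lemma lin_eq_iff: "Const c * Var j = (Const e * Var k :: 'a::field mpoly) \<longleftrightarrow> c = 0 \<and> e = 0 \<or> j = k \<and> c = e"
proof -
  have l: "Poly_Mapping.lookup (Const c * Var j :: 'a mpoly) (Poly_Mapping.single i 1) = (if i = j then c else 0)" for c i j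
  proof -
    have "Poly_Mapping.single i (1::nat) = Poly_Mapping.single j 1 \<longleftrightarrow> i = j"
      by (metis Var_def Var_eq_iff lookup_single_eq lookup_single_not_eq one_neq_zero)
    then show ?thesis by (simp add: lookup_Const_mult lookup_Var)
  qed
  show ?thesis
  proof
    assume "Const c * Var j = (Const e * Var k :: 'a mpoly)"
    then have "(if i = j then c else 0) = (if i = k then e else 0)" for i
      using l[of c j i] l[of e k i] by simp
    from this[of j] this[of k] show "c = 0 \<and> e = 0 \<or> j = k \<and> c = e" by (auto split: if_splits)
  qed auto
qed

lemma lin_eq_Var_iff:
  "Const c * Var j = (Var k :: 'a::field mpoly) \<longleftrightarrow> j = k \<and> c = 1"
  "(Var k :: 'a::field mpoly) = Const c * Var j \<longleftrightarrow> j = k \<and> c = 1"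
  using lin_eq_iff[of c j 1 k] by (auto simp: Const_simps)

definition lform :: "nat \<Rightarrow> nat \<Rightarrow> 'a::field \<Rightarrow> 'a \<Rightarrow> 'a mpoly" where
  "lform a b \<alpha> \<beta> = Const \<alpha> * Var a - Const \<beta> * Var b"

text \<open>Composing with \<open>hyp a b \<gamma>\<close> restricts to the hyperplane \<open>x\<^sub>a = \<gamma> x\<^sub>b\<close>.\<close>

definition hyp :: "nat \<Rightarrow> nat \<Rightarrow> 'a::field \<Rightarrow> nat \<Rightarrow> 'a mpoly" where
  "hyp a b \<gamma> = Var(a := Const \<gamma> * Var b)"

text \<open>The order a < b makes the triple (a, b, ratio) a normal form of the hyperplane, so
  different triples give different hyperplanes.\<close>

lemma hyp_lform_neq_0:
  assumes "a < b" "a' < b'" "\<alpha> \<noteq> 0" "\<beta> \<noteq> 0" "\<gamma> \<noteq> 0" "(a, b, \<beta> / \<alpha>) \<noteq> (a', b', \<gamma>)"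
  shows "eval_mpoly Const (hyp a' b' \<gamma>) (lform a b \<alpha> \<beta>) \<noteq> 0"
proof
  assume "eval_mpoly Const (hyp a' b' \<gamma>) (lform a b \<alpha> \<beta>) = 0"
  then have e: "Const \<alpha> * hyp a' b' \<gamma> a = Const \<beta> * hyp a' b' \<gamma> b"
    by (simp add: lform_def eval_simps[OF ringhom_Const] eval_Const eval_Var ringhom_Const)
  consider "a = a'" | "a \<noteq> a'" "b = a'" | "a \<noteq> a'" "b \<noteq> a'" by blast
  then show False
  proof cases
    case 1
    then have "Const (\<alpha> * \<gamma>) * Var b' = (Const \<beta> * Var b :: 'a mpoly)"
      using e assms by (simp add: hyp_def Const_simps mult.assoc)
    then show False using 1 assms by (auto simp: lin_eq_iff)
  next
    case 2
    then have "Const \<alpha> * Var a = (Const (\<beta> * \<gamma>) * Var b' :: 'a mpoly)"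
      using e assms by (simp add: hyp_def Const_simps mult.assoc)
    then show False using 2 assms by (auto simp: lin_eq_iff)
  next
    case 3
    then have "Const \<alpha> * Var a = (Const \<beta> * Var b :: 'a mpoly)"
      using e by (simp add: hyp_def)
    then show False using assms by (auto simp: lin_eq_iff)
  qed
qed

text \<open>The factors are split off one at a time: the product already split off does not vanish
  on the next hyperplane, so the cofactor does.\<close>

lemma linear_factors_dvd:
  fixes A :: "'a::field mpoly"
  assumes "finite I" "\<And>i. i \<in> I \<Longrightarrow> a i < b i \<and> \<alpha> i \<noteq> 0 \<and> \<beta> i \<noteq> 0"
    and "inj_on (\<lambda>i. (a i, b i, \<beta> i / \<alpha> i)) I"
    and "\<And>i. i \<in> I \<Longrightarrow> eval_mpoly Const (hyp (a i) (b i) (\<beta> i / \<alpha> i)) A = 0"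
  shows "\<exists>s. A = (\<Prod>i\<in>I. lform (a i) (b i) (\<alpha> i) (\<beta> i)) * s"
  using assms
proof (induction I rule: finite_induct)
  case (insert i I)
  then obtain s where s: "A = (\<Prod>i\<in>I. lform (a i) (b i) (\<alpha> i) (\<beta> i)) * s" by auto
  let ?e = "eval_mpoly Const (hyp (a i) (b i) (\<beta> i / \<alpha> i))"
  have "?e (lform (a j) (b j) (\<alpha> j) (\<beta> j)) \<noteq> 0" if "j \<in> I" for j
    using insert that by (intro hyp_lform_neq_0) (auto simp: inj_on_def)
  then have "(\<Prod>j\<in>I. ?e (lform (a j) (b j) (\<alpha> j) (\<beta> j))) \<noteq> 0" using insert.hyps by simp
  moreover have "?e A = 0" using insert.prems by simp
  ultimately have "?e s = 0" unfolding s by (simp add: eval_simps[OF ringhom_Const])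
  then have "(Var (a i) - Const (\<beta> i / \<alpha> i) * Var (b i)) dvd s"
    using Var_minus_dvd[of "a i" "Const (\<beta> i / \<alpha> i) * Var (b i)" s] by (simp add: hyp_def)
  then obtain s' where s': "s = (Var (a i) - Const (\<beta> i / \<alpha> i) * Var (b i)) * s'" by (auto simp: dvd_def)
  have \<alpha>: "\<alpha> i \<noteq> 0" using insert.prems by auto
  have "lform (a i) (b i) (\<alpha> i) (\<beta> i) = Const (\<alpha> i) * (Var (a i) - Const (\<beta> i / \<alpha> i) * Var (b i))"
    using \<alpha> by (simp add: lform_def right_diff_distrib mult.assoc[symmetric] Const_simps(3)[symmetric])
  then have "s = lform (a i) (b i) (\<alpha> i) (\<beta> i) * (Const (1 / \<alpha> i) * s')"
    unfolding s' using Const_mult_cancel[OF \<alpha>, of "(Var (a i) - Const (\<beta> i / \<alpha> i) * Var (b i)) * s'"] by (simp add: mult_ac)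
  then show ?case unfolding s using insert.hyps by (auto simp: mult_ac intro!: exI[of _ "Const (1 / \<alpha> i) * s'"])
qed auto

section \<open>The polynomial at S_0 as a multiple of \<open>h0\<close>\<close>

context params
begin

definition col_pairs :: "(nat \<times> nat) set" where
  "col_pairs = same_col_pairs \<tau> S0"

lemma col_pairs_iff: "(i, j) \<in> col_pairs \<longleftrightarrow> 1 \<le> i \<and> i < j \<and> j \<le> N \<and> col_of S0 i = col_of S0 j"
  by (auto simp: col_pairs_def same_col_pairs_def)

lemma finite_col_pairs: "finite col_pairs"
  by (rule finite_subset[of _ "{1..N} \<times> {1..N}"]) (auto simp: col_pairs_iff)

definition h0 :: "cu mpoly" where
  "h0 = (\<Prod>(i, j)\<in>col_pairs. Const t * Var i - Var j)"

end

context macdonald_params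
begin

text \<open>The eigenvalue -1 with the denominator cleared. In this form two coordinates can be
  exchanged at any point, also where they coincide.\<close>

lemma P0_adjacent:
  assumes "1 \<le> k" "k < N" "col_of S0 k = col_of S0 (Suc k)"
  shows "P0 * (Var k - Const t * Var (Suc k)) = swap_vars k P0 * (Var (Suc k) - Const t * Var k)"
proof -
  have "(Const (1 - t) * Var (Suc k) * divdiff k P0 + Const t * swap_vars k P0) * (Var k - Var (Suc k)) = - P0 * (Var k - Var (Suc k))"
    using sign_S0[OF assms] unfolding opT_divdiff by simp
  then have "Const (1 - t) * Var (Suc k) * (P0 - swap_vars k P0) + Const t * swap_vars k P0 * (Var k - Var (Suc k)) = - P0 * (Var k - Var (Suc k))"
    unfolding divdiff_mult[of k P0, symmetric] by (simp add: algebra_simps)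
  then show ?thesis by (simp add: Const_simps algebra_simps)
qed

lemma eval_P0_adjacent:
  assumes "1 \<le> k" "k < N" "col_of S0 k = col_of S0 (Suc k)"
  shows "gev x P0 * (x k - Fract (Const t) 1 * x (Suc k)) = gev (x \<circ> tp k) P0 * (x (Suc k) - Fract (Const t) 1 * x k)"
  using arg_cong[OF P0_adjacent[OF assms], of "gev x"]
  by (simp add: gev_simps gev_Const) (simp add: gev_def eval_swap ringhom_FC eval_Var)

lemma S0_col_between:
  assumes "1 \<le> i" "i \<le> k" "k \<le> j" "j \<le> N" "col_of S0 i = col_of S0 j"
  shows "col_of S0 k = col_of S0 j"
  using S0_col_antitone[of i k] S0_col_antitone[of k j] assms by simp

text \<open>The coordinate x_j is exchanged downwards inside the column until it is next to x_i;
  there the relation reads (1 - t^2) x_i times the value = 0. The conditions on the x_k in between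
  keep the factors met on the way nonzero.\<close>

lemma P0_vanish:
  fixes x :: "nat \<Rightarrow> cuyz"
  assumes "1 \<le> i" "i < j" "j \<le> N" "col_of S0 i = col_of S0 j"
    and "x j = Fract (Const t) 1 * x i" "x i \<noteq> 0" "\<And>k. i < k \<Longrightarrow> k < j \<Longrightarrow> x k \<noteq> Fract (Const t) 1 * x j"
  shows "gev x P0 = 0"
  using assms
proof (induction "j - i" arbitrary: j x)
  case 0
  then show ?case by simp
next
  case (Suc e)
  define T where "T = (Fract (Const t) 1 :: cuyz)"
  obtain k where k: "j = Suc k" using Suc.prems by (cases j) auto
  have ck: "col_of S0 k = col_of S0 (Suc k)"
    using S0_col_between[of i k j] Suc.prems k by auto
  have adj: "gev x P0 * (x k - T * x j) = gev (x \<circ> tp k) P0 * (x j - T * x k)"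
    using eval_P0_adjacent[of k x] ck Suc.prems k by (simp add: T_def)
  show ?case
  proof (cases "k = i")
    case True
    have "T * T \<noteq> 1"
    proof
      assume "T * T = 1"
      then have "Const (t * t) = (1 :: cu mpoly)"
        unfolding T_def by (simp add: Const_simps One_fract_def Fract_1_eq_iff)
      then have "t powi 2 = 1" using Const_eq_iff[of "t * t" 1] by (simp add: Const_simps power2_eq_square)
      then show False using t_powi_eq_1[of 2] by simp
    qed
    then have "x i * (1 - T * T) \<noteq> 0" using Suc.prems by simp
    moreover have "gev x P0 * (x i * (1 - T * T)) = 0"
      using adj Suc.prems(5) True by (simp add: T_def algebra_simps)
    ultimately show ?thesis by simp
  next
    case False
    then have ik: "i < k" using Suc.prems k by simp
    have "gev (x \<circ> tp k) P0 = 0"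
    proof (rule Suc.hyps(1))
      show "e = k - i" using Suc.hyps(2) k by simp
      show "col_of S0 i = col_of S0 k" using Suc.prems k ck by simp
    qed (use Suc.prems k ik in \<open>auto simp: transpose_def\<close>)
    moreover have "x k \<noteq> T * x j" using Suc.prems(7)[of k] ik k by (simp add: T_def)
    ultimately show ?thesis using adj by simp
  qed
qed

lemma h0_lform: "h0 = (\<Prod>p\<in>col_pairs. lform (fst p) (snd p) t 1)"
  by (simp add: h0_def lform_def split_beta Const_simps)

lemma P0_factor: "\<exists>s. P0 = h0 * s"
  unfolding h0_lform
proof (rule linear_factors_dvd)
  show "inj_on (\<lambda>p. (fst p, snd p, 1 / t)) col_pairs" by (auto simp: inj_on_def prod_eq_iff)
  fix p assume "p \<in> col_pairs"
  then obtain i j where p: "p = (i, j)" and ij: "1 \<le> i" "i < j" "j \<le> N" "col_of S0 i = col_of S0 j"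
    by (metis col_pairs_iff surj_pair)
  define x where "x = (\<lambda>k. Fract (hyp i j (1 / t) k) 1)"
  have "gev x P0 = 0"
  proof (rule P0_vanish[OF ij])
    have "Const t * Const (1 / t) = (1 :: cu mpoly)"
      by (simp add: Const_simps(3)[symmetric] Const_simps(1))
    then show "x j = Fract (Const t) 1 * x i" using ij by (simp add: x_def hyp_def mult.assoc[symmetric])
    have "Const (1 / t) * Var j \<noteq> (0 :: cu mpoly)" by simp
    then show "x i \<noteq> 0" by (simp add: x_def hyp_def Zero_fract_def eq_fract)
    show "x k \<noteq> Fract (Const t) 1 * x j" if "i < k" "k < j" for k
      using that by (simp add: x_def hyp_def Fract_1_eq_iff lin_eq_Var_iff)
  qed
  then show "eval_mpoly Const (hyp (fst p) (snd p) (1 / t)) P0 = 0"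
    unfolding x_def gev_Fract by (simp add: p Zero_fract_def eq_fract)
qed (auto simp: finite_col_pairs col_pairs_iff)

definition s0 :: "cu mpoly" where "s0 = (SOME s. P0 = h0 * s)"

lemma P0_eq: "P0 = h0 * s0"
  unfolding s0_def by (rule someI_ex[OF P0_factor])

end

section \<open>Evaluation at the special points\<close>

text \<open>The recursion of \<^const>\<open>is_min_poly\<close> with an arbitrary start, which also produces the Macdonald polynomials from the one at \<open>S\<^sub>0\<close>.\<close>

inductive reach :: "'a::field \<Rightarrow> nat list \<Rightarrow> 'a mpoly \<Rightarrow> tableau \<Rightarrow> 'a mpoly \<Rightarrow> bool"
  for t \<tau> p0 where
  reach_base: "reach t \<tau> p0 (tab0 \<tau>) p0"
| reach_step: "reach t \<tau> p0 S p \<Longrightarrow> 1 \<le> i \<Longrightarrow> i < sum_list \<tau> \<Longrightarrow> row_of S i < row_of S (Suc i) \<Longrightarrow>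
    col_of S (Suc i) < col_of S i \<Longrightarrow> reach t \<tau> p0 (exchange S i) (opA t i (cont_ratio t S i) p)"

lemma reach_min_poly:
  "reach t \<tau> (\<Prod>(i, j)\<in>same_col_pairs \<tau> (tab0 \<tau>). Const t * Var i - Var j) S h \<Longrightarrow> is_min_poly t \<tau> S h"
  by (induction rule: reach.induct) (auto intro: is_min_poly.base min_poly_step)

context partition_shape
begin

lemma reach_Tab: "reach t \<tau> p0 S p \<Longrightarrow> S \<in> Tab \<tau>"
  by (induction rule: reach.induct) (auto intro: tab0_Tab Tab_exchange)

lemma reach_ex:
  assumes "S \<in> Tab \<tau>"
  shows "\<exists>p. reach t \<tau> p0 S p"
  using assms
proof (induction "invs N (col_of S)" arbitrary: S rule: less_induct)
  case less
  show ?case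
  proof (cases "\<exists>k. descent S k")
    case True
    then obtain k where k: "descent S k" by blast
    obtain p where p: "reach t \<tau> p0 (exchange S k) p"
      using less.hyps[of "exchange S k"] invs_descent[OF k] descent_exchange[OF less.prems k] by auto
    have "reach t \<tau> p0 (exchange (exchange S k) k) (opA t k (cont_ratio t (exchange S k) k) p)"
      using k descent_row[OF less.prems k]
      by (intro reach_step[OF p]) (auto simp: descent_def row_of_exchange col_of_exchange)
    then show ?thesis by auto
  next
    case False
    then have "S = tab0 \<tau>"
      by (intro no_descent_tab0[OF less.prems]) (metis descent_def not_le)
    then show ?thesis using reach_base by blast
  qed
qed

end

text \<open>In row \<open>L\<close> the column is replaced by the rank of the entry. The last row of a special point consists of independent
  variables, so the order of its entries must not be visible.\<close>

definition point_col :: "nat \<Rightarrow> nat \<Rightarrow> (nat \<Rightarrow> nat) \<Rightarrow> (nat \<Rightarrow> nat) \<Rightarrow> nat \<Rightarrow> nat" where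
  "point_col n L r c k = (if r k = L then card {l\<in>{k..n}. r l = L} else c k)"

lemma point_col_swap_same:
  assumes "r k = L" "r (Suc k) = L"
  shows "point_col n L (r \<circ> tp k) (c \<circ> tp k) = point_col n L r c"
proof -
  have "r \<circ> tp k = r" using assms by (auto simp: fun_eq_iff transpose_def)
  then show ?thesis using assms by (auto simp: point_col_def fun_eq_iff transpose_def)
qed

lemma point_col_swap:
  assumes "1 \<le> k" "k < n" "\<not> (r k = L \<and> r (Suc k) = L)"
  shows "point_col n L (r \<circ> tp k) (c \<circ> tp k) = point_col n L r c \<circ> tp k"
proof
  fix j
  have "card {l\<in>{j..n}. r (tp k l) = L} = card {l\<in>{tp k j..n}. r l = L}" if rj: "r (tp k j) = L"
  proof (rule bij_betw_same_card[of "tp k"], rule bij_betw_byWitness[where f' = "tp k"])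
    have *: "tp k l \<in> {tp k j..n}" if "l \<in> {j..n}" "r (tp k l) = L" for l
      using that assms rj by (auto simp: transpose_def split: if_splits)
    have **: "tp k l \<in> {j..n}" if "l \<in> {tp k j..n}" "r l = L" for l
      using that assms rj by (auto simp: transpose_def split: if_splits)
    show "tp k ` {l \<in> {j..n}. r (tp k l) = L} \<subseteq> {l \<in> {tp k j..n}. r l = L}" using * by auto
    show "tp k ` {l \<in> {tp k j..n}. r l = L} \<subseteq> {l \<in> {j..n}. r (tp k l) = L}" using ** by auto
  qed auto
  then show "point_col n L (r \<circ> tp k) (c \<circ> tp k) j = (point_col n L r c \<circ> tp k) j"
    by (simp add: point_col_def)
qed

lemma strict_mono_fixes:
  fixes f :: "nat \<Rightarrow> nat"
  assumes "\<And>c. 1 \<le> c \<Longrightarrow> c < n \<Longrightarrow> f c < f (Suc c)" "\<And>c. 1 \<le> c \<Longrightarrow> c \<le> n \<Longrightarrow> 1 \<le> f c \<and> f c \<le> n"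
    and "1 \<le> c" "c \<le> n"
  shows "f c = c"
proof -
  have ge: "c \<le> f c" if "1 \<le> c" "c \<le> n" for c
    using that
  proof (induction c rule: dec_induct)
    case base
    then show ?case using assms(2)[of 1] by simp
  next
    case (step c)
    then show ?case using assms(1)[of c] by simp
  qed
  have le: "f (n - e) \<le> n - e" if "e < n" for e
    using that
  proof (induction e)
    case 0
    then show ?case using assms(2)[of n] by simp
  next
    case (Suc e)
    then have "f (n - Suc e) < f (n - e)" using assms(1)[of "n - Suc e"] by (simp add: Suc_diff_Suc)
    then show ?case using Suc by simp
  qed
  show ?thesis using ge[OF assms(3,4)] le[of "n - c"] assms(3,4) by simp
qed

section \<open>Special points of fillings\<close>

context params
begin

text \<open>The coordinates of the special points, taken in the polynomial ring and not in its
  fraction field, where divisibility and degree make sense. The variables z come first and the y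
  follow after index \<nu>.\<close>

definition box_pt :: "nat \<times> nat \<Rightarrow> cu mpoly" where
  "box_pt b = (if fst b = 1 then Const (t ^ (d * n - 1 - snd b)) * Var (\<nu> + K)
    else if fst b \<le> K then Const (t ^ (n - 1 - snd b)) * Var (\<nu> + (K + 1 - fst b))
    else Var (\<nu> + 1 - snd b))"

definition entry_pt :: "tableau \<Rightarrow> nat \<Rightarrow> cu mpoly" where "entry_pt R k = box_pt (box_of R k)"

definition ev :: "tableau \<Rightarrow> cu mpoly \<Rightarrow> cu mpoly" where "ev R p = eval_mpoly Const (entry_pt R) p"

lemmas ev_simps = eval_simps[OF ringhom_Const, of "entry_pt R" for R, folded ev_def]

lemma gev_entry_pt: "gev (\<lambda>k. Fract (entry_pt R k) 1) p = Fract (ev R p) 1"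
  unfolding ev_def by (rule gev_Fract)

lemma entry_pt_exchange: "entry_pt (exchange R k) = entry_pt R \<circ> tp k"
  by (auto simp: entry_pt_def box_of_exchange fun_eq_iff)

lemma row_len_simps: "row_len 1 = d * n - 1" "2 \<le> r \<Longrightarrow> r \<le> K \<Longrightarrow> row_len r = n - 1" "row_len (Suc K) = \<nu>"
  using K by (auto simp: row_len_def)

lemma box_pt_Suc:
  assumes "(r, c) \<in> B" "(r, Suc c) \<in> B" "r \<le> K"
  shows "box_pt (r, c) = Const t * box_pt (r, Suc c)"
proof -
  have c: "Suc c \<le> row_len r" using assms boxes_iff by auto
  have e: "t ^ (L - c) = t * t ^ (L - Suc c)" if "Suc c \<le> L" for L
    using that by (simp add: Suc_diff_Suc[symmetric, of c L] Suc_le_eq flip: power_Suc)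
  show ?thesis
  proof (cases "r = 1")
    case True
    then show ?thesis using e[of "d * n - 1"] c by (simp add: box_pt_def row_len_def Const_simps mult.assoc)
  next
    case False
    then show ?thesis using e[of "n - 1"] c assms(3) by (simp add: box_pt_def row_len_def Const_simps mult.assoc)
  qed
qed

lemma box_pt_shift:
  assumes "(r, c) \<in> B" "1 \<le> c'" "c' \<le> c" "r \<le> K"
  shows "box_pt (r, c') = Const (t ^ (c - c')) * box_pt (r, c)"
  using assms(3,1)
proof (induction c rule: dec_induct)
  case base
  then show ?case by (simp add: Const_simps)
next
  case (step c)
  have b: "(r, c) \<in> B" using boxes_row[OF step.prems, of c] step assms(2) by simp
  then have "box_pt (r, c') = Const (t ^ (c - c')) * (Const t * box_pt (r, Suc c))"
    using step box_pt_Suc[OF b step.prems assms(4)] by simp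
  then show ?case using step by (simp add: Suc_diff_le Const_simps mult_ac)
qed

lemma box_pt_neq_0 [simp]: "box_pt b \<noteq> 0"
  by (simp add: box_pt_def)

lemma box_pt_ratio:
  assumes "(r, c) \<in> B" "(r', c') \<in> B" "r \<noteq> r'" "\<alpha> \<noteq> 0 \<or> \<beta> \<noteq> 0"
  shows "Const \<alpha> * box_pt (r, c) \<noteq> Const \<beta> * box_pt (r', c')"
proof -
  define vr where "vr = (\<lambda>r c. if r = 1 then \<nu> + K else if r \<le> K then \<nu> + (K + 1 - r) else \<nu> + 1 - c)"
  have p: "\<exists>e. e \<noteq> 0 \<and> box_pt (r, c) = Const e * Var (vr r c)" if "(r, c) \<in> B" for r c
    using that by (auto simp: box_pt_def vr_def boxes_iff lin_eq_Var_iff Const_simps(1) intro: exI[of _ "1::cu"])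
  obtain e e' where e: "e \<noteq> 0" "box_pt (r, c) = Const e * Var (vr r c)" "e' \<noteq> 0" "box_pt (r', c') = Const e' * Var (vr r' c')"
    using p[OF assms(1)] p[OF assms(2)] by blast
  have "vr r c \<noteq> vr r' c'"
    using assms(1-3) unfolding vr_def boxes_iff row_len_def by (auto split: if_splits)
  then show ?thesis unfolding e mult.assoc[symmetric] Const_simps(3)[symmetric] using e assms(4) by (auto simp: lin_eq_iff)
qed

lemma box_pt_inj:
  assumes "b \<in> B" "b' \<in> B" "box_pt b = box_pt b'"
  shows "b = b'"
proof -
  obtain r c r' c' where b: "b = (r, c)" "b' = (r', c')" by (metis surj_pair)
  have r: "r = r'" using box_pt_ratio[of r c r' c' 1 1] assms b by (auto simp: Const_simps)
  have ex: "n - 1 - c = n - 1 - c' \<Longrightarrow> c \<le> n - 1 \<Longrightarrow> c' \<le> n - 1 \<Longrightarrow> c = c'" for n :: nat by linarith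
  have tp: "t ^ a = t ^ a' \<Longrightarrow> a = a'" for a a' using t_powi_inj[of "int a" "int a'"] by simp
  have "c = c'"
    using assms unfolding b r box_pt_def boxes_iff row_len_def
    by (auto simp: lin_eq_iff split: if_splits dest!: tp dest: ex)
  then show ?thesis using b r by simp
qed

text \<open>The last row may be in any order, since a generator moves one \<open>z\<^sub>k\<close> past another.\<close>

definition semi_standard :: "tableau \<Rightarrow> bool" where
  "semi_standard R \<longleftrightarrow> filling \<tau> R \<and> (\<forall>r c. r \<le> K \<and> (r, c) \<in> B \<and> (r, Suc c) \<in> B \<longrightarrow> R (r, Suc c) < R (r, c))"

lemma Tab_semi_standard: "S \<in> Tab \<tau> \<Longrightarrow> semi_standard S"
  using Tab_row_standard[of S \<tau>] by (auto simp: semi_standard_def row_standard_def)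

lemma semi_standard_less:
  assumes "semi_standard R" "(r, c) \<in> B" "(r, c') \<in> B" "c < c'" "r \<le> K"
  shows "R (r, c') < R (r, c)"
  using assms(4,3)
proof (induction c')
  case (Suc j)
  have b: "(r, j) \<in> B"
    using boxes_row[OF Suc.prems(2), of j] Suc.prems assms(2) by (auto simp: boxes_def)
  then have "R (r, Suc j) < R (r, j)" using assms(1,5) Suc.prems by (auto simp: semi_standard_def)
  then show ?case using Suc b by (cases "c = j") auto
qed simp

lemma semi_standard_exchange:
  assumes R: "semi_standard R" and k: "1 \<le> k" "k < N" "row_of R k \<noteq> row_of R (Suc k) \<or> K < row_of R k"
  shows "semi_standard (exchange R k)"
  unfolding semi_standard_def
proof (intro conjI allI impI)
  have f: "filling \<tau> R" using R by (simp add: semi_standard_def)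
  then show "filling \<tau> (exchange R k)" by (rule filling_exchange[OF _ k(1,2)])
  fix r c assume b: "r \<le> K \<and> (r, c) \<in> B \<and> (r, Suc c) \<in> B"
  have "\<not> (R (r, Suc c) = k \<and> R (r, c) = Suc k)"
    using filling_box(1)[OF f] b k(3) by (metis fst_conv row_of_box not_le)
  then show "exchange R k (r, Suc c) < exchange R k (r, c)"
    using R b by (auto simp: exchange_def semi_standard_def intro!: tp_less)
qed

lemma semi_standard_adjacent:
  assumes R: "semi_standard R" and k: "1 \<le> k" "k < N" "row_of R k = row_of R (Suc k)" "row_of R k \<le> K"
  shows "entry_pt R (Suc k) = Const t * entry_pt R k"
proof -
  have f: "filling \<tau> R" using R by (simp add: semi_standard_def)
  have kN: "k \<in> {1..N}" "Suc k \<in> {1..N}" using k by auto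
  obtain r c where b: "box_of R k = (r, c)" by force
  obtain c' where b': "box_of R (Suc k) = (r, c')" using k(3) b by (metis fst_conv row_of_box surj_pair)
  have B: "(r, c) \<in> B" "R (r, c) = k" "(r, c') \<in> B" "R (r, c') = Suc k"
    using filling_box(3,4)[OF f] kN b b' by metis+
  have rK: "r \<le> K" using k(4) b by (simp add: row_of_box)
  have lt: "c' < c"
    using semi_standard_less[OF R B(1,3) _ rK] B by (cases c c' rule: linorder_cases) auto
  have "c = Suc c'"
  proof (rule ccontr)
    assume "c \<noteq> Suc c'"
    then have lt': "Suc c' < c" using lt by simp
    have m: "(r, Suc c') \<in> B" using boxes_row[OF B(1), of "Suc c'"] lt' by simp
    show False using semi_standard_less[OF R m B(1) lt' rK] semi_standard_less[OF R B(3) m _ rK] B by simp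
  qed
  then show ?thesis unfolding entry_pt_def b b' using box_pt_Suc[of r c'] B rK by simp
qed

text \<open>Inside a row up to K neighbouring entries have coordinates of ratio t, so the point of
  the exchanged filling, which is no longer semistandard, is not consulted.\<close>

lemma ev_opT_adjacent:
  assumes R: "semi_standard R" and k: "1 \<le> k" "k < N" "row_of R k = row_of R (Suc k)" "row_of R k \<le> K"
  shows "ev R (opT t k p) = Const t * ev R p"
proof -
  let ?x = "\<lambda>k. Fract (entry_pt R k) 1"
  have 1: "?x (Suc k) = Fract (Const t) 1 * ?x k" using semi_standard_adjacent[OF assms] by simp
  have 2: "Fract (Const t) 1 \<noteq> (1 :: cuyz)"
  proof -
    have "Const t \<noteq> 1" using t_neq_1 Const_eq_iff[of t 1] by (simp add: Const_simps(1))
    then show ?thesis using Fract_1_eq_iff[of "Const t" 1] by (simp add: One_fract_def)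
  qed
  have 3: "?x k \<noteq> 0" by (simp add: entry_pt_def Zero_fract_def eq_fract)
  have "gev ?x (opT t k p) = Fract (Const t) 1 * gev ?x p"
    unfolding gev_def by (rule eval_opT_eq[OF ringhom_FC 1 2 3])
  then show ?thesis unfolding gev_entry_pt by (simp add: Fract_1_eq_iff)
qed

lemma entry_pt_neq: "filling \<tau> R \<Longrightarrow> k \<in> {1..N} \<Longrightarrow> l \<in> {1..N} \<Longrightarrow> k \<noteq> l \<Longrightarrow> entry_pt R k \<noteq> entry_pt R l"
  using box_pt_inj[of "box_of R k" "box_of R l"] filling_box(3)[of \<tau> R] box_of_inj[of \<tau> R k l]
  by (auto simp: entry_pt_def)

lemma ev_opT:
  assumes R: "filling \<tau> R" and k: "1 \<le> k" "k < N"
  shows "Fract (ev R (opT t k p)) 1 = hecke_at (Fract (Const t) 1) (Fract (entry_pt R k) 1) (Fract (entry_pt R (Suc k)) 1)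
    (Fract (ev R p) 1) (Fract (ev (exchange R k) p) 1)"
proof -
  let ?x = "\<lambda>k. Fract (entry_pt R k) 1"
  have "?x k \<noteq> ?x (Suc k)" using entry_pt_neq[OF R, of k "Suc k"] k by (simp add: Fract_1_eq_iff)
  from gev_opT[where x = ?x, OF this, of t p]
  have "gev ?x (opT t k p) = hecke_at (Fract (Const t) 1) (?x k) (?x (Suc k)) (gev ?x p) (gev (?x \<circ> tp k) p)" .
  moreover have "?x \<circ> tp k = (\<lambda>j. Fract (entry_pt (exchange R k) j) 1)"
    by (auto simp: entry_pt_exchange fun_eq_iff)
  ultimately show ?thesis by (simp only: gev_entry_pt)
qed

text \<open>The inversion number governing the triangularity: \<open>h0\<close> is nonzero only at
  points where it is 0, and one exchange changes it by at most one.\<close>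

definition point_invs :: "tableau \<Rightarrow> nat" where
  "point_invs R = invs N (point_col N (Suc K) (row_of R) (col_of R))"

lemma point_invs_exchange:
  assumes "1 \<le> k" "k < N"
  shows "point_invs (exchange R k) \<le> Suc (point_invs R)" "point_invs R \<le> Suc (point_invs (exchange R k))"
proof -
  have *: "point_invs (exchange R k) \<le> Suc (point_invs R)" for R
  proof (cases "row_of R k = Suc K \<and> row_of R (Suc k) = Suc K")
    case True
    then show ?thesis unfolding point_invs_def row_of_exchange col_of_exchange by (simp add: point_col_swap_same)
  next
    case False
    show ?thesis unfolding point_invs_def row_of_exchange col_of_exchange point_col_swap[OF assms False]
      by (rule invs_swap_le[OF assms])
  qed
  show "point_invs (exchange R k) \<le> Suc (point_invs R)" "point_invs R \<le> Suc (point_invs (exchange R k))"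
    using *[of R] *[of "exchange R k"] by simp_all
qed

text \<open>In a tableau the last row decreases, so the rank of an entry in it is its
  column.\<close>

lemma point_invs_Tab:
  assumes S: "S \<in> Tab \<tau>"
  shows "point_invs S = invs N (col_of S)"
proof -
  note f = Tab_filling[OF S] and rs = Tab_row_standard[OF S]
  have "point_col N (Suc K) (row_of S) (col_of S) k = col_of S k" if k: "k \<in> {1..N}" for k
  proof (cases "row_of S k = Suc K")
    case True
    define c where "c = col_of S k"
    have b: "(Suc K, c) \<in> B" "S (Suc K, c) = k"
      using filling_box(3,4)[OF f k] True by (metis c_def col_of_box prod.collapse row_of_box)+
    have "{l\<in>{k..N}. row_of S l = Suc K} = (\<lambda>c'. S (Suc K, c')) ` {1..c}"
    proof (intro set_eqI iffI)
      fix l assume l: "l \<in> {l\<in>{k..N}. row_of S l = Suc K}"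
      then have lN: "l \<in> {1..N}" using k by auto
      have bl: "(Suc K, col_of S l) \<in> B" "S (Suc K, col_of S l) = l"
        using filling_box(3,4)[OF f lN] l by (metis (mono_tags, lifting) col_of_box mem_Collect_eq prod.collapse row_of_box)+
      have "col_of S l \<le> c"
        using row_standard_less[OF rs b(1) bl(1)] b bl l by (cases "c < col_of S l") auto
      then show "l \<in> (\<lambda>c'. S (Suc K, c')) ` {1..c}"
        using bl by (intro image_eqI[of _ _ "col_of S l"]) (auto simp: boxes_iff)
    next
      fix l assume "l \<in> (\<lambda>c'. S (Suc K, c')) ` {1..c}"
      then obtain c' where c': "l = S (Suc K, c')" "1 \<le> c'" "c' \<le> c" by auto
      then have b': "(Suc K, c') \<in> B" using boxes_row[OF b(1)] by simp
      have "k \<le> l" using row_standard_less[OF rs b' b(1)] b c' by (cases "c' = c") auto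
      then show "l \<in> {l\<in>{k..N}. row_of S l = Suc K}"
        using filling_box(1,2)[OF f b'] c' by (simp add: row_of_box)
    qed
    moreover have "inj_on (\<lambda>c'. S (Suc K, c')) {1..c}"
      using filling_inj[OF f] boxes_row[OF b(1)] by (auto simp: inj_on_def)
    ultimately have "card {l\<in>{k..N}. row_of S l = Suc K} = c" by (simp add: card_image)
    then show ?thesis using True by (simp add: point_col_def c_def)
  qed (simp add: point_col_def)
  then have "inv_set N (point_col N (Suc K) (row_of S) (col_of S)) = inv_set N (col_of S)"
    by (auto simp: inv_set_def)
  then show ?thesis by (simp add: point_invs_def invs_def)
qed

text \<open>Where \<open>h0\<close> does not vanish, entries with coordinates of ratio t lie in
  different columns of S_0, so these columns increase strictly along each row of R up to K. Row 1
  has as many boxes as there are columns, which leaves the identity; for the other rows the columns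
  beyond n - 1 have to be excluded first.\<close>

lemma h0_supp_cols:
  assumes R: "semi_standard R" and nz: "ev R h0 \<noteq> 0" and b: "(r, c) \<in> B" "r \<le> K"
  shows "col_of S0 (R (r, c)) = c"
proof -
  have f: "filling \<tau> R" using R by (simp add: semi_standard_def)
  note fb = filling_box[OF f]
  have pairs: "Const t * entry_pt R i \<noteq> entry_pt R j" if "(i, j) \<in> col_pairs" for i j
  proof -
    have "ev R h0 = (\<Prod>(i, j)\<in>col_pairs. Const t * entry_pt R i - entry_pt R j)"
      by (simp add: h0_def ev_simps ringhom_Const split_beta)
    then show ?thesis using nz finite_col_pairs that by (auto simp: split_beta)
  qed
  have mono: "col_of S0 (R (r, c)) < col_of S0 (R (r, Suc c))" if b: "(r, c) \<in> B" "(r, Suc c) \<in> B" "r \<le> K" for r c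
  proof -
    define i j where "i = R (r, Suc c)" "j = R (r, c)"
    have ij: "i < j" "1 \<le> i" "j \<le> N"
      using R b fb(2)[OF b(1)] fb(2)[OF b(2)] by (auto simp: semi_standard_def i_j_def)
    have "entry_pt R j = Const t * entry_pt R i" unfolding entry_pt_def i_j_def fb(1)[OF b(1)] fb(1)[OF b(2)] by (rule box_pt_Suc[OF b])
    then have "col_of S0 i \<noteq> col_of S0 j" using pairs[of i j] ij by (auto simp: col_pairs_iff)
    moreover have "col_of S0 j \<le> col_of S0 i" using S0_col_antitone ij by simp
    ultimately show ?thesis by (simp add: i_j_def)
  qed
  have S0bx: "(row_of S0 k, col_of S0 k) \<in> B" if "k \<in> {1..N}" for k
    using S0_box(3)[OF that] by (simp add: row_of_box col_of_box)
  have row1: "col_of S0 (R (1, c)) = c" if "1 \<le> c" "c \<le> row_len 1" for c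
  proof (rule strict_mono_fixes[where f = "\<lambda>c. col_of S0 (R (1, c))" and n = "row_len 1", OF _ _ that])
    fix c
    show "col_of S0 (R (1, c)) < col_of S0 (R (1, Suc c))" if "1 \<le> c" "c < row_len 1"
      using mono[of 1 c] that K by (simp add: boxes_iff)
    show "1 \<le> col_of S0 (R (1, c)) \<and> col_of S0 (R (1, c)) \<le> row_len 1" if "1 \<le> c" "c \<le> row_len 1"
    proof -
      have "(1, c) \<in> B" using that by (simp add: boxes_iff)
      from S0bx[OF fb(2)[OF this]] show ?thesis using row_len_antimono[of 1 "row_of S0 (R (1, c))"] by (simp add: boxes_iff)
    qed
  qed
  show ?thesis
  proof (cases "r = 1")
    case True
    then show ?thesis using row1[of c] b by (simp add: boxes_iff)
  next
    case False
    then have r: "2 \<le> r" "r \<le> K" using b by (auto simp: boxes_iff)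
    have rlr: "row_len r = n - 1" using row_len_simps(2)[OF r] .
    have bb: "(r, c) \<in> B" if "1 \<le> c" "c \<le> row_len r" for c using that r by (simp add: boxes_iff)
    show ?thesis
    proof (rule strict_mono_fixes[where f = "\<lambda>c. col_of S0 (R (r, c))" and n = "row_len r"])
      fix c
      show "col_of S0 (R (r, c)) < col_of S0 (R (r, Suc c))" if "1 \<le> c" "c < row_len r"
        using mono[of r c] bb[of c] bb[of "Suc c"] that r by simp
      show "1 \<le> col_of S0 (R (r, c)) \<and> col_of S0 (R (r, c)) \<le> row_len r" if c: "1 \<le> c" "c \<le> row_len r"
      proof
        define k where "k = R (r, c)"
        have kN: "k \<in> {1..N}" using fb(2)[OF bb[OF c]] by (simp add: k_def)
        note kb = S0bx[OF kN]
        show "1 \<le> col_of S0 (R (r, c))" using kb by (simp add: boxes_iff k_def)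
        show "col_of S0 (R (r, c)) \<le> row_len r"
        proof (rule ccontr)
          assume "\<not> ?thesis"
          then have gt: "col_of S0 k > n - 1" by (simp add: rlr k_def)
          \<comment> \<open>A column of S_0 beyond n - 1 is a single box, and its entry is already
            taken by row 1 of R.\<close>
          have one: "row_of S0 l = 1" if "l \<in> {1..N}" "col_of S0 l > n - 1" for l
            using S0bx[OF that(1)] that(2) \<nu> by (auto simp: boxes_iff row_len_def split: if_splits)
          define l where "l = R (1, col_of S0 k)"
          have cb: "(1, col_of S0 k) \<in> B" using kb one[OF kN gt] by (simp add: boxes_iff)
          have lN: "l \<in> {1..N}" using fb(2)[OF cb] by (simp add: l_def)
          have cl: "col_of S0 l = col_of S0 k" using row1[of "col_of S0 k"] cb by (simp add: l_def boxes_iff)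
          have "box_of S0 l = box_of S0 k"
            using one[OF kN gt] one[OF lN] gt cl by (simp add: prod_eq_iff row_of_box[symmetric] col_of_box[symmetric])
          then have "l = k" using box_of_inj[OF tab0_less(1) lN kN] by simp
          then have "(1, col_of S0 k) = (r, c)"
            using filling_inj[OF f cb bb[OF c]] by (simp add: l_def k_def)
          then show False using r by simp
        qed
      qed
    qed (use b in \<open>auto simp: boxes_iff\<close>)
  qed
qed

text \<open>In each column of S_0 the rows of R up to K take as many places as the column has boxes
  in those rows. At most one place is left for the last row, and only in a column reaching row K +
  1. So the column word of R, with ranks in the last row, is that of S_0.\<close>

lemma h0_supp:
  assumes R: "semi_standard R" and nz: "ev R h0 \<noteq> 0"
  shows "point_invs R = 0"
proof -
  have f: "filling \<tau> R" using R by (simp add: semi_standard_def)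
  note fb = filling_box[OF f]
  define A where "A = {k\<in>{1..N}. row_of R k = Suc K}"
  have A_img: "A = (\<lambda>c. R (Suc K, c)) ` {1..\<nu>}"
  proof (intro set_eqI iffI)
    fix k assume k: "k \<in> A"
    have "box_of R k \<in> B" "R (box_of R k) = k" using fb(3,4)[of k] k by (auto simp: A_def)
    moreover have "box_of R k = (Suc K, col_of R k)" using k by (simp add: A_def row_of_box col_of_box prod_eq_iff)
    ultimately show "k \<in> (\<lambda>c. R (Suc K, c)) ` {1..\<nu>}"
      using row_len_simps(3) by (intro image_eqI[of _ _ "col_of R k"]) (auto simp: boxes_iff)
  next
    fix k assume "k \<in> (\<lambda>c. R (Suc K, c)) ` {1..\<nu>}"
    then obtain c where c: "k = R (Suc K, c)" "(Suc K, c) \<in> B" using row_len_simps(3) by (auto simp: boxes_iff)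
    then show "k \<in> A" using fb(1,2)[OF c(2)] by (simp add: A_def row_of_box)
  qed
  have "inj_on (\<lambda>c. R (Suc K, c)) {1..\<nu>}"
    using filling_inj[OF f] row_len_simps(3) by (auto simp: inj_on_def boxes_iff)
  then have cardA: "card A = \<nu>" by (simp add: A_img card_image)
  have col1: "col_of S0 k = col_of R k" if "k \<in> {1..N}" "k \<notin> A" for k
  proof -
    have "row_of R k \<le> K"
      using that fb(3)[of k] by (auto simp: A_def row_of_box boxes_iff prod_eq_iff split: prod.splits)
        (metis boxes_iff le_Suc_eq Suc_eq_plus1 prod.collapse)
    then show ?thesis
      using h0_supp_cols[OF R nz, of "row_of R k" "col_of R k"] fb(3,4)[OF that(1)] by (simp add: row_of_box col_of_box)
  qed
  have key: "col_of S0 k \<le> \<nu> \<and> (\<forall>l\<in>A. col_of S0 l = col_of S0 k \<longrightarrow> l = k)" if k: "k \<in> A" for k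
  proof -
    define c where "c = col_of S0 k"
    define D where "D = {l\<in>{1..N}. col_of S0 l = c}"
    define E where "E = (\<lambda>r. R (r, c)) ` {r. r \<le> K \<and> (r, c) \<in> B}"
    have fin: "finite {r. (r, c) \<in> B}" "finite {r. r \<le> K \<and> (r, c) \<in> B}"
      by (rule finite_subset[of _ "{..Suc K}"]; auto simp: boxes_iff)+
    have "D = (\<lambda>r. S0 (r, c)) ` {r. (r, c) \<in> B}"
    proof (intro set_eqI iffI)
      fix l assume l: "l \<in> D"
      then have "box_of S0 l \<in> B" "S0 (box_of S0 l) = l" "box_of S0 l = (row_of S0 l, c)"
        using S0_box(3,4)[of l] by (auto simp: D_def row_of_box col_of_box prod_eq_iff)
      then show "l \<in> (\<lambda>r. S0 (r, c)) ` {r. (r, c) \<in> B}" by (intro image_eqI[of _ _ "row_of S0 l"]) auto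
    next
      fix l assume "l \<in> (\<lambda>r. S0 (r, c)) ` {r. (r, c) \<in> B}"
      then show "l \<in> D" using S0_box(1,2) by (auto simp: D_def col_of_box)
    qed
    moreover have "inj_on (\<lambda>r. S0 (r, c)) {r. (r, c) \<in> B}"
      using filling_inj[OF tab0_less(1)] by (auto simp: inj_on_def)
    ultimately have cD: "card D = card {r. (r, c) \<in> B}" by (simp add: card_image)
    have "inj_on (\<lambda>r. R (r, c)) {r. r \<le> K \<and> (r, c) \<in> B}"
      using filling_inj[OF f] by (auto simp: inj_on_def)
    then have cE: "card E = card {r. r \<le> K \<and> (r, c) \<in> B}" by (simp add: E_def card_image)
    have ED: "E \<subseteq> D" using h0_supp_cols[OF R nz] fb(2) by (auto simp: E_def D_def)
    have EA: "A \<inter> D \<subseteq> D - E" using fb(1) by (auto simp: A_def E_def row_of_box)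
    define Z where "Z = {r. r = Suc K \<and> (r, c) \<in> B}"
    have "{r. (r, c) \<in> B} = {r. r \<le> K \<and> (r, c) \<in> B} \<union> Z"
      by (auto simp: boxes_iff Z_def)
    then have "card {r. (r, c) \<in> B} \<le> card {r. r \<le> K \<and> (r, c) \<in> B} + card Z"
      using card_Un_le[of "{r. r \<le> K \<and> (r, c) \<in> B}" Z] by simp
    moreover have "Z = (if (Suc K, c) \<in> B then {Suc K} else {})" by (auto simp: Z_def)
    moreover have finD: "finite D" by (simp add: D_def)
    moreover have "card (D - E) = card D - card E" using ED finD by (intro card_Diff_subset) (auto intro: finite_subset)
    moreover have "card (A \<inter> D) \<le> card (D - E)" using finD by (intro card_mono EA) simp
    ultimately have le: "card (A \<inter> D) \<le> (if (Suc K, c) \<in> B then 1 else 0)"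
      using cD cE by (auto split: if_splits)
    have kAD: "k \<in> A \<inter> D" using k by (auto simp: D_def c_def A_def)
    have fAD: "finite (A \<inter> D)" using finD by simp
    have "card (A \<inter> D) \<noteq> 0" using kAD fAD by (metis card_0_eq empty_iff)
    then have "(Suc K, c) \<in> B" "card (A \<inter> D) \<le> Suc 0" using le by (auto split: if_splits)
    then have u: "x = y" if "x \<in> A \<inter> D" "y \<in> A \<inter> D" for x y
      using card_le_Suc0_iff_eq[OF fAD] that by blast
    have "c \<le> \<nu>" using \<open>(Suc K, c) \<in> B\<close> row_len_simps(3) by (simp add: boxes_iff)
    moreover have "l = k" if "l \<in> A" "col_of S0 l = c" for l
      using u[OF _ kAD] that by (simp add: D_def A_def)
    ultimately show ?thesis unfolding c_def by blast
  qed
  have point_col: "point_col N (Suc K) (row_of R) (col_of R) k = col_of S0 k" if k: "k \<in> {1..N}" for k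
  proof (cases "k \<in> A")
    case True
    have inj: "inj_on (col_of S0) A" using key by (auto simp: inj_on_def)
    have ge: "1 \<le> col_of S0 l" if "l \<in> {1..N}" for l
      using S0_box(3)[OF that] by (cases "box_of S0 l") (simp add: boxes_iff col_of_box)
    have "col_of S0 ` A = {1..\<nu>}"
    proof (rule card_subset_eq)
      show "col_of S0 ` A \<subseteq> {1..\<nu>}" using key ge by (auto simp: A_def)
    qed (simp_all add: card_image inj cardA)
    moreover have le: "l \<in> A \<Longrightarrow> k \<le> l \<longleftrightarrow> col_of S0 l \<le> col_of S0 k" for l
    proof -
      assume l: "l \<in> A"
      then have lN: "1 \<le> l" "l \<le> N" by (auto simp: A_def)
      show ?thesis
      proof (cases "k \<le> l")
        case True
        then show ?thesis using S0_col_antitone[of k l] k lN by auto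
      next
        case False
        then have "col_of S0 k \<le> col_of S0 l" "l \<noteq> k" using S0_col_antitone[of l k] k lN by auto
        then show ?thesis using key[OF True] l False by force
      qed
    qed
    have "col_of S0 ` {l\<in>{k..N}. row_of R l = Suc K} = {1..col_of S0 k}"
    proof (intro set_eqI iffI)
      fix c assume "c \<in> col_of S0 ` {l\<in>{k..N}. row_of R l = Suc K}"
      then obtain l where l: "l \<in> A" "k \<le> l" "c = col_of S0 l" using k by (auto simp: A_def)
      then show "c \<in> {1..col_of S0 k}" using le[OF l(1)] ge[of l] by (auto simp: A_def)
    next
      fix c assume c: "c \<in> {1..col_of S0 k}"
      then have "c \<in> {1..\<nu>}" using key[OF True] by auto
      then obtain l where l: "l \<in> A" "c = col_of S0 l" using calculation by blast
      then have "k \<le> l" using le[OF l(1)] c by simp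
      then show "c \<in> col_of S0 ` {l\<in>{k..N}. row_of R l = Suc K}" using l by (auto simp: A_def)
    qed
    moreover have "inj_on (col_of S0) {l\<in>{k..N}. row_of R l = Suc K}"
      by (rule inj_on_subset[OF inj]) (use k in \<open>auto simp: A_def\<close>)
    ultimately have "card {l\<in>{k..N}. row_of R l = Suc K} = col_of S0 k"
      by (metis (no_types, lifting) card_atLeastAtMost card_image diff_Suc_1)
    then show ?thesis using True by (simp add: point_col_def A_def)
  next
    case False
    then show ?thesis using col1[OF k] k by (simp add: point_col_def A_def)
  qed
  have "inv_set N (point_col N (Suc K) (row_of R) (col_of R)) = {}"
  proof -
    have "\<not> point_col N (Suc K) (row_of R) (col_of R) i < point_col N (Suc K) (row_of R) (col_of R) j"
      if "1 \<le> i" "i < j" "j \<le> N" for i j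
      using point_col[of i] point_col[of j] S0_col_antitone[of i j] that by simp
    then show ?thesis unfolding inv_set_def by blast
  qed
  then show ?thesis by (simp add: point_invs_def invs_def)
qed

lemma ev_opA_0:
  assumes R: "semi_standard R" and k: "1 \<le> k" "k < N"
    and z: "ev R p = 0" "semi_standard (exchange R k) \<Longrightarrow> ev (exchange R k) p = 0"
  shows "ev R (opA t k \<rho> p) = 0"
proof -
  have f: "filling \<tau> R" using R by (simp add: semi_standard_def)
  have "ev R (opT t k p) = 0"
  proof (cases "row_of R k = row_of R (Suc k) \<and> row_of R k \<le> K")
    case True
    then show ?thesis using ev_opT_adjacent[OF R k] z by simp
  next
    case False
    then have "semi_standard (exchange R k)" using R k by (intro semi_standard_exchange) auto
    then have "Fract (ev R (opT t k p)) 1 = 0"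
      unfolding ev_opT[OF f k] using z by (simp add: hecke_at_def Zero_fract_def[symmetric])
    then show ?thesis by (simp add: Zero_fract_def Fract_1_eq_iff)
  qed
  then show ?thesis using z by (simp add: opA_def ev_simps)
qed

text \<open>A step at k uses only the values at R and at \<open>exchange R k\<close>, whose
  inversion numbers differ by at most one, while the inversion number of the tableau grows by
  one.\<close>

lemma reach_supp:
  assumes "reach t \<tau> (h0 * s) S p" "semi_standard R" "point_invs R > invs N (col_of S)"
  shows "ev R p = 0"
  using assms
proof (induction arbitrary: R rule: reach.induct)
  case reach_base
  then show ?case using h0_supp[of R] by (auto simp: ev_simps)
next
  case (reach_step S p i)
  have "invs N (col_of (exchange S i)) = Suc (invs N (col_of S))"
    unfolding col_of_exchange using reach_step by (intro invs_swap_greater) auto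
  then show ?case
    using reach_step point_invs_exchange[of i R] by (intro ev_opA_0) auto
qed

section \<open>The values of the modified alternating polynomials\<close>

definition fS :: "tableau \<Rightarrow> cu mpoly" where "fS S = ev S (alt_poly t \<tau> S)"

lemma fS_eq: "fS S = (\<Prod>(i, j)\<in>same_col_pairs \<tau> S. Const (t ^ alt_exponent \<tau> S i j) * entry_pt S i - entry_pt S j)"
  by (simp add: fS_def alt_poly_def ev_simps ringhom_Const split_beta)

lemma finite_scp: "finite (same_col_pairs \<tau> S)"
  by (rule finite_subset[of _ "{1..N} \<times> {1..N}"]) (auto simp: same_col_pairs_def)

text \<open>A larger entry of S_0 lies weakly further left, so among the entries of its row each
  exponent counts only j itself.\<close>

lemma alt_poly_S0: "alt_poly t \<tau> S0 = h0"
  unfolding alt_poly_def h0_def col_pairs_def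
proof (intro prod.cong refl, clarify)
  fix i j assume ij: "(i, j) \<in> same_col_pairs \<tau> S0"
  then have ij': "1 \<le> i" "i < j" "j \<le> N" "col_of S0 i = col_of S0 j" by (auto simp: same_col_pairs_def)
  have "{k. i < k \<and> k \<le> N \<and> row_of S0 k = row_of S0 j \<and> col_of S0 i \<le> col_of S0 k} = {j}"
  proof (intro set_eqI iffI)
    fix k assume k: "k \<in> {k. i < k \<and> k \<le> N \<and> row_of S0 k = row_of S0 j \<and> col_of S0 i \<le> col_of S0 k}"
    then have "col_of S0 k = col_of S0 j" using S0_col_antitone[of i k] ij' by auto
    then have "box_of S0 k = box_of S0 j" using k by (simp add: row_of_box col_of_box prod_eq_iff)
    then show "k \<in> {j}" using box_of_inj[OF tab0_less(1)[of \<tau>], of k j] k ij' by auto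
  qed (use ij' in auto)
  then show "Const (t ^ alt_exponent \<tau> S0 i j) * Var i - Var j = Const t * Var i - Var j"
    by (simp add: alt_exponent_def)
qed

text \<open>Only k and k + 1 change their relative order. A pair notices this only if k newly enters
  the count, that is if i = k + 1 and j lies in the row of k.\<close>

lemma alt_exponent_swap:
  assumes S: "S \<in> Tab \<tau>" and k: "1 \<le> k" "k < N" "row_of S k < row_of S (Suc k)" "col_of S (Suc k) < col_of S k"
    and ij: "(i, j) \<in> same_col_pairs \<tau> S"
  shows "alt_exponent \<tau> (exchange S k) (tp k i) (tp k j) =
    alt_exponent \<tau> S i j + (if i = Suc k \<and> row_of S j = row_of S k then 1 else 0)"
proof -
  define A where "A = {l. i < l \<and> l \<le> N \<and> row_of S l = row_of S j \<and> col_of S i \<le> col_of S l}"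
  define A' where "A' = {l. tp k i < l \<and> l \<le> N \<and> row_of S (tp k l) = row_of S j \<and> col_of S i \<le> col_of S (tp k l)}"
  have i: "1 \<le> i" "i \<le> N" using ij by (auto simp: same_col_pairs_def)
  have bij: "card A' = card {l. 1 \<le> l \<and> l \<le> N \<and> tp k i < tp k l \<and> row_of S l = row_of S j \<and> col_of S i \<le> col_of S l}"
    (is "_ = card ?C")
  proof (rule bij_betw_same_card[of "tp k"], rule bij_betw_byWitness[where f' = "tp k"])
    have r: "1 \<le> tp k l \<and> tp k l \<le> N" if "1 \<le> l" "l \<le> N" for l
      using tp_range[OF k(1,2), of l] that by auto
    show "tp k ` A' \<subseteq> ?C"
    proof (rule image_subsetI)
      fix l assume l: "l \<in> A'"
      then have "1 \<le> l" "l \<le> N" by (auto simp: A'_def)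
      from r[OF this] show "tp k l \<in> ?C" using l by (simp add: A'_def)
    qed
    show "tp k ` ?C \<subseteq> A'"
    proof (rule image_subsetI)
      fix l assume l: "l \<in> ?C"
      then have "1 \<le> l" "l \<le> N" by auto
      from r[OF this] show "tp k l \<in> A'" using l by (simp add: A'_def)
    qed
  qed auto
  have C: "?C = (if i = Suc k \<and> row_of S j = row_of S k then insert k A else A)"
  proof (intro set_eqI)
    fix l
    consider "i = Suc k" "l = k" | "i = k" "l = Suc k" | "\<not> (i = Suc k \<and> l = k)" "\<not> (i = k \<and> l = Suc k)" by blast
    then show "l \<in> ?C \<longleftrightarrow> l \<in> (if i = Suc k \<and> row_of S j = row_of S k then insert k A else A)"
    proof cases
      case 3
      then have "tp k i < tp k l \<longleftrightarrow> i < l"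
        using tp_less[of i l k] tp_less[of l i k] by (cases i l rule: linorder_cases) auto
      moreover have "l = k \<Longrightarrow> i \<noteq> Suc k" using 3 by auto
      ultimately show ?thesis using i by (auto simp: A_def)
    qed (use k in \<open>auto simp: A_def\<close>)
  qed
  have "finite A" by (rule finite_subset[of _ "{..N}"]) (auto simp: A_def)
  moreover have "i = Suc k \<Longrightarrow> k \<notin> A" by (auto simp: A_def)
  ultimately have "card A' = card A + (if i = Suc k \<and> row_of S j = row_of S k then 1 else 0)"
    unfolding bij C by auto
  then show ?thesis
    by (simp add: alt_exponent_def row_of_exchange col_of_exchange A_def A'_def)
qed

text \<open>The factors correspond one to one and agree except for the pair (k + 1, j0), with j0 the
  entry in the row of k and the column of k + 1. The coordinate at j0 is t^(c-c') times that at k;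
  with this power removed, the two exceptional factors have the ratio that a generator produces in
  \<open>reach_value\<close>.\<close>

lemma fS_exchange:
  assumes S: "S \<in> Tab \<tau>" and k: "1 \<le> k" "k < N" "row_of S k < row_of S (Suc k)" "col_of S (Suc k) < col_of S k"
  shows "fS (exchange S k) * (entry_pt S (Suc k) - entry_pt S k) = (Const t * entry_pt S (Suc k) - entry_pt S k) * fS S"
proof -
  note f = Tab_filling[OF S] and rs = Tab_row_standard[OF S]
  note fb = filling_box[OF f]
  define r c r' c' where "r = row_of S k" "c = col_of S k" "r' = row_of S (Suc k)" "c' = col_of S (Suc k)"
  have kN: "k \<in> {1..N}" "Suc k \<in> {1..N}" using k by auto
  have bk: "box_of S k = (r, c)" "box_of S (Suc k) = (r', c')" by (simp_all add: r_c_r'_c'_def row_of_box col_of_box)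
  have B: "(r, c) \<in> B" "S (r, c) = k" "(r', c') \<in> B" "S (r', c') = Suc k"
    using fb(3,4)[OF kN(1)] fb(3,4)[OF kN(2)] bk by auto
  have rc: "r < r'" "c' < c" using k by (simp_all add: r_c_r'_c'_def)
  have rK: "r \<le> K" "1 \<le> c'" using rc B by (auto simp: boxes_iff)
  have m: "(r, c') \<in> B" using boxes_row[OF B(1) rK(2)] rc by simp
  define j0 where "j0 = S (r, c')"
  have boxj0: "box_of S j0 = (r, c')" using fb(1)[OF m] by (simp add: j0_def)
  have j0: "Suc k < j0" "j0 \<le> N"
    using Tab_less[OF S m B(3)] rc fb(2)[OF m] B(4) by (auto simp: j0_def)
  have p0: "(Suc k, j0) \<in> same_col_pairs \<tau> S"
    using j0 k boxj0 bk by (simp add: same_col_pairs_def col_of_box)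
  let ?tp = "map_prod (tp k) (tp k)"
  define F where "F = (\<lambda>p. Const (t ^ alt_exponent \<tau> S (fst p) (snd p)) * entry_pt S (fst p) - entry_pt S (snd p))"
  define F' where "F' = (\<lambda>p. Const (t ^ alt_exponent \<tau> (exchange S k) (tp k (fst p)) (tp k (snd p))) * entry_pt S (fst p) - entry_pt S (snd p))"
  define Q where "Q = same_col_pairs \<tau> S - {(Suc k, j0)}"
  have map: "map_prod (tp k) (tp k) p \<in> same_col_pairs \<tau> (exchange S' k)"
    if pp: "p \<in> same_col_pairs \<tau> S'" "col_of S' k \<noteq> col_of S' (Suc k)" for p S'
  proof -
    obtain i j where p: "p = (i, j)" "1 \<le> i" "i < j" "j \<le> N" "col_of S' i = col_of S' j"
      using pp(1) by (cases p) (auto simp: same_col_pairs_def)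
    then have "tp k i < tp k j" using pp(2) by (intro tp_less) auto
    moreover have "tp k i \<in> {1..N}" "tp k j \<in> {1..N}" using p tp_range[OF k(1,2)] by auto
    ultimately show ?thesis using p by (auto simp: same_col_pairs_def col_of_exchange)
  qed
  have fS': "fS (exchange S k) = prod F' (same_col_pairs \<tau> S)"
    unfolding fS_eq
  proof (rule prod.reindex_bij_witness[where i = ?tp and j = ?tp])
    show "?tp p \<in> same_col_pairs \<tau> S" if "p \<in> same_col_pairs \<tau> (exchange S k)" for p
      using map[OF that] k by (simp add: col_of_exchange)
    show "?tp p \<in> same_col_pairs \<tau> (exchange S k)" if "p \<in> same_col_pairs \<tau> S" for p
      using map[OF that] k by simp
  qed (auto simp: F'_def entry_pt_exchange)
  have "F' p = F p" if "p \<in> Q" for p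
  proof -
    obtain i j where p: "p = (i, j)" "(i, j) \<in> same_col_pairs \<tau> S" "\<not> (i = Suc k \<and> j = j0)"
      using \<open>p \<in> Q\<close> by (cases p) (auto simp: Q_def)
    have "\<not> (i = Suc k \<and> row_of S j = row_of S k)"
    proof
      assume a: "i = Suc k \<and> row_of S j = row_of S k"
      have jN: "j \<in> {1..N}" using p by (auto simp: same_col_pairs_def)
      have "box_of S j = (r, c')" using a p by (simp add: same_col_pairs_def r_c_r'_c'_def row_of_box col_of_box prod_eq_iff)
      then have "j = j0" using fb(4)[OF jN] by (simp add: j0_def)
      then show False using p a by simp
    qed
    then show ?thesis using alt_exponent_swap[OF S k p(2)] by (auto simp: F_def F'_def p)
  qed
  then have Q: "prod F' Q = prod F Q" by (rule prod.cong[OF refl])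
  have e: "alt_exponent \<tau> S (Suc k) j0 = c - c'"
  proof -
    have "{l. Suc k < l \<and> l \<le> N \<and> row_of S l = row_of S j0 \<and> col_of S (Suc k) \<le> col_of S l} = (\<lambda>x. S (r, x)) ` {c'..<c}"
    proof (intro set_eqI iffI)
      fix l assume l: "l \<in> {l. Suc k < l \<and> l \<le> N \<and> row_of S l = row_of S j0 \<and> col_of S (Suc k) \<le> col_of S l}"
      then have lN: "l \<in> {1..N}" by auto
      have bl: "box_of S l = (r, col_of S l)" using l boxj0 by (simp add: row_of_box col_of_box prod_eq_iff)
      then have bB: "(r, col_of S l) \<in> B" "S (r, col_of S l) = l" using fb(3,4)[OF lN] by auto
      have "col_of S l < c"
        using row_standard_less[OF rs B(1) bB(1)] bB B l by (cases c "col_of S l" rule: linorder_cases) auto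
      then show "l \<in> (\<lambda>x. S (r, x)) ` {c'..<c}"
        using l bB by (intro image_eqI[of _ _ "col_of S l"]) (auto simp: r_c_r'_c'_def)
    next
      fix l assume "l \<in> (\<lambda>x. S (r, x)) ` {c'..<c}"
      then obtain x where x: "l = S (r, x)" "c' \<le> x" "x < c" by auto
      have xB: "(r, x) \<in> B" using boxes_row[OF B(1), of x] x rK by simp
      have "k < l" using row_standard_less[OF rs xB B(1)] x B by simp
      moreover have "l \<noteq> Suc k" using filling_inj[OF f xB B(3)] B(4) x rc by auto
      ultimately show "l \<in> {l. Suc k < l \<and> l \<le> N \<and> row_of S l = row_of S j0 \<and> col_of S (Suc k) \<le> col_of S l}"
        using fb(1,2)[OF xB] x boxj0 by (simp add: row_of_box col_of_box r_c_r'_c'_def)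
    qed
    moreover have "inj_on (\<lambda>x. S (r, x)) {c'..<c}"
      using filling_inj[OF f] boxes_row[OF B(1)] rK by (auto simp: inj_on_def)
    ultimately show ?thesis by (simp add: alt_exponent_def card_image)
  qed
  have xj0: "entry_pt S j0 = Const (t ^ (c - c')) * entry_pt S k"
    unfolding entry_pt_def boxj0 bk using box_pt_shift[OF B(1) rK(2) _ rK(1)] rc by simp
  have F0: "F (Suc k, j0) = Const (t ^ (c - c')) * (entry_pt S (Suc k) - entry_pt S k)"
    by (simp add: F_def e xj0 right_diff_distrib)
  have "row_of S j0 = row_of S k" using boxj0 bk by (simp add: row_of_box)
  then have F'0: "F' (Suc k, j0) = Const (t ^ (c - c')) * (Const t * entry_pt S (Suc k) - entry_pt S k)"
    using alt_exponent_swap[OF S k p0] by (simp add: F'_def e xj0 right_diff_distrib Const_simps mult_ac)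
  have a: "prod F' (same_col_pairs \<tau> S) = F' (Suc k, j0) * prod F Q"
    unfolding Q_def Q[symmetric, unfolded Q_def] by (rule prod.remove[OF finite_scp p0])
  have b: "fS S = F (Suc k, j0) * prod F Q"
    unfolding fS_eq Q_def using prod.remove[OF finite_scp p0, of F] by (simp add: F_def split_beta)
  show ?thesis unfolding fS' a b F0 F'0 by (simp only: mult_ac)
qed

text \<open>The tableau S' = \<open>exchange S k\<close> has one inversion more than S, so p
  vanishes at its point by \<open>reach_supp\<close>. The generator then contributes only through
  the value at the point of S, with the ratio of \<open>fS_exchange\<close>.\<close>

lemma reach_value:
  assumes "reach t \<tau> (h0 * s) S p"
  shows "ev S p = ev S0 s * fS S"
  using assms
proof (induction rule: reach.induct)
  case reach_base
  then show ?case by (simp add: ev_simps fS_def alt_poly_S0 mult.commute)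
next
  case (reach_step S p k)
  note k = reach_step.hyps(2-5)
  have S: "S \<in> Tab \<tau>" by (rule reach_Tab[OF reach_step.hyps(1)])
  define S' where "S' = exchange S k"
  have S': "S' \<in> Tab \<tau>" unfolding S'_def using S k by (intro Tab_exchange) auto
  have "invs N (col_of S') = Suc (invs N (col_of S))"
    unfolding S'_def col_of_exchange using k by (intro invs_swap_greater) auto
  then have z: "ev S' p = 0"
    using reach_supp[OF reach_step.hyps(1) Tab_semi_standard[OF S']] point_invs_Tab[OF S'] by simp
  define X Z where "X = entry_pt S k" "Z = entry_pt S (Suc k)"
  have x': "entry_pt S' k = Z" "entry_pt S' (Suc k) = X" by (simp_all add: S'_def entry_pt_exchange X_Z_def)
  have ne: "Z \<noteq> X" unfolding X_Z_def using entry_pt_neq[OF Tab_filling[OF S], of "Suc k" k] k by simp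
  define P where "P = ev S' (opA t k (cont_ratio t S k) p)"
  have "P = ev S' (opT t k p)" by (simp add: P_def opA_def ev_simps z)
  then have "Fract P 1 = hecke_at (Fract (Const t) 1) (Fract Z 1) (Fract X 1) 0 (Fract (ev S p) 1)"
    using ev_opT[OF Tab_filling[OF S'] k(1,2), of p] by (simp add: x' z) (simp add: S'_def Zero_fract_def)
  moreover have "Fract Z 1 - Fract X 1 \<noteq> (0 :: cuyz)" using ne by (simp add: Fract_1_eq_iff Zero_fract_def)
  ultimately have "Fract P 1 * (Fract Z 1 - Fract X 1) = (Fract (Const t) 1 * Fract Z 1 - Fract X 1) * Fract (ev S p) 1"
    by (simp add: hecke_at_def divide_simps) (simp add: algebra_simps)
  then have "P * (Z - X) = (Const t * Z - X) * ev S p"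
    by (simp add: Fract_1_eq_iff)
  also have "\<dots> = ev S0 s * fS S' * (Z - X)"
    using fS_exchange[OF S k] reach_step.IH unfolding X_Z_def S'_def by (simp add: mult_ac)
  finally show ?case using ne by (simp add: P_def S'_def)
qed

text \<open>The minimal polynomials are the family started with s = 1.\<close>

lemma min_poly_tab1:
  "ev (tab1 \<tau>) (min_poly t \<tau> (tab1 \<tau>)) = fS (tab1 \<tau>)"
proof -
  have h: "(\<Prod>(i, j)\<in>same_col_pairs \<tau> S0. Const t * Var i - Var j) = h0 * 1"
    by (simp add: h0_def col_pairs_def)
  obtain p where p: "reach t \<tau> (h0 * 1) (tab1 \<tau>) p" using reach_ex[OF tab1_Tab] by blast
  have "is_min_poly t \<tau> (tab1 \<tau>) p" using p unfolding h[symmetric] by (rule reach_min_poly)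
  then have "min_poly t \<tau> (tab1 \<tau>) = p" using min_poly_eq t_powi_eq_1 t_neq_0 by blast
  then show ?thesis using reach_value[OF p] by (simp add: ev_simps)
qed

end

context macdonald_params
begin

definition C0 :: "cu mpoly" where "C0 = ev S0 s0"

lemma reach_P: "S \<in> Tab \<tau> \<Longrightarrow> reach t \<tau> (h0 * s0) S (P S)"
proof (induction "invs N (col_of S)" arbitrary: S rule: less_induct)
  case less
  show ?case
  proof (cases "\<exists>k. descent S k")
    case True
    then obtain k where k: "descent S k" by blast
    have p: "reach t \<tau> (h0 * s0) (exchange S k) (P (exchange S k))"
      using less.hyps[of "exchange S k"] invs_descent[OF k] descent_exchange[OF less.prems k] by auto
    have "reach t \<tau> (h0 * s0) (exchange (exchange S k) k) (opA t k (cont_ratio t (exchange S k) k) (P (exchange S k)))"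
      using k descent_row[OF less.prems k]
      by (intro reach_step[OF p]) (auto simp: descent_def row_of_exchange col_of_exchange)
    then show ?thesis using P_descent[OF less.prems k] by simp
  next
    case False
    then have "S = tab0 \<tau>"
      by (intro no_descent_tab0[OF less.prems]) (metis descent_def not_le)
    then show ?thesis using reach_base[of t \<tau> "h0 * s0"] P0_eq by simp
  qed
qed

lemma P_value: "S \<in> Tab \<tau> \<Longrightarrow> ev S (P S) = C0 * fS S"
  unfolding C0_def by (rule reach_value[OF reach_P])

end

section \<open>Wheel conditions\<close>

definition insert_at :: "(nat \<Rightarrow> 'b) \<Rightarrow> nat \<Rightarrow> 'b \<Rightarrow> nat \<Rightarrow> 'b" where
  "insert_at w l z k = (if k < l then w k else if k = l then z else w (k - 1))"

lemma insert_at_swap: "insert_at w l z \<circ> tp l = insert_at w (Suc l) z"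
  by (auto simp: insert_at_def fun_eq_iff transpose_def)

lemma insert_at_Suc_same: "insert_at w (Suc l) (w l) = insert_at w l (w l)"
  by (auto simp: insert_at_def fun_eq_iff)

context macdonald_params
begin

abbreviation "TT \<equiv> (Fract (Const t) 1 :: cuyz)"
abbreviation "QQ \<equiv> (Fract (Const q) 1 :: cuyz)"

lemma Fract_Const_power: "Fract (Const c) 1 ^ k = (Fract (Const (c ^ k)) 1 :: cuyz)"
  by (simp add: ringhom_simps(7)[OF ringhom_FC])

lemmas FC_simps = ringhom_simps[OF ringhom_FC]

lemma FC_eq_iff: "Fract (Const a) 1 = (Fract (Const b) 1 :: cuyz) \<longleftrightarrow> a = b"
  by (simp only: Fract_1_eq_iff Const_eq_iff)

lemma FC_eq_0: "Fract (Const a) 1 = (0 :: cuyz) \<longleftrightarrow> a = 0"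
  using FC_eq_iff[of a 0] by (simp only: FC_simps)

lemma QT_eq_1: "QQ ^ a * TT ^ b = 1 \<Longrightarrow> q ^ a * t ^ b = 1"
  using FC_eq_iff[of "q ^ a * t ^ b" 1] by (simp only: FC_simps) simp

lemma TT_facts [simp]: "TT \<noteq> 0" "TT \<noteq> 1" "QQ \<noteq> 0"
  using QT_eq_1[of 0 1] t_neq_1 FC_eq_0[of t] FC_eq_0[of q] by auto

lemma TT_m1: "TT + 1 \<noteq> 0"
proof
  assume "TT + 1 = 0"
  then have "t + 1 = 0" using FC_eq_0[of "t + 1"] by (simp only: FC_simps) simp
  then show False using t_neq_m1 by (simp add: eq_neg_iff_add_eq_0)
qed

lemma V_fold: "p \<in> V \<Longrightarrow> fold (opT t) [1..<j] p \<in> V" if "j \<le> N"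
  using that
proof (induction j)
  case (Suc j)
  then show ?case by (cases "1 \<le> j") (auto intro!: V_opT)
qed simp

text \<open>The singularity relation expresses p at the rotated point by p T_1 ... T_{N-1} at the
  original one; this is why the vanishing is demanded for the whole module and not for p
  alone.\<close>

lemma wheel_shift:
  assumes "\<And>p. p \<in> V \<Longrightarrow> gev (insert_at w N z) p = 0" "p \<in> V"
  shows "gev (insert_at w 1 (QQ * z)) p = 0"
proof -
  have N1: "1 \<le> N" using N_ge_2 by simp
  have "shift_rel q t N p" by (rule sing_shift_rel[OF V_sing[OF assms(2)] N1])
  then have "gev (insert_at w N z) (Const (t ^ (N - 1)) * op_omega q N p) = 0"
    unfolding shift_rel_def using assms(1)[OF V_fold[OF order_refl assms(2)]] by simp
  moreover have "gev (insert_at w N z) (op_omega q N p) = gev (insert_at w 1 (QQ * z)) p"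
  proof -
    have "(\<lambda>j. if j = 1 then QQ * insert_at w N z N else if j \<in> {2..N} then insert_at w N z (j - 1) else insert_at w N z j) = insert_at w 1 (QQ * z)"
      using N1 by (auto simp: insert_at_def fun_eq_iff)
    then show ?thesis unfolding gev_def eval_omega[OF ringhom_FC] by simp
  qed
  moreover have "Fract (Const (t ^ (N - 1))) 1 \<noteq> (0 :: cuyz)" by (simp only: FC_eq_0) simp
  ultimately show ?thesis by (simp add: gev_simps gev_Const)
qed

text \<open>Vanishing of p and of p T_l at the old point gives (t z - w_l) times the value at the
  new point = 0. The hypothesis \<open>hit\<close> ensures that in the exceptional case the position
  before l belongs to the progression too.\<close>

lemma wheel_move:
  assumes w: "\<And>a. a < L \<Longrightarrow> w (b + a) = TT ^ a * Y" and Y: "Y \<noteq> 0" and b: "1 \<le> b"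
    and z: "z \<noteq> 0" and l: "1 \<le> l" "l < N"
    and hit: "TT * z = w l \<Longrightarrow> \<exists>a. l = b + Suc a \<and> Suc a < L"
    and van: "\<And>p. p \<in> V \<Longrightarrow> gev (insert_at w l z) p = 0" and p: "p \<in> V"
  shows "gev (insert_at w (Suc l) z) p = 0"
proof (cases "z = w l")
  case True
  then show ?thesis using van[OF p] insert_at_Suc_same[of w l] by simp
next
  case False
  let ?x = "insert_at w l z" and ?y = "insert_at w (Suc l) z"
  have x: "?x l = z" "?x (Suc l) = w l" by (auto simp: insert_at_def)
  have "0 = gev ?x (opT t l p)" using van[OF V_opT[OF p l]] by simp
  also have "\<dots> = hecke_at TT z (w l) 0 (gev ?y p)"
    using gev_opT[of ?x l t p] False van[OF p] unfolding x insert_at_swap by simp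
  finally have "(TT * z - w l) * gev ?y p = 0"
    using False by (simp add: hecke_at_def field_simps) argo
  then consider "gev ?y p = 0" | "TT * z = w l" by auto
  then show ?thesis
  proof cases
    case 2
    \<comment> \<open>The predecessor of w_l = t z in the progression is z, so the new point reads
      z, t z, z at positions i, l, l + 1. There T_i acts by t, and T_l by -1 because the exchanged
      point is a zero of V; the braid relation leaves t (t+1) times the value = 0.\<close>
    then obtain a where a: "l = b + Suc a" "Suc a < L" using hit by blast
    define i where "i = b + a"
    have li: "l = Suc i" and i: "1 \<le> i" "i < N" using a b l by (auto simp: i_def)
    have "TT * w i = w l" using w[of a] w[of "Suc a"] a by (simp add: i_def)
    then have wi: "w i = z" using 2 TT_facts(1) by (metis mult_left_cancel)
    have y: "?y i = z" "?y l = TT * z" "?y (Suc l) = z" using wi 2 by (auto simp: insert_at_def li)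
    have e1: "gev ?y (opT t i r) = TT * gev ?y r" for r
      unfolding gev_def using y z li by (intro eval_opT_eq[OF ringhom_FC]) auto
    have e2: "gev ?y (opT t l r) = - gev ?y r" if r: "r \<in> V" for r
    proof -
      have ne: "TT * z \<noteq> z" using z by simp
      have "?y \<circ> tp l = ?x" unfolding insert_at_swap[symmetric] by (simp add: fun_eq_iff)
      then have "gev ?y (opT t l r) = hecke_at TT (TT * z) z (gev ?y r) 0"
        using gev_opT[of ?y l t r] ne van[OF r] unfolding y by simp
      also have "(1 - TT) * z / (TT * z - z) = -1" using ne z by (simp add: field_simps)
      then have "hecke_at TT (TT * z) z (gev ?y r) 0 = - gev ?y r" by (simp add: hecke_at_def)
      finally show ?thesis .
    qed
    have Vi: "opT t i r \<in> V" "opT t l r \<in> V" if "r \<in> V" for r using that i l by (auto intro: V_opT)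
    have "- (TT * (TT * gev ?y p)) = TT * gev ?y p"
      using arg_cong[OF opT_braid[of t i p], of "gev ?y"] p Vi unfolding li[symmetric] by (simp add: e1 e2)
    then have "TT * (TT + 1) * gev ?y p = 0" by algebra
    then show ?thesis using TT_m1 by simp
  qed
qed

text \<open>The extra point \<open>q\<^sup>j t\<^bsup>en-1\<^esup> Y\<close> is moved from position 1 to \<open>N\<close> by the generators, and the singularity relation then brings it back
  to position 1 with \<open>j\<close> replaced by \<open>j + 1\<close>. A generator fails to move it only past \<open>t\<close> times itself, where the braid
  relation helps.\<close>

lemma wheel_field:
  assumes w: "\<And>a. a < e * n - 1 \<Longrightarrow> w (b + a) = TT ^ a * Y" and Y: "Y \<noteq> 0" and b: "1 \<le> b" and e: "1 \<le> e"
    and others: "\<And>k j. 1 \<le> k \<Longrightarrow> k < N \<Longrightarrow> k \<notin> {b..<b + (e * n - 1)} \<Longrightarrow> TT * (QQ ^ j * TT ^ (e * n - 1) * Y) \<noteq> w k"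
    and base: "\<And>p. p \<in> V \<Longrightarrow> gev (insert_at w N (TT ^ (e * n - 1) * Y)) p = 0"
    and j: "1 \<le> j" "j < e * m" and l: "1 \<le> l" "l \<le> N" and p: "p \<in> V"
  shows "gev (insert_at w l (QQ ^ j * TT ^ (e * n - 1) * Y)) p = 0"
proof -
  define z where "z = (\<lambda>j. QQ ^ j * TT ^ (e * n - 1) * Y)"
  have en: "2 \<le> e * n" using e n by (metis le_trans mult_le_mono1 nat_mult_1)
  have z0: "z j \<noteq> 0" for j using Y by (simp add: z_def)
  have zS: "z (Suc j) = QQ * z j" for j by (simp add: z_def)
  \<comment> \<open>A collision means q^j t^(en-a) = 1, hence (j, en - a) = kappa (m, n), and kappa
    < e because j < em. Since a = 0 would need kappa = e, the member met is never the first of the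
    progression and has a predecessor.\<close>
  have hit: "\<exists>a. k = b + Suc a \<and> Suc a < e * n - 1"
    if k: "1 \<le> k" "k < N" and jj: "1 \<le> j" "j < e * m" and h: "TT * z j = w k" for k j
  proof -
    have "k \<in> {b..<b + (e * n - 1)}" using others[OF k, of j] h by (auto simp: z_def)
    then obtain a where a: "k = b + a" "a < e * n - 1" by (metis atLeastLessThan_iff le_Suc_ex nat_add_left_cancel_less)
    have "TT ^ a * Y = QQ ^ j * TT ^ (e * n) * Y"
    proof -
      have "TT ^ (e * n) = TT * TT ^ (e * n - 1)" using en by (cases "e * n") auto
      then show ?thesis using h[symmetric] w[OF a(2)] unfolding a z_def by (simp add: mult_ac)
    qed
    moreover have "TT ^ (e * n) = TT ^ (e * n - a) * TT ^ a" using a by (simp flip: power_add)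
    ultimately have "QQ ^ j * TT ^ (e * n - a) = 1" using Y by simp
    then have "q ^ j * t ^ (e * n - a) = 1" by (rule QT_eq_1)
    then obtain \<kappa> where \<kappa>: "int j = int m * \<kappa>" "int (e * n - a) = int n * \<kappa>"
      using qt_eq_1[of "int j" "int (e * n - a)"] by auto
    have "int m * \<kappa> < int m * int e" using \<kappa>(1) jj by (simp flip: of_nat_mult add: mult.commute)
    then have ke: "\<kappa> < int e" using m by simp
    have "a \<noteq> 0"
    proof
      assume "a = 0"
      then have "int n * int e = int n * \<kappa>" using \<kappa>(2) by (simp add: mult.commute)
      then show False using ke n by simp
    qed
    then show ?thesis using a by (cases a) auto
  qed
  have move: "\<forall>l\<in>{1..N}. \<forall>p\<in>V. gev (insert_at w l (z j)) p = 0"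
    if first: "\<And>p. p \<in> V \<Longrightarrow> gev (insert_at w 1 (z j)) p = 0" and jj: "1 \<le> j" "j < e * m" for j
  proof -
    have "\<forall>p\<in>V. gev (insert_at w l (z j)) p = 0" if "1 \<le> l" "l \<le> N" for l
      using that
    proof (induction l rule: dec_induct)
      case base
      then show ?case using first by blast
    next
      case (step l)
      have "gev (insert_at w (Suc l) (z j)) p = 0" if "p \<in> V" for p
        by (rule wheel_move[where L = "e * n - 1", OF w Y b z0 _ _ hit _ that]) (use step jj in auto)
      then show ?case by blast
    qed
    then show ?thesis by auto
  qed
  have "\<forall>l\<in>{1..N}. \<forall>p\<in>V. gev (insert_at w l (z j)) p = 0"
    using j
  proof (induction j rule: dec_induct)
    case base
    have "gev (insert_at w 1 (z 1)) p = 0" if "p \<in> V" for p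
      using wheel_shift[OF assms(6) that] zS[of 0] by (simp add: z_def mult.assoc)
    then show ?case by (rule move) (use base in auto)
  next
    case (step j)
    have N: "N \<in> {1..N}" using N_ge_2 by auto
    have "gev (insert_at w N (z j)) p = 0" if "p \<in> V" for p
      using step.IH step.prems N that by auto
    then have "gev (insert_at w 1 (z (Suc j))) p = 0" if "p \<in> V" for p
      using wheel_shift[of w "z j" p] that zS[of j] by simp
    then show ?case by (rule move) (use step in auto)
  qed
  then show ?thesis using l p by (auto simp: z_def)
qed

text \<open>A vanishing criterion by the pigeonhole principle: the members of a chain lie in different columns of \<open>S\<^sub>0\<close> unless
  \<open>h0\<close> vanishes.\<close>

definition chain :: "(nat \<Rightarrow> cuyz) \<Rightarrow> nat \<Rightarrow> cuyz \<Rightarrow> bool" where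
  "chain x L Y \<longleftrightarrow> (\<exists>a. (\<forall>i<L. a i \<in> {1..N} \<and> x (a i) = TT ^ i * Y) \<and> (\<forall>i j. i < j \<longrightarrow> j < L \<longrightarrow> a i < a j))"

text \<open>Two chain members whose order would be reversed sit at neighbouring positions, so they
  are consecutive in the chain and have ratio t, which is excluded.\<close>

lemma chain_swap:
  assumes "chain x L Y" "1 \<le> k" "k < N" "x (Suc k) \<noteq> TT * x k"
  shows "chain (x \<circ> tp k) L Y"
proof -
  obtain a where a: "\<And>i. i < L \<Longrightarrow> a i \<in> {1..N} \<and> x (a i) = TT ^ i * Y" "\<And>i j. i < j \<Longrightarrow> j < L \<Longrightarrow> a i < a j"
    using assms(1) unfolding chain_def by blast
  have "tp k (a i) < tp k (a j)" if ij: "i < j" "j < L" for i j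
  proof (rule tp_less[OF a(2)[OF ij]])
    show "\<not> (a i = k \<and> a j = Suc k)"
    proof
      assume h: "a i = k \<and> a j = Suc k"
      show False
      proof (cases "j = Suc i")
        case True
        then show False using h a(1)[of i] a(1)[of j] ij assms(4) by simp
      next
        case False
        then have "a i < a (Suc i)" "a (Suc i) < a j" using ij a(2) by auto
        then show False using h by simp
      qed
    qed
  qed
  moreover have "tp k (a i) \<in> {1..N} \<and> (x \<circ> tp k) (tp k (a i)) = TT ^ i * Y" if "i < L" for i
    using a(1)[OF that] tp_range[OF assms(2,3), of "a i"] by simp
  ultimately show ?thesis unfolding chain_def by (intro exI[of _ "tp k \<circ> a"]) auto
qed

text \<open>A generator uses the value at x and at its exchange, or at x alone if x_{k+1} = t x_k.
  So G has to be stable only under the exchanges that keep chains intact.\<close>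

lemma V_vanish:
  assumes G: "\<And>x. G x \<Longrightarrow> inj_on x {1..N}"
    "\<And>x k. G x \<Longrightarrow> 1 \<le> k \<Longrightarrow> k < N \<Longrightarrow> x (Suc k) \<noteq> TT * x k \<Longrightarrow> G (x \<circ> tp k)"
    "\<And>x. G x \<Longrightarrow> gev x P0 = 0"
    and "p \<in> V" "G x"
  shows "gev x p = 0"
  using assms(4,5)
proof (induction arbitrary: x rule: V.induct)
  case V_P0
  then show ?case by (rule G(3))
next
  case (V_add p r)
  then show ?case by (simp add: gev_simps)
next
  case (V_smult p c)
  then show ?case by (simp add: gev_simps)
next
  case (V_opT p k)
  have ne: "x k \<noteq> x (Suc k)"
    using inj_onD[OF G(1)[OF V_opT.prems], of k "Suc k"] V_opT.hyps by auto
  show ?case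
  proof (cases "x (Suc k) = TT * x k")
    case True
    then have "x k \<noteq> 0" using ne by auto
    then have "gev x (opT t k p) = TT * gev x p"
      unfolding gev_def using True by (intro eval_opT_eq[OF ringhom_FC]) auto
    then show ?thesis using V_opT by simp
  next
    case False
    then show ?thesis
      using gev_opT[OF ne, of t p] V_opT.IH[OF V_opT.prems] V_opT.IH[OF G(2)[OF V_opT.prems V_opT.hyps(2,3) False]]
      by (simp add: hecke_at_def)
  qed
qed

text \<open>Consecutive members have ratio t, so \<open>h0\<close> would vanish if they shared a
  column; the columns of S_0 decrease weakly with the entry, hence strictly along the chain.\<close>

lemma chain_cols:
  assumes nz: "gev x P0 \<noteq> 0" and a: "\<And>i. i < L \<Longrightarrow> a i \<in> {1..N} \<and> x (a i) = TT ^ i * Y"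
    "\<And>i j. i < j \<Longrightarrow> j < L \<Longrightarrow> a i < a j"
  shows "inj_on (\<lambda>i. col_of S0 (a i)) {..<L}"
proof -
  have "gev x h0 \<noteq> 0" using nz unfolding P0_eq gev_simps by simp
  then have pairs: "TT * x i \<noteq> x j" if "(i, j) \<in> col_pairs" for i j
  proof -
    have v: "gev x (Var i) = x i" for i by (simp add: gev_def eval_Var ringhom_FC)
    have "gev x h0 = (\<Prod>(i, j)\<in>col_pairs. TT * x i - x j)"
      by (simp add: h0_def gev_simps gev_Const v split_beta)
    then show ?thesis using \<open>gev x h0 \<noteq> 0\<close> finite_col_pairs that by (auto simp: split_beta)
  qed
  have dec: "col_of S0 (a (Suc i)) < col_of S0 (a i)" if "Suc i < L" for i
  proof -
    have "TT * x (a i) = x (a (Suc i))" using a(1)[of i] a(1)[of "Suc i"] that by simp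
    then have "(a i, a (Suc i)) \<notin> col_pairs" using pairs by blast
    then have "col_of S0 (a i) \<noteq> col_of S0 (a (Suc i))"
      using a(1)[of i] a(1)[of "Suc i"] a(2)[of i "Suc i"] that by (auto simp: col_pairs_iff)
    moreover have "col_of S0 (a (Suc i)) \<le> col_of S0 (a i)"
      using a(1)[of i] a(1)[of "Suc i"] a(2)[of i "Suc i"] that by (intro S0_col_antitone) auto
    ultimately show ?thesis by simp
  qed
  have lt: "col_of S0 (a j) < col_of S0 (a i)" if "i < j" "j < L" for i j
    using that
  proof (induction j)
    case (Suc j)
    then show ?case using dec[of j] by (cases "i = j") auto
  qed simp
  show ?thesis
  proof (rule inj_onI)
    fix i j assume "i \<in> {..<L}" "j \<in> {..<L}" "col_of S0 (a i) = col_of S0 (a j)"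
    then show "i = j" using lt[of i j] lt[of j i] by (cases i j rule: linorder_cases) auto
  qed
qed

lemma S0_box_iff: "k \<in> {1..N} \<Longrightarrow> (row_of S0 k, col_of S0 k) \<in> B"
  using S0_box(3)[of k] by (simp add: row_of_box col_of_box)

lemma S0_col_range: "k \<in> {1..N} \<Longrightarrow> col_of S0 k \<in> {1..d * n - 1}"
  using S0_box_iff[of k] row_len_antimono[of 1 "row_of S0 k"] row_len_simps(1) by (auto simp: boxes_iff)

lemma P0_chain_long:
  assumes "chain x (d * n) Y"
  shows "gev x P0 = 0"
proof (rule ccontr)
  assume nz: "gev x P0 \<noteq> 0"
  obtain a where a: "\<And>i. i < d * n \<Longrightarrow> a i \<in> {1..N} \<and> x (a i) = TT ^ i * Y" "\<And>i j. i < j \<Longrightarrow> j < d * n \<Longrightarrow> a i < a j"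
    using assms unfolding chain_def by blast
  have "card {..<d * n} \<le> card {1..d * n - 1}"
    by (rule card_inj_on_le[OF chain_cols[OF nz a]]) (use S0_col_range a(1) in auto)
  moreover have "d * n \<ge> 1" using dn_ge n by linarith
  ultimately show False by (cases "d * n") auto
qed

text \<open>The longer chain meets every column. A column beyond n - 1 has a single box, which is
  then used up, so the other chain, with n members disjoint from it, would have to fit into n - 1
  columns.\<close>

lemma P0_chain_two:
  assumes "chain x n Y" "chain x (d * n - 1) Y'" "\<And>i j. TT ^ i * Y \<noteq> TT ^ j * Y'"
  shows "gev x P0 = 0"
proof (rule ccontr)
  assume nz: "gev x P0 \<noteq> 0"
  obtain a where a: "\<And>i. i < n \<Longrightarrow> a i \<in> {1..N} \<and> x (a i) = TT ^ i * Y" "\<And>i j. i < j \<Longrightarrow> j < n \<Longrightarrow> a i < a j"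
    using assms unfolding chain_def by blast
  obtain a' where a': "\<And>i. i < d * n - 1 \<Longrightarrow> a' i \<in> {1..N} \<and> x (a' i) = TT ^ i * Y'" "\<And>i j. i < j \<Longrightarrow> j < d * n - 1 \<Longrightarrow> a' i < a' j"
    using assms unfolding chain_def by blast
  have "(\<lambda>i. col_of S0 (a' i)) ` {..<d * n - 1} = {1..d * n - 1}"
  proof (rule card_subset_eq)
    show "(\<lambda>i. col_of S0 (a' i)) ` {..<d * n - 1} \<subseteq> {1..d * n - 1}"
      using S0_col_range a'(1) by blast
    show "card ((\<lambda>i. col_of S0 (a' i)) ` {..<d * n - 1}) = card {1..d * n - 1}"
      using card_image[OF chain_cols[OF nz a']] by simp
  qed simp
  then have surj: "\<exists>i<d * n - 1. col_of S0 (a' i) = c" if "c \<in> {1..d * n - 1}" for c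
    using that by (metis (no_types, lifting) image_iff lessThan_iff)
  have one: "row_of S0 l = 1" if "l \<in> {1..N}" "col_of S0 l > n - 1" for l
    using S0_box_iff[OF that(1)] that(2) \<nu> by (auto simp: boxes_iff row_len_def split: if_splits)
  have "col_of S0 (a i) \<le> n - 1" if i: "i < n" for i
  proof (rule ccontr)
    assume gt: "\<not> ?thesis"
    have ai: "a i \<in> {1..N}" using a(1)[OF i] by simp
    obtain j where j: "j < d * n - 1" "col_of S0 (a' j) = col_of S0 (a i)"
      using surj S0_col_range[OF ai] by blast
    have aj: "a' j \<in> {1..N}" using a'(1)[OF j(1)] by simp
    have "box_of S0 (a' j) = box_of S0 (a i)"
      using one[OF ai] one[OF aj] gt j by (simp add: prod_eq_iff row_of_box[symmetric] col_of_box[symmetric])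
    then have "a' j = a i" using box_of_inj[OF tab0_less(1) aj ai] by simp
    then show False using a(1)[OF i] a'(1)[OF j(1)] assms(3) by metis
  qed
  then have "(\<lambda>i. col_of S0 (a i)) ` {..<n} \<subseteq> {1..n - 1}" using S0_col_range a(1) by fastforce
  then have "card {..<n} \<le> card {1..n - 1}"
    by (intro card_inj_on_le[OF chain_cols[OF nz a]]) auto
  then show False using n by simp
qed

text \<open>A generic point with two geometric progressions, at the positions \<open>{b..<b + L}\<close> and \<open>{b'..<b' + L'}\<close>.\<close>

definition block_start :: "nat \<Rightarrow> nat \<Rightarrow> nat \<Rightarrow> nat \<Rightarrow> nat \<Rightarrow> nat" where
  "block_start b L b' L' k = (if k \<in> {b..<b + L} then b else if k \<in> {b'..<b' + L'} then b' else k)"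

definition block_pt :: "nat \<Rightarrow> nat \<Rightarrow> nat \<Rightarrow> nat \<Rightarrow> nat \<Rightarrow> cu mpoly" where
  "block_pt b L b' L' k = Const (t ^ (k - block_start b L b' L' k)) * Var (block_start b L b' L' k)"

lemma t_power_inj: "t ^ a = t ^ b \<longleftrightarrow> a = b"
  using t_powi_inj[of "int a" "int b"] by auto

lemma block_start_le: "block_start b L b' L' k \<le> k"
  by (auto simp: block_start_def)

lemma block_pt_inj: "block_pt b L b' L' k = block_pt b L b' L' k' \<longleftrightarrow> k = k'"
proof
  assume "block_pt b L b' L' k = block_pt b L b' L' k'"
  then have "block_start b L b' L' k = block_start b L b' L' k'" "k - block_start b L b' L' k = k' - block_start b L b' L' k'"
    by (auto simp: block_pt_def lin_eq_iff t_power_inj)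
  then show "k = k'" using block_start_le[of b L b' L' k] block_start_le[of b L b' L' k'] by linarith
qed simp

text \<open>Two cases of the pigeonhole argument: e = d is the progression of row 1 on its own; e =
  1 is a shorter row, which needs row 1 as a second chain.\<close>

lemma wheel_generic:
  assumes cs: "e = d \<and> L' = 0 \<or> e = 1 \<and> L' = d * n - 1 \<and> b' + L' \<le> N"
    and b: "1 \<le> b" "b + (e * n - 1) \<le> N" "b + (e * n - 1) \<le> b'"
    and j: "1 \<le> j" "j < e * m" and l: "1 \<le> l" "l \<le> N" and p: "p \<in> V"
  shows "eval_mpoly Const (insert_at (block_pt b (e * n - 1) b' L') l (Const (q ^ j * t ^ (e * n - 1)) * Var b)) p = 0"
proof -
  define L where "L = e * n - 1"
  have e1: "1 \<le> e" using cs d by auto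
  have en: "2 \<le> e * n" using e1 n by (metis le_trans mult_le_mono1 nat_mult_1)
  have L1: "1 \<le> L" "Suc L = e * n" using en by (auto simp: L_def)
  define W where "W = block_pt b L b' L'"
  define w where "w = (\<lambda>k. Fract (W k) 1)"
  define Y where "Y = (Fract (Var b) 1 :: cuyz)"
  define Y' where "Y' = (Fract (Var b') 1 :: cuyz)"
  have TF: "TT ^ a * Fract x 1 = Fract (Const (t ^ a) * x) 1" for a x
    unfolding Fract_Const_power by simp
  have Wrow: "W (b + a) = Const (t ^ a) * Var b" if "a < L" for a
    using that by (simp add: W_def block_pt_def block_start_def)
  have Wrow': "W (b' + a) = Const (t ^ a) * Var b'" if "a < L'" for a
    using that b(3) by (simp add: W_def block_pt_def block_start_def L_def)
  have W_inj: "W k = W k' \<longleftrightarrow> k = k'" for k k'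
    by (simp add: W_def block_pt_inj)
  have Wtop: "W k \<noteq> Const (t ^ L) * Var b" if "k < N" for k
  proof
    assume "W k = Const (t ^ L) * Var b"
    then have "block_start b L b' L' k = b" "k - b = L" by (auto simp: W_def block_pt_def lin_eq_iff t_power_inj)
    moreover have "k = b + L" using \<open>k - b = L\<close> block_start_le[of b L b' L' k] \<open>block_start b L b' L' k = b\<close> by simp
    ultimately show False using L1 b(3) by (auto simp: block_start_def L_def split: if_splits)
  qed
  define x where "x = insert_at w N (TT ^ L * Y)"
  have xk: "x k = Fract (W k) 1" if "k < N" for k using that by (simp add: x_def insert_at_def w_def)
  have xN: "x N = Fract (Const (t ^ L) * Var b) 1" by (simp add: x_def insert_at_def Y_def TF)
  have inj: "inj_on x {1..N}"
  proof (rule inj_onI)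
    fix k k' assume kk: "k \<in> {1..N}" "k' \<in> {1..N}" "x k = x k'"
    consider "k = N" "k' = N" | "k = N" "k' < N" | "k < N" "k' = N" | "k < N" "k' < N" using kk by fastforce
    then show "k = k'"
      by cases (use kk Wtop[of k] Wtop[of k'] W_inj in \<open>auto simp: xk xN Fract_1_eq_iff\<close>)
  qed
  \<comment> \<open>The progression of length en - 1 together with the extra point t^L Y at position
    N is a chain with one member too many.\<close>
  have ch: "chain x (e * n) Y"
    unfolding chain_def
  proof (intro exI[of _ "\<lambda>i. if i < L then b + i else N"] conjI allI impI)
    fix i assume i: "i < e * n"
    show "(if i < L then b + i else N) \<in> {1..N}" using b by (auto simp: L_def)
    show "x (if i < L then b + i else N) = TT ^ i * Y"
    proof (cases "i < L")
      case True
      then have "b + i < N" using b(2) by (simp add: L_def)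
      then show ?thesis using True by (simp add: xk Wrow Y_def TF)
    next
      case False
      then have "i = L" using i L1 by simp
      then show ?thesis by (simp add: xN Y_def TF)
    qed
  next
    fix i j assume "i < j" "j < e * n"
    then show "(if i < L then b + i else N) < (if j < L then b + j else N)"
      using b(2) L1 by (auto simp: L_def)
  qed
  have base: "gev (insert_at w N (TT ^ (e * n - 1) * Y)) r = 0" if r: "r \<in> V" for r
    using cs
  proof
    assume A: "e = d \<and> L' = 0"
    have "gev x r = 0"
    proof (rule V_vanish[where G = "\<lambda>x. inj_on x {1..N} \<and> chain x (d * n) Y", OF _ _ _ r])
      fix x k assume G: "inj_on x {1..N} \<and> chain x (d * n) Y" and k: "1 \<le> k" "k < N" "x (Suc k) \<noteq> TT * x k"
      have "inj_on (x \<circ> tp k) {1..N}" using G bij_tp[OF k(1,2)] by (intro comp_inj_on) (auto simp: bij_betw_def)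
      then show "inj_on (x \<circ> tp k) {1..N} \<and> chain (x \<circ> tp k) (d * n) Y" using chain_swap G k by blast
    qed (use inj ch A P0_chain_long in auto)
    then show ?thesis by (simp add: x_def L_def)
  next
    assume Bc: "e = 1 \<and> L' = d * n - 1 \<and> b' + L' \<le> N"
    have ne: "TT ^ i * Y \<noteq> TT ^ j * Y'" for i j
      unfolding Y_def Y'_def TF using b(3) L1 by (auto simp: Fract_1_eq_iff lin_eq_iff L_def)
    have ch': "chain x (d * n - 1) Y'"
      unfolding chain_def
    proof (intro exI[of _ "\<lambda>i. b' + i"] conjI allI impI)
      fix i assume i: "i < d * n - 1"
      show "b' + i \<in> {1..N}" using b i Bc by auto
      show "x (b' + i) = TT ^ i * Y'" using i Bc by (simp add: xk Wrow' Y'_def TF)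
    qed auto
    have "gev x r = 0"
    proof (rule V_vanish[where G = "\<lambda>x. inj_on x {1..N} \<and> chain x n Y \<and> chain x (d * n - 1) Y'", OF _ _ _ r])
      fix x k assume G: "inj_on x {1..N} \<and> chain x n Y \<and> chain x (d * n - 1) Y'" and k: "1 \<le> k" "k < N" "x (Suc k) \<noteq> TT * x k"
      have "inj_on (x \<circ> tp k) {1..N}" using G bij_tp[OF k(1,2)] by (intro comp_inj_on) (auto simp: bij_betw_def)
      then show "inj_on (x \<circ> tp k) {1..N} \<and> chain (x \<circ> tp k) n Y \<and> chain (x \<circ> tp k) (d * n - 1) Y'"
        using chain_swap G k by blast
    next
      show "gev x P0 = 0" if "inj_on x {1..N} \<and> chain x n Y \<and> chain x (d * n - 1) Y'" for x
        using that ne by (intro P0_chain_two[of x Y Y']) auto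
    qed (use inj ch ch' Bc in auto)
    then show ?thesis by (simp add: x_def L_def)
  qed
  have "gev (insert_at w l (QQ ^ j * TT ^ (e * n - 1) * Y)) p = 0"
  proof (rule wheel_field[where b = b, OF _ _ b(1) e1 _ base j l p])
    show "w (b + a) = TT ^ a * Y" if "a < e * n - 1" for a
      using that by (simp add: w_def Wrow L_def Y_def TF)
    show "Y \<noteq> 0" by (simp add: Y_def Zero_fract_def Fract_1_eq_iff)
    fix k j assume k: "1 \<le> k" "k < N" "k \<notin> {b..<b + (e * n - 1)}"
    have "TT * (QQ ^ j * TT ^ (e * n - 1) * Y) = Fract (Const (t * (q ^ j * t ^ (e * n - 1))) * Var b) 1"
      unfolding Y_def Fract_Const_power by (simp add: Const_simps mult.assoc)
    moreover have "block_start b L b' L' k \<noteq> b" using k b(3) L1 by (auto simp: block_start_def L_def)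
    ultimately show "TT * (QQ ^ j * TT ^ (e * n - 1) * Y) \<noteq> w k"
      by (auto simp: w_def W_def block_pt_def Fract_1_eq_iff lin_eq_iff)
  qed
  moreover have "QQ ^ j * TT ^ (e * n - 1) * Y = Fract (Const (q ^ j * t ^ (e * n - 1)) * Var b) 1"
    unfolding Y_def Fract_Const_power by (simp add: Const_simps)
  moreover have "insert_at w l (Fract z 1) = (\<lambda>k. Fract (insert_at W l z k) 1)" for z
    by (auto simp: insert_at_def w_def)
  ultimately have "Fract (eval_mpoly Const (insert_at W l (Const (q ^ j * t ^ (e * n - 1)) * Var b)) p) 1 = (0 :: cuyz)"
    by (simp only: gev_Fract)
  then show ?thesis by (simp add: W_def L_def Zero_fract_def Fract_1_eq_iff)
qed

text \<open>Obtained from the generic point by a substitution, so the coordinates outside the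
  progressions may be arbitrary, even equal. The rows start at b + 1 and b' + 1 since the point
  inserted at l shifts everything behind it by one.\<close>

lemma wheel_point:
  assumes cs: "e = d \<and> L' = 0 \<or> e = 1 \<and> L' = d * n - 1 \<and> b' + L' \<le> N"
    and b: "b + (e * n - 1) \<le> N" "b + (e * n - 1) \<le> b'"
    and row: "\<And>a. a < e * n - 1 \<Longrightarrow> x (b + Suc a) = Const (t ^ a) * Y"
    and row': "\<And>a. a < L' \<Longrightarrow> x (b' + Suc a) = Const (t ^ a) * Y'"
    and j: "1 \<le> j" "j < e * m" and l: "1 \<le> l" "l \<le> b" and xl: "x l = Const (q ^ j * t ^ (e * n - 1)) * Y"
    and p: "p \<in> V"
  shows "eval_mpoly Const x p = 0"
proof -
  define L where "L = e * n - 1"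
  define \<sigma> where "\<sigma> = (\<lambda>k. if k = b then Y else if k = b' \<and> 0 < L' then Y' else if k < l then x k else x (Suc k))"
  define z where "z = (Const (q ^ j * t ^ L) * Var b :: cu mpoly)"
  have "e \<ge> 1" using cs d by auto
  then have "2 \<le> e * n" using n by (metis le_trans mult_le_mono1 nat_mult_1)
  then have L1: "1 \<le> L" by (simp add: L_def)
  have lN: "l \<le> N" using l b(1) by simp
  have z0: "eval_mpoly Const (insert_at (block_pt b L b' L') l z) p = 0"
    unfolding z_def L_def using l b by (intro wheel_generic[OF cs _ b j l(1) lN p]) simp
  have E: "eval_mpoly Const \<sigma> (Const c * Var k) = Const c * \<sigma> k" for c k
    by (simp add: eval_simps[OF ringhom_Const] ringhom_Const)
  have \<sigma>: "\<sigma> b = Y" "0 < L' \<Longrightarrow> \<sigma> b' = Y'" using b(2) L1 by (auto simp: \<sigma>_def L_def)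
  have "eval_mpoly Const \<sigma> (insert_at (block_pt b L b' L') l z k) = x k" for k
  proof -
    consider "k < l" | "k = l" | "l < k" by linarith
    then show ?thesis
    proof cases
      case 1
      then have "block_start b L b' L' k = k" "k \<noteq> b" "k \<noteq> b'" using l b(2) by (auto simp: block_start_def)
      then show ?thesis using 1 E[of "t ^ 0" k] by (simp add: insert_at_def block_pt_def \<sigma>_def Const_simps)
    next
      case 2
      then show ?thesis using xl E \<sigma>(1) by (simp add: insert_at_def z_def L_def)
    next
      case 3
      then obtain i where i: "k = Suc i" "l \<le> i" by (cases k) auto
      have "eval_mpoly Const \<sigma> (block_pt b L b' L' i) = x (Suc i)"
      proof -
        consider "i \<in> {b..<b + L}" | "i \<notin> {b..<b + L}" "i \<in> {b'..<b' + L'}" | "i \<notin> {b..<b + L}" "i \<notin> {b'..<b' + L'}" by blast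
        then show ?thesis
        proof cases
          case 1
          then show ?thesis using row[of "i - b"] \<sigma>(1) by (auto simp: block_pt_def block_start_def E L_def)
        next
          case 2
          then show ?thesis using row'[of "i - b'"] 2 \<sigma>(2) by (auto simp: block_pt_def block_start_def E)
        next
          case 3
          then have "i \<noteq> b" "\<not> (i = b' \<and> 0 < L')" using L1 by auto
          then have "\<sigma> i = x (Suc i)" using i(2) by (auto simp: \<sigma>_def)
          moreover have "block_start b L b' L' i = i" using 3 by (auto simp: block_start_def)
          ultimately show ?thesis using E[of "t ^ 0" i] by (simp add: block_pt_def Const_simps)
        qed
      qed
      then show ?thesis using i by (simp add: insert_at_def)
    qed
  qed
  then have "eval_mpoly Const x p = eval_mpoly Const (\<lambda>k. eval_mpoly Const \<sigma> (insert_at (block_pt b L b' L') l z k)) p" by simp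
  also have "\<dots> = eval_mpoly Const \<sigma> (eval_mpoly Const (insert_at (block_pt b L b' L') l z) p)"
    using eval_comp[OF ringhom_Const ringhom_eval[OF ringhom_Const], of \<sigma> "insert_at (block_pt b L b' L') l z" p]
    by (simp add: eval_Const ringhom_Const)
  finally show ?thesis using z0 by simp
qed

end

section \<open>The product formula\<close>

context params
begin

abbreviation "S1 \<equiv> tab1 \<tau>"

lemma S1_val: "(r, c) \<in> B \<Longrightarrow> S1 (r, c) = N - (if r = 1 then c - 1 else d * n - 1 + (n - 1) * (r - 2) + (c - 1))"
  using card_bef1[of r c] by (simp add: tab1_def bef1_def)

lemmas S1_box = filling_box[OF tab1_less(1)[of \<tau>]]
lemmas S1_less = tab1_less(2)[of _ \<tau>]

lemma entry_pt_S1: "b \<in> B \<Longrightarrow> entry_pt S1 (S1 b) = box_pt b"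
  using S1_box(1) by (simp add: entry_pt_def)

text \<open>The multiplicity e for which the length of row b is e n - 1 (for b up to K); row 1 and
  the other rows are then treated alike.\<close>

definition row_mult :: "nat \<Rightarrow> nat" where "row_mult b = (if b = 1 then d else 1)"

lemma row_len_row_mult: "1 \<le> b \<Longrightarrow> b \<le> K \<Longrightarrow> row_len b = row_mult b * n - 1"
  by (simp add: row_len_def row_mult_def)

definition box_exp :: "nat \<times> nat \<Rightarrow> nat" where "box_exp ac = (if fst ac \<le> K then row_len (fst ac) - snd ac else 0)"

definition box_var :: "nat \<times> nat \<Rightarrow> nat" where "box_var ac = (if fst ac \<le> K then \<nu> + (K + 1 - fst ac) else \<nu> + 1 - snd ac)"

lemma box_pt_eq: "ac \<in> B \<Longrightarrow> box_pt ac = Const (t ^ box_exp ac) * Var (box_var ac)"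
  using K by (cases ac) (auto simp: boxes_iff box_pt_def box_exp_def box_var_def row_len_def Const_simps(1))

lemma box_exp_le: "ac \<in> B \<Longrightarrow> 2 \<le> fst ac \<Longrightarrow> box_exp ac \<le> n - 2"
  by (cases ac) (auto simp: box_exp_def row_len_def boxes_iff)

lemma box_var_less:
  assumes "ac \<in> B" "1 \<le> b" "b < fst ac"
  shows "box_var ac < \<nu> + (K + 1 - b)"
  using assms \<nu> by (cases ac) (auto simp: box_var_def boxes_iff row_len_def)

lemma box_var_box_exp_inj:
  assumes "ac \<in> B" "ac' \<in> B" "box_var ac = box_var ac'" "box_exp ac = box_exp ac'"
  shows "ac = ac'"
proof -
  have "box_pt ac = box_pt ac'" using assms by (simp add: box_pt_eq)
  then show ?thesis using box_pt_inj assms by blast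
qed

text \<open>An index \<open>(ac, b, j)\<close> is a box, a lower row and an exponent of \<open>q\<close>: the factor vanishes where the value of the box is
  \<open>q\<^sup>j t\<^bsup>r\<^esup>\<close> times the variable of row \<open>b\<close>, with \<open>r\<close> the length of that row.\<close>

definition factor_index :: "((nat \<times> nat) \<times> nat \<times> nat) set" where
  "factor_index = Sigma B (\<lambda>ac. Sigma {1..fst ac - 1} (\<lambda>b. {1..row_mult b * m - 1}))"

lemma factor_index_iff: "(ac, b, j) \<in> factor_index \<longleftrightarrow> ac \<in> B \<and> 1 \<le> b \<and> b < fst ac \<and> 1 \<le> j \<and> j < row_mult b * m"
  by (auto simp: factor_index_def)

lemma finite_factor_index: "finite factor_index"
  unfolding factor_index_def by (intro finite_SigmaI finite_boxes) auto

definition factor :: "(nat \<times> nat) \<times> nat \<times> nat \<Rightarrow> cu mpoly" where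
  "factor i = (case i of (ac, b, j) \<Rightarrow> lform (box_var ac) (\<nu> + (K + 1 - b)) (t ^ box_exp ac) (q ^ j * t ^ row_len b))"

lemma fst_le: "ac \<in> B \<Longrightarrow> fst ac \<le> K + 1"
  by (cases ac) (simp add: boxes_iff)

lemma qt_ratio_eq:
  assumes "q ^ j * t ^ x / t ^ y = q ^ j' * t ^ x' / t ^ y'"
  shows "\<exists>k. int j - int j' = int m * k \<and> int x - int y - int x' + int y' = int n * k"
proof -
  have "q powi (int j - int j') * t powi (int x - int y - int x' + int y') = 1"
    using assms by (simp add: power_int_diff power_int_add field_simps)
  then show ?thesis by (rule qt_eq_1)
qed

text \<open>Two indices of one hyperplane differ in j and in the exponent of t by a common multiple
  of (m, n). The boxes involved lie above row 1, where exponents are at most n - 2, so the multiple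
  is 0.\<close>

lemma factor_index_inj: "inj_on (\<lambda>(ac, b, j). (box_var ac, \<nu> + (K + 1 - b), (q ^ j * t ^ row_len b) / t ^ box_exp ac)) factor_index"
proof (rule inj_onI)
  fix i i' assume ii: "i \<in> factor_index" "i' \<in> factor_index"
    and e': "(case i of (ac, b, j) \<Rightarrow> (box_var ac, \<nu> + (K + 1 - b), (q ^ j * t ^ row_len b) / t ^ box_exp ac)) =
      (case i' of (ac, b, j) \<Rightarrow> (box_var ac, \<nu> + (K + 1 - b), (q ^ j * t ^ row_len b) / t ^ box_exp ac))"
  obtain a c b j a' c' b' j' where eq: "i = ((a, c), b, j)" "i' = ((a', c'), b', j')" by (metis surj_pair)
  note i = ii[unfolded eq]
  have e: "box_var (a, c) = box_var (a', c')" "\<nu> + (K + 1 - b) = \<nu> + (K + 1 - b')"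
      "(q ^ j * t ^ row_len b) / t ^ box_exp (a, c) = (q ^ j' * t ^ row_len b') / t ^ box_exp (a', c')"
    using e' unfolding eq by auto
  have h: "(a, c) \<in> B" "(a', c') \<in> B" "1 \<le> b" "b < a" "1 \<le> b'" "b' < a'"
    using i by (auto simp: factor_index_iff)
  have b: "b = b'" using e(2) h fst_le[OF h(1)] fst_le[OF h(2)] by auto
  obtain k where k: "int j - int j' = int m * k" "int (box_exp (a', c')) - int (box_exp (a, c)) = int n * k"
    using qt_ratio_eq[OF e(3)] unfolding b by auto
  have "box_exp (a, c) \<le> n - 2" "box_exp (a', c') \<le> n - 2" using box_exp_le h by auto
  then have "\<bar>int n * k\<bar> < int n" unfolding k(2)[symmetric] using n by linarith
  have "k = 0"
  proof (rule ccontr)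
    assume "k \<noteq> 0"
    then have "int n * 1 \<le> int n * \<bar>k\<bar>" by (intro mult_left_mono) auto
    then show False using \<open>\<bar>int n * k\<bar> < int n\<close> by (simp add: abs_mult)
  qed
  then show "i = i'"
    unfolding eq using k b box_var_box_exp_inj[OF h(1,2) e(1)] by simp
qed

text \<open>In S_1 a lower row carries larger entries, so the exponent counts all boxes of row b
  from column c on.\<close>

lemma scp_S1:
  assumes "(i, j) \<in> same_col_pairs \<tau> S1"
  obtains a b c where "(a, c) \<in> B" "(b, c) \<in> B" "b < a" "i = S1 (a, c)" "j = S1 (b, c)"
    "alt_exponent \<tau> S1 i j = row_len b - c + 1"
proof -
  have ij: "i \<in> {1..N}" "j \<in> {1..N}" "i < j" "col_of S1 i = col_of S1 j" using assms by (auto simp: same_col_pairs_def)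
  define a b c where "a = row_of S1 i" "b = row_of S1 j" "c = col_of S1 i"
  have bi: "box_of S1 i = (a, c)" "box_of S1 j = (b, c)"
    using ij by (simp_all add: a_b_c_def row_of_box col_of_box prod_eq_iff)
  have Bb: "(a, c) \<in> B" "S1 (a, c) = i" "(b, c) \<in> B" "S1 (b, c) = j"
    using S1_box(3,4)[OF ij(1)] S1_box(3,4)[OF ij(2)] bi by auto
  have ba: "b < a" using S1_less[OF Bb(3,1)] Bb ij by (simp add: bef1_def)
  have cb: "c \<le> row_len b" "1 \<le> c" using Bb by (auto simp: boxes_iff)
  have "{k. i < k \<and> k \<le> N \<and> row_of S1 k = row_of S1 j \<and> col_of S1 i \<le> col_of S1 k} = (\<lambda>x. S1 (b, x)) ` {c..row_len b}"
  proof (intro set_eqI iffI)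
    fix k assume k: "k \<in> {k. i < k \<and> k \<le> N \<and> row_of S1 k = row_of S1 j \<and> col_of S1 i \<le> col_of S1 k}"
    then have kN: "k \<in> {1..N}" by auto
    have bk: "box_of S1 k = (b, col_of S1 k)" using k by (simp add: a_b_c_def row_of_box col_of_box prod_eq_iff)
    then have "(b, col_of S1 k) \<in> B" "S1 (b, col_of S1 k) = k" using S1_box(3,4)[OF kN] by auto
    then show "k \<in> (\<lambda>x. S1 (b, x)) ` {c..row_len b}"
      using k by (intro image_eqI[of _ _ "col_of S1 k"]) (auto simp: boxes_iff a_b_c_def)
  next
    fix k assume "k \<in> (\<lambda>x. S1 (b, x)) ` {c..row_len b}"
    then obtain x where x: "k = S1 (b, x)" "c \<le> x" "x \<le> row_len b" by auto
    have xB: "(b, x) \<in> B" using x Bb cb by (auto simp: boxes_iff)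
    have "i < k" using S1_less[OF xB Bb(1)] Bb ba x by (simp add: bef1_def)
    then show "k \<in> {k. i < k \<and> k \<le> N \<and> row_of S1 k = row_of S1 j \<and> col_of S1 i \<le> col_of S1 k}"
      using S1_box(1,2)[OF xB] x by (simp add: row_of_box col_of_box) (simp add: bi)
  qed
  moreover have "inj_on (\<lambda>x. S1 (b, x)) {c..row_len b}"
    using filling_inj[OF tab1_less(1)[of \<tau>]] Bb cb by (auto simp: inj_on_def boxes_iff)
  ultimately have "alt_exponent \<tau> S1 i j = row_len b - c + 1" using cb by (simp add: alt_exponent_def card_image)
  then show ?thesis using that[of a c b] Bb ba by simp
qed

lemma fS_S1_factor:
  assumes "(a, c) \<in> B" "(b, c) \<in> B" "b < a"
  shows "Const (t ^ (row_len b - c + 1)) * box_pt (a, c) - box_pt (b, c) =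
    lform (box_var (a, c)) (\<nu> + (K + 1 - b)) (t ^ (row_len b - c + 1) * t ^ box_exp (a, c)) (t ^ (row_len b - c))"
proof -
  have "b \<le> K" using assms by (auto simp: boxes_iff)
  then have "box_exp (b, c) = row_len b - c" "box_var (b, c) = \<nu> + (K + 1 - b)" by (simp_all add: box_exp_def box_var_def)
  then show ?thesis using box_pt_eq[OF assms(1)] box_pt_eq[OF assms(2)]
    by (simp add: lform_def Const_simps(3) mult.assoc)
qed

text \<open>A factor vanishing on the hyperplane would belong to the same row b and give q^j t^e =
  1, so j = m k and e = n k with k < \<open>row_mult b\<close>. But e is at least n
  (\<open>row_mult b\<close> - 1) + 2, because the exponent of the box is at most n - 2.\<close>

lemma hyp_fS_neq_0:
  assumes i: "(ac, b, j) \<in> factor_index"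
  shows "eval_mpoly Const (hyp (box_var ac) (\<nu> + (K + 1 - b)) ((q ^ j * t ^ row_len b) / t ^ box_exp ac)) (fS S1) \<noteq> 0"
proof -
  let ?\<gamma> = "(q ^ j * t ^ row_len b) / t ^ box_exp ac"
  let ?H = "eval_mpoly Const (hyp (box_var ac) (\<nu> + (K + 1 - b)) ?\<gamma>)"
  have h: "ac \<in> B" "1 \<le> b" "b < fst ac" "1 \<le> j" "j < row_mult b * m" using i by (auto simp: factor_index_iff)
  have bK: "b \<le> K" using h fst_le[OF h(1)] by simp
  have "?H (Const (t ^ alt_exponent \<tau> S1 i1 j1) * entry_pt S1 i1 - entry_pt S1 j1) \<noteq> 0" if p: "(i1, j1) \<in> same_col_pairs \<tau> S1" for i1 j1
  proof -
    obtain a1 b1 c1 where *: "(a1, c1) \<in> B" "(b1, c1) \<in> B" "b1 < a1" "i1 = S1 (a1, c1)" "j1 = S1 (b1, c1)"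
      "alt_exponent \<tau> S1 i1 j1 = row_len b1 - c1 + 1" by (rule scp_S1[OF p])
    have b1: "1 \<le> b1" "b1 \<le> K" using *(1-3) by (auto simp: boxes_iff)
    have eq: "Const (t ^ alt_exponent \<tau> S1 i1 j1) * entry_pt S1 i1 - entry_pt S1 j1 =
      lform (box_var (a1, c1)) (\<nu> + (K + 1 - b1)) (t ^ (row_len b1 - c1 + 1) * t ^ box_exp (a1, c1)) (t ^ (row_len b1 - c1))"
      using fS_S1_factor[OF *(1-3)] * by (simp add: entry_pt_S1)
    have ne: "\<not> (b1 = b \<and> t ^ (row_len b1 - c1) / (t ^ (row_len b1 - c1 + 1) * t ^ box_exp (a1, c1)) = ?\<gamma>)"
    proof
      assume a: "b1 = b \<and> t ^ (row_len b1 - c1) / (t ^ (row_len b1 - c1 + 1) * t ^ box_exp (a1, c1)) = ?\<gamma>"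
      have "q ^ j * t ^ row_len b / t ^ box_exp ac = q ^ 0 * t ^ 0 / t ^ (1 + box_exp (a1, c1))"
        using a by (simp add: power_add field_simps)
      then obtain k where k: "int j = int m * k" "int (row_len b) - int (box_exp ac) + (1 + int (box_exp (a1, c1))) = int n * k"
        using qt_ratio_eq[of j "row_len b" "box_exp ac" 0 0 "1 + box_exp (a1, c1)"] by auto
      have "int m * k < int m * int (row_mult b)" using h(5) unfolding k(1)[symmetric] by (simp add: mult.commute flip: of_nat_mult)
      then have "k < int (row_mult b)" using m by simp
      then have "int n * k \<le> int n * (int (row_mult b) - 1)" by (intro mult_left_mono) auto
      moreover have "box_exp ac \<le> n - 2" using box_exp_le h by simp
      moreover have "row_len b + 1 = row_mult b * n" using row_len_row_mult[OF h(2) bK] n d by (simp add: row_mult_def)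
      then have "int (row_len b) + 1 = int (row_mult b) * int n" by (simp flip: of_nat_mult of_nat_Suc) 
      ultimately show False using k(2) n by (simp add: algebra_simps)
    qed
    show ?thesis
      unfolding eq
    proof (rule hyp_lform_neq_0)
      show "box_var (a1, c1) < \<nu> + (K + 1 - b1)" using box_var_less[OF *(1) b1(1)] *(3) by simp
      show "box_var ac < \<nu> + (K + 1 - b)" by (rule box_var_less[OF h(1-3)])
      show "(box_var (a1, c1), \<nu> + (K + 1 - b1), t ^ (row_len b1 - c1) / (t ^ (row_len b1 - c1 + 1) * t ^ box_exp (a1, c1))) \<noteq>
        (box_var ac, \<nu> + (K + 1 - b), ?\<gamma>)"
        using ne b1 bK h(2) by auto
    qed simp_all
  qed
  then show ?thesis
    unfolding fS_eq by (auto simp: eval_simps[OF ringhom_Const] split_beta finite_scp)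
qed

end

text \<open>The polynomial variable is a scaling parameter, so a form of degree \<open>D\<close> is mapped to a multiple of its \<open>D\<close>-th power.\<close>

definition scale :: "'a::field mpoly \<Rightarrow> 'a mpoly poly" where
  "scale p = eval_mpoly (\<lambda>c. [:Const c:]) (\<lambda>i. monom (Var i) 1) p"

lemma ringhom_C: "ringhom (\<lambda>c::'a::field. [:Const c:])"
  by (auto simp: ringhom_def Const_simps one_pCons mult.commute)

lemma scale_Var: "scale (Const c * Var v) = monom (Const c * Var v) 1"
  unfolding scale_def by (simp add: eval_simps[OF ringhom_C] ringhom_C smult_monom)

lemma monom_diff: "monom a k - monom b k = monom (a - b) k" for a b :: "'a::ab_group_add"
  by (simp add: poly_eq_iff)

lemma monom_prod: "(\<Prod>i\<in>I. monom (f i) (e i)) = monom (\<Prod>i\<in>I. f i) (\<Sum>i\<in>I. e i)" for f :: "'b \<Rightarrow> 'a::comm_ring_1"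
  by (induction I rule: infinite_finite_induct) (simp_all add: mult_monom one_pCons monom_0)

lemma scale_lform: "scale (lform a b \<alpha> \<beta>) = monom (lform a b \<alpha> \<beta>) 1"
  unfolding lform_def scale_def ringhom_simps(6)[OF ringhom_eval[OF ringhom_C]]
  by (simp only: scale_Var[unfolded scale_def] monom_diff)

lemmas scale_simps = ringhom_simps[OF ringhom_eval[OF ringhom_C], of "\<lambda>i. monom (Var i) 1", folded scale_def]

lemma scale_eval_homogeneous:
  assumes "\<And>k. k \<in> Poly_Mapping.keys p \<Longrightarrow> Poly_Mapping.keys k \<subseteq> {1..N} \<and> (\<Sum>i=1..N. Poly_Mapping.lookup k i) = D"
    and "\<And>i. i \<in> {1..N} \<Longrightarrow> scale (x i) = monom (x i) 1"
  shows "scale (eval_mpoly Const x p) = monom (eval_mpoly Const x p) D"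
proof -
  have "scale (\<Prod>j\<in>Poly_Mapping.keys k. x j ^ Poly_Mapping.lookup k j) =
    monom (\<Prod>j\<in>Poly_Mapping.keys k. x j ^ Poly_Mapping.lookup k j) D" if k: "k \<in> Poly_Mapping.keys p" for k
  proof -
    have kN: "Poly_Mapping.keys k \<subseteq> {1..N}" using assms(1)[OF k] by blast
    have "scale (\<Prod>j\<in>Poly_Mapping.keys k. x j ^ Poly_Mapping.lookup k j) =
        (\<Prod>j=1..N. monom (x j ^ Poly_Mapping.lookup k j) (Poly_Mapping.lookup k j))"
      unfolding prod_keys_superset[OF finite_atLeastAtMost kN] scale_simps
      by (rule prod.cong) (simp_all add: assms(2) monom_power)
    also have "\<dots> = monom (\<Prod>j=1..N. x j ^ Poly_Mapping.lookup k j) D"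
      using assms(1)[OF k] by (simp add: monom_prod)
    finally show ?thesis unfolding prod_keys_superset[OF finite_atLeastAtMost kN, of x] .
  qed
  moreover have "scale (Const c) = [:Const c:]" for c :: 'a
    unfolding scale_def by (rule eval_Const[OF ringhom_C])
  ultimately have "scale (eval_mpoly Const x p) = (\<Sum>k\<in>Poly_Mapping.keys p. monom (Const (Poly_Mapping.lookup p k) *
      (\<Prod>j\<in>Poly_Mapping.keys k. x j ^ Poly_Mapping.lookup k j)) D)"
    unfolding eval_mpoly_def scale_simps by (intro sum.cong refl) (simp add: smult_monom)
  also have "\<dots> = monom (eval_mpoly Const x p) D"
    unfolding eval_mpoly_def by (simp add: poly_eq_iff coeff_sum)
  finally show ?thesis .
qed

text \<open>Setting the scaling parameter to 0 leaves the constant term.\<close>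

lemma scale_const:
  assumes "scale s = [:s:]"
  shows "\<exists>c. s = Const c"
proof -
  have h: "ringhom (\<lambda>c::'a. poly [:Const c:] (0 :: 'a mpoly))" by (simp add: ringhom_Const)
  have "ringhom (\<lambda>p. poly p (0 :: 'a mpoly))" by (simp add: ringhom_def)
  from eval_comp[OF ringhom_C this, of "\<lambda>i. monom (Var i) 1" s]
  have "poly (scale s) 0 = eval_mpoly Const (\<lambda>i. 0) s"
    by (simp add: scale_def poly_monom)
  also have "\<dots> = Const (eval_mpoly (\<lambda>c. c) (\<lambda>i. 0) s)"
    using eval_comp[OF ringhom_id ringhom_Const, of "\<lambda>i. 0" s] by (simp add: Const_simps)
  finally show ?thesis using assms by auto
qed

context macdonald_params
begin

text \<open>The identity of \<open>P_value\<close> at S_1 is restricted to the hyperplane: the left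
  side vanishes by the wheel condition, and the factor f_{S_1} does not.\<close>

lemma C0_hyp:
  assumes i: "(ac, b, j) \<in> factor_index"
  shows "eval_mpoly Const (hyp (box_var ac) (\<nu> + (K + 1 - b)) ((q ^ j * t ^ row_len b) / t ^ box_exp ac)) C0 = 0"
proof -
  define u where "u = box_var ac"
  define v where "v = \<nu> + (K + 1 - b)"
  define \<gamma> where "\<gamma> = (q ^ j * t ^ row_len b) / t ^ box_exp ac"
  let ?H = "eval_mpoly Const (hyp u v \<gamma>)"
  have h: "ac \<in> B" "1 \<le> b" "b < fst ac" "1 \<le> j" "j < row_mult b * m" using i by (auto simp: factor_index_iff)
  have bK: "b \<le> K" using h fst_le[OF h(1)] by simp
  have uv: "u < v" unfolding u_def v_def by (rule box_var_less[OF h(1-3)])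
  have H: "?H (Const c * Var k) = Const c * hyp u v \<gamma> k" for c k
    by (simp add: eval_simps[OF ringhom_Const] ringhom_Const)
  define x where "x = (\<lambda>k. ?H (entry_pt S1 k))"
  have xb: "x (S1 bb) = ?H (box_pt bb)" if "bb \<in> B" for bb using that by (simp add: x_def entry_pt_S1)
  \<comment> \<open>Row b occupies the positions b0 + 1, ..., b0 + \<open>row_len b\<close>, from
    its right end to its left; the box \<open>ac\<close> of a higher row comes before. For b > 1 row
    1 fills the last dn - 1 positions, while for b = 1 the second progression is empty.\<close>
  define b0 where "b0 = S1 (b, row_len b) - 1"
  define b' where "b' = (if b = 1 then N else N - (d * n - 1))"
  define L' where "L' = (if b = 1 then 0 else d * n - 1)"
  have rlb: "row_len b = row_mult b * n - 1" by (rule row_len_row_mult[OF h(2) bK])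
  have dn1: "1 \<le> d * n - 1" using dn_ge n by linarith
  have rl1: "1 \<le> row_len b" using row_len_antimono[of b "Suc K"] row_len_simps(3) \<nu> h(2) bK by simp
  have NN: "d * n - 1 \<le> N" by (simp add: N_eq)
  have bB: "(b, row_len b - a) \<in> B" if "a < row_len b" for a using that h(2) bK by (auto simp: boxes_iff)
  have off: "(b, c) \<in> B \<Longrightarrow> (if b = 1 then c - 1 else d * n - 1 + (n - 1) * (b - 2) + (c - 1)) < N" for c
  proof -
    assume c: "(b, c) \<in> B"
    let ?Y = "if b = 1 then c - 1 else d * n - 1 + (n - 1) * (b - 2) + (c - 1)"
    have "S1 (b, c) = N - ?Y" "1 \<le> S1 (b, c)" using S1_val[OF c] S1_box(2)[OF c] by simp_all
    then show "?Y < N" by linarith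
  qed
  have S1row: "S1 (b, row_len b - a) = b0 + Suc a" if a: "a < row_len b" for a
  proof -
    define X where "X = (if b = 1 then 0 else d * n - 1 + (n - 1) * (b - 2))"
    have "S1 (b, row_len b - a) = N - (X + (row_len b - a - 1))" "S1 (b, row_len b) = N - (X + (row_len b - 1))" "X + (row_len b - 1) < N"
      using S1_val[OF bB[OF a]] S1_val[OF bB[of 0]] off[OF bB[of 0]] rl1 by (auto simp: X_def)
    then show ?thesis using a rl1 unfolding b0_def by linarith
  qed
  have top: "b0 + row_len b = S1 (b, 1)" using S1row[of "row_len b - 1"] rl1 by simp
  have b1B: "(b, 1) \<in> B" using bB[of "row_len b - 1"] rl1 by simp
  have "eval_mpoly Const x p = 0" if p: "p \<in> V" for p
  proof (rule wheel_point[where e = "row_mult b" and L' = L' and b' = b' and b = b0 and Y = "Var v" and Y' = "?H (Var (\<nu> + K))" and l = "S1 ac", OF _ _ _ _ _ h(4,5) _ _ _ p])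
    show "row_mult b = d \<and> L' = 0 \<or> row_mult b = 1 \<and> L' = d * n - 1 \<and> b' + L' \<le> N"
      using NN by (auto simp: row_mult_def L'_def b'_def)
    show "b0 + (row_mult b * n - 1) \<le> N" using S1_box(2)[OF b1B] top by (simp add: rlb)
    show "b0 + (row_mult b * n - 1) \<le> b'"
      unfolding rlb[symmetric] top b'_def using S1_box(2)[OF b1B] S1_val[OF b1B]
      by auto (intro diff_le_mono2 le_add1)
    show "x (b0 + Suc a) = Const (t ^ a) * Var v" if "a < row_mult b * n - 1" for a
    proof -
      have a: "a < row_len b" using that by (simp add: rlb)
      have "row_len b - (row_len b - a) = a" using a by simp
      then have "box_pt (b, row_len b - a) = Const (t ^ a) * Var v"
        using box_pt_eq[OF bB[OF a]] bK by (simp add: box_exp_def box_var_def v_def)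
      then show ?thesis
        using xb[OF bB[OF a]] S1row[OF a] H uv by (simp add: hyp_def)
    qed
    show "x (b' + Suc a) = Const (t ^ a) * ?H (Var (\<nu> + K))" if a: "a < L'" for a
    proof -
      have b: "b \<noteq> 1" and a': "a < d * n - 1" using a by (auto simp: L'_def split: if_splits)
      have bb: "(1, d * n - 1 - a) \<in> B" using a' by (auto simp: boxes_iff row_len_def)
      have "S1 (1, d * n - 1 - a) = b' + Suc a"
        using S1_val[OF bb] a' NN b by (simp add: b'_def)
      moreover have "d * n - 1 - (d * n - 1 - a) = a" using a' by simp
      then have "box_pt (1, d * n - 1 - a) = Const (t ^ a) * Var (\<nu> + K)" by (simp add: box_pt_def)
      ultimately show ?thesis using xb[OF bb] by (simp add: eval_simps[OF ringhom_Const] ringhom_Const)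
    qed
    show "1 \<le> S1 ac" using S1_box(2)[OF h(1)] by simp
    have "S1 ac < S1 (b, row_len b)" using S1_less[OF bB[of 0] h(1)] h(3) rl1 by (simp add: bef1_def)
    then show "S1 ac \<le> b0" by (simp add: b0_def)
    show "x (S1 ac) = Const (q ^ j * t ^ (row_mult b * n - 1)) * Var v"
    proof -
      have "t ^ box_exp ac * \<gamma> = q ^ j * t ^ row_len b" by (simp add: \<gamma>_def)
      then have "Const (t ^ box_exp ac) * Const \<gamma> = (Const (q ^ j * t ^ row_len b) :: cu mpoly)" by (simp only: Const_simps(3)[symmetric])
      then show ?thesis
        unfolding xb[OF h(1)] box_pt_eq[OF h(1)] u_def[symmetric] H by (simp add: hyp_def rlb mult.assoc[symmetric])
    qed
  qed
  then have "eval_mpoly Const x (P S1) = 0" using P_in_V[OF tab1_Tab] by blast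
  moreover have "?H (ev S1 (P S1)) = eval_mpoly Const x (P S1)"
    unfolding ev_def x_def using eval_comp[OF ringhom_Const ringhom_eval[OF ringhom_Const], of "hyp u v \<gamma>" "entry_pt S1" "P S1"]
    by (simp add: eval_Const ringhom_Const)
  moreover have "?H (ev S1 (P S1)) = ?H C0 * ?H (fS S1)"
    unfolding P_value[OF tab1_Tab] by (simp add: eval_simps[OF ringhom_Const])
  moreover have "?H (fS S1) \<noteq> 0" using hyp_fS_neq_0[OF i] by (simp add: u_def v_def \<gamma>_def)
  ultimately show ?thesis by (simp add: u_def v_def \<gamma>_def)
qed

lemma C0_factor: "\<exists>s. C0 = (\<Prod>i\<in>factor_index. factor i) * s"
proof -
  define a where "a = (\<lambda>i::(nat \<times> nat) \<times> nat \<times> nat. box_var (fst i))"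
  define b where "b = (\<lambda>i::(nat \<times> nat) \<times> nat \<times> nat. \<nu> + (K + 1 - fst (snd i)))"
  define \<alpha> where "\<alpha> = (\<lambda>i::(nat \<times> nat) \<times> nat \<times> nat. t ^ box_exp (fst i))"
  define \<beta> where "\<beta> = (\<lambda>i::(nat \<times> nat) \<times> nat \<times> nat. q ^ snd (snd i) * t ^ row_len (fst (snd i)))"
  have "\<exists>s. C0 = (\<Prod>i\<in>factor_index. lform (a i) (b i) (\<alpha> i) (\<beta> i)) * s"
  proof (rule linear_factors_dvd[OF finite_factor_index])
    show "inj_on (\<lambda>i. (a i, b i, \<beta> i / \<alpha> i)) factor_index"
      using factor_index_inj unfolding a_def b_def \<alpha>_def \<beta>_def case_prod_unfold .
    fix i assume i: "i \<in> factor_index"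
    obtain ac bb j where ii: "i = (ac, bb, j)" by (metis surj_pair)
    show "a i < b i \<and> \<alpha> i \<noteq> 0 \<and> \<beta> i \<noteq> 0"
      using box_var_less[of ac bb] i by (simp add: ii factor_index_iff a_def b_def \<alpha>_def \<beta>_def)
    show "eval_mpoly Const (hyp (a i) (b i) (\<beta> i / \<alpha> i)) C0 = 0"
      using C0_hyp[of ac bb j] i by (simp add: ii a_def b_def \<alpha>_def \<beta>_def)
  qed
  moreover have "factor = (\<lambda>i. lform (a i) (b i) (\<alpha> i) (\<beta> i))"
    by (auto simp: factor_def a_def b_def \<alpha>_def \<beta>_def fun_eq_iff)
  ultimately show ?thesis by simp
qed

text \<open>Specialization can only lose monomials, and the leading coefficient, a power of t, is
  not lost.\<close>

lemma M_tab1_keys: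
  obtains e :: int where
    "\<And>k. k \<in> Poly_Mapping.keys (P S1) \<Longrightarrow> Poly_Mapping.keys k \<subseteq> {1..N} \<and>
      (Poly_Mapping.lookup k = al S1 \<or> comp_greater N (al S1) (Poly_Mapping.lookup k))"
    "\<And>k. Poly_Mapping.lookup k = al S1 \<Longrightarrow> Poly_Mapping.lookup (P S1) k = t powi e"
proof -
  obtain e :: int where iv: "in_vars N (M (al S1))" and
    e: "\<forall>l\<in>Poly_Mapping.keys (M (al S1) - Const (gen_t powi e) * (\<Prod>i=1..N. Var i ^ al S1 i)).
      comp_greater N (al S1) (Poly_Mapping.lookup l)"
    using M al_compositions[of S1] unfolding macdonald_family_def by blast
  have sp: "spz q t (M (al S1)) (P S1)" using P_no_pole[OF tab1_Tab] by (simp add: spz_iff)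
  have z: "Poly_Mapping.lookup (M (al S1)) k = 0 \<Longrightarrow> Poly_Mapping.lookup (P S1) k = 0" for k
    using sp spv_unique[OF spv_0] unfolding spz_def by metis
  have mk: "(\<Prod>i=1..N. Var i ^ al S1 i) = (mon k :: cqt mpoly)" if "Poly_Mapping.lookup k = al S1" for k
  proof -
    have "Poly_Mapping.keys k \<subseteq> {1..N}" using that al_compositions[of S1] by (auto simp: compositions_def in_keys_iff)
    then show ?thesis unfolding mon_conv_prod using prod_keys_superset[of "{1..N}" k Var, symmetric] that by simp
  qed
  have "finite {i. al S1 i \<noteq> 0}"
    by (rule finite_subset[of _ "{1..N}"]) (use al_compositions[of S1] in \<open>auto simp: compositions_def\<close>)
  then obtain k0 :: "nat \<Rightarrow>\<^sub>0 nat" where k0: "Poly_Mapping.lookup k0 = al S1"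
    by (metis (no_types, lifting) lookup_Abs_poly_mapping Collect_cong)
  have low: "comp_greater N (al S1) (Poly_Mapping.lookup k)"
    if "Poly_Mapping.lookup (M (al S1)) k \<noteq> 0" "Poly_Mapping.lookup k \<noteq> al S1" for k
  proof -
    have "k \<noteq> k0" using that k0 by auto
    then have "Poly_Mapping.lookup (M (al S1) - Const (gen_t powi e) * mon k0) k \<noteq> 0"
      using that by (simp add: lookup_minus lookup_Const_mult mon_def lookup_single_not_eq)
    then show ?thesis using e mk[OF k0] by (simp add: in_keys_iff)
  qed
  show ?thesis
  proof (rule that)
    fix k assume "k \<in> Poly_Mapping.keys (P S1)"
    then have k: "Poly_Mapping.lookup (M (al S1)) k \<noteq> 0" using z by (auto simp: in_keys_iff)
    then have "Poly_Mapping.keys k \<subseteq> {1..N}" using iv by (auto simp: in_vars_def in_keys_iff)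
    then show "Poly_Mapping.keys k \<subseteq> {1..N} \<and>
      (Poly_Mapping.lookup k = al S1 \<or> comp_greater N (al S1) (Poly_Mapping.lookup k))"
      using low[OF k] by blast
  next
    fix k :: "nat \<Rightarrow>\<^sub>0 nat" assume k: "Poly_Mapping.lookup k = al S1"
    have "Poly_Mapping.lookup (M (al S1) - Const (gen_t powi e) * mon k) k = 0"
    proof (rule ccontr)
      assume "\<not> ?thesis"
      then have "comp_greater N (al S1) (al S1)" using e[unfolded mk[OF k]] k by (metis in_keys_iff)
      then show False by (simp add: comp_greater_def dominates_def)
    qed
    then have "Poly_Mapping.lookup (M (al S1)) k = gen_t powi e"
      by (simp add: lookup_minus lookup_Const_mult mon_def)
    moreover have "spv q t (gen_t powi e) (t powi e)" by (intro spv_powi spv_gen_t t_neq_0)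
    ultimately show "Poly_Mapping.lookup (P S1) k = t powi e"
      using sp spv_unique unfolding spz_def by metis
  qed
qed

end

section \<open>Dominance and the survival of the leading monomial\<close>

lemma antitone_sum_le:
  fixes y :: "nat \<Rightarrow> nat"
  assumes "\<And>i j. i \<le> j \<Longrightarrow> j < n \<Longrightarrow> y j \<le> y i" "A \<subseteq> {..<n}"
  shows "(\<Sum>i\<in>A. y i) \<le> (\<Sum>i<card A. y i)"
proof -
  define S where "S = {..<card A}"
  have fA: "finite A" using assms(2) finite_subset by blast
  have cA: "card A \<le> n" using card_mono[OF _ assms(2)] by simp
  have cS: "card (A - S) = card (S - A)"
    using card_Diff_subset_Int[of A S] card_Diff_subset_Int[of S A] fA by (simp add: S_def Int_commute)
  have "(\<Sum>i\<in>A - S. y i) \<le> (\<Sum>i\<in>S - A. y i)"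
  proof (cases "A - S = {}")
    case False
    then obtain a where "a \<in> A" "a \<notin> S" by blast
    then have a: "a \<in> A" "card A \<le> a" by (simp_all add: S_def)
    then have cn: "card A < n" using assms(2) by auto
    have "(\<Sum>i\<in>A - S. y i) \<le> card (A - S) * y (card A)"
      using assms by (intro sum_bounded_above[where 'a = nat, simplified]) (auto simp: S_def subset_iff)
    also have "\<dots> = card (S - A) * y (card A)" by (simp add: cS)
    also have "\<dots> \<le> (\<Sum>i\<in>S - A. y i)"
      using assms(1) cn by (intro sum_bounded_below[where 'a = nat, simplified]) (auto simp: S_def)
    finally show ?thesis .
  qed (simp only: sum.empty le0)
  moreover have "(\<Sum>i\<in>A. y i) = (\<Sum>i\<in>A \<inter> S. y i) + (\<Sum>i\<in>A - S. y i)"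
    by (rule sum.Int_Diff[OF fA])
  moreover have "(\<Sum>i\<in>S. y i) = (\<Sum>i\<in>S \<inter> A. y i) + (\<Sum>i\<in>S - A. y i)"
    by (rule sum.Int_Diff) (simp add: S_def)
  ultimately show ?thesis by (simp add: S_def Int_commute)
qed

lemma sum_le_comp_plus:
  assumes "A \<subseteq> {1..N}"
  shows "(\<Sum>i\<in>A. \<beta> i) \<le> (\<Sum>i=1..card A. comp_plus N \<beta> i)"
proof -
  define xs where "xs = map \<beta> [1..<N + 1]"
  define ys where "ys = rev (sort xs)"
  have len: "length xs = N" "length ys = N" by (simp_all add: xs_def ys_def)
  have "mset xs = mset ys" by (simp add: ys_def)
  then obtain f where f: "bij_betw f {..<N} {..<N}" "\<And>i. i < N \<Longrightarrow> xs ! i = ys ! f i"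
    using permutation_Ex_bij[of xs ys] len by auto
  have \<beta>: "\<beta> i = ys ! f (i - 1)" if "i \<in> {1..N}" for i
    proof -
    have "i - 1 < N" using that by auto
    then show ?thesis using f(2)[of "i - 1"] that by (simp add: xs_def del: upt_Suc)
  qed
  define A' where "A' = (\<lambda>i. f (i - 1)) ` A"
  have inj: "inj_on (\<lambda>i. f (i - 1)) A"
  proof (rule inj_onI)
    fix i j assume ij: "i \<in> A" "j \<in> A" "f (i - 1) = f (j - 1)"
    then have "i - 1 \<in> {..<N}" "j - 1 \<in> {..<N}" "1 \<le> i" "1 \<le> j" using assms by fastforce+
    then show "i = j" using inj_onD[OF bij_betw_imp_inj_on[OF f(1)] ij(3)] by simp
  qed
  have sub: "A' \<subseteq> {..<N}"
  proof
    fix x assume "x \<in> A'"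
    then obtain i where i: "i \<in> A" "x = f (i - 1)" by (auto simp: A'_def)
    then have "i - 1 \<in> {..<N}" using assms by fastforce
    then show "x \<in> {..<N}" using i f(1) by (auto simp: bij_betw_def)
  qed
  have "(\<Sum>i\<in>A. \<beta> i) = (\<Sum>i\<in>A'. ys ! i)"
    unfolding A'_def sum.reindex[OF inj] using \<beta> assms by (intro sum.cong) auto
  also have "\<dots> \<le> (\<Sum>i<card A'. ys ! i)"
  proof (rule antitone_sum_le[OF _ sub])
    fix i j assume ij: "i \<le> j" "j < N"
    have "sort xs ! (N - Suc j) \<le> sort xs ! (N - Suc i)"
      by (rule sorted_nth_mono) (use ij len in auto)
    then show "ys ! j \<le> ys ! i" using ij len by (simp add: ys_def rev_nth)
  qed
  also have "card A' = card A" unfolding A'_def by (rule card_image[OF inj])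
  also have "(\<Sum>i<card A. ys ! i) = (\<Sum>i=1..card A. comp_plus N \<beta> i)"
  proof (rule sum.reindex_bij_witness[where i = "\<lambda>i. i - 1" and j = Suc])
    have "card A \<le> N" using card_mono[OF _ assms] by simp
    then show "comp_plus N \<beta> (Suc i) = ys ! i" if "i \<in> {..<card A}" for i
      using that len by (simp add: comp_plus_def comp_of_list_def ys_def xs_def)
  qed auto
  finally show ?thesis .
qed

lemma comp_plus_sorted:
  assumes "\<And>i j. 1 \<le> i \<Longrightarrow> i \<le> j \<Longrightarrow> j \<le> N \<Longrightarrow> \<mu> j \<le> \<mu> i" "i \<in> {1..N}"
  shows "comp_plus N \<mu> i = \<mu> i"
proof -
  define xs where "xs = map \<mu> [1..<N + 1]"
  have "sorted (rev xs)" using assms(1) by (auto simp: sorted_iff_nth_mono xs_def rev_nth nth_append)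
  then have "sort xs = rev xs" by (intro properties_for_sort) simp_all
  moreover have "i - 1 < N" using assms(2) by auto
  ultimately show ?thesis using assms(2) by (simp add: comp_plus_def comp_of_list_def xs_def[symmetric] del: upt_Suc)
    (simp add: xs_def del: upt_Suc)
qed

lemma mon_sum: "mon (sum f I) = (\<Prod>i\<in>I. mon (f i))"
  by (induction I rule: infinite_finite_induct) (simp_all add: mon_plus)

lemma mon_single: "mon (Poly_Mapping.single v e) = Var v ^ e"
proof (induction e)
  case (Suc e)
  have "Poly_Mapping.single v (Suc e) = Poly_Mapping.single v e + Poly_Mapping.single v (Suc 0)"
    by (simp add: single_add[symmetric])
  then show ?case using Suc by (simp add: mon_Suc mult.commute)
qed simp

context macdonald_params
begin

lemma al_S1_antitone:
  assumes "1 \<le> i" "i \<le> j" "j \<le> N"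
  shows "row_of S1 j \<le> row_of S1 i" "al S1 j \<le> al S1 i"
proof -
  have ij: "i \<in> {1..N}" "j \<in> {1..N}" using assms by auto
  show r: "row_of S1 j \<le> row_of S1 i"
  proof (cases "i = j")
    case False
    have "S1 (box_of S1 i) < S1 (box_of S1 j)" using S1_box(4) ij False assms by simp
    then have "bef1 (box_of S1 j) (box_of S1 i)" using S1_less S1_box(3) ij by blast
    then show ?thesis by (auto simp: bef1_def row_of_box)
  qed simp
  show "al S1 j \<le> al S1 i"
    using al_less_iff[OF tab1_less(1) ij] r by (simp add: not_less[symmetric])
qed

definition entry_var :: "nat \<Rightarrow> nat" where "entry_var k = box_var (box_of S1 k)"

lemma entry_var_eq_iff:
  assumes "i \<in> {1..N}" "j \<in> {1..N}"
  shows "entry_var i = entry_var j \<longleftrightarrow> (if row_of S1 j \<le> K then row_of S1 i = row_of S1 j else i = j)"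
proof -
  obtain a c a' c' where b: "box_of S1 i = (a, c)" "box_of S1 j = (a', c')" by (metis surj_pair)
  have B: "(a, c) \<in> B" "(a', c') \<in> B" using S1_box(3) assms b by metis+
  have "i = j \<longleftrightarrow> (a, c) = (a', c')" using box_of_inj[OF tab1_less(1) assms] b by simp
  then show ?thesis
    using B \<nu> K unfolding entry_var_def box_var_def row_of_box b by (auto simp: boxes_iff row_len_def split: if_splits)
qed

text \<open>Monomials of \<open>M\<^sub>\<mu>\<close> are dominated by \<open>\<mu>\<close>, so none of them cancels the leading one after the substitution.\<close>

lemma key_eq:
  assumes k: "k = al S1 \<or> comp_greater N (al S1) k" "k \<in> compositions N"
    and pf: "\<And>v. (\<Sum>j | j \<in> {1..N} \<and> entry_var j = v. k j) = (\<Sum>j | j \<in> {1..N} \<and> entry_var j = v. al S1 j)"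
  shows "k = al S1"
proof -
  have bound: "(\<Sum>i\<in>A. k i) \<le> (\<Sum>i=1..card A. al S1 i)" if A: "A \<subseteq> {1..N}" for A
  proof -
    have cA: "card A \<le> N" using card_mono[OF _ A] by simp
    have cp: "(\<Sum>i=1..a. comp_plus N (al S1) i) = (\<Sum>i=1..a. al S1 i)" if "a \<le> N" for a
      using comp_plus_sorted[OF al_S1_antitone(2)] that by (intro sum.cong) auto
    have "(\<Sum>i\<in>A. k i) \<le> (\<Sum>i=1..card A. comp_plus N k i)" by (rule sum_le_comp_plus[OF A])
    also have "\<dots> \<le> (\<Sum>i=1..card A. comp_plus N (al S1) i)"
    proof (cases "card A = 0")
      case False
      then have "card A \<in> {1..N}" using cA by auto
      then show ?thesis using k by (auto simp: comp_greater_def dominates_def)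
    qed simp
    finally show ?thesis using cp[OF cA] by simp
  qed
  \<comment> \<open>Row by row from the last one down, e being the distance from it. Once the rows
    above agree, dominance bounds each further part by that of mu. The exponent of the variable of
    the row gives its sum, which forces equality; in the last row every box has its own
    variable.\<close>
  have row: "\<forall>j\<in>{1..N}. row_of S1 j = K + 1 - e \<longrightarrow> k j = al S1 j" if "e \<le> K" for e
    using that
  proof (induction e rule: less_induct)
    case (less e)
    define r where "r = K + 1 - e"
    define Pr where "Pr = {i\<in>{1..N}. r < row_of S1 i}"
    define Rw where "Rw = {i\<in>{1..N}. row_of S1 i = r}"
    have prev: "k i = al S1 i" if "i \<in> Pr" for i
    proof -
      have iN: "i \<in> {1..N}" "r < row_of S1 i" using that by (auto simp: Pr_def)
      have "row_of S1 i \<le> K + 1" using fst_le[OF S1_box(3)[OF iN(1)]] by (simp add: row_of_box)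
      then have "K + 1 - row_of S1 i < e" "K + 1 - row_of S1 i \<le> K" "row_of S1 i = K + 1 - (K + 1 - row_of S1 i)"
        using iN r_def less.prems by auto
      then show ?thesis using less.IH iN(1) by blast
    qed
    have Pr_seg: "{1..card Pr} = Pr"
    proof -
      have down: "i \<in> Pr" if "j \<in> Pr" "1 \<le> i" "i \<le> j" for i j
        using that al_S1_antitone(1)[of i j] by (auto simp: Pr_def)
      have fin: "finite Pr" by (simp add: Pr_def)
      show ?thesis
      proof (cases "Pr = {}")
        case False
        then have M: "Max Pr \<in> Pr" using fin by simp
        have "Pr = {1..Max Pr}"
        proof (intro equalityI subsetI)
          fix i assume i: "i \<in> Pr"
          then have "1 \<le> i" by (simp add: Pr_def)
          then show "i \<in> {1..Max Pr}" using Max_ge[OF fin i] by simp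
        next
          fix i assume "i \<in> {1..Max Pr}"
          then show "i \<in> Pr" using down[OF M] by simp
        qed
        moreover from this have "card Pr = Max Pr" by (metis card_atLeastAtMost diff_Suc_1)
        ultimately show ?thesis by simp
      qed simp
    qed
    have le: "k j \<le> al S1 j" if j: "j \<in> Rw" for j
    proof -
      have jN: "j \<in> {1..N}" "row_of S1 j = r" using j by (auto simp: Rw_def)
      have jP: "j \<notin> Pr" by (simp add: Pr_def jN)
      have fin: "finite Pr" by (simp add: Pr_def)
      \<comment> \<open>The first position of row r, right behind the positions of the higher rows;
        mu takes the same value there as at j.\<close>
      define f where "f = Suc (card Pr)"
      have fj: "f \<le> j" using jP jN Pr_seg unfolding f_def by (metis atLeastAtMost_iff not_less_eq_eq)
      then have fN: "f \<in> {1..N}" using jN by (auto simp: f_def)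
      have fP: "f \<notin> Pr" using Pr_seg unfolding f_def by (metis atLeastAtMost_iff Suc_n_not_le_n)
      then have "\<not> r < row_of S1 f" using fN by (simp add: Pr_def)
      then have "row_of S1 f = r" using al_S1_antitone(1)[of f j] fj fN jN by simp
      then have alf: "al S1 f = al S1 j" using al_eq_iff[OF tab1_less(1) fN jN(1)] jN by simp
      have "(\<Sum>i\<in>insert j Pr. k i) \<le> (\<Sum>i=1..card (insert j Pr). al S1 i)"
        by (rule bound) (use jN in \<open>auto simp: Pr_def\<close>)
      also have "card (insert j Pr) = Suc (card Pr)" using fin jP by simp
      also have "(\<Sum>i=1..Suc (card Pr). al S1 i) = (\<Sum>i\<in>Pr. al S1 i) + al S1 j"
      proof -
        have "{1..Suc (card Pr)} = insert f {1..card Pr}" by (auto simp: f_def)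
        also have "\<dots> = insert f Pr" by (simp only: Pr_seg)
        finally show ?thesis using fP fin alf by (simp add: add.commute)
      qed
      finally show ?thesis using fin jP prev by simp
    qed
    have "k j = al S1 j" if j: "j \<in> Rw" for j
    proof (cases "r \<le> K")
      case True
      have jN: "j \<in> {1..N}" "row_of S1 j = r" using j by (auto simp: Rw_def)
      have "{i. i \<in> {1..N} \<and> entry_var i = entry_var j} = Rw"
        using entry_var_eq_iff[OF _ jN(1)] jN(2) True by (auto simp: Rw_def)
      then have s: "(\<Sum>i\<in>Rw. k i) = (\<Sum>i\<in>Rw. al S1 i)" using pf[of "entry_var j"] by simp
      show ?thesis
      proof (rule ccontr)
        assume "k j \<noteq> al S1 j"
        then have "k j < al S1 j" using le[OF j] by simp
        then have "(\<Sum>i\<in>Rw. k i) < (\<Sum>i\<in>Rw. al S1 i)"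
        proof (intro sum_strict_mono_ex1 ballI bexI)
          show "finite Rw" by (simp add: Rw_def)
          show "k i \<le> al S1 i" if "i \<in> Rw" for i by (rule le[OF that])
        qed (use j in simp_all)
        then show False using s by simp
      qed
    next
      case False
      have jN: "j \<in> {1..N}" "row_of S1 j = r" using j by (auto simp: Rw_def)
      have "{i. i \<in> {1..N} \<and> entry_var i = entry_var j} = {j}"
        using entry_var_eq_iff[OF _ jN(1)] jN False by auto
      then show ?thesis using pf[of "entry_var j"] by simp
    qed
    then show ?case by (auto simp: Rw_def r_def)
  qed
  show ?thesis
  proof
    fix j
    show "k j = al S1 j"
    proof (cases "j \<in> {1..N}")
      case True
      have "1 \<le> row_of S1 j" "row_of S1 j \<le> K + 1"
        using row_ge_1[OF tab1_less(1) True] fst_le[OF S1_box(3)[OF True]] by (auto simp: row_of_box)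
      then have "K + 1 - row_of S1 j \<le> K" "row_of S1 j = K + 1 - (K + 1 - row_of S1 j)" by auto
      then show ?thesis using row True by blast
    next
      case False
      then show ?thesis using k(2) al_compositions[of S1] by (auto simp: compositions_def)
    qed
  qed
qed

text \<open>The substitution sends a monomial with exponents k to a power of t, \<open>cf k\<close>,
  times the monomial \<open>pf k\<close>. By \<open>key_eq\<close> only the leading monomial is sent
  to \<open>pf k0\<close>, so its coefficient there is not cancelled.\<close>

lemma ev_P_S1_neq_0: "ev S1 (P S1) \<noteq> 0"
proof -
  obtain e :: int where e: "\<And>k. k \<in> Poly_Mapping.keys (P S1) \<Longrightarrow> Poly_Mapping.keys k \<subseteq> {1..N} \<and>
      (Poly_Mapping.lookup k = al S1 \<or> comp_greater N (al S1) (Poly_Mapping.lookup k))"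
    "\<And>k. Poly_Mapping.lookup k = al S1 \<Longrightarrow> Poly_Mapping.lookup (P S1) k = t powi e"
    by (rule M_tab1_keys) blast
  define pf where "pf = (\<lambda>k. \<Sum>j=1..N. Poly_Mapping.single (entry_var j) (Poly_Mapping.lookup k j :: nat))"
  define cf where "cf = (\<lambda>k. \<Prod>j=1..N. (t ^ box_exp (box_of S1 j)) ^ Poly_Mapping.lookup k j)"
  have lpf: "Poly_Mapping.lookup (pf k) v = (\<Sum>j | j \<in> {1..N} \<and> entry_var j = v. Poly_Mapping.lookup k j)" for k v
    unfolding pf_def lookup_sum lookup_single when_def
    by (subst sum.inter_filter[symmetric]) (auto intro!: sum.cong)
  have xpk: "entry_pt S1 j = Const (t ^ box_exp (box_of S1 j)) * Var (entry_var j)" if "j \<in> {1..N}" for j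
    using box_pt_eq[OF S1_box(3)[OF that]] by (simp add: entry_pt_def entry_var_def)
  have eq: "ev S1 (P S1) = (\<Sum>k\<in>Poly_Mapping.keys (P S1). Const (Poly_Mapping.lookup (P S1) k * cf k) * mon (pf k))"
    unfolding ev_def eval_mpoly_def
  proof (rule sum.cong[OF refl])
    fix k assume "k \<in> Poly_Mapping.keys (P S1)"
    then have kN: "Poly_Mapping.keys k \<subseteq> {1..N}" using e(1) by blast
    have "(\<Prod>j\<in>Poly_Mapping.keys k. entry_pt S1 j ^ Poly_Mapping.lookup k j) =
      (\<Prod>j=1..N. Const ((t ^ box_exp (box_of S1 j)) ^ Poly_Mapping.lookup k j) * mon (Poly_Mapping.single (entry_var j) (Poly_Mapping.lookup k j)))"
      unfolding prod_keys_superset[OF finite_atLeastAtMost kN]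
      by (rule prod.cong) (simp_all add: xpk mon_single power_mult_distrib Const_simps(7))
    also have "\<dots> = Const (cf k) * mon (pf k)"
      by (simp add: prod.distrib cf_def pf_def mon_sum Const_simps)
    finally show "Const (Poly_Mapping.lookup (P S1) k) * (\<Prod>j\<in>Poly_Mapping.keys k. entry_pt S1 j ^ Poly_Mapping.lookup k j) =
      Const (Poly_Mapping.lookup (P S1) k * cf k) * mon (pf k)" by (simp add: Const_simps(3) mult.assoc)
  qed
  have "finite {i. al S1 i \<noteq> 0}"
    by (rule finite_subset[of _ "{1..N}"]) (use al_compositions[of S1] in \<open>auto simp: compositions_def\<close>)
  then obtain k0 :: "nat \<Rightarrow>\<^sub>0 nat" where k0: "Poly_Mapping.lookup k0 = al S1"
    by (metis (no_types, lifting) lookup_Abs_poly_mapping Collect_cong)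
  have uniq: "k = k0" if k: "k \<in> Poly_Mapping.keys (P S1)" "pf k = pf k0" for k
  proof -
    have "Poly_Mapping.lookup k = al S1"
    proof (rule key_eq)
      show "Poly_Mapping.lookup k = al S1 \<or> comp_greater N (al S1) (Poly_Mapping.lookup k)"
        "Poly_Mapping.lookup k \<in> compositions N" using e(1)[OF k(1)] keys_compositions by auto
      show "(\<Sum>j | j \<in> {1..N} \<and> entry_var j = v. Poly_Mapping.lookup k j) = (\<Sum>j | j \<in> {1..N} \<and> entry_var j = v. al S1 j)" for v
        using lpf[of k v] lpf[of k0 v] k(2) k0 by simp
    qed
    then show ?thesis using k0 by (simp add: poly_mapping_eq_iff)
  qed
  have k0P: "Poly_Mapping.lookup (P S1) k0 = t powi e" by (rule e(2)[OF k0])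
  have nz: "Poly_Mapping.lookup (P S1) k0 * cf k0 \<noteq> 0" by (simp add: k0P cf_def power_int_not_zero)
  have "Poly_Mapping.lookup (ev S1 (P S1)) (pf k0)
    = (\<Sum>k\<in>Poly_Mapping.keys (P S1). if k = k0 then Poly_Mapping.lookup (P S1) k * cf k else 0)"
    unfolding eq lookup_sum lookup_Const_mult mon_def lookup_single when_def
    by (rule sum.cong) (use uniq in auto)
  also have "\<dots> = Poly_Mapping.lookup (P S1) k0 * cf k0"
    using nz by (simp add: in_keys_iff)
  finally show ?thesis using nz by auto
qed

end

section \<open>Counting degrees\<close>

context params
begin

lemma sum_row_mult: "(\<Sum>b=1..k. row_mult b * m) = (if k = 0 then 0 else (d + k - 1) * m)"
proof (induction k)
  case (Suc k)
  have "d + k = Suc (d + k - 1)" using d by simp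
  then have "(d + k) * m = (d + k - 1) * m + m" by (metis mult_Suc add.commute)
  then show ?case using Suc by (cases "k = 0") (auto simp: row_mult_def)
qed simp

text \<open>Bookkeeping for one box of row a: each lower row b gives one factor of f_{S_1} and
  \<open>row_mult b * m - 1\<close> factors involving q. Together they make up the part of mu in row
  a; the jump from 0 to dm comes from row 1.\<close>

lemma box_degree: "1 \<le> a \<Longrightarrow> (a - 1) + (\<Sum>b=1..a - 1. row_mult b * m - 1) = row_value m d a"
proof -
  assume a: "1 \<le> a"
  have "1 + (row_mult b * m - 1) = row_mult b * m" for b
    using mult_le_mono[OF d m] m by (simp add: row_mult_def)
  then have "(\<Sum>b=1..a - 1. 1 + (row_mult b * m - 1)) = (\<Sum>b=1..a - 1. row_mult b * m)" by (simp only:)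
  then have "(a - 1) + (\<Sum>b=1..a - 1. row_mult b * m - 1) = (\<Sum>b=1..a - 1. row_mult b * m)"
    unfolding sum.distrib by simp
  also have "\<dots> = row_value m d a"
    unfolding sum_row_mult row_value_def using a by (auto simp: numeral_2_eq_2)
  finally show ?thesis .
qed

lemma card_scp_S1: "card (same_col_pairs \<tau> S1) = (\<Sum>ac\<in>B. fst ac - 1)"
proof -
  have "bij_betw (\<lambda>(i, j). (box_of S1 i, row_of S1 j)) (same_col_pairs \<tau> S1) (Sigma B (\<lambda>ac. {1..fst ac - 1}))"
  proof (rule bij_betw_byWitness[where f' = "\<lambda>(ac, b). (S1 ac, S1 (b, snd ac))"])
    show "\<forall>p\<in>same_col_pairs \<tau> S1. (\<lambda>(ac, b). (S1 ac, S1 (b, snd ac))) ((\<lambda>(i, j). (box_of S1 i, row_of S1 j)) p) = p"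
    proof
      fix p assume p: "p \<in> same_col_pairs \<tau> S1"
      obtain i j where ij: "p = (i, j)" by (cases p)
      obtain a b c where "(a, c) \<in> B" "(b, c) \<in> B" "b < a" "i = S1 (a, c)" "j = S1 (b, c)"
        by (rule scp_S1[OF p[unfolded ij]])
      then show "(\<lambda>(ac, b). (S1 ac, S1 (b, snd ac))) ((\<lambda>(i, j). (box_of S1 i, row_of S1 j)) p) = p"
        by (simp add: ij row_of_box S1_box(1))
    qed
    have m: "(b, c) \<in> B" if "(a, c) \<in> B" "1 \<le> b" "b < a" for a b c
      using that row_len_antimono[of b a] by (auto simp: boxes_iff)
    show "\<forall>p\<in>Sigma B (\<lambda>ac. {1..fst ac - 1}). (\<lambda>(i, j). (box_of S1 i, row_of S1 j)) ((\<lambda>(ac, b). (S1 ac, S1 (b, snd ac))) p) = p"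
    proof
      fix p assume p: "p \<in> Sigma B (\<lambda>ac. {1..fst ac - 1})"
      obtain a c b where e: "p = ((a, c), b)" by (metis surj_pair)
      have "(a, c) \<in> B" "1 \<le> b" "b < a" using p by (auto simp: e)
      then show "(\<lambda>(i, j). (box_of S1 i, row_of S1 j)) ((\<lambda>(ac, b). (S1 ac, S1 (b, snd ac))) p) = p"
        using m[of a c b] by (simp add: e row_of_box S1_box(1))
    qed
    show "(\<lambda>(i, j). (box_of S1 i, row_of S1 j)) ` same_col_pairs \<tau> S1 \<subseteq> Sigma B (\<lambda>ac. {1..fst ac - 1})"
    proof (rule image_subsetI)
      fix p assume p: "p \<in> same_col_pairs \<tau> S1"
      obtain i j where ij: "p = (i, j)" by (cases p)
      obtain a b c where "(a, c) \<in> B" "(b, c) \<in> B" "b < a" "i = S1 (a, c)" "j = S1 (b, c)"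
        by (rule scp_S1[OF p[unfolded ij]])
      then show "(\<lambda>(i, j). (box_of S1 i, row_of S1 j)) p \<in> Sigma B (\<lambda>ac. {1..fst ac - 1})"
        by (simp add: ij row_of_box S1_box(1)) (simp add: boxes_iff)
    qed
    show "(\<lambda>(ac, b). (S1 ac, S1 (b, snd ac))) ` Sigma B (\<lambda>ac. {1..fst ac - 1}) \<subseteq> same_col_pairs \<tau> S1"
    proof (rule image_subsetI)
      fix p assume p: "p \<in> Sigma B (\<lambda>ac. {1..fst ac - 1})"
      obtain a c b where e: "p = ((a, c), b)" by (metis surj_pair)
      have h: "(a, c) \<in> B" "1 \<le> b" "b < a" using p by (auto simp: e)
      have h': "(b, c) \<in> B" by (rule m[OF h])
      have "S1 (a, c) < S1 (b, c)" using S1_less[OF h' h(1)] h by (simp add: bef1_def)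
      then show "(\<lambda>(ac, b). (S1 ac, S1 (b, snd ac))) p \<in> same_col_pairs \<tau> S1"
        using S1_box(1,2)[OF h(1)] S1_box(1,2)[OF h'] by (simp add: e same_col_pairs_def col_of_box)
    qed
  qed
  then show ?thesis by (simp add: bij_betw_same_card card_SigmaI finite_boxes)
qed

text \<open>The degree of M_mu is used up by the known linear factors, so the cofactor in
  \<open>C0_eq\<close> has degree 0.\<close>

lemma sum_al_S1: "(\<Sum>i=1..N. al S1 i) = card (same_col_pairs \<tau> S1) + card factor_index"
proof -
  have "bij_betw S1 B {1..N}" using tab1_less(1)[of \<tau>] by (simp add: filling_def)
  then have "(\<Sum>i=1..N. al S1 i) = (\<Sum>ac\<in>B. al S1 (S1 ac))"
    by (rule sum.reindex_bij_betw[symmetric])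
  also have "\<dots> = (\<Sum>ac\<in>B. (fst ac - 1) + (\<Sum>b=1..fst ac - 1. row_mult b * m - 1))"
  proof (rule sum.cong[OF refl])
    fix ac assume ac: "ac \<in> B"
    have "1 \<le> fst ac" using ac by (cases ac) (simp add: boxes_iff)
    then show "al S1 (S1 ac) = (fst ac - 1) + (\<Sum>b=1..fst ac - 1. row_mult b * m - 1)"
      using S1_box(1,2)[OF ac] by (simp only: box_degree) (simp add: tab_comp_def row_of_box)
  qed
  also have "\<dots> = card (same_col_pairs \<tau> S1) + card factor_index"
    by (simp add: sum.distrib card_scp_S1 factor_index_def card_SigmaI finite_boxes finite_SigmaI)
  finally show ?thesis .
qed

lemma scale_entry_pt: "i \<in> {1..N} \<Longrightarrow> scale (entry_pt S1 i) = monom (entry_pt S1 i) 1"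
  using box_pt_eq[OF S1_box(3)] by (simp add: entry_pt_def scale_Var)

lemma scale_fS: "scale (fS S1) = monom (fS S1) (card (same_col_pairs \<tau> S1))"
proof -
  have "scale (Const (t ^ alt_exponent \<tau> S1 (fst p) (snd p)) * entry_pt S1 (fst p) - entry_pt S1 (snd p)) =
      monom (Const (t ^ alt_exponent \<tau> S1 (fst p) (snd p)) * entry_pt S1 (fst p) - entry_pt S1 (snd p)) 1"
    if p: "p \<in> same_col_pairs \<tau> S1" for p
  proof -
    obtain i j where ij: "p = (i, j)" by (cases p)
    obtain a b c where "(a, c) \<in> B" "(b, c) \<in> B" "b < a" "i = S1 (a, c)" "j = S1 (b, c)"
      "alt_exponent \<tau> S1 i j = row_len b - c + 1"
      by (rule scp_S1[OF p[unfolded ij]])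
    then show ?thesis unfolding ij fst_conv snd_conv
      by (simp only: entry_pt_S1 fS_S1_factor scale_lform)
  qed
  then show ?thesis
    unfolding fS_eq case_prod_unfold scale_simps(9) by (simp add: monom_prod)
qed

end

context macdonald_params
begin

lemma C0_eq: "\<exists>c. c \<noteq> 0 \<and> C0 = Const c * (\<Prod>i\<in>factor_index. factor i)"
proof -
  define F where "F = (\<Prod>i\<in>factor_index. factor i)"
  obtain s where s: "C0 = F * s" using C0_factor unfolding F_def by blast
  have nz: "F * s * fS S1 \<noteq> 0" using ev_P_S1_neq_0 P_value[OF tab1_Tab] s by simp
  have "scale (factor i) = monom (factor i) 1" for i
    unfolding factor_def by (cases i) (simp add: scale_lform)
  then have F: "scale F = monom F (card factor_index)"
    unfolding F_def scale_simps(9) by (simp add: monom_prod)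
  have "scale (ev S1 (P S1)) = monom (ev S1 (P S1)) (\<Sum>i=1..N. al S1 i)"
    unfolding ev_def
  proof (rule scale_eval_homogeneous[OF _ scale_entry_pt])
    obtain e :: int where e: "\<And>k. k \<in> Poly_Mapping.keys (P S1) \<Longrightarrow> Poly_Mapping.keys k \<subseteq> {1..N} \<and>
      (Poly_Mapping.lookup k = al S1 \<or> comp_greater N (al S1) (Poly_Mapping.lookup k))"
      by (rule M_tab1_keys) blast
    show "Poly_Mapping.keys k \<subseteq> {1..N} \<and> (\<Sum>i=1..N. Poly_Mapping.lookup k i) = (\<Sum>i=1..N. al S1 i)"
      if "k \<in> Poly_Mapping.keys (P S1)" for k
      using e[OF that] unfolding comp_greater_def by metis
  qed
  then have "monom F (card factor_index) * scale s * monom (fS S1) (card (same_col_pairs \<tau> S1)) =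
    monom (F * s * fS S1) (card (same_col_pairs \<tau> S1) + card factor_index)"
    unfolding P_value[OF tab1_Tab] s sum_al_S1 scale_simps(3) F scale_fS .
  moreover have "monom F i * p * monom f j = monom (F * f) (i + j) * p" for f i j p
    unfolding mult_monom[symmetric] by (simp only: mult_ac)
  moreover have "monom (F * s * f) (j + i) = monom (F * f) (i + j) * [:s:]" for f i j
    by (simp add: smult_monom mult_ac add.commute)
  ultimately have "monom (F * fS S1) (card factor_index + card (same_col_pairs \<tau> S1)) * scale s =
    monom (F * fS S1) (card factor_index + card (same_col_pairs \<tau> S1)) * [:s:]"
    by simp
  moreover have "monom (F * fS S1) k \<noteq> 0" for k using nz by simp
  ultimately have "scale s = [:s:]" by (metis mult_left_cancel)
  then obtain c where "s = Const c" using scale_const by blast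
  then show ?thesis using s nz by (auto simp: F_def mult.commute intro!: exI[of _ c])
qed

end

section \<open>The product in its displayed form\<close>

context params
begin

text \<open>The display counts rows from the top: row a belongs to y_i with i = K + 1 - a, the
  variable z_k to column \<nu> + 1 - k of the last row, and t^s to column n - 1 - s. The term b = 1
  is split off because row 1 has its own length.\<close>

lemma prod_boxes:
  fixes G :: "nat \<times> nat \<Rightarrow> nat \<Rightarrow> 'a::comm_monoid_mult"
  shows "(\<Prod>ac\<in>B. \<Prod>b=1..fst ac - 1. G ac b) =
    (\<Prod>k=1..\<nu>. G (K + 1, \<nu> + 1 - k) 1 * (\<Prod>i=1..K - 1. G (K + 1, \<nu> + 1 - k) (K + 1 - i))) *
    (\<Prod>i=1..K - 1. \<Prod>s=0..n - 2. G (K + 1 - i, n - 1 - s) 1) *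
    (\<Prod>(i, j)\<in>{(i, j). 1 \<le> i \<and> i < j \<and> j \<le> K - 1}. \<Prod>s=0..n - 2. G (K + 1 - i, n - 1 - s) (K + 1 - j))"
proof -
  define R where "R = (\<lambda>a. \<Prod>c=1..row_len a. \<Prod>b=1..a - 1. G (a, c) b)"
  have split: "(\<Prod>b=1..a - 1. h b) = h 1 * (\<Prod>b=2..a - 1. h b)" if "2 \<le> a" for a and h :: "nat \<Rightarrow> 'a"
    using that by (simp add: prod.atLeast_Suc_atMost numeral_2_eq_2)
  have B: "B = Sigma {1..K + 1} (\<lambda>a. {1..row_len a})" by (auto simp: boxes_iff)
  have "(\<Prod>ac\<in>B. h ac) = (\<Prod>a=1..K + 1. \<Prod>c=1..row_len a. h (a, c))" for h :: "nat \<times> nat \<Rightarrow> 'a"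
    unfolding B by (subst prod.Sigma) simp_all
  from this[of "\<lambda>ac. \<Prod>b=1..fst ac - 1. G ac b"]
  have "(\<Prod>ac\<in>B. \<Prod>b=1..fst ac - 1. G ac b) = (\<Prod>a=1..K + 1. R a)" unfolding R_def fst_conv .
  also have "\<dots> = R (K + 1) * (\<Prod>a=2..K. R a)"
  proof -
    have "R 1 = 1" by (simp add: R_def)
    moreover have "(\<Prod>a=1..K. R a) = R 1 * (\<Prod>a=2..K. R a)" using split[of "K + 1" R] K by simp
    ultimately show ?thesis by (simp add: mult.commute)
  qed
  also have "R (K + 1) = (\<Prod>k=1..\<nu>. G (K + 1, \<nu> + 1 - k) 1 * (\<Prod>i=1..K - 1. G (K + 1, \<nu> + 1 - k) (K + 1 - i)))"
  proof -
    have "(\<Prod>b=1..K. G (K + 1, c) b) = G (K + 1, c) 1 * (\<Prod>i=1..K - 1. G (K + 1, c) (K + 1 - i))" for c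
    proof -
      have "(\<Prod>b=2..K. G (K + 1, c) b) = (\<Prod>i=1..K - 1. G (K + 1, c) (K + 1 - i))"
        by (rule prod.reindex_bij_witness[of _ "\<lambda>i. K + 1 - i" "\<lambda>i. K + 1 - i"]) auto
      then show ?thesis using split[of "K + 1" "G (K + 1, c)"] K by simp
    qed
    moreover have "row_len (K + 1) = \<nu>" using K by (simp add: row_len_def)
    ultimately have "R (K + 1) = (\<Prod>c=1..\<nu>. G (K + 1, c) 1 * (\<Prod>i=1..K - 1. G (K + 1, c) (K + 1 - i)))"
      by (simp add: R_def)
    also have "\<dots> = (\<Prod>k=1..\<nu>. G (K + 1, \<nu> + 1 - k) 1 * (\<Prod>i=1..K - 1. G (K + 1, \<nu> + 1 - k) (K + 1 - i)))"
      by (rule prod.reindex_bij_witness[of _ "\<lambda>i. \<nu> + 1 - i" "\<lambda>i. \<nu> + 1 - i"]) auto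
    finally show ?thesis .
  qed
  also have "(\<Prod>a=2..K. R a) = (\<Prod>i=1..K - 1. (\<Prod>s=0..n - 2. G (K + 1 - i, n - 1 - s) 1) *
      (\<Prod>j=i + 1..K - 1. \<Prod>s=0..n - 2. G (K + 1 - i, n - 1 - s) (K + 1 - j)))"
  proof (rule prod.reindex_bij_witness[of _ "\<lambda>i. K + 1 - i" "\<lambda>i. K + 1 - i"])
    fix a assume a: "a \<in> {2..K}"
    define i where "i = K + 1 - a"
    have i: "K + 1 - i = a" "K + 1 - a = i" "1 \<le> i" "i \<le> K - 1" using a by (auto simp: i_def)
    have "R a = (\<Prod>c=1..n - 1. G (a, c) 1 * (\<Prod>b=2..a - 1. G (a, c) b))"
      using a split[of a] by (simp add: R_def row_len_def)
    also have "\<dots> = (\<Prod>s=0..n - 2. G (a, n - 1 - s) 1 * (\<Prod>b=2..a - 1. G (a, n - 1 - s) b))"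
      by (rule prod.reindex_bij_witness[of _ "\<lambda>s. n - 1 - s" "\<lambda>s. n - 1 - s"]) (use n in auto)
    also have "\<dots> = (\<Prod>s=0..n - 2. G (a, n - 1 - s) 1) * (\<Prod>b=2..a - 1. \<Prod>s=0..n - 2. G (a, n - 1 - s) b)"
      unfolding prod.distrib by (subst (2) prod.swap) simp
    also have "(\<Prod>b=2..a - 1. \<Prod>s=0..n - 2. G (a, n - 1 - s) b) =
        (\<Prod>j=i + 1..K - 1. \<Prod>s=0..n - 2. G (a, n - 1 - s) (K + 1 - j))"
      by (rule prod.reindex_bij_witness[of _ "\<lambda>i. K + 1 - i" "\<lambda>i. K + 1 - i"]) (use a in \<open>auto simp: i_def\<close>)
    finally show "(\<Prod>s=0..n - 2. G (K + 1 - (K + 1 - a), n - 1 - s) 1) *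
      (\<Prod>j=K + 1 - a + 1..K - 1. \<Prod>s=0..n - 2. G (K + 1 - (K + 1 - a), n - 1 - s) (K + 1 - j)) = R a"
      unfolding i by simp
  qed auto
  also have "\<dots> = (\<Prod>i=1..K - 1. \<Prod>s=0..n - 2. G (K + 1 - i, n - 1 - s) 1) *
      (\<Prod>(i, j)\<in>Sigma {1..K - 1} (\<lambda>i. {i + 1..K - 1}). \<Prod>s=0..n - 2. G (K + 1 - i, n - 1 - s) (K + 1 - j))"
    unfolding prod.distrib by (subst prod.Sigma) simp_all
  also have "Sigma {1..K - 1} (\<lambda>i. {i + 1..K - 1}) = {(i, j). 1 \<le> i \<and> i < j \<and> j \<le> K - 1}" by auto
  finally show ?thesis by (simp only: mult.assoc)
qed

lemma Fract_prod_factor: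
  defines "t' \<equiv> cuyz_const t" and "q' \<equiv> cuyz_const q" and "y \<equiv> y_var \<nu>"
  shows "Fract (\<Prod>i\<in>factor_index. factor i) 1 =
    (\<Prod>k=1..\<nu>. qpoch2 (z_var k) (t' ^ (d * n - 1) * q' * y K) q' (d * m - 1)
                  * (\<Prod>i=1..K - 1. qpoch2 (z_var k) (t' ^ (n - 1) * q' * y i) q' (m - 1)))
               * (\<Prod>i=1..K - 1. \<Prod>s=0..n - 2.
                    qpoch2 (t' ^ s * y i) (t' ^ (d * n - 1) * q' * y K) q' (d * m - 1))
               * (\<Prod>(i, j)\<in>{(i, j). 1 \<le> i \<and> i < j \<and> j \<le> K - 1}. \<Prod>s=0..n - 2.
                    qpoch2 (t' ^ s * y i) (t' ^ (n - 1) * q' * y j) q' (m - 1))"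
proof -
  define G where "G = (\<lambda>ac b. qpoch2 (t' ^ box_exp ac * Fract (Var (box_var ac)) 1) (t' ^ row_len b * q' * y (K + 1 - b)) q' (row_mult b * m - 1))"
  have f: "Fract (factor (ac, b, j)) 1 = t' ^ box_exp ac * Fract (Var (box_var ac)) 1 - t' ^ row_len b * q' * y (K + 1 - b) * q' ^ (j - 1)"
    if "1 \<le> j" for ac b j
  proof -
    have "q' * q' ^ (j - 1) = q' ^ j" using that by (cases j) simp_all
    then have "t' ^ row_len b * q' * y (K + 1 - b) * q' ^ (j - 1) = q' ^ j * t' ^ row_len b * y (K + 1 - b)"
      by (simp add: mult_ac)
    moreover have "q' ^ j = Fract (Const (q ^ j)) 1" "t' ^ k = Fract (Const (t ^ k)) 1" for k
      by (simp_all only: q'_def t'_def cuyz_const_def ringhom_simps(7)[OF ringhom_FC])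
    ultimately show ?thesis
      unfolding factor_def lform_def prod.case y_def y_var_def ringhom_simps(6)[OF ringhom_Fract]
        ringhom_simps(3)[OF ringhom_Fract] Const_simps(3) by simp
  qed
  have "(\<Prod>i\<in>factor_index. factor i) = (\<Prod>ac\<in>B. \<Prod>b=1..fst ac - 1. \<Prod>j=1..row_mult b * m - 1. factor (ac, b, j))"
    unfolding factor_index_def by (simp add: prod.Sigma finite_boxes split_beta)
  then have "Fract (\<Prod>i\<in>factor_index. factor i) 1 = (\<Prod>ac\<in>B. \<Prod>b=1..fst ac - 1. \<Prod>j=1..row_mult b * m - 1. Fract (factor (ac, b, j)) 1)"
    by (simp only: ringhom_simps(9)[OF ringhom_Fract])
  also have "\<dots> = (\<Prod>ac\<in>B. \<Prod>b=1..fst ac - 1. G ac b)"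
    unfolding G_def qpoch2_def by (intro prod.cong refl f) simp
  also have "\<dots> = (\<Prod>k=1..\<nu>. G (K + 1, \<nu> + 1 - k) 1 * (\<Prod>i=1..K - 1. G (K + 1, \<nu> + 1 - k) (K + 1 - i))) *
    (\<Prod>i=1..K - 1. \<Prod>s=0..n - 2. G (K + 1 - i, n - 1 - s) 1) *
    (\<Prod>(i, j)\<in>{(i, j). 1 \<le> i \<and> i < j \<and> j \<le> K - 1}. \<Prod>s=0..n - 2. G (K + 1 - i, n - 1 - s) (K + 1 - j))"
    by (rule prod_boxes)
  also have "(\<Prod>k=1..\<nu>. G (K + 1, \<nu> + 1 - k) 1 * (\<Prod>i=1..K - 1. G (K + 1, \<nu> + 1 - k) (K + 1 - i))) =
    (\<Prod>k=1..\<nu>. qpoch2 (z_var k) (t' ^ (d * n - 1) * q' * y K) q' (d * m - 1)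
                  * (\<Prod>i=1..K - 1. qpoch2 (z_var k) (t' ^ (n - 1) * q' * y i) q' (m - 1)))"
    by (intro prod.cong refl arg_cong2[where f = "(*)"])
      (auto simp: G_def box_exp_def box_var_def z_var_def row_len_def row_mult_def)
  also have "(\<Prod>i=1..K - 1. \<Prod>s=0..n - 2. G (K + 1 - i, n - 1 - s) 1) =
    (\<Prod>i=1..K - 1. \<Prod>s=0..n - 2. qpoch2 (t' ^ s * y i) (t' ^ (d * n - 1) * q' * y K) q' (d * m - 1))"
    using n by (intro prod.cong refl) (auto simp: G_def box_exp_def box_var_def y_def y_var_def row_len_def row_mult_def)
  also have "(\<Prod>(i, j)\<in>{(i, j). 1 \<le> i \<and> i < j \<and> j \<le> K - 1}. \<Prod>s=0..n - 2. G (K + 1 - i, n - 1 - s) (K + 1 - j)) =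
    (\<Prod>(i, j)\<in>{(i, j). 1 \<le> i \<and> i < j \<and> j \<le> K - 1}. \<Prod>s=0..n - 2. qpoch2 (t' ^ s * y i) (t' ^ (n - 1) * q' * y j) q' (m - 1))"
    unfolding case_prod_unfold
    using n by (intro prod.cong refl) (auto simp: G_def box_exp_def box_var_def y_def y_var_def row_len_def row_mult_def)
  finally show ?thesis .
qed

end

section \<open>Identification of mu and of the special points\<close>

lemma nth_concat_replicate:
  "l < length ys \<Longrightarrow> k < r \<Longrightarrow> concat (map (\<lambda>j. replicate r (f j)) ys) ! (r * l + k) = f (ys ! l)"
proof (induction ys arbitrary: l)
  case (Cons y ys)
  then show ?case by (cases l) (simp_all add: nth_append add.assoc)
qed simp

context params
begin

text \<open>The first box of S_1 holds N, so the list is read backwards: position i belongs to the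
  box preceded by N - i others in row order.\<close>

lemma comp_of_list_eq_al_S1:
  "comp_of_list (replicate \<nu> ((d + K - 1) * m)
      @ concat (map (\<lambda>j. replicate (n - 1) ((d + j - 2) * m)) (rev [2..<K + 1]))
      @ replicate (d * n - 1) 0) = al S1" (is "comp_of_list ?xs = _")
proof
  fix i
  let ?cs = "concat (map (\<lambda>j. replicate (n - 1) ((d + j - 2) * m)) [2..<K + 1])"
  define zs where "zs = replicate (d * n - 1) 0 @ ?cs @ replicate \<nu> ((d + K - 1) * m)"
  have xs: "?xs = rev zs" by (simp add: zs_def rev_concat rev_map comp_def del: upt_Suc)
  have lc: "length ?cs = (n - 1) * (K - 1)"
    by (simp add: length_concat comp_def sum_list_triv del: upt_Suc)
  then have lz: "length zs = N" by (simp add: zs_def N_eq del: upt_Suc)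
  have "comp_of_list (rev zs) i = al S1 i"
  proof (cases "i \<in> {1..N}")
    case True
    obtain a c where ac: "box_of S1 i = (a, c)" by (metis surj_pair)
    have B: "(a, c) \<in> B" "S1 (a, c) = i" using S1_box(3,4)[OF True] ac by simp_all
    have r: "1 \<le> a" "a \<le> K + 1" "1 \<le> c" "c \<le> row_len a" using B(1) by (simp_all add: boxes_iff)
    define X where "X = (if a = 1 then c - 1 else d * n - 1 + (n - 1) * (a - 2) + (c - 1))"
    have i: "i = N - X" using S1_val[OF B(1)] B(2) by (simp add: X_def)
    then have X: "X < N" "i - 1 = N - Suc X" using True by auto
    have "rev zs ! (i - 1) = zs ! X" using X lz by (simp add: rev_nth)
    also have "zs ! X = row_value m d a"
    proof -
      consider "a = 1" | "2 \<le> a" "a \<le> K" | "a = K + 1" "a \<noteq> 1" using r K by linarith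
      then show ?thesis
      proof cases
        case 1
        then have "X < d * n - 1" using r by (simp add: X_def row_len_def)
        then show ?thesis using 1 by (simp add: zs_def nth_append row_value_def)
      next
        case 2
        have X': "X = d * n - 1 + ((n - 1) * (a - 2) + (c - 1))" using 2 by (simp add: X_def)
        have c: "c - 1 < n - 1" using r 2 by (simp add: row_len_def)
        have "(n - 1) * (a - 2) + (c - 1) < (n - 1) * Suc (a - 2)" using c by simp
        also have "\<dots> \<le> (n - 1) * (K - 1)" using 2 by (intro mult_le_mono2) simp
        finally have "zs ! X = ?cs ! ((n - 1) * (a - 2) + (c - 1))"
          unfolding zs_def X' using lc by (simp add: nth_append del: upt_Suc)
        also have "\<dots> = (d + [2..<K + 1] ! (a - 2) - 2) * m"
          by (rule nth_concat_replicate) (use 2 c in auto)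
        also have "[2..<K + 1] ! (a - 2) = a" using 2 by (simp del: upt_Suc)
        finally show ?thesis using 2 by (simp add: row_value_def)
      next
        case 3
        have X': "X = d * n - 1 + ((n - 1) * (K - 1) + (c - 1))" using 3 by (simp add: X_def)
        have "c - 1 < \<nu>" using r 3 K by (simp add: row_len_def)
        then show ?thesis
          unfolding zs_def X' using lc 3 by (simp add: nth_append row_value_def del: upt_Suc)
      qed
    qed
    finally show ?thesis
      using True ac lz by (simp add: comp_of_list_def tab_comp_def row_of_box)
  next
    case False
    then show ?thesis using lz by (auto simp: comp_of_list_def tab_comp_def)
  qed
  then show "comp_of_list ?xs i = al S1 i" unfolding xs .
qed

lemma eval_special_point:
  "eval_mpoly cuyz_const (special_point (cuyz_const t) n d K \<nu> z_var (y_var \<nu>) S) p = Fract (ev S p) 1"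
proof -
  have pw: "Fract (Const (t ^ k)) 1 = cuyz_const t ^ k" for k
    unfolding cuyz_const_def by (rule ringhom_simps(7)[OF ringhom_FC])
  have F: "Fract (Const (t ^ k) * p) 1 = cuyz_const t ^ k * Fract p 1" for k p
    unfolding ringhom_simps(3)[OF ringhom_Fract] pw ..
  have "special_point (cuyz_const t) n d K \<nu> z_var (y_var \<nu>) S k = Fract (entry_pt S k) 1" for k
    unfolding special_point_def Let_def entry_pt_def box_pt_def row_of_box col_of_box
    by (simp add: F z_var_def y_var_def)
  then have "special_point (cuyz_const t) n d K \<nu> z_var (y_var \<nu>) S = (\<lambda>k. Fract (entry_pt S k) 1)" by blast
  moreover have "cuyz_const = (\<lambda>c. Fract (Const c) 1)" by (simp add: fun_eq_iff cuyz_const_def)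
  ultimately show ?thesis using gev_entry_pt[of S p] by (simp add: gev_def)
qed

end

context macdonald_params
begin

lemma fS_S1_neq_0: "fS S1 \<noteq> 0"
  using ev_P_S1_neq_0 P_value[OF tab1_Tab] by auto

lemma C0_ratio: "Fract (ev S1 (P S1)) 1 / Fract (ev S1 (min_poly t \<tau> S1)) 1 = Fract C0 1"
  using fS_S1_neq_0 by (simp add: min_poly_tab1 P_value[OF tab1_Tab] eq_fract)

lemma P_special_value:
  assumes "S \<in> Tab \<tau>"
  shows "Fract (ev S (P S)) 1 =
    Fract (ev S1 (P S1)) 1 / Fract (ev S1 (min_poly t \<tau> S1)) 1 * Fract (ev S (alt_poly t \<tau> S)) 1"
  unfolding C0_ratio P_value[OF assms] fS_def by (rule ringhom_simps(3)[OF ringhom_Fract])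

end

text \<open>Division and specialization are total functions here. The absence of poles and the
  nonvanishing of the denominator are therefore part of the conclusion, since they give the two
  formulas their meaning. The scalar c lies in the field of rational functions of u, so it does not
  depend on the variables y and z.\<close>

theorem corollary6p24:
  fixes m d K n \<nu> N g :: nat and \<tau> :: "nat list" and \<mu> :: "nat \<Rightarrow> nat"
    and \<omega> :: complex and q t :: cu and q' t' :: cuyz
    and M :: "(nat \<Rightarrow> nat) \<Rightarrow> cqt mpoly"
    and z y :: "nat \<Rightarrow> cuyz" and xbar :: "tableau \<Rightarrow> nat \<Rightarrow> cuyz"
  assumes "m \<ge> 1" and "d \<ge> 1" and "K \<ge> 1" and "n \<ge> 2" and "1 \<le> \<nu>" and "\<nu> \<le> n - 1"
    and "N = d * n - 1 + (n - 1) * (K - 1) + \<nu>"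
    and "g = gcd m n"
    and "\<tau> = (d * n - 1) # replicate (K - 1) (n - 1) @ [\<nu>]"
    and "\<mu> = comp_of_list (replicate \<nu> ((d + K - 1) * m)
              @ concat (map (\<lambda>j. replicate (n - 1) ((d + j - 2) * m)) (rev [2..<K + 1]))
              @ replicate (d * n - 1) 0)"
    and "primitive_root_of_unity g (\<omega> ^ (m div g))"
    and "q = cu_const \<omega> * inverse cu_u ^ (n div g)"
    and "t = cu_u ^ (m div g)"
    and "macdonald_family N M"
    and "no_pole_mpoly q t (M \<mu>)"
    and "singular_poly q t N (specialize q t (M \<mu>))"
    and "z = z_var" and "y = y_var \<nu>"
    and "q' = cuyz_const q" and "t' = cuyz_const t"
    and "xbar = special_point t' n d K \<nu> z y"
  shows "(\<forall>S\<in>Tab \<tau>. no_pole_mpoly q t (M (tab_comp m d \<tau> S)) \<and>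
            eval_mpoly cuyz_const (xbar S) (specialize q t (M (tab_comp m d \<tau> S)))
            = eval_mpoly cuyz_const (xbar (tab1 \<tau>)) (specialize q t (M \<mu>))
              / eval_mpoly cuyz_const (xbar (tab1 \<tau>)) (min_poly t \<tau> (tab1 \<tau>))
              * eval_mpoly cuyz_const (xbar S) (alt_poly t \<tau> S))
       \<and> eval_mpoly cuyz_const (xbar (tab1 \<tau>)) (min_poly t \<tau> (tab1 \<tau>)) \<noteq> 0
       \<and> (\<exists>c. c \<noteq> 0 \<and>
            eval_mpoly cuyz_const (xbar (tab1 \<tau>)) (specialize q t (M \<mu>))
            / eval_mpoly cuyz_const (xbar (tab1 \<tau>)) (min_poly t \<tau> (tab1 \<tau>))
            = cuyz_const c *
              ((\<Prod>k=1..\<nu>. qpoch2 (z k) (t' ^ (d * n - 1) * q' * y K) q' (d * m - 1)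
                  * (\<Prod>i=1..K - 1. qpoch2 (z k) (t' ^ (n - 1) * q' * y i) q' (m - 1)))
               * (\<Prod>i=1..K - 1. \<Prod>s=0..n - 2.
                    qpoch2 (t' ^ s * y i) (t' ^ (d * n - 1) * q' * y K) q' (d * m - 1))
               * (\<Prod>(i, j)\<in>{(i, j). 1 \<le> i \<and> i < j \<and> j \<le> K - 1}. \<Prod>s=0..n - 2.
                    qpoch2 (t' ^ s * y i) (t' ^ (n - 1) * q' * y j) q' (m - 1))))"
proof -
  have N: "N = sum_list \<tau>" using assms(3,7,9) by (simp add: sum_list_replicate mult.commute)
  interpret P: params m d K n \<nu> \<omega> q t \<tau>
    using assms(1-6,8,9,11-13) by unfold_locales simp_all
  have \<mu>: "\<mu> = tab_comp m d \<tau> (tab1 \<tau>)"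
    using assms(10) P.comp_of_list_eq_al_S1 by simp
  interpret I: macdonald_params m d K n \<nu> \<omega> q t \<tau> M
    using assms(14-16) unfolding \<mu> N by unfold_locales
  have x: "eval_mpoly cuyz_const (xbar S) p = Fract (P.ev S p) 1" for S p
    unfolding assms(17,18,20,21) by (rule P.eval_special_point)
  obtain c where c: "c \<noteq> 0" "I.C0 = Const c * (\<Prod>i\<in>P.factor_index. P.factor i)" using I.C0_eq by blast
  have "Fract I.C0 1 = cuyz_const c * Fract (\<Prod>i\<in>P.factor_index. P.factor i) 1"
    unfolding c(2) cuyz_const_def by (rule ringhom_simps(3)[OF ringhom_Fract])
  moreover have "Fract (P.ev (tab1 \<tau>) (min_poly t \<tau> (tab1 \<tau>))) 1 \<noteq> (0 :: cuyz)"
    unfolding P.min_poly_tab1 using I.fS_S1_neq_0 by (simp add: Zero_fract_def eq_fract)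
  ultimately show ?thesis
    unfolding x \<mu> I.C0_ratio assms(17-20)
    using I.P_no_pole I.P_special_value c(1) P.Fract_prod_factor unfolding I.C0_ratio by auto
qed

end
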